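(* The indecomposable characters of the infinite block-diagonal unitary group $\mathrm U_{\widehat{\mathbf n}}$ are exactly the functions of the form $$u\mapsto \mathrm{tr}(u)^p\,\overline{\mathrm{tr}(u)}^{\,q},\qquad u\in \mathrm U_{\widehat{\mathbf n}},$$ where $p,q$ are non-negative integers.
   Context: Fix a sequence $\widehat{\mathbf n}=\{n_k\}_{k\ge 1}$ of integers $n_k>1$ and put $N_k=n_1\cdots n_k$. Let $\mathrm{Mat}_N$ be the algebra of complex $N\times N$ matrices and $\mathrm U_N\subset\mathrm{Mat}_N$ the unitary group. The block-diagonal embeddings $\mathrm{Mat}_{N_k}\to\mathrm{Mat}_{N_{k+1}}$ send $a$ to the block-diagonal matrix $\mathrm{diag}(a,\ldots,a)$ with $n_{k+1}$ blocks. Let $\varinjlim\mathrm{Mat}_{N_k}$ be the inductive limit algebra and $\mathrm U_{\widehat{\mathbf n}}=\varinjlim \mathrm U_{N_k}=\bigcup_k \mathrm U_{N_k}$ the inductive limit group with the inductive limit topology (a function is continuous iff its restriction to each $\mathrm U_{N_k}$ is continuous). $\mathrm{tr}$ is the unique tracial state on $\varinjlim\mathrm{Mat}_{N_k}$: $\mathrm{tr}(x)=\frac1{N_k}\mathrm{Tr}(x)$ for $x\in\mathrm{Mat}_{N_k}$. A character of a topological group $G$ is a continuous positive-definite function $\chi:G\to\mathbb C$ with $\chi(gh)=\chi(hg)$ for all $g,h\in G$ and $\chi(1_G)=1$. It is indecomposable if it is not of the form $\alpha\chi_1+(1-\alpha)\chi_2$ with $\alpha\in(0,1)$ and $\chi_1\neq\chi_2$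 characters. *)

theory Defs
  imports
    "HOL-Analysis.Function_Topology"
    "HOL-Library.Nonpos_Ints"
    "HOL-Algebra.Group"
    "Jordan_Normal_Form.Schur_Decomposition"
begin

section \<open>Characters of topological groups\<close>

text \<open>A topological group is given by a group \<open>G\<close> and a topology \<open>T\<close> with
  \<open>topspace T = carrier G\<close>. Complex functions on \<open>G\<close> are total functions in HOL; requiring them
  to be \<^const>\<open>extensional\<close> makes equality of characters equality on \<open>carrier G\<close>.\<close>

definition positive_definite :: "('g, 'm) monoid_scheme \<Rightarrow> ('g \<Rightarrow> complex) \<Rightarrow> bool" where
  "positive_definite G \<chi> \<longleftrightarrow>
     (\<forall>(m::nat) (g::nat \<Rightarrow> 'g) (c::nat \<Rightarrow> complex). (\<forall>i<m. g i \<in> carrier G) \<longrightarrow>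
        (\<Sum>i<m. \<Sum>j<m. c i * cnj (c j) * \<chi> (inv\<^bsub>G\<^esub> (g j) \<otimes>\<^bsub>G\<^esub> g i)) \<in> \<real>\<^sub>\<ge>\<^sub>0)"

definition group_character ::
    "('g, 'm) monoid_scheme \<Rightarrow> 'g topology \<Rightarrow> ('g \<Rightarrow> complex) \<Rightarrow> bool" where
  "group_character G T \<chi> \<longleftrightarrow>
     \<chi> \<in> extensional (carrier G) \<and>
     continuous_map T euclidean \<chi> \<and>
     positive_definite G \<chi> \<and>
     (\<forall>g\<in>carrier G. \<forall>h\<in>carrier G. \<chi> (g \<otimes>\<^bsub>G\<^esub> h) = \<chi> (h \<otimes>\<^bsub>G\<^esub> g)) \<and>
     \<chi> \<one>\<^bsub>G\<^esub> = 1"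

definition indecomposable_character ::
    "('g, 'm) monoid_scheme \<Rightarrow> 'g topology \<Rightarrow> ('g \<Rightarrow> complex) \<Rightarrow> bool" where
  "indecomposable_character G T \<chi> \<longleftrightarrow>
     group_character G T \<chi> \<and>
     \<not> (\<exists>(\<alpha>::real) \<chi>1 \<chi>2. 0 < \<alpha> \<and> \<alpha> < 1 \<and>
          group_character G T \<chi>1 \<and> group_character G T \<chi>2 \<and> \<chi>1 \<noteq> \<chi>2 \<and>
          (\<forall>g\<in>carrier G. \<chi> g = of_real \<alpha> * \<chi>1 g + of_real (1 - \<alpha>) * \<chi>2 g))"

section \<open>Unitary groups\<close>

definition mat_trace :: "complex mat \<Rightarrow> complex" where
  "mat_trace A = (\<Sum>i<dim_row A. A $$ (i, i))"

definition unitary_mats :: "nat \<Rightarrow> complex mat set" where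
  "unitary_mats N =
     {A \<in> carrier_mat N N. A * mat_adjoint A = 1\<^sub>m N \<and> mat_adjoint A * A = 1\<^sub>m N}"

text \<open>The topology of \<open>U(N)\<close> as a subset of the space of \<open>N \<times> N\<close> complex matrices.\<close>

definition unitary_topology :: "nat \<Rightarrow> complex mat topology" where
  "unitary_topology N =
     pullback_topology (unitary_mats N)
       (\<lambda>A. \<lambda>(i, j)\<in>{..<N} \<times> {..<N}. A $$ (i, j))
       (product_topology (\<lambda>_. euclidean) ({..<N} \<times> {..<N}))"

section \<open>The inductive limits\<close>

text \<open>The sequence is \<open>n 1, n 2, \<dots>\<close>; the value \<open>n 0\<close> plays no role.\<close>

definition level_size :: "(nat \<Rightarrow> nat) \<Rightarrow> nat \<Rightarrow> nat" where
  "level_size n k = (\<Prod>i=1..k. n i)"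

text \<open>\<open>level_embed n k i\<close> is the composite embedding from level \<open>k\<close> to level \<open>k + i\<close>.\<close>

primrec level_embed :: "(nat \<Rightarrow> nat) \<Rightarrow> nat \<Rightarrow> nat \<Rightarrow> complex mat \<Rightarrow> complex mat" where
  "level_embed n k 0 A = A"
| "level_embed n k (Suc i) A =
     diag_block_mat (replicate (n (Suc (k + i))) (level_embed n k i A))"

text \<open>Elements of the inductive limit are equivalence classes of pairs \<open>(k, A)\<close>, with \<open>A\<close> a matrix
  at level \<open>k \<ge> 1\<close>; two pairs are identified iff they become equal at some later level.\<close>

definition level_pairs :: "(nat \<Rightarrow> nat) \<Rightarrow> (nat \<times> complex mat) set" where
  "level_pairs n = {(k, A). 1 \<le> k \<and> A \<in> carrier_mat (level_size n k) (level_size n k)}"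

definition lim_rel :: "(nat \<Rightarrow> nat) \<Rightarrow> ((nat \<times> complex mat) \<times> (nat \<times> complex mat)) set" where
  "lim_rel n =
     {((k, A), (l, B)). (k, A) \<in> level_pairs n \<and> (l, B) \<in> level_pairs n \<and>
        (\<exists>i j. k + i = l + j \<and> level_embed n k i A = level_embed n l j B)}"

type_synonym lim_elem = "(nat \<times> complex mat) set"

definition to_lim :: "(nat \<Rightarrow> nat) \<Rightarrow> nat \<Rightarrow> complex mat \<Rightarrow> lim_elem" where
  "to_lim n k A = lim_rel n `` {(k, A)}"

definition mat_lim :: "(nat \<Rightarrow> nat) \<Rightarrow> lim_elem monoid" where
  "mat_lim n =
     \<lparr> carrier = level_pairs n // lim_rel n,
       monoid.mult = (\<lambda>X Y. \<Union>{to_lim n k (A * B) | k A B. (k, A) \<in> X \<and> (k, B) \<in> Y}),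
       monoid.one = to_lim n 1 (1\<^sub>m (level_size n 1)) \<rparr>"

definition lim_tr :: "(nat \<Rightarrow> nat) \<Rightarrow> lim_elem \<Rightarrow> complex" where
  "lim_tr n X =
     (THE c. \<exists>k A. (k, A) \<in> X \<and> c = mat_trace A / of_nat (level_size n k))"

definition unitary_lim :: "(nat \<Rightarrow> nat) \<Rightarrow> lim_elem monoid" where
  "unitary_lim n =
     (mat_lim n)\<lparr> carrier := (\<Union>k\<in>{1..}. to_lim n k ` unitary_mats (level_size n k)) \<rparr>"

definition unitary_lim_topology :: "(nat \<Rightarrow> nat) \<Rightarrow> lim_elem topology" where
  "unitary_lim_topology n = topology (\<lambda>V. V \<subseteq> carrier (unitary_lim n) \<and>
     (\<forall>k\<ge>1. openin (unitary_topology (level_size n k))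
               {A \<in> unitary_mats (level_size n k). to_lim n k A \<in> V}))"

section \<open>Well-definedness\<close>

lemma level_size_Suc: "level_size n (Suc k) = level_size n k * n (Suc k)"
  by (simp add: level_size_def)

lemma diag_block_mat_replicate_carrier:
  "A \<in> carrier_mat N N \<Longrightarrow> diag_block_mat (replicate m A) \<in> carrier_mat (m * N) (m * N)"
  by (intro carrier_matI) (simp_all add: dim_diag_block_mat sum_list_replicate)

lemma diag_block_mat_replicate_Suc:
  assumes "A \<in> carrier_mat N N"
  shows "diag_block_mat (replicate (Suc m) A) =
    four_block_mat A (0\<^sub>m N (m * N)) (0\<^sub>m (m * N) N) (diag_block_mat (replicate m A))"
  using assms diag_block_mat_replicate_carrier[OF assms, of m]
  by (simp add: Let_def)

lemma diag_block_mat_replicate_mult: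
  assumes "A \<in> carrier_mat N N" "B \<in> carrier_mat N N"
  shows "diag_block_mat (replicate m A) * diag_block_mat (replicate m B) =
    diag_block_mat (replicate m (A * B))"
proof (induction m)
  case 0
  show ?case by (auto intro!: eq_matI)
next
  case (Suc m)
  note c = diag_block_mat_replicate_carrier
  have AB: "A * B \<in> carrier_mat N N" using assms by auto
  show ?case
    unfolding diag_block_mat_replicate_Suc[OF assms(1)] diag_block_mat_replicate_Suc[OF assms(2)]
      diag_block_mat_replicate_Suc[OF AB] Suc[symmetric]
    using assms c[OF assms(1), of m] c[OF assms(2), of m]
    by (subst mult_four_block_mat[OF assms(1) zero_carrier_mat zero_carrier_mat c[OF assms(1)]
          assms(2) zero_carrier_mat zero_carrier_mat c[OF assms(2)]]) simp
qed

lemma diag_block_mat_replicate_one: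
  "diag_block_mat (replicate m (1\<^sub>m N)) = (1\<^sub>m (m * N) :: complex mat)"
  using diag_block_one_mat[of "replicate m (1\<^sub>m N :: complex mat)"]
  by (simp add: sum_list_replicate)

lemma mat_adjoint_index:
  "i < dim_col A \<Longrightarrow> j < dim_row A \<Longrightarrow> mat_adjoint A $$ (i, j) = cnj (A $$ (j, i))"
  for A :: "complex mat"
  by (simp add: mat_adjoint_def mat_of_rows_def)

lemma mat_adjoint_dim [simp]:
  "dim_row (mat_adjoint A) = dim_col A" "dim_col (mat_adjoint A) = dim_row A"
  by (auto simp: mat_adjoint_def)

lemma diag_block_mat_replicate_adjoint:
  fixes A :: "complex mat"
  assumes "A \<in> carrier_mat N N"
  shows "mat_adjoint (diag_block_mat (replicate m A)) = diag_block_mat (replicate m (mat_adjoint A))"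
proof (induction m)
  case 0
  show ?case by (auto intro!: eq_matI)
next
  case (Suc m)
  let ?D = "diag_block_mat (replicate m A)"
  have D: "?D \<in> carrier_mat (m * N) (m * N)"
    by (rule diag_block_mat_replicate_carrier[OF assms])
  have A': "mat_adjoint A \<in> carrier_mat N N" using assms by auto
  show ?case
    unfolding diag_block_mat_replicate_Suc[OF assms] diag_block_mat_replicate_Suc[OF A']
      Suc[symmetric]
    using assms D by (intro eq_matI) (auto simp: mat_adjoint_index)
qed

lemma mat_trace_replicate:
  assumes "A \<in> carrier_mat N N"
  shows "mat_trace (diag_block_mat (replicate m A)) = of_nat m * mat_trace A"
proof (induction m)
  case 0
  show ?case by (simp add: mat_trace_def)
next
  case (Suc m)
  let ?D = "diag_block_mat (replicate m A)"
  have D: "?D \<in> carrier_mat (m * N) (m * N)"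
    by (rule diag_block_mat_replicate_carrier[OF assms])
  have split: "(\<Sum>i<a + b. f i) = (\<Sum>i<a. f i) + (\<Sum>i<b. f (a + i))"
    for a b and f :: "nat \<Rightarrow> complex"
    by (induction b) (simp_all add: add.assoc)
  have "mat_trace (diag_block_mat (replicate (Suc m) A)) =
      (\<Sum>i<N + m * N. if i < N then A $$ (i, i) else ?D $$ (i - N, i - N))"
    unfolding diag_block_mat_replicate_Suc[OF assms] mat_trace_def
    using assms D by (intro sum.cong) auto
  also have "\<dots> = (\<Sum>i<N. A $$ (i, i)) + (\<Sum>i<m * N. ?D $$ (i, i))"
    by (simp add: split cong: sum.cong_simp)
  finally show ?case
    using Suc assms D by (simp add: mat_trace_def algebra_simps)
qed

lemma topspace_unitary_topology [simp]: "topspace (unitary_topology N) = unitary_mats N"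
  by (auto simp: unitary_topology_def topspace_pullback_topology)

lemma openin_unitary_lim_topology:
  "openin (unitary_lim_topology n) V \<longleftrightarrow> V \<subseteq> carrier (unitary_lim n) \<and>
     (\<forall>k\<ge>1. openin (unitary_topology (level_size n k))
               {A \<in> unitary_mats (level_size n k). to_lim n k A \<in> V})"
proof -
  let ?P = "\<lambda>k V. openin (unitary_topology (level_size n k))
               {A \<in> unitary_mats (level_size n k). to_lim n k A \<in> V}"
  have "istopology (\<lambda>V. V \<subseteq> carrier (unitary_lim n) \<and> (\<forall>k\<ge>1. ?P k V))"
    unfolding istopology_def
  proof (intro conjI allI impI)
    fix S T k
    assume "S \<subseteq> carrier (unitary_lim n) \<and> (\<forall>k\<ge>1. ?P k S)"
      and "T \<subseteq> carrier (unitary_lim n) \<and> (\<forall>k\<ge>1. ?P k T)" and "1 \<le> (k::nat)"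
    then have "openin (unitary_topology (level_size n k))
        ({A \<in> unitary_mats (level_size n k). to_lim n k A \<in> S} \<inter>
         {A \<in> unitary_mats (level_size n k). to_lim n k A \<in> T})" by blast
    then show "?P k (S \<inter> T)" by (rule back_subst) blast
  next
    fix K k
    assume "\<forall>V\<in>K. V \<subseteq> carrier (unitary_lim n) \<and> (\<forall>k\<ge>1. ?P k V)" and "1 \<le> (k::nat)"
    then have "openin (unitary_topology (level_size n k))
        (\<Union>((\<lambda>V. {A \<in> unitary_mats (level_size n k). to_lim n k A \<in> V}) ` K))" by blast
    then show "?P k (\<Union>K)" by (rule back_subst) blast
  qed blast+
  then show ?thesis
    by (simp add: unitary_lim_topology_def topology_inverse')
qed

lemma to_lim_in_unitary_lim:
  "1 \<le> k \<Longrightarrow> A \<in> unitary_mats (level_size n k) \<Longrightarrow> to_lim n k A \<in> carrier (unitary_lim n)"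
  by (auto simp: unitary_lim_def)

lemma topspace_unitary_lim_topology [simp]:
  "topspace (unitary_lim_topology n) = carrier (unitary_lim n)"
proof
  show "topspace (unitary_lim_topology n) \<subseteq> carrier (unitary_lim n)"
    by (meson openin_unitary_lim_topology openin_topspace)
  have "{A \<in> unitary_mats (level_size n k). to_lim n k A \<in> carrier (unitary_lim n)} =
      topspace (unitary_topology (level_size n k))" if "1 \<le> k" for k
    using to_lim_in_unitary_lim that by auto
  then have "openin (unitary_lim_topology n) (carrier (unitary_lim n))"
    by (simp add: openin_unitary_lim_topology del: topspace_unitary_topology)
  then show "carrier (unitary_lim n) \<subseteq> topspace (unitary_lim_topology n)"
    by (rule openin_subset)
qed

lemma continuous_map_unitary_lim:
  assumes "\<And>x. x \<in> carrier (unitary_lim n) \<Longrightarrow> f x \<in> topspace Y"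
  shows "continuous_map (unitary_lim_topology n) Y f \<longleftrightarrow>
    (\<forall>k\<ge>1. continuous_map (unitary_topology (level_size n k)) Y (\<lambda>A. f (to_lim n k A)))"
proof -
  have "{A \<in> unitary_mats (level_size n k).
           to_lim n k A \<in> {x \<in> carrier (unitary_lim n). f x \<in> W}} =
        {A \<in> unitary_mats (level_size n k). f (to_lim n k A) \<in> W}" if "1 \<le> k" for k W
    using to_lim_in_unitary_lim that by auto
  then show ?thesis
    using assms to_lim_in_unitary_lim
    by (auto simp: continuous_map_def openin_unitary_lim_topology Pi_iff)
qed

lemma level_embed_carrier:
  assumes "A \<in> carrier_mat (level_size n k) (level_size n k)"
  shows "level_embed n k i A \<in> carrier_mat (level_size n (k + i)) (level_size n (k + i))"
proof (induction i)
  case (Suc i)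
  then show ?case
    using diag_block_mat_replicate_carrier[OF Suc, of "n (Suc (k + i))"]
    by (simp add: level_size_Suc mult.commute)
qed (use assms in simp)

lemma level_embed_add:
  "level_embed n k (i + j) A = level_embed n (k + i) j (level_embed n k i A)"
  by (induction j) (simp_all add: add.assoc)

lemma level_embed_mult:
  assumes "A \<in> carrier_mat (level_size n k) (level_size n k)"
    and "B \<in> carrier_mat (level_size n k) (level_size n k)"
  shows "level_embed n k i (A * B) = level_embed n k i A * level_embed n k i B"
  by (induction i)
     (simp_all add: diag_block_mat_replicate_mult[OF level_embed_carrier level_embed_carrier] assms)

lemma level_embed_one: "level_embed n k i (1\<^sub>m (level_size n k)) = 1\<^sub>m (level_size n (k + i))"
  by (induction i) (simp_all add: diag_block_mat_replicate_one level_size_Suc mult.commute)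

lemma level_embed_adjoint:
  assumes "A \<in> carrier_mat (level_size n k) (level_size n k)"
  shows "level_embed n k i (mat_adjoint A) = mat_adjoint (level_embed n k i A)"
  by (induction i)
     (simp_all add: diag_block_mat_replicate_adjoint[OF level_embed_carrier] assms)

lemma level_embed_trace:
  assumes "\<And>k. 1 \<le> k \<Longrightarrow> 1 < n k" and "A \<in> carrier_mat (level_size n k) (level_size n k)"
  shows "mat_trace (level_embed n k i A) / of_nat (level_size n (k + i)) =
    mat_trace A / of_nat (level_size n k)"
proof (induction i)
  case (Suc i)
  have "n (Suc (k + i)) \<noteq> 0" using assms(1)[of "Suc (k + i)"] by simp
  then show ?case
    by (simp add: mat_trace_replicate[OF level_embed_carrier[OF assms(2)]] level_size_Suc
        flip: Suc)
qed simp

lemma equiv_lim_rel: "equiv (level_pairs n) (lim_rel n)"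
proof (rule equivI)
  show "lim_rel n \<subseteq> level_pairs n \<times> level_pairs n"
    by (auto simp: lim_rel_def)
  show "refl_on (level_pairs n) (lim_rel n)"
    by (auto simp: refl_on_def lim_rel_def)
  show "sym (lim_rel n)"
    unfolding sym_def lim_rel_def by (auto 0 4 dest: sym)
  show "trans (lim_rel n)"
  proof (rule transI, clarify)
    fix k A l B m C
    assume "((k, A), (l, B)) \<in> lim_rel n" "((l, B), (m, C)) \<in> lim_rel n"
    then obtain i j i' j' where *: "(k, A) \<in> level_pairs n" "(m, C) \<in> level_pairs n"
        "k + i = l + j" "level_embed n k i A = level_embed n l j B"
        "l + i' = m + j'" "level_embed n l i' B = level_embed n m j' C"
      unfolding lim_rel_def by auto
    have "level_embed n k (i + i') A = level_embed n l (j + i') B"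
      using * by (simp add: level_embed_add)
    also have "\<dots> = level_embed n m (j' + j) C"
      using * by (subst add.commute) (simp add: level_embed_add)
    finally show "((k, A), (m, C)) \<in> lim_rel n"
      using * unfolding lim_rel_def
      by (simp, intro exI[of _ "i + i'"] exI[of _ "j' + j"]) simp
  qed
qed

lemma to_lim_embed:
  assumes "(k, A) \<in> level_pairs n"
  shows "to_lim n (k + i) (level_embed n k i A) = to_lim n k A"
proof -
  have "((k + i, level_embed n k i A), (k, A)) \<in> lim_rel n"
    using assms level_embed_carrier[of A n k i]
    unfolding lim_rel_def level_pairs_def
    by (simp, intro exI[of _ 0] exI[of _ i]) simp
  then show ?thesis
    unfolding to_lim_def by (rule equiv_class_eq[OF equiv_lim_rel])
qed

lemma mem_to_lim: "(l, B) \<in> to_lim n k A \<longleftrightarrow> ((k, A), (l, B)) \<in> lim_rel n"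
  by (simp add: to_lim_def)

lemma mult_to_lim:
  assumes A: "(k, A) \<in> level_pairs n" and B: "(k, B) \<in> level_pairs n"
  shows "to_lim n k A \<otimes>\<^bsub>mat_lim n\<^esub> to_lim n k B = to_lim n k (A * B)"
proof -
  have "to_lim n l (C * D) = to_lim n k (A * B)"
    if "(l, C) \<in> to_lim n k A" "(l, D) \<in> to_lim n k B" for l C D
  proof -
    from that obtain i j i' j' where
      C: "(l, C) \<in> level_pairs n" and D: "(l, D) \<in> level_pairs n"
      and eqs: "k + i = l + j" "level_embed n k i A = level_embed n l j C"
        "k + i' = l + j'" "level_embed n k i' B = level_embed n l j' D"
      by (auto simp: mem_to_lim lim_rel_def)
    have eA: "level_embed n k (i + i') A = level_embed n l (j + i') C"
      using eqs by (simp add: level_embed_add)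
    have "level_embed n k (i' + i) B = level_embed n l (j' + i) D"
      using eqs by (simp add: level_embed_add)
    moreover have "j' + i = j + i'" using eqs by simp
    ultimately have eB: "level_embed n k (i + i') B = level_embed n l (j + i') D"
      by (simp add: add.commute)
    have AB: "(k, A * B) \<in> level_pairs n" and CD: "(l, C * D) \<in> level_pairs n"
      using A B C D by (auto simp: level_pairs_def)
    have "level_embed n k (i + i') (A * B) = level_embed n l (j + i') (C * D)"
      using A B C D eA eB by (simp add: level_embed_mult level_pairs_def)
    moreover have "k + (i + i') = l + (j + i')" using eqs by simp
    ultimately show ?thesis
      using to_lim_embed[OF AB, of "i + i'"] to_lim_embed[OF CD, of "j + i'"] by metis
  qed
  moreover have "(k, A) \<in> to_lim n k A" "(k, B) \<in> to_lim n k B"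
    using A B equiv_class_self[OF equiv_lim_rel] by (auto simp: to_lim_def)
  ultimately have "{to_lim n l (C * D) | l C D. (l, C) \<in> to_lim n k A \<and> (l, D) \<in> to_lim n k B} =
      {to_lim n k (A * B)}"
    by blast
  then show ?thesis by (simp add: mat_lim_def)
qed

lemma lim_tr_to_lim:
  assumes "\<And>k. 1 \<le> k \<Longrightarrow> 1 < n k" and A: "(k, A) \<in> level_pairs n"
  shows "lim_tr n (to_lim n k A) = mat_trace A / of_nat (level_size n k)"
  unfolding lim_tr_def
proof (rule the_equality)
  show "\<exists>l B. (l, B) \<in> to_lim n k A \<and>
      mat_trace A / of_nat (level_size n k) = mat_trace B / of_nat (level_size n l)"
    using A equiv_class_self[OF equiv_lim_rel A] by (auto simp: to_lim_def)
next
  fix c assume "\<exists>l B. (l, B) \<in> to_lim n k A \<and> c = mat_trace B / of_nat (level_size n l)"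
  then obtain l B i j where *: "c = mat_trace B / of_nat (level_size n l)"
      "(l, B) \<in> level_pairs n" "k + i = l + j" "level_embed n k i A = level_embed n l j B"
    by (auto simp: mem_to_lim lim_rel_def)
  have "c = mat_trace (level_embed n l j B) / of_nat (level_size n (l + j))"
    using * level_embed_trace[OF assms(1)] by (simp add: level_pairs_def)
  also have "\<dots> = mat_trace (level_embed n k i A) / of_nat (level_size n (k + i))"
    using * by simp
  also have "\<dots> = mat_trace A / of_nat (level_size n k)"
    using A level_embed_trace[OF assms(1)] by (simp add: level_pairs_def)
  finally show "c = mat_trace A / of_nat (level_size n k)" .
qed

lemma unitary_mats_pairs: "1 \<le> k \<Longrightarrow> A \<in> unitary_mats (level_size n k) \<Longrightarrow> (k, A) \<in> level_pairs n"
  by (simp add: unitary_mats_def level_pairs_def)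

lemma unitary_mats_mult:
  assumes "A \<in> unitary_mats N" "B \<in> unitary_mats N"
  shows "A * B \<in> unitary_mats N"
proof -
  have A: "A \<in> carrier_mat N N" and B: "B \<in> carrier_mat N N"
    and A': "mat_adjoint A \<in> carrier_mat N N" and B': "mat_adjoint B \<in> carrier_mat N N"
    using assms by (auto simp: unitary_mats_def)
  have adj: "mat_adjoint (A * B) = mat_adjoint B * mat_adjoint A"
    using A B
    by (intro eq_matI)
       (auto simp: mat_adjoint_index scalar_prod_def mult.commute intro!: sum.cong)
  have "A * B * (mat_adjoint B * mat_adjoint A) = A * (B * mat_adjoint B) * mat_adjoint A"
    using A B A' B' by (simp add: assoc_mult_mat[of _ N N _ N _ N])
  moreover have "mat_adjoint B * mat_adjoint A * (A * B) =
      mat_adjoint B * (mat_adjoint A * A) * B"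
    using A B A' B' by (simp add: assoc_mult_mat[of _ N N _ N _ N])
  ultimately show ?thesis
    using assms A B A' B' adj by (simp add: unitary_mats_def)
qed

lemma unitary_mats_one: "1\<^sub>m N \<in> unitary_mats N"
proof -
  have "mat_adjoint (1\<^sub>m N) = (1\<^sub>m N :: complex mat)"
    by (intro eq_matI) (auto simp: mat_adjoint_index)
  then show ?thesis by (simp add: unitary_mats_def)
qed

lemma unitary_mats_adjoint:
  assumes "A \<in> unitary_mats N"
  shows "mat_adjoint A \<in> unitary_mats N"
proof -
  have "mat_adjoint (mat_adjoint A) = A"
    by (intro eq_matI) (auto simp: mat_adjoint_index)
  then show ?thesis using assms by (auto simp: unitary_mats_def)
qed

lemma unitary_mats_embed:
  assumes "A \<in> unitary_mats (level_size n k)"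
  shows "level_embed n k i A \<in> unitary_mats (level_size n (k + i))"
proof -
  have A: "A \<in> carrier_mat (level_size n k) (level_size n k)"
    and A': "mat_adjoint A \<in> carrier_mat (level_size n k) (level_size n k)"
    using assms by (auto simp: unitary_mats_def)
  have "level_embed n k i A * mat_adjoint (level_embed n k i A) = 1\<^sub>m (level_size n (k + i))"
    "mat_adjoint (level_embed n k i A) * level_embed n k i A = 1\<^sub>m (level_size n (k + i))"
    using assms level_embed_mult[OF A A', of i] level_embed_mult[OF A' A, of i]
    by (simp_all add: level_embed_adjoint[OF A] level_embed_one unitary_mats_def)
  then show ?thesis using level_embed_carrier[OF A] by (simp add: unitary_mats_def)
qed

lemma unitary_lim_common_level:
  assumes "X \<in> carrier (unitary_lim n)" "Y \<in> carrier (unitary_lim n)"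
  obtains k A B where "1 \<le> k" "A \<in> unitary_mats (level_size n k)"
    "B \<in> unitary_mats (level_size n k)" "X = to_lim n k A" "Y = to_lim n k B"
proof -
  from assms obtain k A l B where *: "1 \<le> k" "A \<in> unitary_mats (level_size n k)"
      "X = to_lim n k A" "1 \<le> l" "B \<in> unitary_mats (level_size n l)" "Y = to_lim n l B"
    by (auto simp: unitary_lim_def)
  show ?thesis
  proof (rule that[of "k + l"])
    show "level_embed n k l A \<in> unitary_mats (level_size n (k + l))"
      using * unitary_mats_embed by blast
    show "level_embed n l k B \<in> unitary_mats (level_size n (k + l))"
      using * unitary_mats_embed[of B n l k] by (simp add: add.commute)
    show "X = to_lim n (k + l) (level_embed n k l A)"
      using * by (simp add: to_lim_embed unitary_mats_pairs)
    show "Y = to_lim n (k + l) (level_embed n l k B)"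
      using * to_lim_embed[of l B n k] by (simp add: unitary_mats_pairs add.commute)
  qed (use * in simp)
qed

lemma mult_unitary_lim:
  assumes "1 \<le> k" "A \<in> unitary_mats (level_size n k)" "B \<in> unitary_mats (level_size n k)"
  shows "to_lim n k A \<otimes>\<^bsub>unitary_lim n\<^esub> to_lim n k B = to_lim n k (A * B)"
  using mult_to_lim[of k A n B] assms by (simp add: unitary_lim_def unitary_mats_pairs)

lemma one_unitary_lim:
  assumes "1 \<le> k"
  shows "\<one>\<^bsub>unitary_lim n\<^esub> = to_lim n k (1\<^sub>m (level_size n k))"
proof -
  have "(1, 1\<^sub>m (level_size n 1)) \<in> level_pairs n" by (simp add: level_pairs_def)
  from to_lim_embed[OF this, of "k - 1"] show ?thesis
    using assms by (simp add: level_embed_one unitary_lim_def mat_lim_def del: One_nat_def)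
qed

lemma group_unitary_lim: "group (unitary_lim n)"
proof (rule groupI)
  show "X \<otimes>\<^bsub>unitary_lim n\<^esub> Y \<in> carrier (unitary_lim n)"
    if "X \<in> carrier (unitary_lim n)" "Y \<in> carrier (unitary_lim n)" for X Y
    using unitary_lim_common_level[OF that]
    by (metis mult_unitary_lim to_lim_in_unitary_lim unitary_mats_mult)
  show "\<one>\<^bsub>unitary_lim n\<^esub> \<in> carrier (unitary_lim n)"
    using one_unitary_lim[of 1 n] to_lim_in_unitary_lim[OF _ unitary_mats_one, of 1 n] by simp
  show "X \<otimes>\<^bsub>unitary_lim n\<^esub> Y \<otimes>\<^bsub>unitary_lim n\<^esub> Z = X \<otimes>\<^bsub>unitary_lim n\<^esub> (Y \<otimes>\<^bsub>unitary_lim n\<^esub> Z)"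
    if X: "X \<in> carrier (unitary_lim n)" and Y: "Y \<in> carrier (unitary_lim n)"
      and Z: "Z \<in> carrier (unitary_lim n)" for X Y Z
  proof -
    obtain k A B where 1: "1 \<le> k" "A \<in> unitary_mats (level_size n k)"
      "B \<in> unitary_mats (level_size n k)" "X = to_lim n k A" "Y = to_lim n k B"
      using unitary_lim_common_level[OF X Y] .
    obtain l C where 2: "1 \<le> l" "C \<in> unitary_mats (level_size n l)" "Z = to_lim n l C"
      using Z by (auto simp: unitary_lim_def)
    define A' B' C' where "A' = level_embed n k l A" and "B' = level_embed n k l B"
      and "C' = level_embed n l k C"
    have U: "A' \<in> unitary_mats (level_size n (k + l))" "B' \<in> unitary_mats (level_size n (k + l))"
      "C' \<in> unitary_mats (level_size n (k + l))"
      using 1 2 unitary_mats_embed[of _ n k l] unitary_mats_embed[of C n l k]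
      by (simp_all add: A'_def B'_def C'_def add.commute)
    have XYZ: "X = to_lim n (k + l) A'" "Y = to_lim n (k + l) B'" "Z = to_lim n (k + l) C'"
      using 1 2 to_lim_embed[of k _ n l] to_lim_embed[of l C n k]
      by (simp_all add: A'_def B'_def C'_def unitary_mats_pairs add.commute)
    have "A' * B' * C' = A' * (B' * C')"
      using U by (auto simp: unitary_mats_def intro!: assoc_mult_mat)
    then show ?thesis
      using \<open>1 \<le> k\<close> U unfolding XYZ by (simp add: mult_unitary_lim unitary_mats_mult)
  qed
  show "\<one>\<^bsub>unitary_lim n\<^esub> \<otimes>\<^bsub>unitary_lim n\<^esub> X = X" if "X \<in> carrier (unitary_lim n)" for X
  proof -
    from that obtain k A where "1 \<le> k" "A \<in> unitary_mats (level_size n k)" "X = to_lim n k A"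
      by (auto simp: unitary_lim_def)
    then show ?thesis
      by (simp add: one_unitary_lim[of k] mult_unitary_lim unitary_mats_one)
         (auto simp: unitary_mats_def)
  qed
  show "\<exists>Y\<in>carrier (unitary_lim n). Y \<otimes>\<^bsub>unitary_lim n\<^esub> X = \<one>\<^bsub>unitary_lim n\<^esub>"
    if "X \<in> carrier (unitary_lim n)" for X
  proof -
    from that obtain k A
      where *: "1 \<le> k" "A \<in> unitary_mats (level_size n k)" "X = to_lim n k A"
      by (auto simp: unitary_lim_def)
    have "to_lim n k (mat_adjoint A) \<otimes>\<^bsub>unitary_lim n\<^esub> X = \<one>\<^bsub>unitary_lim n\<^esub>"
      using * by (simp add: one_unitary_lim[of k] mult_unitary_lim unitary_mats_adjoint)
        (simp add: unitary_mats_def)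
    then show ?thesis
      using * to_lim_in_unitary_lim unitary_mats_adjoint by blast
  qed
qed

end

theory Submission
  imports Defs "HOL-Probability.Probability" "HOL-Complex_Analysis.Great_Picard"
    "Jordan_Normal_Form.Spectral_Radius"
begin

text \<open>
  Fix a character and look at its restriction to the unitary group of size \<open>N k\<close>. It is a
  class function, hence by the spectral theorem determined by its values on diagonal
  matrices, and on the diagonal torus Bochner's theorem writes it as the expectation of
  \<open>\<Prod>i. z i powi w i\<close> for a random integer vector \<open>w\<close>. Conjugation by permutation matrices
  makes the law of \<open>w\<close> exchangeable. Everything rests on describing \<open>w\<close> for large \<open>k\<close>:
  with probability close to 1 it has a bounded number of nonzero coordinates, and these
  are all 1 or -1. A bounded number of weights placed at random among \<open>N k\<close> positions is
  almost an independent uniform placement, so the character is close to the expectation of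
  \<open>t ^ a * cnj t ^ b\<close>, where \<open>t\<close> is the normalised trace and \<open>a\<close>, \<open>b\<close> count the weights 1
  and -1. The laws of \<open>(a, b)\<close> are tight, and a limit point \<open>c\<close> represents the character
  exactly on all levels at once: every character is a mixture of the functions
  \<open>t ^ a * cnj t ^ b\<close> (\<open>character_representation\<close>).

  Boundedness of the number of nonzero weights (\<open>small_block_vanishes\<close>, \<open>weights_tight\<close>)
  comes from compatibility of the levels together with continuity at the identity of a low
  level. A one-coordinate rotation at level \<open>l\<close> embeds into level \<open>k\<close> as the rotation of a
  whole block of \<open>N k div N l\<close> coordinates, so it controls the sum of \<open>w\<close> over any block
  of that size, uniformly in \<open>k\<close>. Comparing overlapping blocks shows that \<open>w\<close> is constant
  on a small block with high probability; the block sum is then a large multiple of that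
  constant, while continuity keeps it from being a nonzero multiple of a large number, so
  the constant is 0. By exchangeability, a vector that vanishes on a fixed proportion of
  the positions has few nonzero coordinates.

  That large weights are excluded (\<open>weights_bounded\<close>) is again continuity. That a nonzero
  weight divisible by some \<open>d\<close> at least 2 is excluded (\<open>multiples_vanish\<close>) needs matrices
  outside the torus. Let \<open>S\<close> be the permutation matrix of many disjoint \<open>d\<close>-cycles and
  multiply it by a scalar \<open>\<zeta>\<close> on the support of the cycles. Averaging over conjugation by
  diagonal matrices and using positive definiteness, the value of the character changes
  little with \<open>\<zeta>\<close>, because a vector \<open>w\<close> with few nonzero coordinates is rarely invariant
  under the cycles unless it vanishes on them (\<open>clock_rotation\<close>). On the other hand \<open>S\<close> is
  diagonalised by the discrete Fourier transform, with all \<open>d\<close>-th roots of unity as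
  equally frequent eigenvalues; the average of the \<open>v\<close>-th powers of these eigenvalues
  depends on \<open>\<zeta>\<close> exactly when \<open>d\<close> divides \<open>v\<close>. Hence nonzero weights divisible by \<open>d\<close> must
  be rare.

  Conversely every mixture of trace monomials is a character, since the normalised trace
  is the Gram kernel of the matrix entries and such kernels are closed under products and
  conjugation (\<open>group_character_mixed\<close>). So an indecomposable character cannot be a
  mixture of two different ones, and is a single trace monomial. A single monomial is
  indecomposable because its mixing distribution is unique: if \<open>t\<close> and \<open>(norm t)\<^sup>2\<close> are
  both traces of group elements, then the variance of \<open>t ^ a * cnj t ^ b\<close> around the given
  monomial vanishes (\<open>trace_monomial_variance\<close>), and suitable \<open>t\<close> separate all pairs
  \<open>(a, b)\<close>.
\<close>

section \<open>Bounded functions and tight families of discrete distributions\<close>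

lemma pmf_integrable_bounded:
  fixes g :: "'a \<Rightarrow> 'b::{banach, second_countable_topology}"
  assumes "\<And>x. norm (g x) \<le> B"
  shows "integrable (measure_pmf p) g"
  using assms by (intro measure_pmf.integrable_const_bound[where B = B]) auto

text \<open>Markov's inequality for a bounded function.\<close>

lemma pmf_expectation_indicator_le:
  assumes "\<And>x. x \<in> A \<Longrightarrow> c \<le> g x" "\<And>x. 0 \<le> g x" "\<And>x. g x \<le> (B::real)"
  shows "c * measure_pmf.prob p A \<le> measure_pmf.expectation p g"
proof -
  have "measure_pmf.expectation p (\<lambda>x. c * indicator A x) \<le> measure_pmf.expectation p g"
  proof (rule integral_mono)
    show "integrable (measure_pmf p) (\<lambda>x. c * indicator A x)"
      by (rule pmf_integrable_bounded[where B = "\<bar>c\<bar>"]) (auto simp: indicator_def)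
    show "integrable (measure_pmf p) g"
      by (rule pmf_integrable_bounded[where B = B]) (use assms in auto)
  qed (use assms in \<open>auto simp: indicator_def\<close>)
  then show ?thesis by simp
qed

lemma pmf_expectation_outside_finite:
  fixes g :: "'a \<Rightarrow> complex"
  assumes K: "finite K" and g: "\<And>x. norm (g x) \<le> 1"
  shows "norm (measure_pmf.expectation p g - (\<Sum>x\<in>K. pmf p x *\<^sub>R g x)) \<le> 1 - measure_pmf.prob p K"
proof -
  have i1: "integrable (measure_pmf p) g"
    by (rule pmf_integrable_bounded[OF g])
  have i2: "integrable (measure_pmf p) (\<lambda>x. indicator K x *\<^sub>R g x)"
    by (rule pmf_integrable_bounded[where B=1]) (use g in \<open>auto simp: indicator_def\<close>)
  have "measure_pmf.expectation p (\<lambda>x. indicator K x *\<^sub>R g x) = (\<Sum>x\<in>K. pmf p x *\<^sub>R (indicator K x *\<^sub>R g x))"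
    by (rule integral_measure_pmf[OF K]) (auto simp: indicator_def split: if_splits)
  also have "\<dots> = (\<Sum>x\<in>K. pmf p x *\<^sub>R g x)"
    by (intro sum.cong) auto
  finally have "measure_pmf.expectation p g - (\<Sum>x\<in>K. pmf p x *\<^sub>R g x) =
      measure_pmf.expectation p (\<lambda>x. g x - indicator K x *\<^sub>R g x)"
    using i1 i2 by simp
  also have "norm \<dots> \<le> measure_pmf.expectation p (\<lambda>x. norm (g x - indicator K x *\<^sub>R g x))"
    by (rule integral_norm_bound)
  also have "\<dots> \<le> measure_pmf.expectation p (\<lambda>x. indicator (-K) x)"
  proof (rule integral_mono)
    show "integrable (measure_pmf p) (\<lambda>x. norm (g x - indicator K x *\<^sub>R g x))"
      by (rule pmf_integrable_bounded[where B=1]) (use g in \<open>auto simp: indicator_def\<close>)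
    show "integrable (measure_pmf p) (indicat_real (-K))"
      by (rule pmf_integrable_bounded[where B=1]) (auto simp: indicator_def)
  qed (use g in \<open>auto simp: indicator_def\<close>)
  also have "\<dots> = 1 - measure_pmf.prob p K"
    by (simp add: measure_pmf.prob_compl[of K p, simplified, folded Compl_eq_Diff_UNIV])
  finally show ?thesis .
qed

text \<open>Prokhorov's theorem on a countable set: a diagonal subsequence converges pointwise,
  tightness prevents mass from escaping, so the limit is a distribution and expectations of
  bounded functions converge.\<close>

lemma tight_pmf_convergent_subsequence:
  fixes p :: "nat \<Rightarrow> 'a pmf"
  assumes S: "countable S" "\<And>n. set_pmf (p n) \<subseteq> S"
    and tight: "\<And>e. 0 < e \<Longrightarrow> \<exists>K n0. finite K \<and> (\<forall>n\<ge>n0. 1 - e \<le> measure_pmf.prob (p n) K)"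
  obtains r q where "strict_mono (r :: nat \<Rightarrow> nat)"
    "\<And>g :: 'a \<Rightarrow> complex. (\<And>x. norm (g x) \<le> 1) \<Longrightarrow>
       (\<lambda>n. measure_pmf.expectation (p (r n)) g) \<longlonglongrightarrow> measure_pmf.expectation q g"
proof -
  obtain r where r: "strict_mono (r::nat\<Rightarrow>nat)" and ex: "\<And>x. x \<in> S \<Longrightarrow> \<exists>l. (\<lambda>n. pmf (p (r n)) x) \<longlonglongrightarrow> l"
    by (rule function_convergent_subsequence[OF S(1), where f = "\<lambda>n. pmf (p n)" and M = 1])
       (auto simp: pmf_le_1)
  define l where "l x = lim (\<lambda>n. pmf (p (r n)) x)" for x
  have l: "(\<lambda>n. pmf (p (r n)) x) \<longlonglongrightarrow> l x" for x
  proof (cases "x \<in> S")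
    case True
    then show ?thesis using ex[OF True] by (simp add: l_def convergent_LIMSEQ_iff[symmetric] convergent_def)
  next
    case False
    then have "pmf (p (r n)) x = 0" for n using S(2)[of "r n"] by (auto simp: set_pmf_eq)
    then show ?thesis by (simp add: l_def)
  qed
  have l0: "0 \<le> l x" for x
    by (rule LIMSEQ_le_const[OF l]) auto
  have le: "(\<integral>\<^sup>+x. ennreal (l x) \<partial>count_space UNIV) \<le> 1"
  proof -
    have "(\<integral>\<^sup>+x. ennreal (l x) \<partial>count_space UNIV) =
       (\<integral>\<^sup>+x. liminf (\<lambda>n. ennreal (pmf (p (r n)) x)) \<partial>count_space UNIV)"
      by (intro nn_integral_cong lim_imp_Liminf[symmetric] tendsto_ennrealI l) auto
    also have "\<dots> \<le> liminf (\<lambda>n. \<integral>\<^sup>+x. ennreal (pmf (p (r n)) x) \<partial>count_space UNIV)"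
      by (rule nn_integral_liminf) auto
    also have "\<dots> = 1"
      by (simp add: nn_integral_pmf measure_pmf.emeasure_space_1[simplified] Liminf_const)
    finally show ?thesis .
  qed
  have K: "\<exists>K n0. finite K \<and> (\<forall>n\<ge>n0. 1 - e \<le> measure_pmf.prob (p (r n)) K) \<and> 1 - e \<le> (\<Sum>x\<in>K. l x)"
    if e: "0 < e" for e
  proof -
    obtain K n0 where K: "finite K" "\<And>n. n \<ge> n0 \<Longrightarrow> 1 - e \<le> measure_pmf.prob (p n) K"
      using tight[OF e] by blast
    have rn: "r n \<ge> n0" if "n \<ge> n0" for n using seq_suble[OF r, of n] that by linarith
    have "(\<lambda>n. \<Sum>x\<in>K. pmf (p (r n)) x) \<longlonglongrightarrow> (\<Sum>x\<in>K. l x)"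
      by (intro tendsto_sum l)
    moreover have "\<forall>\<^sub>F n in sequentially. 1 - e \<le> (\<Sum>x\<in>K. pmf (p (r n)) x)"
      using eventually_ge_at_top[of n0]
      by eventually_elim (use K rn in \<open>simp add: measure_measure_pmf_finite[symmetric]\<close>)
    ultimately have "1 - e \<le> (\<Sum>x\<in>K. l x)"
      by (rule tendsto_lowerbound) auto
    then show ?thesis using K rn by blast
  qed
  have ge: "1 \<le> (\<integral>\<^sup>+x. ennreal (l x) \<partial>count_space UNIV)"
  proof (rule ennreal_le_epsilon)
    fix e :: real assume e: "0 < e"
    obtain K where K: "finite K" "1 - e \<le> (\<Sum>x\<in>K. l x)" using K[OF e] by blast
    have "ennreal (\<Sum>x\<in>K. l x) = (\<integral>\<^sup>+x. ennreal (l x) \<partial>count_space K)"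
      using K(1) l0 by (simp add: nn_integral_count_space_finite sum_ennreal)
    also have "\<dots> = (\<integral>\<^sup>+x. ennreal (l x) * indicator K x \<partial>count_space UNIV)"
      by (subst nn_integral_count_space_indicator) auto
    also have "\<dots> \<le> (\<integral>\<^sup>+x. ennreal (l x) \<partial>count_space UNIV)"
      by (rule nn_integral_mono) (auto simp: indicator_def)
    finally have *: "ennreal (\<Sum>x\<in>K. l x) \<le> (\<integral>\<^sup>+x. ennreal (l x) \<partial>count_space UNIV)" .
    have "1 \<le> ennreal ((\<Sum>x\<in>K. l x) + e)"
      using K(2) by (simp add: ennreal_1[symmetric] del: ennreal_1)
    also have "\<dots> = ennreal (\<Sum>x\<in>K. l x) + ennreal e"
      using e l0 by (simp add: ennreal_plus sum_nonneg)
    finally show "1 \<le> (\<integral>\<^sup>+x. ennreal (l x) \<partial>count_space UNIV) + ennreal e"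
      using * by (meson add_right_mono order_trans)
  qed
  define q where "q = embed_pmf l"
  have q: "pmf q x = l x" for x
    unfolding q_def by (rule pmf_embed_pmf) (use l0 le ge in auto)
  show ?thesis
  proof (rule that[OF r, of q])
    fix g :: "'a \<Rightarrow> complex" assume g: "\<And>x. norm (g x) \<le> 1"
    show "(\<lambda>n. measure_pmf.expectation (p (r n)) g) \<longlonglongrightarrow> measure_pmf.expectation q g"
    proof (rule LIMSEQ_I)
      fix e :: real assume "0 < e"
      then have e: "0 < e / 3" by simp
      obtain K n0 where K: "finite K" "\<And>n. n \<ge> n0 \<Longrightarrow> 1 - e/3 \<le> measure_pmf.prob (p (r n)) K"
         "1 - e/3 \<le> (\<Sum>x\<in>K. l x)" using K[OF e] by blast
      have "(\<lambda>n. \<Sum>x\<in>K. pmf (p (r n)) x *\<^sub>R g x) \<longlonglongrightarrow> (\<Sum>x\<in>K. l x *\<^sub>R g x)"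
        by (intro tendsto_sum tendsto_scaleR l tendsto_const)
      from LIMSEQ_D[OF this e] obtain n1 where n1: "\<And>n. n \<ge> n1 \<Longrightarrow>
         norm ((\<Sum>x\<in>K. pmf (p (r n)) x *\<^sub>R g x) - (\<Sum>x\<in>K. l x *\<^sub>R g x)) < e / 3" by blast
      show "\<exists>no. \<forall>n\<ge>no. norm (measure_pmf.expectation (p (r n)) g - measure_pmf.expectation q g) < e"
      proof (intro exI allI impI)
        fix n assume n: "n \<ge> max n0 n1"
        have a: "norm (measure_pmf.expectation (p (r n)) g - (\<Sum>x\<in>K. pmf (p (r n)) x *\<^sub>R g x)) \<le> e / 3"
          using pmf_expectation_outside_finite[OF K(1), of g "p (r n)", OF g] K(2)[of n] n
          by linarith
        have b: "norm (measure_pmf.expectation q g - (\<Sum>x\<in>K. l x *\<^sub>R g x)) \<le> e / 3"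
          using pmf_expectation_outside_finite[OF K(1), of g q, OF g] K(3)
          unfolding measure_measure_pmf_finite[OF K(1)] q by linarith
        have c: "norm ((\<Sum>x\<in>K. pmf (p (r n)) x *\<^sub>R g x) - (\<Sum>x\<in>K. l x *\<^sub>R g x)) < e / 3"
          using n1 n by simp
        have "norm (measure_pmf.expectation (p (r n)) g - measure_pmf.expectation q g) =
          norm ((measure_pmf.expectation (p (r n)) g - (\<Sum>x\<in>K. pmf (p (r n)) x *\<^sub>R g x)) +
            ((\<Sum>x\<in>K. pmf (p (r n)) x *\<^sub>R g x) - (\<Sum>x\<in>K. l x *\<^sub>R g x)) -
            (measure_pmf.expectation q g - (\<Sum>x\<in>K. l x *\<^sub>R g x)))"
          by simp
        also have "\<dots> \<le> norm (measure_pmf.expectation (p (r n)) g - (\<Sum>x\<in>K. pmf (p (r n)) x *\<^sub>R g x)) +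
            norm ((\<Sum>x\<in>K. pmf (p (r n)) x *\<^sub>R g x) - (\<Sum>x\<in>K. l x *\<^sub>R g x)) +
            norm (measure_pmf.expectation q g - (\<Sum>x\<in>K. l x *\<^sub>R g x))"
          by (meson norm_triangle_ineq4 norm_triangle_ineq add_right_mono order_trans)
        also have "\<dots> < e" using a b c by simp
        finally show "norm (measure_pmf.expectation (p (r n)) g - measure_pmf.expectation q g) < e" .
      qed
    qed
  qed
qed

section \<open>Integer random variables and expectations of cosines\<close>

lemma sum_cis_multiples:
  fixes x :: real and J :: nat
  assumes "cis x \<noteq> 1"
  shows "(\<Sum>s<J. cis (real s * x)) = (1 - cis (real J * x)) / (1 - cis x)"
proof -
  have "(\<Sum>s<J. cis (real s * x)) = (\<Sum>s<J. cis x ^ s)"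
    by (intro sum.cong refl) (simp add: Complex.DeMoivre)
  also have "\<dots> = (1 - cis x ^ J) / (1 - cis x)"
    using assms by (subst sum_gp_strict) auto
  finally show ?thesis by (simp add: Complex.DeMoivre)
qed

text \<open>Jordan's inequality, with the optimal constant \<open>2 / pi\<close> weakened to 1/2.\<close>

lemma half_le_sin:
  assumes "0 \<le> y" "y \<le> pi / 2"
  shows "y / 2 \<le> sin y"
proof (cases "y \<le> pi / 3")
  case True
  show ?thesis
  proof (cases "y = 0")
    case False
    then have "0 < y" using assms by simp
    then obtain z where z: "0 < z" "z < y" "sin y - sin 0 = (y - 0) * cos z"
      using MVT2[of 0 y sin cos] by (auto intro: DERIV_sin)
    have "cos (pi / 3) \<le> cos z"
      using z True by (intro cos_monotone_0_pi_le) auto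
    then have "1 / 2 \<le> cos z" by (simp add: cos_60)
    then show ?thesis using z \<open>0 < y\<close> by (simp add: field_simps)
  qed simp
next
  case False
  then have "sin (pi / 3) \<le> sin y"
    using assms by (intro sin_monotone_2pi_le) auto
  moreover have "(17/10 :: real) \<le> sqrt 3" by (rule real_le_rsqrt) (simp add: power2_eq_square)
  ultimately have "17/20 \<le> sin y" by (simp add: sin_60)
  moreover have "y \<le> 8/5" using assms pi_less_4 pi_approx by simp
  ultimately show ?thesis by simp
qed

lemma norm_one_minus_cis_ge:
  assumes "\<bar>x\<bar> \<le> pi"
  shows "\<bar>x\<bar> / 2 \<le> norm (1 - cis x)"
proof -
  have "norm (1 - cis x) ^ 2 = (1 - cos x)\<^sup>2 + (sin x)\<^sup>2"
    by (simp add: cmod_power2)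
  also have "\<dots> = 2 - 2 * cos x"
    using sin_cos_squared_add[of x] by (simp add: power2_diff)
  also have "\<dots> = (2 * sin (\<bar>x\<bar> / 2))\<^sup>2"
    using cos_double_sin[of "\<bar>x\<bar> / 2"] by (simp add: power_mult_distrib)
  finally have "norm (1 - cis x) = \<bar>2 * sin (\<bar>x\<bar> / 2)\<bar>"
    by (metis abs_norm_cancel power2_eq_iff_nonneg abs_ge_zero norm_ge_zero power2_abs)
  moreover have "\<bar>x\<bar> / 4 \<le> sin (\<bar>x\<bar> / 2)"
    using half_le_sin[of "\<bar>x\<bar> / 2"] assms by simp
  ultimately show ?thesis by simp
qed

lemma sum_cos_multiples_le:
  fixes x :: real and J :: nat
  assumes "0 < \<bar>x\<bar>" "\<bar>x\<bar> \<le> pi"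
  shows "(\<Sum>s<J. cos (real s * x)) \<le> 4 / \<bar>x\<bar>"
proof -
  have n: "\<bar>x\<bar> / 2 \<le> norm (1 - cis x)" by (rule norm_one_minus_cis_ge) fact
  have ne: "cis x \<noteq> 1" using n assms by auto
  have "(\<Sum>s<J. cos (real s * x)) = Re (\<Sum>s<J. cis (real s * x))"
    by simp
  also have "\<dots> \<le> norm (\<Sum>s<J. cis (real s * x))" by (rule complex_Re_le_cmod)
  also have "\<dots> = norm (1 - cis (real J * x)) / norm (1 - cis x)"
    by (simp add: sum_cis_multiples[OF ne] norm_divide)
  also have "\<dots> \<le> 2 / norm (1 - cis x)"
    by (intro divide_right_mono order_trans[OF norm_triangle_ineq4]) auto
  also have "\<dots> \<le> 2 / (\<bar>x\<bar> / 2)"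
    using n assms ne by (intro divide_left_mono mult_pos_pos) auto
  finally show ?thesis by simp
qed

lemma sum_cis_roots_of_unity:
  fixes a :: int and J :: nat
  assumes "0 < J"
  shows "(\<Sum>s<J. cis (real s * (2 * pi * a / J))) = (if int J dvd a then of_nat J else 0)"
proof (cases "int J dvd a")
  case True
  then obtain k where k: "a = int J * k" by auto
  have "cis (real s * (2 * pi * a / J)) = 1" for s
  proof -
    have "real s * (2 * pi * a / J) = 2 * pi * of_int (int s * k)" using assms by (simp add: k)
    then show ?thesis by (metis Complex.cis_multiple_2pi Ints_of_int)
  qed
  then show ?thesis using True by simp
next
  case False
  let ?x = "2 * pi * a / J"
  have "cis ?x \<noteq> 1"
  proof
    assume "cis ?x = 1"
    then have "cos ?x = 1" by (metis cis.sel(1) one_complex.sel(1))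
    then obtain k :: int where "?x = of_int k * 2 * pi"
      by (auto simp: cos_one_2pi_int)
    then have "real_of_int a = of_int k * real J" using assms(1)
      by (simp add: field_simps)
    then have "a = k * int J" by (metis of_int_eq_iff of_int_mult of_int_of_nat_eq)
    with False show False by simp
  qed
  moreover have "cis (real J * ?x) = 1"
  proof -
    have "real J * ?x = 2 * pi * of_int a" using assms(1) by simp
    then show ?thesis
      by (metis Complex.cis_multiple_2pi Ints_of_int)
  qed
  ultimately show ?thesis using False
    by (subst sum_cis_multiples) auto
qed

lemma sum_cos_roots_of_unity:
  fixes a :: int and J :: nat
  assumes "0 < J" "\<not> int J dvd a"
  shows "(\<Sum>s<J. cos (real s * (2 * pi * a / J))) = 0"
  using sum_cis_roots_of_unity[of J a] assms by (simp add: complex_eq_iff)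

lemma pmf_expectation_sum_cos:
  "measure_pmf.expectation p (\<lambda>w. \<Sum>s<J. cos (f s w)) = (\<Sum>s<J. measure_pmf.expectation p (\<lambda>w. cos (f s w :: real)))"
  by (rule Bochner_Integration.integral_sum) (rule pmf_integrable_bounded[where B=1], simp)

text \<open>The common principle of the next lemmas: if all the cosines have expectation close to
  1, then so has their average over a grid of frequencies; an event on which this average
  stays below \<open>1 - c\<close> must therefore be rare.\<close>

lemma prob_le_of_averaged_cosines:
  fixes f :: "'a \<Rightarrow> real" and J :: nat and c :: real
  assumes J: "0 < J"
    and E: "\<And>s. s < J \<Longrightarrow> 1 - e \<le> measure_pmf.expectation p (\<lambda>w. cos (real s * f w))"
    and A: "\<And>w. w \<in> A \<Longrightarrow> (\<Sum>s<J. cos (real s * f w)) \<le> (1 - c) * J"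
  shows "c * measure_pmf.prob p A \<le> e"
proof -
  let ?g = "\<lambda>w. \<Sum>s<J. cos (real s * f w)"
  have b: "\<bar>?g w\<bar> \<le> J" for w
    by (rule order_trans[OF sum_abs]) (rule order_trans[OF sum_bounded_above[where K=1]], auto)
  have i: "integrable (measure_pmf p) ?g"
    by (rule pmf_integrable_bounded[where B=J]) (use b in simp)
  have "c * J * measure_pmf.prob p A \<le> measure_pmf.expectation p (\<lambda>w. J - ?g w)"
  proof (rule pmf_expectation_indicator_le)
    fix w show "0 \<le> J - ?g w" "J - ?g w \<le> 2 * J" using b[of w] by (auto simp: abs_le_iff)
  next
    fix w assume "w \<in> A" then show "c * J \<le> J - ?g w" using A[of w] by (simp add: algebra_simps)
  qed
  also have "\<dots> = J - measure_pmf.expectation p ?g"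
    using i by (subst Bochner_Integration.integral_diff) auto
  also have "measure_pmf.expectation p ?g = (\<Sum>s<J. measure_pmf.expectation p (\<lambda>w. cos (real s * f w)))"
    by (rule pmf_expectation_sum_cos)
  also have "J - \<dots> \<le> J - (\<Sum>s<J. 1 - e)"
    by (intro diff_left_mono sum_mono E) auto
  finally have "c * measure_pmf.prob p A * J \<le> e * J" by (simp add: algebra_simps)
  then show ?thesis using J by simp
qed

text \<open>The upper bound \<open>pi\<close> keeps the geometric sum over the grid away from its other
  resonances, so that a large value of \<open>Y\<close> makes the average small. The grid version is what
  applies when expectations are only known at roots of unity.\<close>

lemma tail_bound_of_cosines_grid:
  fixes Y :: "'a \<Rightarrow> int" and x C :: real and J :: nat
  assumes x: "0 < x" and J: "0 < J"
    and E: "\<And>s. s < J \<Longrightarrow> 1 - e \<le> measure_pmf.expectation p (\<lambda>w. cos (real s * x * Y w))"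
    and C: "8 \<le> C * x * J"
  shows "measure_pmf.prob p {w. C \<le> \<bar>Y w\<bar> \<and> \<bar>Y w\<bar> * x \<le> pi} \<le> 2 * e"
proof -
  have "(1/2) * measure_pmf.prob p {w. C \<le> \<bar>Y w\<bar> \<and> \<bar>Y w\<bar> * x \<le> pi} \<le> e"
  proof (rule prob_le_of_averaged_cosines[OF J, where f = "\<lambda>w. x * Y w"])
    show "1 - e \<le> measure_pmf.expectation p (\<lambda>w. cos (real s * (x * Y w)))" if "s < J" for s
      using E[OF that] by (simp add: mult.assoc)
    fix w assume w: "w \<in> {w. C \<le> \<bar>Y w\<bar> \<and> \<bar>Y w\<bar> * x \<le> pi}"
    have "0 < C * (x * J)" using C by (simp add: mult.assoc)
    moreover have "0 < x * J" using x J by simp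
    ultimately have "C > 0" by (rule zero_less_mult_pos2)
    then have pos: "0 < \<bar>x * Y w\<bar>" using w x by (auto simp: abs_mult)
    have "(\<Sum>s<J. cos (real s * (x * Y w))) \<le> 4 / \<bar>x * Y w\<bar>"
      by (rule sum_cos_multiples_le[OF pos]) (use w x in \<open>simp add: abs_mult mult.commute\<close>)
    also have "\<dots> \<le> 4 / (C * x)"
      using w x \<open>C > 0\<close> by (intro divide_left_mono) (auto simp: abs_mult mult.commute)
    also have "\<dots> \<le> (1 - 1/2) * J"
      using C x \<open>C > 0\<close> by (simp add: field_simps)
    finally show "(\<Sum>s<J. cos (real s * (x * Y w))) \<le> (1 - 1/2) * J" .
  qed
  then show ?thesis by simp
qed

lemma prob_le_of_increasing_bounds:
  assumes "incseq A" "\<And>n. measure_pmf.prob p (A n) \<le> e"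
  shows "measure_pmf.prob p (\<Union>n. A n) \<le> e"
  by (rule LIMSEQ_le_const2[OF measure_pmf.finite_Lim_measure_incseq]) (use assms in auto)

text \<open>Refining the grid removes the upper restriction of the previous lemma.\<close>

lemma tail_bound_of_cosines:
  fixes Y :: "'a \<Rightarrow> int" and t C :: real
  assumes t: "0 < t"
    and E: "\<And>x. 0 \<le> x \<Longrightarrow> x \<le> t \<Longrightarrow> 1 - e \<le> measure_pmf.expectation p (\<lambda>w. cos (x * Y w))"
    and C: "8 \<le> C * t"
  shows "measure_pmf.prob p {w. C \<le> \<bar>Y w\<bar>} \<le> 2 * e"
proof -
  define A where "A J = {w. C \<le> \<bar>Y w\<bar> \<and> \<bar>Y w\<bar> * (t / Suc J) \<le> pi}" for J
  have "measure_pmf.prob p (\<Union>J. A J) \<le> 2 * e"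
  proof (rule prob_le_of_increasing_bounds)
    show "incseq A"
    proof (rule incseq_SucI, unfold A_def, safe)
      fix J w assume "real_of_int \<bar>Y w\<bar> * (t / real (Suc J)) \<le> pi"
      moreover have "real_of_int \<bar>Y w\<bar> * (t / real (Suc (Suc J))) \<le> real_of_int \<bar>Y w\<bar> * (t / real (Suc J))"
        using t by (intro mult_left_mono divide_left_mono) auto
      ultimately show "real_of_int \<bar>Y w\<bar> * (t / real (Suc (Suc J))) \<le> pi" by linarith
    qed
    fix J
    show "measure_pmf.prob p (A J) \<le> 2 * e"
      unfolding A_def
    proof (rule tail_bound_of_cosines_grid[where J = "Suc J"])
      show "0 < t / Suc J" using t by simp
      show "8 \<le> C * (t / real (Suc J)) * real (Suc J)" using C by simp
      fix s assume s: "s < Suc J"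
      have "real s * t \<le> t * real (Suc J)" using s t by (simp add: mult.commute)
      then show "1 - e \<le> measure_pmf.expectation p (\<lambda>w. cos (real s * (t / real (Suc J)) * Y w))"
        using t by (intro E) (auto simp: field_simps)
    qed simp
  qed
  moreover have "(\<Union>J. A J) = {w. C \<le> \<bar>Y w\<bar>}"
  proof safe
    fix w assume w: "C \<le> \<bar>Y w\<bar>"
    obtain J :: nat where "real_of_int \<bar>Y w\<bar> * t / pi < J" using reals_Archimedean2 by blast
    then have "real_of_int \<bar>Y w\<bar> * t / pi < Suc J" by simp
    then have "real_of_int \<bar>Y w\<bar> * (t / real (Suc J)) \<le> pi" by (simp add: field_simps)
    then show "w \<in> (\<Union>J. A J)" using w by (auto simp: A_def)
  qed (auto simp: A_def)
  ultimately show ?thesis by simp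
qed

text \<open>On a nonzero multiple of \<open>M\<close> the average of the cosines over a sufficiently fine
  equidistant grid of \<open>[0, 2 * pi / M]\<close> is exactly 0, because it is a full sum over roots of
  unity. With large \<open>M\<close> this says that only a tiny interval of frequencies is needed to
  exclude nonzero multiples of \<open>M\<close>.\<close>

lemma divisibility_of_cosines:
  fixes Y :: "'a \<Rightarrow> int" and M :: nat
  assumes M: "0 < M"
    and E: "\<And>x. 0 \<le> x \<Longrightarrow> x \<le> 2 * pi / M \<Longrightarrow> 1 - e \<le> measure_pmf.expectation p (\<lambda>w. cos (x * Y w))"
  shows "measure_pmf.prob p {w. int M dvd Y w \<and> Y w \<noteq> 0} \<le> e"
proof -
  \<comment> \<open>The grid with \<open>Suc J\<close> points detects the multiples \<open>M * y\<close> with \<open>\<bar>y\<bar> < Suc J\<close>; these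
    events exhaust all nonzero multiples.\<close>
  define A where "A J = {w. int M dvd Y w \<and> Y w \<noteq> 0 \<and> \<bar>Y w\<bar> < int M * int (Suc J)}" for J
  have "measure_pmf.prob p (\<Union>J. A J) \<le> e"
  proof (rule prob_le_of_increasing_bounds)
    show "incseq A"
      by (rule incseq_SucI) (auto simp: A_def algebra_simps)
    fix J
    have "1 * measure_pmf.prob p (A J) \<le> e"
    proof (rule prob_le_of_averaged_cosines[where J = "Suc J" and f = "\<lambda>w. 2 * pi / M / Suc J * Y w"])
      fix s assume s: "s < Suc J"
      have "1 - e \<le> measure_pmf.expectation p (\<lambda>w. cos (real s / real (Suc J) * (2 * pi / M) * Y w))"
      proof (rule E)
        have "real s / real (Suc J) * (2 * pi / M) \<le> 1 * (2 * pi / M)"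
          using s by (intro mult_right_mono) auto
        then show "real s / real (Suc J) * (2 * pi / M) \<le> 2 * pi / M" by simp
      qed simp
      then show "1 - e \<le> measure_pmf.expectation p (\<lambda>w. cos (real s * (2 * pi / M / real (Suc J) * Y w)))"
        by (simp add: field_simps)
    next
      fix w assume w: "w \<in> A J"
      then obtain y where y: "Y w = int M * y" by (auto simp: A_def)
      have "y \<noteq> 0" "\<bar>y\<bar> < int (Suc J)" using w y M by (auto simp: A_def abs_mult)
      then have nd: "\<not> int (Suc J) dvd y" using zdvd_not_zless[of "\<bar>y\<bar>" "int (Suc J)"] by auto
      have "(\<Sum>s<Suc J. cos (real s * (2 * pi * y / of_int (int (Suc J))))) = 0"
        using sum_cos_roots_of_unity[OF _ nd] by (simp only: zero_less_Suc of_int_of_nat_eq simp_thms)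
      moreover have "2 * pi / M / Suc J * Y w = 2 * pi * y / of_int (int (Suc J))"
      proof -
        have "2 * pi / M / Suc J * (M * y) = 2 * pi * y / Suc J" using M by (simp del: of_nat_Suc)
        then show ?thesis by (simp add: y)
      qed
      ultimately show "(\<Sum>s<Suc J. cos (real s * (2 * pi / M / real (Suc J) * Y w))) \<le> (1 - 1) * real (Suc J)"
        by (simp del: sum.lessThan_Suc of_nat_Suc)
    qed simp
    then show "measure_pmf.prob p (A J) \<le> e" by simp
  qed
  moreover have "(\<Union>J. A J) = {w. int M dvd Y w \<and> Y w \<noteq> 0}"
  proof safe
    fix w assume w: "int M dvd Y w" "Y w \<noteq> 0"
    have "\<bar>Y w\<bar> < int M * int (Suc (nat \<bar>Y w\<bar>))"
    proof -
      have "1 * (1 + \<bar>Y w\<bar>) \<le> int M * (1 + \<bar>Y w\<bar>)" using M by (intro mult_right_mono) auto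
      then show ?thesis by simp
    qed
    then have "w \<in> A (nat \<bar>Y w\<bar>)" using w by (auto simp: A_def)
    then show "w \<in> (\<Union>J. A J)" by blast
  qed (auto simp: A_def)
  ultimately show ?thesis by simp
qed

section \<open>Products over a random permutation\<close>

lemma sum_permutes_compose_transpose:
  assumes "finite S" "j \<in> S" "x \<in> S"
  shows "(\<Sum>\<sigma> | \<sigma> permutes S. g (\<sigma> \<circ> Transposition.transpose j x)) = (\<Sum>\<sigma> | \<sigma> permutes S. g \<sigma>)"
proof -
  let ?t = "Transposition.transpose j x"
  have t: "?t permutes S" using assms by (intro permutes_swap_id)
  show ?thesis
    by (rule sum.reindex_bij_witness[where i = "\<lambda>\<sigma>. \<sigma> \<circ> ?t" and j = "\<lambda>\<sigma>. \<sigma> \<circ> ?t"])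
       (auto simp: fun_eq_iff intro!: permutes_compose[OF t])
qed

text \<open>The values of a random permutation at a few points are almost independent. Induction
  on \<open>I\<close>: precomposing with the transposition of the new point \<open>j\<close> and a random \<open>x\<close>
  preserves the uniform distribution, makes the value at \<open>j\<close> uniform, and disturbs the
  remaining factors only if \<open>x\<close> lies in \<open>I\<close>. Each step thus costs \<open>2 * card I / card S\<close>, and
  these add up to the square.\<close>

lemma permutation_average_almost_independent:
  fixes a :: "'i \<Rightarrow> 'i \<Rightarrow> complex"
  assumes S: "finite S" "S \<noteq> {}" and I: "I \<subseteq> S" and a: "\<And>i x. norm (a i x) \<le> 1"
  shows "norm ((\<Sum>\<sigma> | \<sigma> permutes S. \<Prod>i\<in>I. a i (\<sigma> i)) / fact (card S) -
      (\<Prod>i\<in>I. (\<Sum>x\<in>S. a i x) / card S)) \<le> (card I)\<^sup>2 / card S"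
proof -
  have "finite I" using S I finite_subset by blast
  then show ?thesis using I
  proof (induction I)
    case empty
    show ?case using S by (simp add: card_permutations)
  next
    case (insert j I)
    let ?N = "card S" and ?P = "{\<sigma>. \<sigma> permutes S}"
    have N: "0 < ?N" using S by (simp add: card_gt_0_iff)
    have P: "finite ?P" "card ?P = fact ?N" using S by (auto simp: finite_permutations card_permutations)
    define Q where "Q \<sigma> = (\<Prod>i\<in>I. a i (\<sigma> i))" for \<sigma>
    define m where "m = (\<Sum>x\<in>S. a j x) / ?N"
    have Q1: "norm (Q \<sigma>) \<le> 1" for \<sigma>
      unfolding Q_def prod_norm[symmetric] using a by (intro prod_le_1) auto
    have m1: "norm m \<le> 1"
    proof -
      have "norm (\<Sum>x\<in>S. a j x) \<le> of_nat ?N * 1" by (intro sum_norm_bound a)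
      then show ?thesis using N by (simp add: m_def norm_divide divide_le_eq)
    qed
    have j: "j \<in> S" "I \<subseteq> S" "j \<notin> I" using insert by auto
    have cI: "card I \<le> ?N" using S j by (intro card_mono) auto
    have A: "(\<Sum>\<sigma>\<in>?P. \<Prod>i\<in>insert j I. a i (\<sigma> i)) = (\<Sum>\<sigma>\<in>?P. a j (\<sigma> j) * Q \<sigma>)"
      using insert by (simp add: Q_def)
    \<comment> \<open>Average over the transposition partner \<open>x\<close>.\<close>
    have B: "?N * (\<Sum>\<sigma>\<in>?P. a j (\<sigma> j) * Q \<sigma>) =
        (\<Sum>\<sigma>\<in>?P. \<Sum>x\<in>S. a j (\<sigma> x) * Q (\<sigma> \<circ> Transposition.transpose j x))"
    proof -
      have "?N * (\<Sum>\<sigma>\<in>?P. a j (\<sigma> j) * Q \<sigma>) = (\<Sum>x\<in>S. \<Sum>\<sigma>\<in>?P. a j (\<sigma> j) * Q \<sigma>)" by simp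
      also have "\<dots> = (\<Sum>x\<in>S. \<Sum>\<sigma>\<in>?P. a j ((\<sigma> \<circ> Transposition.transpose j x) j) * Q (\<sigma> \<circ> Transposition.transpose j x))"
        by (intro sum.cong refl sum_permutes_compose_transpose[symmetric] S j)
      also have "\<dots> = (\<Sum>\<sigma>\<in>?P. \<Sum>x\<in>S. a j (\<sigma> x) * Q (\<sigma> \<circ> Transposition.transpose j x))"
        by (subst sum.swap) simp
      finally show ?thesis .
    qed
    have C: "norm ((\<Sum>x\<in>S. a j (\<sigma> x) * Q (\<sigma> \<circ> Transposition.transpose j x)) - ?N * m * Q \<sigma>) \<le> 2 * card I"
      if "\<sigma> permutes S" for \<sigma>
    proof -
      have "?N * m = (\<Sum>x\<in>S. a j (\<sigma> x))"
        using N sum.permute[OF that, of "a j"] by (simp add: m_def o_def)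
      then have "(\<Sum>x\<in>S. a j (\<sigma> x) * Q (\<sigma> \<circ> Transposition.transpose j x)) - ?N * m * Q \<sigma> =
         (\<Sum>x\<in>S. a j (\<sigma> x) * (Q (\<sigma> \<circ> Transposition.transpose j x) - Q \<sigma>))"
        by (simp add: sum_distrib_right sum_subtractf right_diff_distrib)
      also have "\<dots> = (\<Sum>x\<in>I. a j (\<sigma> x) * (Q (\<sigma> \<circ> Transposition.transpose j x) - Q \<sigma>))"
      proof (intro sum.mono_neutral_right S j ballI)
        fix x assume x: "x \<in> S - I"
        have "Q (\<sigma> \<circ> Transposition.transpose j x) = Q \<sigma>"
          unfolding Q_def using x j by (intro prod.cong refl) (auto simp: Transposition.transpose_def)
        then show "a j (\<sigma> x) * (Q (\<sigma> \<circ> Transposition.transpose j x) - Q \<sigma>) = 0" by simp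
      qed
      also have "norm \<dots> \<le> of_nat (card I) * 2"
      proof (intro sum_norm_bound)
        fix x
        have "norm (a j (\<sigma> x) * (Q (\<sigma> \<circ> Transposition.transpose j x) - Q \<sigma>)) \<le> 1 * (1 + 1)"
          unfolding norm_mult
          by (intro mult_mono a order_trans[OF norm_triangle_ineq4] add_mono Q1) auto
        then show "norm (a j (\<sigma> x) * (Q (\<sigma> \<circ> Transposition.transpose j x) - Q \<sigma>)) \<le> 2" by simp
      qed
      finally show ?thesis by simp
    qed
    define R where "R = (\<Sum>\<sigma>\<in>?P. Q \<sigma>) / fact ?N"
    define T where "T = (\<Sum>\<sigma>\<in>?P. a j (\<sigma> j) * Q \<sigma>) / fact ?N"
    have "norm (?N * fact ?N * (T - m * R)) = norm (\<Sum>\<sigma>\<in>?P. (\<Sum>x\<in>S. a j (\<sigma> x) * Q (\<sigma> \<circ> Transposition.transpose j x)) - ?N * m * Q \<sigma>)"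
      unfolding T_def R_def sum_subtractf B[symmetric] sum_distrib_left[symmetric]
      by (simp add: right_diff_distrib mult.assoc)
    also have "\<dots> \<le> of_nat (card ?P) * (2 * real (card I))"
      by (intro sum_norm_bound) (use C in auto)
    finally have "?N * fact ?N * norm (T - m * R) \<le> fact ?N * (2 * card I)"
      by (simp add: norm_mult P(2))
    then have D: "norm (T - m * R) \<le> 2 * card I / ?N"
      using N by (simp add: field_simps)
    let ?p = "\<Prod>i\<in>I. (\<Sum>x\<in>S. a i x) / ?N"
    have E: "norm (R - ?p) \<le> (card I)\<^sup>2 / ?N"
      using insert.IH j unfolding R_def Q_def by simp
    have "norm (T - m * ?p) = norm ((T - m * R) + m * (R - ?p))" by (simp add: algebra_simps)
    also have "\<dots> \<le> norm (T - m * R) + norm m * norm (R - ?p)"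
      by (metis norm_triangle_ineq norm_mult)
    also have "\<dots> \<le> 2 * card I / ?N + 1 * ((card I)\<^sup>2 / ?N)"
      by (intro add_mono D mult_mono m1 E) auto
    also have "\<dots> \<le> (card (insert j I))\<^sup>2 / ?N"
      using insert N by (simp add: field_simps power2_eq_square)
    finally show ?case
      unfolding A T_def m_def using insert by simp
  qed
qed

section \<open>Bochner's theorem on the torus\<close>

definition torus_monomial :: "nat \<Rightarrow> (nat \<Rightarrow> complex) \<Rightarrow> (nat \<Rightarrow> int) \<Rightarrow> complex" where
  "torus_monomial N z w = (\<Prod>i<N. z i powi w i)"

lemma norm_torus_monomial:
  "(\<And>i. norm (z i) = 1) \<Longrightarrow> norm (torus_monomial N z w) = 1"
  by (simp add: torus_monomial_def prod_norm[symmetric] norm_power_int)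

definition torus_points :: "nat \<Rightarrow> nat \<Rightarrow> (nat \<Rightarrow> nat) set" where
  "torus_points N m = PiE {..<N} (\<lambda>_. {..<m})"

definition torus_point :: "nat \<Rightarrow> nat \<Rightarrow> (nat \<Rightarrow> nat) \<Rightarrow> nat \<Rightarrow> complex" where
  "torus_point N m s i = (if i < N then cis (2 * pi * s i / m) else 1)"

text \<open>The points of order \<open>m\<close> form a finite group isomorphic to the \<open>N\<close>-th power of the
  integers modulo \<open>m\<close>. Both this group and its dual are indexed by the set of the
  \<open>torus_points\<close>; this is the pairing between them.\<close>

definition torus_pairing :: "nat \<Rightarrow> nat \<Rightarrow> (nat \<Rightarrow> nat) \<Rightarrow> (nat \<Rightarrow> nat) \<Rightarrow> complex" where
  "torus_pairing N m s w = (\<Prod>i<N. cis (2 * pi * (int (s i) * int (w i)) / m))"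

lemma finite_torus_points: "finite (torus_points N m)"
  by (simp add: torus_points_def finite_PiE)

lemma card_torus_points: "card (torus_points N m) = m ^ N"
  by (simp add: torus_points_def card_PiE)

lemma cis_mod_period:
  fixes a b :: int
  assumes "0 < m" "int m dvd a - b"
  shows "cis (2 * pi * a / m) = cis (2 * pi * b / m)"
proof -
  obtain k where k: "a = b + int m * k" using assms(2) by (metis add.commute diff_add_cancel dvd_def)
  have "2 * pi * a / m = 2 * pi * b / m + 2 * pi * of_int k"
    using assms(1) by (simp add: k field_simps)
  then show ?thesis by (simp add: cis_mult[symmetric])
qed

text \<open>Orthogonality of the characters of a finite abelian group.\<close>

lemma sum_torus_pairing:
  assumes "0 < m" "s \<in> torus_points N m" "t \<in> torus_points N m"
  shows "(\<Sum>w\<in>torus_points N m. torus_pairing N m s w * cnj (torus_pairing N m t w)) =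
    (if s = t then of_nat m ^ N else 0)"
proof -
  have "(\<Sum>w\<in>torus_points N m. torus_pairing N m s w * cnj (torus_pairing N m t w)) =
     (\<Sum>w\<in>PiE {..<N} (\<lambda>_. {..<m}). \<Prod>i<N. cis (real (w i) * (2 * pi * (int (s i) - int (t i)) / m)))"
    unfolding torus_points_def torus_pairing_def cnj_prod prod.distrib[symmetric]
    by (intro sum.cong prod.cong refl)
       (simp add: cis_cnj cis_mult field_simps diff_divide_distrib)
  also have "\<dots> = (\<Prod>i<N. \<Sum>r<m. cis (real r * (2 * pi * (int (s i) - int (t i)) / m)))"
    by (subst prod_sum_PiE) auto
  also have "\<dots> = (\<Prod>i<N. if s i = t i then of_nat m else 0)"
  proof (rule prod.cong[OF refl])
    fix i assume "i \<in> {..<N}"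
    then have "s i < m" "t i < m" using assms by (auto simp: torus_points_def)
    then have "int m dvd int (s i) - int (t i) \<longleftrightarrow> s i = t i"
      by (metis mod_eq_dvd_iff mod_less of_nat_eq_iff zmod_int)
    then show "(\<Sum>r<m. cis (real r * (2 * pi * (int (s i) - int (t i)) / m))) = (if s i = t i then of_nat m else 0)"
      using sum_cis_roots_of_unity[OF assms(1), of "int (s i) - int (t i)"] by simp
  qed
  also have "\<dots> = (if s = t then of_nat m ^ N else 0)"
  proof (cases "s = t")
    case False
    then obtain i where "s i \<noteq> t i" by auto
    then have "i < N" using assms by (cases "i < N") (auto simp: torus_points_def PiE_def extensional_def)
    then show ?thesis using False \<open>s i \<noteq> t i\<close> by (auto intro!: prod_zero)
  qed simp
  finally show ?thesis .
qed

lemma torus_points_shift: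
  assumes "0 < m" "t \<in> torus_points N m"
  shows "bij_betw (\<lambda>u. \<lambda>i\<in>{..<N}. (u i + t i) mod m) (torus_points N m) (torus_points N m)"
proof (rule bij_betwI[where g = "\<lambda>u. \<lambda>i\<in>{..<N}. (u i + (m - t i)) mod m"])
  fix u assume u: "u \<in> torus_points N m"
  have l: "u i < m" "t i < m" if "i < N" for i using u assms that by (auto simp: torus_points_def)
  have "((u i + t i) mod m + (m - t i)) mod m = u i"
    "((u i + (m - t i)) mod m + t i) mod m = u i" if "i < N" for i
    unfolding mod_add_left_eq using l[OF that] by auto
  then show "(\<lambda>i\<in>{..<N}. ((\<lambda>i\<in>{..<N}. (u i + t i) mod m) i + (m - t i)) mod m) = u"
    "(\<lambda>i\<in>{..<N}. ((\<lambda>i\<in>{..<N}. (u i + (m - t i)) mod m) i + t i) mod m) = u"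
    using u by (auto simp: fun_eq_iff torus_points_def PiE_def extensional_def
        simp del: Nat.add_diff_assoc Nat.diff_add_assoc)
qed (use assms in \<open>auto simp: torus_points_def\<close>)

text \<open>Bochner's theorem for the finite group of points of order \<open>m\<close>: the Fourier
  coefficients of a positive-definite function are nonnegative (test positive definiteness
  against a single character), and they sum to the value at the identity.\<close>

lemma finite_torus_fourier_coefficients:
  fixes F :: "(nat \<Rightarrow> complex) \<Rightarrow> complex"
  assumes m: "0 < m"
    and one: "F (\<lambda>_. 1) = 1"
    and pd: "\<And>(I::(nat \<Rightarrow> nat) set) Z c. finite I \<Longrightarrow> (\<And>s i. s \<in> I \<Longrightarrow> norm (Z s i) = 1) \<Longrightarrow>
        (\<Sum>s\<in>I. \<Sum>t\<in>I. c s * cnj (c t) * F (\<lambda>i. Z s i * cnj (Z t i))) \<in> \<real>\<^sub>\<ge>\<^sub>0"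
  obtains q :: "(nat \<Rightarrow> nat) pmf" where "set_pmf q \<subseteq> torus_points N m"
    "\<And>s. s \<in> torus_points N m \<Longrightarrow>
      F (torus_point N m s) = measure_pmf.expectation q (torus_pairing N m s)"
proof -
  let ?S = "torus_points N m"
  note S = finite_torus_points[of N m] card_torus_points[of N m]
  define P where "P w = (\<Sum>s\<in>?S. F (torus_point N m s) * cnj (torus_pairing N m s w)) / of_nat m ^ N" for w
  have P_pos: "P w \<in> \<real>\<^sub>\<ge>\<^sub>0" for w
  proof -
    let ?c = "\<lambda>s. cnj (torus_pairing N m s w)"
    have "(\<Sum>s\<in>?S. \<Sum>t\<in>?S. ?c s * cnj (?c t) * F (\<lambda>i. torus_point N m s i * cnj (torus_point N m t i))) =
        (\<Sum>t\<in>?S. \<Sum>s\<in>?S. ?c s * cnj (?c t) * F (\<lambda>i. torus_point N m s i * cnj (torus_point N m t i)))"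
      by (rule sum.swap)
    \<comment> \<open>Substituting \<open>s = u + t\<close> makes the summand independent of \<open>t\<close>.\<close>
    also have "\<dots> = (\<Sum>t\<in>?S. \<Sum>u\<in>?S. ?c u * F (torus_point N m u))"
    proof (rule sum.cong[OF refl])
      fix t assume t: "t \<in> ?S"
      let ?h = "\<lambda>u. \<lambda>i\<in>{..<N}. (u i + t i) mod m"
      have "(\<Sum>s\<in>?S. ?c s * cnj (?c t) * F (\<lambda>i. torus_point N m s i * cnj (torus_point N m t i))) =
        (\<Sum>u\<in>?S. ?c (?h u) * cnj (?c t) * F (\<lambda>i. torus_point N m (?h u) i * cnj (torus_point N m t i)))"
        by (rule sum.reindex_bij_betw[OF torus_points_shift[OF m t], symmetric])
      also have "\<dots> = (\<Sum>u\<in>?S. ?c u * F (torus_point N m u))"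
      proof (rule sum.cong[OF refl])
        fix u assume u: "u \<in> ?S"
        have e: "cis (2 * pi * (int ((u i + t i) mod m) * int r) / m) =
            cis (2 * pi * (int (u i) * int r) / m) * cis (2 * pi * (int (t i) * int r) / m)" for i r
        proof -
          have "int m dvd int ((u i + t i) mod m) * int r - int (u i + t i) * int r"
            unfolding left_diff_distrib[symmetric]
            by (intro dvd_mult2) (metis mod_eq_dvd_iff mod_mod_trivial zmod_int)
          from cis_mod_period[OF m this]
          show ?thesis by (simp add: cis_mult add_divide_distrib[symmetric] algebra_simps)
        qed
        have "(\<lambda>i. torus_point N m (?h u) i * cnj (torus_point N m t i)) = torus_point N m u"
          using e[of _ 1] by (simp add: fun_eq_iff torus_point_def cis_cnj cis_mult)
        moreover have "torus_pairing N m (?h u) w = torus_pairing N m u w * torus_pairing N m t w"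
          unfolding torus_pairing_def prod.distrib[symmetric] by (rule prod.cong[OF refl]) (use e in simp)
        moreover have "torus_pairing N m t w * cnj (torus_pairing N m t w) = 1"
          unfolding torus_pairing_def cnj_prod prod.distrib[symmetric]
          by (intro prod.neutral ballI) (simp add: cis_cnj cis_mult)
        ultimately show "?c (?h u) * cnj (?c t) * F (\<lambda>i. torus_point N m (?h u) i * cnj (torus_point N m t i)) =
          ?c u * F (torus_point N m u)"
          by (simp add: mult.assoc mult.commute[of "cnj (torus_pairing N m t w)"])
      qed
      finally show "(\<Sum>s\<in>?S. ?c s * cnj (?c t) * F (\<lambda>i. torus_point N m s i * cnj (torus_point N m t i))) =
        (\<Sum>u\<in>?S. ?c u * F (torus_point N m u))" .
    qed
    also have "\<dots> = of_nat m ^ N * (of_nat m ^ N * P w)"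
      using m by (simp add: S P_def mult.commute)
    finally have "of_nat m ^ N * (of_nat m ^ N * P w) \<in> \<real>\<^sub>\<ge>\<^sub>0"
      using pd[OF S(1), of "torus_point N m" ?c] by (simp add: torus_point_def)
    then have "of_real (m ^ N * m ^ N) * P w \<in> \<real>\<^sub>\<ge>\<^sub>0" by (simp add: mult.assoc)
    then have "of_real (1 / (m ^ N * m ^ N)) * (of_real (m ^ N * m ^ N) * P w) \<in> \<real>\<^sub>\<ge>\<^sub>0"
      by (rule nonneg_Reals_mult_I[rotated]) simp
    then show ?thesis using m by simp
  qed
  have inv: "(\<Sum>w\<in>?S. P w * torus_pairing N m s w) = F (torus_point N m s)" if s: "s \<in> ?S" for s
  proof -
    have "(\<Sum>w\<in>?S. P w * torus_pairing N m s w) =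
      (\<Sum>t\<in>?S. F (torus_point N m t) * (\<Sum>w\<in>?S. torus_pairing N m s w * cnj (torus_pairing N m t w))) / of_nat m ^ N"
      unfolding P_def sum_distrib_left sum_divide_distrib sum_distrib_right
      by (subst sum.swap) (simp add: field_simps)
    also have "\<dots> = (\<Sum>t\<in>?S. F (torus_point N m t) * (if s = t then of_nat m ^ N else 0)) / of_nat m ^ N"
      using sum_torus_pairing[OF m s] by simp
    also have "\<dots> = F (torus_point N m s)"
      using m s S(1) by (simp add: if_distrib sum.delta' cong: if_cong)
    finally show ?thesis .
  qed
  have Re_P: "P w = of_real (Re (P w))" "0 \<le> Re (P w)" for w
    using P_pos[of w] by (auto simp: complex_nonneg_Reals_iff complex_eq_iff)
  define f where "f w = (if w \<in> ?S then Re (P w) else 0)" for w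
  define q where "q = embed_pmf f"
  have "(\<Sum>w\<in>?S. f w) = 1"
  proof -
    define s0 where "s0 = (\<lambda>i\<in>{..<N}. 0::nat)"
    have s0: "s0 \<in> ?S" using m by (auto simp: s0_def torus_points_def)
    have "torus_point N m s0 = (\<lambda>_. 1)" by (auto simp: fun_eq_iff torus_point_def s0_def)
    moreover have "torus_pairing N m s0 w = 1" for w by (simp add: torus_pairing_def s0_def)
    ultimately have "(\<Sum>w\<in>?S. P w) = 1" using inv[OF s0] one by simp
    then have "(\<Sum>w\<in>?S. Re (P w)) = 1" by (metis Re_sum one_complex.sel(1))
    then show ?thesis by (simp add: f_def)
  qed
  moreover have "(\<integral>\<^sup>+w. ennreal (f w) \<partial>count_space UNIV) = (\<Sum>w\<in>?S. ennreal (f w))"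
    by (rule nn_integral_count_space'[OF S(1)]) (auto simp: f_def)
  ultimately have q: "pmf q w = f w" for w
    unfolding q_def using Re_P by (intro pmf_embed_pmf) (auto simp: f_def sum_ennreal)
  show ?thesis
  proof (rule that)
    show sub: "set_pmf q \<subseteq> ?S" by (auto simp: set_pmf_eq q f_def)
    fix s assume s: "s \<in> ?S"
    have "measure_pmf.expectation q (torus_pairing N m s) = (\<Sum>w\<in>?S. pmf q w *\<^sub>R torus_pairing N m s w)"
      by (rule integral_measure_pmf[OF S(1)]) (use sub in auto)
    also have "\<dots> = (\<Sum>w\<in>?S. P w * torus_pairing N m s w)"
      by (intro sum.cong refl) (simp add: q f_def scaleR_conv_of_real Re_P(1)[symmetric])
    finally show "F (torus_point N m s) = measure_pmf.expectation q (torus_pairing N m s)"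
      using inv[OF s] by simp
  qed
qed

text \<open>Exponents at points of order \<open>m\<close> are only defined modulo \<open>m\<close>. The representative of
  least absolute value is the one that has a chance to stay bounded as \<open>m\<close> grows.\<close>

definition centered_residue :: "nat \<Rightarrow> nat \<Rightarrow> int" where
  "centered_residue m r = (if 2 * r \<le> m then int r else int r - int m)"

lemma torus_pmf_on_roots_of_unity:
  fixes F :: "(nat \<Rightarrow> complex) \<Rightarrow> complex"
  assumes m: "0 < m"
    and loc: "\<And>z z'. (\<And>i. i < N \<Longrightarrow> z i = z' i) \<Longrightarrow> F z = F z'"
    and one: "F (\<lambda>_. 1) = 1"
    and pd: "\<And>(I::(nat \<Rightarrow> nat) set) Z c. finite I \<Longrightarrow> (\<And>s i. s \<in> I \<Longrightarrow> norm (Z s i) = 1) \<Longrightarrow>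
        (\<Sum>s\<in>I. \<Sum>t\<in>I. c s * cnj (c t) * F (\<lambda>i. Z s i * cnj (Z t i))) \<in> \<real>\<^sub>\<ge>\<^sub>0"
  obtains p :: "(nat \<Rightarrow> int) pmf"
  where "\<And>w i. w \<in> set_pmf p \<Longrightarrow> 2 * \<bar>w i\<bar> \<le> int m" "\<And>w i. w \<in> set_pmf p \<Longrightarrow> N \<le> i \<Longrightarrow> w i = 0"
    "\<And>z. (\<And>i. i < N \<Longrightarrow> z i ^ m = 1) \<Longrightarrow> F z = measure_pmf.expectation p (torus_monomial N z)"
proof -
  obtain q where q: "set_pmf q \<subseteq> torus_points N m"
    "\<And>s. s \<in> torus_points N m \<Longrightarrow> F (torus_point N m s) = measure_pmf.expectation q (torus_pairing N m s)"
  proof (rule finite_torus_fourier_coefficients[where m = m and N = N and F = F])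
    show "(\<Sum>s\<in>I. \<Sum>t\<in>I. c s * cnj (c t) * F (\<lambda>i. Z s i * cnj (Z t i))) \<in> \<real>\<^sub>\<ge>\<^sub>0"
      if "finite I" "\<And>s i. s \<in> I \<Longrightarrow> norm (Z s i) = 1" for I :: "(nat \<Rightarrow> nat) set" and Z c
      by (rule pd[OF that])
  qed (use m one in auto)
  define c where "c w = (\<lambda>i. if i < N then centered_residue m (w i) else 0)" for w
  show ?thesis
  proof (rule that[of "map_pmf c q"])
    fix w i assume "w \<in> set_pmf (map_pmf c q)"
    then obtain v where v: "v \<in> torus_points N m" "w = c v" using q(1) by auto
    then have "i < N \<Longrightarrow> v i < m" by (auto simp: torus_points_def)
    then show "2 * \<bar>w i\<bar> \<le> int m" by (auto simp: v(2) c_def centered_residue_def)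
    show "w i = 0" if "N \<le> i" using that by (simp add: v(2) c_def)
  next
    fix z :: "nat \<Rightarrow> complex" assume z: "\<And>i. i < N \<Longrightarrow> z i ^ m = 1"
    have "\<exists>k<m. z i = cis (2 * pi * real k / real m)" if "i < N" for i
      using Complex.bij_betw_roots_unity[OF m] z[OF that] by (auto simp: bij_betw_def set_eq_iff image_iff)
    then obtain k where k: "\<And>i. i < N \<Longrightarrow> k i < m" "\<And>i. i < N \<Longrightarrow> z i = cis (2 * pi * real (k i) / real m)"
      by metis
    define s where "s = (\<lambda>i\<in>{..<N}. k i)"
    have s: "s \<in> torus_points N m" using k(1) by (auto simp: s_def torus_points_def)
    have "F z = F (torus_point N m s)"
      by (rule loc) (simp add: torus_point_def s_def k(2))
    also have "\<dots> = measure_pmf.expectation q (torus_pairing N m s)" by (rule q(2)[OF s])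
    also have "torus_pairing N m s = (\<lambda>v. torus_monomial N z (c v))"
    proof
      fix v
      show "torus_pairing N m s v = torus_monomial N z (c v)"
        unfolding torus_pairing_def torus_monomial_def
      proof (rule prod.cong[OF refl])
        fix i assume i: "i \<in> {..<N}"
        have "z i powi c v i = cis (2 * pi * (int (s i) * centered_residue m (v i)) / m)"
          using i by (simp add: k(2) cis_power_int c_def s_def field_simps)
        also have "\<dots> = cis (2 * pi * (int (s i) * int (v i)) / m)"
          unfolding of_int_mult[symmetric]
        proof (rule cis_mod_period[OF m])
          show "int m dvd int (s i) * centered_residue m (v i) - int (s i) * int (v i)"
            unfolding right_diff_distrib[symmetric] by (intro dvd_mult) (simp add: centered_residue_def)
        qed
        finally show "cis (2 * pi * (int (s i) * int (v i)) / m) = z i powi c v i"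
          by (simp only: of_int_mult)
      qed
    qed
    finally show "F z = measure_pmf.expectation (map_pmf c q) (torus_monomial N z)" by simp
  qed
qed

lemma finite_bounded_integer_vectors: "finite {w :: nat \<Rightarrow> int. (\<forall>i<N. \<bar>w i\<bar> \<le> C) \<and> (\<forall>i\<ge>N. w i = 0)}"
proof -
  have "finite {w. \<forall>i. (i \<in> {..<N} \<longrightarrow> w i \<in> {-C..C}) \<and> (i \<notin> {..<N} \<longrightarrow> w i = 0)}"
    by (rule finite_set_of_finite_funs) auto
  then show ?thesis by (rule rev_finite_subset) (auto simp: abs_le_iff)
qed

lemma countable_integer_vectors: "countable {w :: nat \<Rightarrow> int. \<forall>i\<ge>N. w i = 0}"
proof -
  have "{w :: nat \<Rightarrow> int. \<forall>i\<ge>N. w i = 0} \<subseteq> (\<Union>C::nat. {w. (\<forall>i<N. \<bar>w i\<bar> \<le> int C) \<and> (\<forall>i\<ge>N. w i = 0)})"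
  proof safe
    fix w :: "nat \<Rightarrow> int" assume w: "\<forall>i\<ge>N. w i = 0"
    have "\<bar>w i\<bar> \<le> int (\<Sum>i<N. nat \<bar>w i\<bar>)" if "i < N" for i
      using member_le_sum[of i "{..<N}" "\<lambda>i. \<bar>w i\<bar>"] that by simp
    then show "w \<in> (\<Union>C::nat. {w. (\<forall>i<N. \<bar>w i\<bar> \<le> int C) \<and> (\<forall>i\<ge>N. w i = 0)})" using w by blast
  qed
  moreover have "countable (\<Union>C::nat. {w :: nat \<Rightarrow> int. (\<forall>i<N. \<bar>w i\<bar> \<le> int C) \<and> (\<forall>i\<ge>N. w i = 0)})"
    by (rule countable_UN) (simp, rule countable_finite[OF finite_bounded_integer_vectors])
  ultimately show ?thesis by (rule countable_subset)
qed

definition one_coordinate :: "nat \<Rightarrow> complex \<Rightarrow> nat \<Rightarrow> complex" where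
  "one_coordinate i z = (\<lambda>j. if j = i then z else 1)"

lemma torus_monomial_one_coordinate:
  "i < N \<Longrightarrow> torus_monomial N (one_coordinate i z) w = z powi w i"
  by (simp add: torus_monomial_def one_coordinate_def if_distrib[of "\<lambda>x. x powi _"] prod.delta' cong: if_cong)

lemma torus_continuity_near_one:
  fixes F :: "(nat \<Rightarrow> complex) \<Rightarrow> complex"
  assumes one: "F (\<lambda>_. 1) = 1"
    and cont: "\<And>Z z. (\<And>n i. norm (Z n i) = 1) \<Longrightarrow> (\<And>i. norm (z i) = 1) \<Longrightarrow>
        (\<And>i. i < N \<Longrightarrow> (\<lambda>n. Z n i) \<longlonglongrightarrow> z i) \<Longrightarrow> (\<lambda>n. F (Z n)) \<longlonglongrightarrow> F z"
    and e: "0 < e"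
  obtains d where "0 < d" "\<And>x. 0 \<le> x \<Longrightarrow> x \<le> d \<Longrightarrow> 1 - e \<le> Re (F (one_coordinate i (cis x)))"
proof (rule ccontr)
  assume neg: "\<not> thesis"
  have "\<exists>x. 0 \<le> x \<and> x \<le> inverse (Suc n) \<and> Re (F (one_coordinate i (cis x))) < 1 - e" for n
    using neg that[of "inverse (Suc n)"] by (meson not_le inverse_positive_iff_positive of_nat_0_less_iff zero_less_Suc)
  then obtain x where x: "\<And>n. 0 \<le> x n" "\<And>n. x n \<le> inverse (Suc n)"
      "\<And>n. Re (F (one_coordinate i (cis (x n)))) < 1 - e" by metis
  have "x \<longlonglongrightarrow> 0"
    by (rule tendsto_sandwich[OF _ _ tendsto_const LIMSEQ_inverse_real_of_nat]) (use x in auto)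
  then have "(\<lambda>n. cis (x n)) \<longlonglongrightarrow> cis 0" by (intro tendsto_intros)
  then have "(\<lambda>n. F (one_coordinate i (cis (x n)))) \<longlonglongrightarrow> F (\<lambda>_. 1)"
  proof (intro cont)
    fix j assume "(\<lambda>n. cis (x n)) \<longlonglongrightarrow> cis 0"
    then show "(\<lambda>n. one_coordinate i (cis (x n)) j) \<longlonglongrightarrow> 1"
      by (cases "j = i") (auto simp: one_coordinate_def)
  qed (auto simp: one_coordinate_def)
  then have "(\<lambda>n. Re (F (one_coordinate i (cis (x n))))) \<longlonglongrightarrow> 1" using one tendsto_Re by fastforce
  then have "1 \<le> 1 - e" by (rule LIMSEQ_le_const2) (use x(3) less_imp_le in blast)
  with e show False by simp
qed

text \<open>The points of order \<open>fact n\<close> are treated first. Continuity at the identity bounds the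
  tails of each coordinate of the resulting distributions uniformly in \<open>n\<close>, so that a
  subsequence converges; its limit represents \<open>F\<close> at all points of finite order, because
  factorials are eventually divisible by any given order, and then everywhere by density.
  Positive definiteness is asked for finite families of the index type \<open>nat \<Rightarrow> nat\<close> only;
  this is the type of the points of finite order.\<close>

theorem torus_bochner:
  fixes F :: "(nat \<Rightarrow> complex) \<Rightarrow> complex"
  assumes loc: "\<And>z z'. (\<And>i. i < N \<Longrightarrow> z i = z' i) \<Longrightarrow> F z = F z'"
    and one: "F (\<lambda>_. 1) = 1"
    and pd: "\<And>(I::(nat \<Rightarrow> nat) set) Z c. finite I \<Longrightarrow> (\<And>s i. s \<in> I \<Longrightarrow> norm (Z s i) = 1) \<Longrightarrow>
        (\<Sum>s\<in>I. \<Sum>t\<in>I. c s * cnj (c t) * F (\<lambda>i. Z s i * cnj (Z t i))) \<in> \<real>\<^sub>\<ge>\<^sub>0"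
    and cont: "\<And>Z z. (\<And>n i. norm (Z n i) = 1) \<Longrightarrow> (\<And>i. norm (z i) = 1) \<Longrightarrow>
        (\<And>i. i < N \<Longrightarrow> (\<lambda>n. Z n i) \<longlonglongrightarrow> z i) \<Longrightarrow> (\<lambda>n. F (Z n)) \<longlonglongrightarrow> F z"
  obtains p :: "(nat \<Rightarrow> int) pmf"
  where "\<And>z. (\<And>i. norm (z i) = 1) \<Longrightarrow> F z = measure_pmf.expectation p (torus_monomial N z)"
proof -
  have "\<exists>p :: (nat \<Rightarrow> int) pmf. (\<forall>w\<in>set_pmf p. \<forall>i. 2 * \<bar>w i\<bar> \<le> int (fact n)) \<and>
     (\<forall>w\<in>set_pmf p. \<forall>i\<ge>N. w i = 0) \<and>
     (\<forall>z. (\<forall>i<N. z i ^ fact n = 1) \<longrightarrow> F z = measure_pmf.expectation p (torus_monomial N z))" for n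
  proof (rule torus_pmf_on_roots_of_unity[where m = "fact n" and N = N and F = F])
    show "0 < (fact n :: nat)" by simp
    show "F z = F z'" if "\<And>i. i < N \<Longrightarrow> z i = z' i" for z z' by (rule loc[OF that])
    show "F (\<lambda>_. 1) = 1" by (rule one)
    show "(\<Sum>s\<in>I. \<Sum>t\<in>I. c s * cnj (c t) * F (\<lambda>i. Z s i * cnj (Z t i))) \<in> \<real>\<^sub>\<ge>\<^sub>0"
      if "finite I" "\<And>s i. s \<in> I \<Longrightarrow> norm (Z s i) = 1" for I :: "(nat \<Rightarrow> nat) set" and Z c
      by (rule pd[OF that])
  next
    fix p :: "(nat \<Rightarrow> int) pmf"
    assume "\<And>w i. w \<in> set_pmf p \<Longrightarrow> 2 * \<bar>w i\<bar> \<le> int (fact n)" "\<And>w i. w \<in> set_pmf p \<Longrightarrow> N \<le> i \<Longrightarrow> w i = 0"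
      "\<And>z. (\<And>i. i < N \<Longrightarrow> z i ^ fact n = 1) \<Longrightarrow> F z = measure_pmf.expectation p (torus_monomial N z)"
    then show ?thesis by blast
  qed
  then obtain p :: "nat \<Rightarrow> (nat \<Rightarrow> int) pmf" where
    p1: "\<And>n w i. w \<in> set_pmf (p n) \<Longrightarrow> 2 * \<bar>w i\<bar> \<le> int (fact n)" and
    p2: "\<And>n w i. w \<in> set_pmf (p n) \<Longrightarrow> i \<ge> N \<Longrightarrow> w i = 0" and
    p3: "\<And>n z. (\<And>i. i < N \<Longrightarrow> z i ^ fact n = 1) \<Longrightarrow> F z = measure_pmf.expectation (p n) (torus_monomial N z)"
    by metis
  \<comment> \<open>Uniform tail bound for one coordinate. The lemma on grids applies: the multiples of
    \<open>x\<close> are the angles of the roots of unity of order \<open>fact n\<close>, and centering the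
    exponents gives the condition \<open>\<bar>w i\<bar> * x \<le> pi\<close>.\<close>
  have coord: "\<exists>C. \<forall>n. measure_pmf.prob (p n) {w. C < \<bar>w i\<bar>} \<le> 2 * e" if i: "i < N" and e: "0 < e" for i and e :: real
  proof -
    obtain d where d: "0 < d" "\<And>x. 0 \<le> x \<Longrightarrow> x \<le> d \<Longrightarrow> 1 - e \<le> Re (F (one_coordinate i (cis x)))"
    proof (rule torus_continuity_near_one[where N = N and F = F and i = i])
      show "(\<lambda>n. F (Z n)) \<longlonglongrightarrow> F z" if "\<And>n i. norm (Z n i) = 1" "\<And>i. norm (z i) = 1"
        "\<And>i. i < N \<Longrightarrow> (\<lambda>n. Z n i) \<longlonglongrightarrow> z i" for Z z by (rule cont[OF that])
    qed (use one e in auto)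
    define C where "C = 8 / d"
    have "measure_pmf.prob (p n) {w. \<lceil>C\<rceil> < \<bar>w i\<bar>} \<le> 2 * e" for n
    proof -
      define x where "x = 2 * pi / fact n"
      define J where "J = Suc (nat \<lfloor>d / x\<rfloor>)"
      have x: "0 < x" by (simp add: x_def)
      have "measure_pmf.prob (p n) {w. C \<le> \<bar>w i\<bar> \<and> \<bar>w i\<bar> * x \<le> pi} \<le> 2 * e"
      proof (rule tail_bound_of_cosines_grid[OF x, where J = J])
        show "0 < J" by (simp add: J_def)
        have "d / x \<le> J" unfolding J_def by linarith
        then have "C * d \<le> C * (x * J)" using x d by (intro mult_left_mono) (auto simp: field_simps C_def)
        then show "8 \<le> C * x * real J" using d by (simp add: C_def mult.assoc)
        fix s assume "s < J"
        then have "real s \<le> d / x" using x d unfolding J_def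
          by (simp add: less_Suc_eq_le le_nat_iff le_floor_iff)
        then have sx: "real s * x \<le> d" using x by (simp add: field_simps)
        have "one_coordinate i (cis (real s * x)) j ^ fact n = 1" for j
        proof -
          have "cis (real s * x) ^ fact n = cis (2 * pi * real_of_int (int s))"
            by (simp add: Complex.DeMoivre x_def field_simps)
          then show ?thesis by (simp add: one_coordinate_def)
        qed
        then have "F (one_coordinate i (cis (real s * x))) =
            measure_pmf.expectation (p n) (\<lambda>w. cis (real s * x) powi w i)"
          using p3[of "one_coordinate i (cis (real s * x))" n] i
          by (simp add: torus_monomial_one_coordinate cong: Bochner_Integration.integral_cong)
        then have "Re (F (one_coordinate i (cis (real s * x)))) =
            measure_pmf.expectation (p n) (\<lambda>w. Re (cis (real s * x) powi w i))"
          by (subst integral_Re) (auto intro!: pmf_integrable_bounded[where B=1] simp: norm_power_int)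
        also have "(\<lambda>w. Re (cis (real s * x) powi w i)) = (\<lambda>w. cos (real s * x * real_of_int (w i)))"
          by (simp add: cis_power_int mult.commute)
        finally show "1 - e \<le> measure_pmf.expectation (p n) (\<lambda>w. cos (real s * x * real_of_int (w i)))"
          using d(2)[of "real s * x"] sx x by simp
      qed
      moreover have "measure_pmf.prob (p n) {w. \<lceil>C\<rceil> < \<bar>w i\<bar>} \<le> measure_pmf.prob (p n) {w. C \<le> \<bar>w i\<bar> \<and> \<bar>w i\<bar> * x \<le> pi}"
      proof (rule measure_pmf.finite_measure_mono_AE)
        show "AE w in measure_pmf (p n). w \<in> {w. \<lceil>C\<rceil> < \<bar>w i\<bar>} \<longrightarrow> w \<in> {w. C \<le> \<bar>w i\<bar> \<and> \<bar>w i\<bar> * x \<le> pi}"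
        proof (rule AE_pmfI, safe)
          fix w assume w: "w \<in> set_pmf (p n)"
          have "real_of_int (2 * \<bar>w i\<bar>) \<le> real_of_int (int (fact n))" using p1[OF w, of i] by (simp only: of_int_le_iff)
          then show "\<bar>w i\<bar> * x \<le> pi" by (simp add: x_def field_simps)
          assume "\<lceil>C\<rceil> < \<bar>w i\<bar>" then show "C \<le> \<bar>w i\<bar>" by linarith
        qed
      qed simp
      ultimately show ?thesis by linarith
    qed
    then show ?thesis by blast
  qed
  have tight: "\<exists>K n0. finite K \<and> (\<forall>n\<ge>n0. 1 - e \<le> measure_pmf.prob (p n) K)" if e: "0 < e" for e
  proof -
    define e' where "e' = e / (2 * Suc N)"
    have e': "0 < e'" using e by (simp add: e'_def)
    obtain C where C: "\<And>i n. i < N \<Longrightarrow> measure_pmf.prob (p n) {w. C i < \<bar>w i\<bar>} \<le> 2 * e'"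
      using coord[OF _ e'] by metis
    define D where "D = (\<Sum>i<N. \<bar>C i\<bar>)"
    let ?K = "{w :: nat \<Rightarrow> int. (\<forall>i<N. \<bar>w i\<bar> \<le> D) \<and> (\<forall>i\<ge>N. w i = 0)}"
    have "1 - e \<le> measure_pmf.prob (p n) ?K" for n
    proof -
      have "measure_pmf.prob (p n) (- ?K) \<le> measure_pmf.prob (p n) (\<Union>i<N. {w. C i < \<bar>w i\<bar>})"
      proof (rule measure_pmf.finite_measure_mono_AE)
        show "AE w in measure_pmf (p n). w \<in> - ?K \<longrightarrow> w \<in> (\<Union>i<N. {w. C i < \<bar>w i\<bar>})"
        proof (rule AE_pmfI, rule impI)
          fix w assume w: "w \<in> set_pmf (p n)" "w \<in> - ?K"
          then obtain i where i: "i < N" "D < \<bar>w i\<bar>" using p2[OF w(1)] by force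
          have "\<bar>C i\<bar> \<le> D" unfolding D_def using i by (intro member_le_sum) auto
          then show "w \<in> (\<Union>i<N. {w. C i < \<bar>w i\<bar>})" using i by force
        qed
      qed simp
      also have "\<dots> \<le> (\<Sum>i<N. measure_pmf.prob (p n) {w. C i < \<bar>w i\<bar>})"
        by (rule measure_pmf.finite_measure_subadditive_finite) auto
      also have "\<dots> \<le> (\<Sum>i<N. 2 * e')" by (intro sum_mono C) auto
      also have "\<dots> \<le> e" using e by (simp add: e'_def field_simps)
      finally show ?thesis by (simp add: measure_pmf.prob_compl[of ?K "p n", simplified, folded Compl_eq_Diff_UNIV])
    qed
    then show ?thesis using finite_bounded_integer_vectors[of N D] by blast
  qed
  obtain r q where r: "strict_mono (r :: nat \<Rightarrow> nat)" and q: "\<And>g :: (nat \<Rightarrow> int) \<Rightarrow> complex. (\<And>x. norm (g x) \<le> 1) \<Longrightarrow>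
       (\<lambda>n. measure_pmf.expectation (p (r n)) g) \<longlonglongrightarrow> measure_pmf.expectation q g"
    by (rule tight_pmf_convergent_subsequence[OF countable_integer_vectors[of N] _ tight]) (use p2 in auto)
  have fin: "F z = measure_pmf.expectation q (torus_monomial N z)"
    if z: "\<And>i. norm (z i) = 1" and M: "0 < M" "\<And>i. i < N \<Longrightarrow> z i ^ M = 1" for z M
  proof (rule LIMSEQ_unique)
    show "(\<lambda>n. measure_pmf.expectation (p (r n)) (torus_monomial N z)) \<longlonglongrightarrow> measure_pmf.expectation q (torus_monomial N z)"
      by (rule q) (simp add: norm_torus_monomial z)
    have "\<forall>\<^sub>F n in sequentially. measure_pmf.expectation (p (r n)) (torus_monomial N z) = F z"
      using eventually_ge_at_top[of M]
    proof eventually_elim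
      case (elim n)
      then have "M dvd fact (r n)" using seq_suble[OF r, of n] M by (intro dvd_fact) auto
      then obtain k where "fact (r n) = M * k" by auto
      then have "z i ^ fact (r n) = 1" if "i < N" for i using M(2)[OF that] by (simp add: power_mult)
      then show ?case by (intro p3[symmetric]) auto
    qed
    then show "(\<lambda>n. measure_pmf.expectation (p (r n)) (torus_monomial N z)) \<longlonglongrightarrow> F z"
      by (rule tendsto_eventually)
  qed
  show ?thesis
  proof (rule that[of q])
    fix z :: "nat \<Rightarrow> complex" assume z: "\<And>i. norm (z i) = 1"
    \<comment> \<open>Approximate the angles of \<open>z\<close> from below by multiples of \<open>2 * pi / Suc n\<close>.\<close>
    define k where "k n i = \<lfloor>Suc n * Arg (z i) / (2 * pi)\<rfloor>" for n i
    define Z where "Z n i = cis (2 * pi * k n i / Suc n)" for n i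
    have lim: "(\<lambda>n. Z n i) \<longlonglongrightarrow> z i" for i
    proof -
      have "(\<lambda>n. 2 * pi * k n i / Suc n) \<longlonglongrightarrow> Arg (z i)"
      proof (rule LIMSEQ_I)
        fix e :: real assume e: "0 < e"
        obtain n0 :: nat where n0: "2 * pi / e < n0" using reals_Archimedean2 by blast
        show "\<exists>no. \<forall>n\<ge>no. norm (2 * pi * k n i / Suc n - Arg (z i)) < e"
        proof (intro exI allI impI)
          fix n assume n: "n \<ge> n0"
          define y where "y = Suc n * Arg (z i) / (2 * pi)"
          have A: "Arg (z i) = 2 * pi * y / Suc n" by (simp add: y_def)
          have "\<bar>2 * pi * k n i / Suc n - Arg (z i)\<bar> = 2 * pi / Suc n * \<bar>k n i - y\<bar>"
            unfolding A by (simp add: abs_mult diff_divide_distrib[symmetric] right_diff_distrib[symmetric] del: of_nat_Suc)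
          also have "\<dots> \<le> 2 * pi / Suc n * 1"
            unfolding k_def y_def[symmetric] by (intro mult_left_mono) (linarith, simp)
          also have "\<dots> < e"
          proof -
            have "2 * pi / e < Suc n" using n0 n by linarith
            then show ?thesis using e by (simp add: field_simps)
          qed
          finally show "norm (2 * pi * k n i / Suc n - Arg (z i)) < e" by simp
        qed
      qed
      then have "(\<lambda>n. Z n i) \<longlonglongrightarrow> cis (Arg (z i))" unfolding Z_def by (intro tendsto_intros)
      moreover have "cis (Arg (z i)) = z i" using z[of i] rcis_cmod_Arg[of "z i"] by (simp add: rcis_def)
      ultimately show ?thesis by simp
    qed
    have Z1: "norm (Z n i) = 1" for n i by (simp add: Z_def)
    have Zr: "Z n i ^ Suc n = 1" for n i
    proof -
      have "Z n i ^ Suc n = cis (2 * pi * real_of_int (k n i))"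
        unfolding Z_def Complex.DeMoivre by (simp del: of_nat_Suc)
      then show ?thesis by simp
    qed
    show "F z = measure_pmf.expectation q (torus_monomial N z)"
    proof (rule LIMSEQ_unique)
      show "(\<lambda>n. F (Z n)) \<longlonglongrightarrow> F z" by (rule cont) (use Z1 z lim in auto)
      have "F (Z n) = measure_pmf.expectation q (torus_monomial N (Z n))" for n
        by (rule fin[of _ "Suc n"]) (use Z1 Zr in auto)
      moreover have "(\<lambda>n. measure_pmf.expectation q (torus_monomial N (Z n))) \<longlonglongrightarrow> measure_pmf.expectation q (torus_monomial N z)"
      proof (rule integral_dominated_convergence[where w = "\<lambda>_. 1"])
        show "AE w in measure_pmf q. (\<lambda>n. torus_monomial N (Z n) w) \<longlonglongrightarrow> torus_monomial N z w"
          unfolding torus_monomial_def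
          by (intro AE_pmfI tendsto_prod tendsto_power_int lim) (metis z norm_zero zero_neq_one)
        show "AE w in measure_pmf q. norm (torus_monomial N (Z n) w) \<le> 1" for n
          by (simp add: norm_torus_monomial Z1)
      qed auto
      ultimately show "(\<lambda>n. F (Z n)) \<longlonglongrightarrow> measure_pmf.expectation q (torus_monomial N z)" by simp
    qed
  qed
qed

lemma expectation_uniform_mixture_real:
  fixes h :: "'b \<Rightarrow> real"
  assumes A: "finite A" "A \<noteq> {}" and h: "\<And>x. \<bar>h x\<bar> \<le> 1"
  shows "measure_pmf.expectation (bind_pmf (pmf_of_set A) f) h = (\<Sum>a\<in>A. measure_pmf.expectation (f a) h) / card A"
proof -
  have h0: "0 \<le> h x + 1" "h x + 1 \<le> 2" for x using h[of x] by linarith+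
  have i: "integrable (measure_pmf p) (\<lambda>x. h x + 1)" "integrable (measure_pmf p) h" for p
    by (rule pmf_integrable_bounded[where B=2], use h0 in simp)
       (rule pmf_integrable_bounded[where B=1], use h in simp)
  have E: "measure_pmf.expectation p (\<lambda>x. h x + 1) = measure_pmf.expectation p h + 1" for p
    using i by simp
  have n: "(\<integral>\<^sup>+x. ennreal (h x + 1) \<partial>measure_pmf p) = ennreal (measure_pmf.expectation p h + 1)" for p
    using nn_integral_eq_integral[OF i(1)[of p]] h0 by (simp add: E)
  have E0: "0 \<le> measure_pmf.expectation p h + 1" for p
    using Bochner_Integration.integral_nonneg[of "measure_pmf p" "\<lambda>x. h x + 1"] h0 by (simp add: E[symmetric])
  have c: "0 < card A" using A by (simp add: card_gt_0_iff)
  have "ennreal (measure_pmf.expectation (bind_pmf (pmf_of_set A) f) h + 1) =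
      (\<integral>\<^sup>+a. ennreal (measure_pmf.expectation (f a) h + 1) \<partial>measure_pmf (pmf_of_set A))"
    by (simp add: n[symmetric])
  also have "\<dots> = (\<Sum>a\<in>A. ennreal (measure_pmf.expectation (f a) h + 1)) / card A"
    by (rule nn_integral_pmf_of_set[OF A(2,1)])
  also have "\<dots> = ennreal ((\<Sum>a\<in>A. measure_pmf.expectation (f a) h + 1) / card A)"
  proof -
    have "(\<Sum>a\<in>A. ennreal (measure_pmf.expectation (f a) h + 1)) =
        ennreal (\<Sum>a\<in>A. measure_pmf.expectation (f a) h + 1)"
      using E0 by (intro sum_ennreal) auto
    moreover have "0 \<le> (\<Sum>a\<in>A. measure_pmf.expectation (f a) h + 1)" using E0 by (intro sum_nonneg) auto
    ultimately show ?thesis using c by (simp only: ennreal_of_nat_eq_real_of_nat divide_ennreal of_nat_0_less_iff)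
  qed
  finally have "measure_pmf.expectation (bind_pmf (pmf_of_set A) f) h + 1 =
      (\<Sum>a\<in>A. measure_pmf.expectation (f a) h + 1) / card A"
  proof (subst (asm) ennreal_inj)
    show "0 \<le> (\<Sum>a\<in>A. measure_pmf.expectation (f a) h + 1) / card A"
      using E0 by (intro divide_nonneg_nonneg sum_nonneg) auto
  qed (use E0 in auto)
  then show ?thesis using c by (simp add: sum.distrib add_divide_distrib)
qed

lemma expectation_uniform_mixture:
  fixes h :: "'b \<Rightarrow> complex"
  assumes A: "finite A" "A \<noteq> {}" and h: "\<And>x. norm (h x) \<le> 1"
  shows "measure_pmf.expectation (bind_pmf (pmf_of_set A) f) h = (\<Sum>a\<in>A. measure_pmf.expectation (f a) h) / card A"
proof -
  have i: "integrable (measure_pmf p) h" for p by (rule pmf_integrable_bounded[OF h])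
  have R: "\<bar>Re (h x)\<bar> \<le> 1" "\<bar>Im (h x)\<bar> \<le> 1" for x
    using h[of x] abs_Re_le_cmod[of "h x"] abs_Im_le_cmod[of "h x"] by linarith+
  show ?thesis
    using expectation_uniform_mixture_real[OF A R(1), of f] expectation_uniform_mixture_real[OF A R(2), of f]
    by (simp add: complex_eq_iff integral_Re[OF i, symmetric] integral_Im[OF i, symmetric])
qed

definition exchangeable :: "nat \<Rightarrow> (nat \<Rightarrow> int) pmf \<Rightarrow> bool" where
  "exchangeable N p \<longleftrightarrow> (\<forall>\<tau>. \<tau> permutes {..<N} \<longrightarrow> map_pmf (\<lambda>w. w \<circ> \<tau>) p = p)"

lemma torus_monomial_permute:
  assumes "\<sigma> permutes {..<N}"
  shows "torus_monomial N z (w \<circ> \<sigma>) = torus_monomial N (z \<circ> inv_into UNIV \<sigma>) w"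
proof -
  have "torus_monomial N (z \<circ> inv_into UNIV \<sigma>) w = (\<Prod>i<N. z (inv_into UNIV \<sigma> (\<sigma> i)) powi w (\<sigma> i))"
    unfolding torus_monomial_def using prod.permute[OF assms, of "\<lambda>i. (z \<circ> inv_into UNIV \<sigma>) i powi w i"] by (simp add: o_def)
  then show ?thesis using permutes_inverses(2)[OF assms] by (simp add: torus_monomial_def)
qed

text \<open>Averaging a representing distribution over all permutations of the coordinates leaves
  the expectations unchanged when \<open>F\<close> is symmetric. This replaces an appeal to uniqueness in
  Bochner's theorem.\<close>

theorem symmetric_torus_bochner:
  fixes F :: "(nat \<Rightarrow> complex) \<Rightarrow> complex"
  assumes loc: "\<And>z z'. (\<And>i. i < N \<Longrightarrow> z i = z' i) \<Longrightarrow> F z = F z'"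
    and one: "F (\<lambda>_. 1) = 1"
    and pd: "\<And>(I::(nat \<Rightarrow> nat) set) Z c. finite I \<Longrightarrow> (\<And>s i. s \<in> I \<Longrightarrow> norm (Z s i) = 1) \<Longrightarrow>
        (\<Sum>s\<in>I. \<Sum>t\<in>I. c s * cnj (c t) * F (\<lambda>i. Z s i * cnj (Z t i))) \<in> \<real>\<^sub>\<ge>\<^sub>0"
    and cont: "\<And>Z z. (\<And>n i. norm (Z n i) = 1) \<Longrightarrow> (\<And>i. norm (z i) = 1) \<Longrightarrow>
        (\<And>i. i < N \<Longrightarrow> (\<lambda>n. Z n i) \<longlonglongrightarrow> z i) \<Longrightarrow> (\<lambda>n. F (Z n)) \<longlonglongrightarrow> F z"
    and sym: "\<And>z \<sigma>. (\<And>i. norm (z i) = 1) \<Longrightarrow> \<sigma> permutes {..<N} \<Longrightarrow> F (z \<circ> \<sigma>) = F z"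
  obtains p :: "(nat \<Rightarrow> int) pmf" where "exchangeable N p"
    "\<And>z. (\<And>i. norm (z i) = 1) \<Longrightarrow> F z = measure_pmf.expectation p (torus_monomial N z)"
proof -
  obtain p where p: "\<And>z. (\<And>i. norm (z i) = 1) \<Longrightarrow> F z = measure_pmf.expectation p (torus_monomial N z)"
  proof (rule torus_bochner[where N = N and F = F])
    show "F z = F z'" if "\<And>i. i < N \<Longrightarrow> z i = z' i" for z z' by (rule loc[OF that])
    show "F (\<lambda>_. 1) = 1" by (rule one)
    show "(\<Sum>s\<in>I. \<Sum>t\<in>I. c s * cnj (c t) * F (\<lambda>i. Z s i * cnj (Z t i))) \<in> \<real>\<^sub>\<ge>\<^sub>0"
      if "finite I" "\<And>s i. s \<in> I \<Longrightarrow> norm (Z s i) = 1" for I :: "(nat \<Rightarrow> nat) set" and Z c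
      by (rule pd[OF that])
    show "(\<lambda>n. F (Z n)) \<longlonglongrightarrow> F z" if "\<And>n i. norm (Z n i) = 1" "\<And>i. norm (z i) = 1"
      "\<And>i. i < N \<Longrightarrow> (\<lambda>n. Z n i) \<longlonglongrightarrow> z i" for Z z by (rule cont[OF that])
  qed blast
  let ?P = "{\<sigma>. \<sigma> permutes {..<N}}"
  have "id \<in> ?P" by (simp add: permutes_id)
  then have P: "finite ?P" "?P \<noteq> {}" by (auto simp only: finite_permutations finite_lessThan)
  define q where "q = bind_pmf (pmf_of_set ?P) (\<lambda>\<sigma>. map_pmf (\<lambda>w. w \<circ> \<sigma>) p)"
  show ?thesis
  proof (rule that[of q])
    show "exchangeable N q"
      unfolding exchangeable_def
    proof safe
      fix \<tau> :: "nat \<Rightarrow> nat" assume \<tau>: "\<tau> permutes {..<N}"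
      have "bij_betw (\<lambda>\<sigma>. \<sigma> \<circ> \<tau>) ?P ?P"
        by (rule bij_betwI[where g = "\<lambda>\<sigma>. \<sigma> \<circ> inv_into UNIV \<tau>"])
           (auto intro!: permutes_compose \<tau> permutes_inv[OF \<tau>] simp: fun_eq_iff permutes_inverses[OF \<tau>])
      then have *: "map_pmf (\<lambda>\<sigma>. \<sigma> \<circ> \<tau>) (pmf_of_set ?P) = pmf_of_set ?P"
        using P by (intro map_pmf_of_set_bij_betw)
      have "map_pmf (\<lambda>w. w \<circ> \<tau>) q = bind_pmf (map_pmf (\<lambda>\<sigma>. \<sigma> \<circ> \<tau>) (pmf_of_set ?P)) (\<lambda>\<sigma>. map_pmf (\<lambda>w. w \<circ> \<sigma>) p)"
        by (simp add: q_def map_bind_pmf bind_map_pmf pmf.map_comp o_def)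
      then show "map_pmf (\<lambda>w. w \<circ> \<tau>) q = q" by (simp add: * q_def)
    qed
    fix z :: "nat \<Rightarrow> complex" assume z: "\<And>i. norm (z i) = 1"
    have "measure_pmf.expectation q (torus_monomial N z) =
      (\<Sum>\<sigma>\<in>?P. measure_pmf.expectation (map_pmf (\<lambda>w. w \<circ> \<sigma>) p) (torus_monomial N z)) / card ?P"
      unfolding q_def by (rule expectation_uniform_mixture[OF P]) (simp add: norm_torus_monomial z)
    also have "\<dots> = (\<Sum>\<sigma>\<in>?P. F z) / card ?P"
    proof (intro arg_cong[where f = "\<lambda>x. x / _"] sum.cong refl)
      fix \<sigma> assume \<sigma>: "\<sigma> \<in> ?P"
      then have \<sigma>': "inv_into UNIV \<sigma> permutes {..<N}" by (simp add: permutes_inv)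
      have "measure_pmf.expectation (map_pmf (\<lambda>w. w \<circ> \<sigma>) p) (torus_monomial N z) =
          measure_pmf.expectation p (torus_monomial N (z \<circ> inv_into UNIV \<sigma>))"
        using \<sigma> by (simp add: torus_monomial_permute)
      also have "\<dots> = F (z \<circ> inv_into UNIV \<sigma>)" by (rule p[symmetric]) (simp add: z)
      also have "\<dots> = F z" by (rule sym[OF z \<sigma>'])
      finally show "measure_pmf.expectation (map_pmf (\<lambda>w. w \<circ> \<sigma>) p) (torus_monomial N z) = F z" .
    qed
    also have "\<dots> = F z" using P by (simp add: card_gt_0_iff)
    finally show "F z = measure_pmf.expectation q (torus_monomial N z)" by simp
  qed
qed

section \<open>Exchangeable integer vectors\<close>

definition weight_support :: "nat \<Rightarrow> (nat \<Rightarrow> int) \<Rightarrow> nat set" where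
  "weight_support N w = {i. i < N \<and> w i \<noteq> 0}"

lemma finite_weight_support [simp]: "finite (weight_support N w)"
  by (simp add: weight_support_def)

lemma weight_support_subset: "weight_support N w \<subseteq> {..<N}"
  by (auto simp: weight_support_def)

lemma exchangeable_expectation:
  fixes g :: "(nat \<Rightarrow> int) \<Rightarrow> 'b::{banach, second_countable_topology}"
  assumes "exchangeable N p" "\<tau> permutes {..<N}"
  shows "measure_pmf.expectation p (\<lambda>w. g (w \<circ> \<tau>)) = measure_pmf.expectation p g"
proof -
  have "measure_pmf.expectation p g = measure_pmf.expectation (map_pmf (\<lambda>w. w \<circ> \<tau>) p) g"
    using assms by (simp add: exchangeable_def)
  then show ?thesis by (simp only: integral_map_pmf)
qed

lemma exchangeable_prob:
  assumes "exchangeable N p" "\<tau> permutes {..<N}"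
  shows "measure_pmf.prob p {w. Q (w \<circ> \<tau>)} = measure_pmf.prob p {w. Q w}"
proof -
  have "measure_pmf.prob p {w. Q w} = measure_pmf.prob (map_pmf (\<lambda>w. w \<circ> \<tau>) p) {w. Q w}"
    using assms by (simp add: exchangeable_def)
  then show ?thesis by (simp add: vimage_def)
qed

text \<open>Inserting a random permutation of the coordinates moves the randomness from the vector
  into the positions of its nonzero entries.\<close>

lemma exchangeable_expectation_product:
  fixes G :: "nat \<Rightarrow> int \<Rightarrow> complex"
  assumes p: "exchangeable N p" and G: "\<And>i v. norm (G i v) \<le> 1" "\<And>i. G i 0 = 1"
  shows "measure_pmf.expectation p (\<lambda>w. \<Prod>i<N. G i (w i)) =
    measure_pmf.expectation p (\<lambda>w. (\<Sum>\<sigma> | \<sigma> permutes {..<N}. \<Prod>i\<in>weight_support N w. G (\<sigma> i) (w i)) / fact N)"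
proof -
  let ?P = "{\<sigma>. \<sigma> permutes {..<N}}"
  let ?g = "\<lambda>w. \<Prod>i<N. G i (w i)"
  have P: "finite ?P" "card ?P = fact N" by (auto simp: finite_permutations card_permutations)
  have b: "norm (?g w) \<le> 1" for w
    unfolding prod_norm[symmetric] using G by (intro prod_le_1) auto
  have s: "(\<Sum>\<sigma>\<in>?P. ?g (w \<circ> \<sigma>)) = (\<Sum>\<sigma>\<in>?P. \<Prod>i\<in>weight_support N w. G (\<sigma> i) (w i))" for w
  proof -
    have "?g (w \<circ> \<sigma>) = (\<Prod>i\<in>weight_support N w. G (inv_into UNIV \<sigma> i) (w i))" if "\<sigma> \<in> ?P" for \<sigma>
    proof -
      have \<sigma>: "\<sigma> permutes {..<N}" using that by simp
      have "(\<Prod>i<N. G (inv_into UNIV \<sigma> i) (w i)) = (\<Prod>i<N. G (inv_into UNIV \<sigma> (\<sigma> i)) (w (\<sigma> i)))"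
        using prod.permute[OF \<sigma>, of "\<lambda>i. G (inv_into UNIV \<sigma> i) (w i)"] by (simp add: o_def)
      also have "\<dots> = ?g (w \<circ> \<sigma>)" using permutes_inverses(2)[OF \<sigma>] by simp
      finally have "?g (w \<circ> \<sigma>) = (\<Prod>i<N. G (inv_into UNIV \<sigma> i) (w i))" by simp
      also have "\<dots> = (\<Prod>i\<in>weight_support N w. G (inv_into UNIV \<sigma> i) (w i))"
        by (rule prod.mono_neutral_right) (auto simp: weight_support_def G)
      finally show ?thesis .
    qed
    then have "(\<Sum>\<sigma>\<in>?P. ?g (w \<circ> \<sigma>)) = (\<Sum>\<sigma>\<in>?P. \<Prod>i\<in>weight_support N w. G (inv_into UNIV \<sigma> i) (w i))"
      by (rule sum.cong[OF refl])
    also have "\<dots> = (\<Sum>\<sigma>\<in>?P. \<Prod>i\<in>weight_support N w. G (\<sigma> i) (w i))"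
      by (rule sum.reindex_bij_witness[where i = "inv_into UNIV" and j = "inv_into UNIV"])
         (auto simp: permutes_inv permutes_inv_inv)
    finally show ?thesis .
  qed
  have "of_nat (fact N) * measure_pmf.expectation p ?g = (\<Sum>\<sigma>\<in>?P. measure_pmf.expectation p ?g)"
    using P by simp
  also have "\<dots> = (\<Sum>\<sigma>\<in>?P. measure_pmf.expectation p (\<lambda>w. ?g (w \<circ> \<sigma>)))"
    using exchangeable_expectation[OF p, of _ ?g] by (intro sum.cong refl) auto
  also have "\<dots> = measure_pmf.expectation p (\<lambda>w. \<Sum>\<sigma>\<in>?P. ?g (w \<circ> \<sigma>))"
    by (rule Bochner_Integration.integral_sum[symmetric]) (rule pmf_integrable_bounded[OF b])
  finally have "measure_pmf.expectation p ?g = measure_pmf.expectation p (\<lambda>w. \<Sum>\<sigma>\<in>?P. ?g (w \<circ> \<sigma>)) / fact N"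
    by (simp add: field_simps)
  then show ?thesis unfolding s by simp
qed

lemma norm_expectation_le_split:
  fixes g :: "'a \<Rightarrow> complex"
  assumes "\<And>w. w \<notin> A \<Longrightarrow> norm (g w) \<le> a" "\<And>w. norm (g w) \<le> b" "0 \<le> a"
  shows "norm (measure_pmf.expectation p g) \<le> a + b * measure_pmf.prob p A"
proof -
  have b: "0 \<le> b" using assms(2) norm_ge_zero order_trans by blast
  have "norm (measure_pmf.expectation p g) \<le> measure_pmf.expectation p (\<lambda>w. norm (g w))"
    by (rule integral_norm_bound)
  also have "\<dots> \<le> measure_pmf.expectation p (\<lambda>w. a + b * indicator A w)"
    using assms b
    by (intro integral_mono pmf_integrable_bounded[where B = "a + b"])
       (auto simp: indicator_def intro: add_increasing)
  also have "\<dots> = a + b * measure_pmf.prob p A"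
  proof -
    have "integrable (measure_pmf p) (indicat_real A)"
      by (rule pmf_integrable_bounded[where B = 1]) (simp add: indicator_le_1)
    then show ?thesis by simp
  qed
  finally show ?thesis .
qed

text \<open>As long as there are fewer than \<open>R\<close> nonzero coordinates, their random positions are
  nearly independent, so each factor may be replaced by its average over all positions.\<close>

theorem exchangeable_product_approximation:
  fixes G :: "nat \<Rightarrow> int \<Rightarrow> complex"
  assumes p: "exchangeable N p" and N: "0 < N" and G: "\<And>i v. norm (G i v) \<le> 1" "\<And>i. G i 0 = 1"
  shows "norm (measure_pmf.expectation p (\<lambda>w. \<Prod>i<N. G i (w i)) -
      measure_pmf.expectation p (\<lambda>w. \<Prod>j<N. (\<Sum>x<N. G x (w j)) / N))
    \<le> (real R)\<^sup>2 / N + 2 * measure_pmf.prob p {w. R \<le> card (weight_support N w)}"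
proof -
  let ?L = "\<lambda>w. (\<Sum>\<sigma> | \<sigma> permutes {..<N}. \<Prod>i\<in>weight_support N w. G (\<sigma> i) (w i)) / fact N"
  let ?M = "\<lambda>w. \<Prod>j<N. (\<Sum>x<N. G x (w j)) / N"
  let ?M' = "\<lambda>w. \<Prod>j\<in>weight_support N w. (\<Sum>x<N. G x (w j)) / N"
  have M: "?M w = ?M' w" for w
    by (rule prod.mono_neutral_right) (auto simp: weight_support_def G N[THEN less_imp_neq, symmetric])
  have M1: "norm (?M w) \<le> 1" for w
  proof -
    have "norm (\<Sum>x<N. G x v) \<le> of_nat (card {..<N}) * 1" for v by (intro sum_norm_bound G)
    then show ?thesis
      unfolding prod_norm[symmetric] using N by (intro prod_le_1) (auto simp: norm_divide divide_le_eq)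
  qed
  have L1: "norm (?L w) \<le> 1" for w
  proof -
    have "norm (\<Sum>\<sigma> | \<sigma> permutes {..<N}. \<Prod>i\<in>weight_support N w. G (\<sigma> i) (w i)) \<le>
      of_nat (card {\<sigma>. \<sigma> permutes {..<N}}) * 1"
    proof (rule sum_norm_bound)
      fix \<sigma>
      show "norm (\<Prod>i\<in>weight_support N w. G (\<sigma> i) (w i)) \<le> 1"
        unfolding prod_norm[symmetric] using G by (intro prod_le_1) auto
    qed
    then show ?thesis by (simp add: card_permutations norm_divide divide_le_eq)
  qed
  have iL: "integrable (measure_pmf p) ?L" by (rule pmf_integrable_bounded[OF L1])
  have iM: "integrable (measure_pmf p) ?M" by (rule pmf_integrable_bounded[OF M1])
  have "measure_pmf.expectation p (\<lambda>w. \<Prod>i<N. G i (w i)) - measure_pmf.expectation p ?M =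
    measure_pmf.expectation p (\<lambda>w. ?L w - ?M w)"
    unfolding exchangeable_expectation_product[where G = G, OF p G]
    by (rule Bochner_Integration.integral_diff[OF iL iM, symmetric])
  also have "norm \<dots> \<le> (real R)\<^sup>2 / N + 2 * measure_pmf.prob p {w. R \<le> card (weight_support N w)}"
  proof (rule norm_expectation_le_split)
    fix w show "norm (?L w - ?M w) \<le> 2"
      using norm_triangle_ineq4[of "?L w" "?M w"] L1[of w] M1[of w] by linarith
  next
    fix w assume "w \<notin> {w. R \<le> card (weight_support N w)}"
    then have c: "card (weight_support N w) \<le> R" by simp
    have "norm (?L w - ?M' w) \<le> (card (weight_support N w))\<^sup>2 / card {..<N}"
      using permutation_average_almost_independent[of "{..<N}" "weight_support N w" "\<lambda>i x. G x (w i)"]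
        weight_support_subset N G by auto
    also have "\<dots> \<le> (real R)\<^sup>2 / N"
      using c by (simp add: power2_eq_square divide_right_mono mult_mono)
    finally show "norm (?L w - ?M w) \<le> (real R)\<^sup>2 / N" by (simp add: M)
  qed simp
  finally show ?thesis .
qed

text \<open>A vector with at least \<open>R\<close> nonzero coordinates, randomly placed, misses the first \<open>n\<close>
  positions with probability about \<open>(1 - n / N) ^ R\<close>. So if it usually vanishes on those
  positions, it rarely has that many nonzero coordinates.\<close>

lemma prob_support_ge:
  fixes n N R :: nat
  assumes p: "exchangeable N p" and N: "0 < N" and n: "n \<le> N"
  shows "measure_pmf.prob p {w. R \<le> card (weight_support N w)} \<le>
    measure_pmf.prob p {w. \<exists>i<n. w i \<noteq> 0} + (1 - n / N) ^ R + (real R)\<^sup>2 / N"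
proof -
  \<comment> \<open>The product of these factors is the indicator of the event that \<open>w\<close> vanishes on the
    first \<open>n\<close> positions.\<close>
  define G :: "nat \<Rightarrow> int \<Rightarrow> complex" where "G i v = (if i < n \<and> v \<noteq> 0 then 0 else 1)" for i v
  let ?L = "\<lambda>w. (\<Sum>\<sigma> | \<sigma> permutes {..<N}. \<Prod>i\<in>weight_support N w. G (\<sigma> i) (w i)) / fact N"
  let ?A = "{w. \<not> R \<le> card (weight_support N w)}"
  define s where "s = (1 - n / N) ^ R + (real R)\<^sup>2 / N"
  have s0: "0 \<le> s" using n by (auto simp: s_def divide_le_eq)
  have G1: "norm (G i v) \<le> 1" "G i 0 = 1" for i v by (auto simp: G_def)
  have ind: "(\<Prod>i<N. G i (w i)) = of_real (indicat_real {w. \<forall>i<n. w i = 0} w)" for w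
  proof (cases "\<forall>i<n. w i = 0")
    case True
    then have "(\<Prod>i<N. G i (w i)) = 1" by (intro prod.neutral) (auto simp: G_def)
    then show ?thesis using True by simp
  next
    case False
    then obtain i where i: "i < n" "w i \<noteq> 0" by blast
    then have "(\<Prod>i<N. G i (w i)) = 0" using n by (intro prod_zero bexI[of _ i]) (auto simp: G_def)
    then show ?thesis using False by simp
  qed
  have "measure_pmf.expectation p (\<lambda>w. \<Prod>i<N. G i (w i)) =
      of_real (measure_pmf.expectation p (indicat_real {w. \<forall>i<n. w i = 0}))"
    unfolding ind by (rule integral_complex_of_real)
  then have "of_real (measure_pmf.prob p {w. \<forall>i<n. w i = 0}) = measure_pmf.expectation p ?L"
    unfolding exchangeable_expectation_product[where G = G, OF p G1] by simp
  from arg_cong[OF this, of norm]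
  have "measure_pmf.prob p {w. \<forall>i<n. w i = 0} = norm (measure_pmf.expectation p ?L)"
    unfolding norm_of_real by (simp only: abs_of_nonneg measure_nonneg)
  also have "\<dots> \<le> s + 1 * measure_pmf.prob p ?A"
  proof (rule norm_expectation_le_split[OF _ _ s0])
    have a: "norm (\<Prod>i\<in>I. G (\<sigma> i) (w i)) \<le> 1" for \<sigma> :: "nat \<Rightarrow> nat" and w I
      unfolding prod_norm[symmetric] using G1 by (intro prod_le_1) auto
    fix w
    have "norm (\<Sum>\<sigma> | \<sigma> permutes {..<N}. \<Prod>i\<in>weight_support N w. G (\<sigma> i) (w i)) \<le>
      of_nat (card {\<sigma>. \<sigma> permutes {..<N}}) * 1" by (intro sum_norm_bound a)
    then show "norm (?L w) \<le> 1" by (simp add: card_permutations norm_divide divide_le_eq)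
    assume "w \<notin> ?A"
    then have "R \<le> card (weight_support N w)" by simp
    then obtain I where I: "I \<subseteq> weight_support N w" "card I = R" "finite I"
      by (rule obtain_subset_with_card_n)
    have IN: "I \<subseteq> {..<N}" using I weight_support_subset by blast
    define g :: "nat \<Rightarrow> nat \<Rightarrow> complex" where "g i x = (if x < n then 0 else 1)" for i x
    have le: "norm (\<Prod>i\<in>weight_support N w. G (\<sigma> i) (w i)) \<le> Re (\<Prod>i\<in>I. g i (\<sigma> i))" for \<sigma>
    proof (cases "\<exists>i\<in>I. \<sigma> i < n")
      case True
      then obtain i where i: "i \<in> I" "\<sigma> i < n" by blast
      then have "G (\<sigma> i) (w i) = 0" using I by (auto simp: G_def weight_support_def)
      then have "(\<Prod>i\<in>weight_support N w. G (\<sigma> i) (w i)) = 0" using I i by (intro prod_zero) auto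
      moreover have "(\<Prod>i\<in>I. g i (\<sigma> i)) = 0" using I i by (intro prod_zero) (auto simp: g_def)
      ultimately show ?thesis by simp
    next
      case False
      then have "(\<Prod>i\<in>I. g i (\<sigma> i)) = 1" by (intro prod.neutral) (auto simp: g_def)
      then show ?thesis using a by simp
    qed
    have "norm (\<Sum>\<sigma> | \<sigma> permutes {..<N}. \<Prod>i\<in>weight_support N w. G (\<sigma> i) (w i)) \<le>
       (\<Sum>\<sigma> | \<sigma> permutes {..<N}. Re (\<Prod>i\<in>I. g i (\<sigma> i)))"
      by (rule order_trans[OF norm_sum sum_mono]) (rule le)
    then have "norm (?L w) \<le> Re ((\<Sum>\<sigma> | \<sigma> permutes {..<N}. \<Prod>i\<in>I. g i (\<sigma> i)) / fact N)"
    proof -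
      assume le: "norm (\<Sum>\<sigma> | \<sigma> permutes {..<N}. \<Prod>i\<in>weight_support N w. G (\<sigma> i) (w i)) \<le>
       (\<Sum>\<sigma> | \<sigma> permutes {..<N}. Re (\<Prod>i\<in>I. g i (\<sigma> i)))"
      have "norm (?L w) = norm (\<Sum>\<sigma> | \<sigma> permutes {..<N}. \<Prod>i\<in>weight_support N w. G (\<sigma> i) (w i)) / fact N"
        by (simp only: norm_divide norm_fact)
      also have "\<dots> \<le> (\<Sum>\<sigma> | \<sigma> permutes {..<N}. Re (\<Prod>i\<in>I. g i (\<sigma> i))) / fact N"
        by (rule divide_right_mono[OF le]) simp
      also have "\<dots> = Re ((\<Sum>\<sigma> | \<sigma> permutes {..<N}. \<Prod>i\<in>I. g i (\<sigma> i)) / of_real (fact N))"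
        by (simp only: Re_divide_of_real Re_sum)
      finally show ?thesis by simp
    qed
    also have "\<dots> \<le> Re (\<Prod>i\<in>I. (\<Sum>x<N. g i x) / N) + (real R)\<^sup>2 / N"
    proof -
      have "norm ((\<Sum>\<sigma> | \<sigma> permutes {..<N}. \<Prod>i\<in>I. g i (\<sigma> i)) / fact (card {..<N}) -
          (\<Prod>i\<in>I. (\<Sum>x<N. g i x) / card {..<N})) \<le> (card I)\<^sup>2 / card {..<N}"
        by (rule permutation_average_almost_independent) (use N IN in \<open>auto simp: g_def\<close>)
      then show ?thesis
        using complex_Re_le_cmod[of "(\<Sum>\<sigma> | \<sigma> permutes {..<N}. \<Prod>i\<in>I. g i (\<sigma> i)) / fact N -
          (\<Prod>i\<in>I. (\<Sum>x<N. g i x) / N)"] by (simp add: I)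
    qed
    also have "(\<Prod>i\<in>I. (\<Sum>x<N. g i x) / N) = of_real ((1 - n / N) ^ R)"
    proof -
      have "(\<Sum>x<N. g i x) = (\<Sum>x\<in>{n..<N}. 1)" for i
        by (rule sum.mono_neutral_cong_right) (auto simp: g_def)
      then show ?thesis using n N by (simp add: I of_nat_diff diff_divide_distrib)
    qed
    finally show "norm (?L w) \<le> s" by (simp add: s_def)
  qed
  also have "measure_pmf.prob p ?A = 1 - measure_pmf.prob p {w. R \<le> card (weight_support N w)}"
    using measure_pmf.prob_compl[of "{w. R \<le> card (weight_support N w)}" p]
    by (simp add: Collect_neg_eq Compl_eq_Diff_UNIV)
  finally have "measure_pmf.prob p {w. R \<le> card (weight_support N w)} \<le> 1 - measure_pmf.prob p {w. \<forall>i<n. w i = 0} + s"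
    by simp
  also have "1 - measure_pmf.prob p {w. \<forall>i<n. w i = 0} = measure_pmf.prob p {w. \<exists>i<n. w i \<noteq> 0}"
  proof -
    have "{w :: nat \<Rightarrow> int. \<exists>i<n. w i \<noteq> 0} = UNIV - {w. \<forall>i<n. w i = 0}" by auto
    then show ?thesis using measure_pmf.prob_compl[of "{w. \<forall>i<n. w i = 0}" p] by simp
  qed
  finally show ?thesis by (simp add: s_def)
qed

lemma prob_le_split: "measure_pmf.prob p A \<le> measure_pmf.prob p B + measure_pmf.prob p (A - B)"
proof -
  have "measure_pmf.prob p A \<le> measure_pmf.prob p (B \<union> (A - B))"
    by (rule measure_pmf.finite_measure_mono) auto
  also have "\<dots> \<le> measure_pmf.prob p B + measure_pmf.prob p (A - B)"
    by (rule measure_Un_le) auto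
  finally show ?thesis .
qed

text \<open>Exchangeability makes every pair \<open>(b, B + b)\<close> equally likely to be bad; if fewer than
  \<open>R\<close> of \<open>B\<close> pairs are bad, each one is bad with probability at most \<open>R / B\<close>, and a union
  bound over the first \<open>n\<close> pairs applies.\<close>

lemma prob_some_bad_pair:
  fixes n N B R :: nat
  assumes p: "exchangeable N p" and B: "0 < B" "2 * B \<le> N" and n: "n \<le> B"
  shows "measure_pmf.prob p {w. \<exists>b<n. \<not> Q (w b - w (B + b))} \<le>
    measure_pmf.prob p {w. R \<le> card {b. b < B \<and> \<not> Q (w b - w (B + b))}} + n * R / B"
proof -
  define bad where "bad w = {b. b < B \<and> \<not> Q (w b - w (B + b))}" for w :: "nat \<Rightarrow> int"
  define m where "m b = measure_pmf.prob p {w. b \<in> bad w \<and> card (bad w) < R}" for b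
  have m: "m b = m 0" if b: "b < B" for b
  proof -
    \<comment> \<open>This permutation exchanges the pairs with indices 0 and \<open>b\<close>.\<close>
    let ?s = "Transposition.transpose 0 b \<circ> Transposition.transpose B (B + b)"
    have s: "?s permutes {..<N}"
      using b B by (intro permutes_compose permutes_swap_id) auto
    have in_bad: "c \<in> bad (w \<circ> ?s) \<longleftrightarrow> Transposition.transpose 0 b c \<in> bad w" for w c
      using b B by (auto simp: bad_def Transposition.transpose_def)
    have img: "bad w = Transposition.transpose 0 b ` bad (w \<circ> ?s)" for w
    proof (rule equalityI; rule subsetI)
      fix c assume "c \<in> bad w"
      then have "Transposition.transpose 0 b c \<in> bad (w \<circ> ?s)" by (simp add: in_bad)
      then show "c \<in> Transposition.transpose 0 b ` bad (w \<circ> ?s)"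
        by (metis image_eqI transpose_involutory)
    qed (auto simp: in_bad)
    have card_eq: "card (bad (w \<circ> ?s)) = card (bad w)" for w
      by (subst img[of w]) (rule card_image[OF inj_on_subset[OF inj_transpose subset_UNIV], symmetric])
    have "m 0 = measure_pmf.prob p {w. b \<in> bad (w \<circ> ?s) \<and> card (bad (w \<circ> ?s)) < R}"
      by (simp only: card_eq in_bad m_def Transposition.transpose_apply_second)
    also have "\<dots> = m b"
      unfolding m_def by (rule exchangeable_prob[OF p s, where Q = "\<lambda>w. b \<in> bad w \<and> card (bad w) < R"])
    finally show ?thesis ..
  qed
  have msum: "(\<Sum>b<c. m b) = c * m 0" if "c \<le> B" for c
  proof -
    have "(\<Sum>b<c. m b) = (\<Sum>b<c. m 0)" by (rule sum.cong[OF refl], rule m) (use that in simp)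
    then show ?thesis by simp
  qed
  have "B * m 0 = (\<Sum>b<B. measure_pmf.expectation p (indicat_real {w. b \<in> bad w \<and> card (bad w) < R}))"
    using msum[of B] by (simp add: m_def)
  also have "\<dots> = measure_pmf.expectation p (\<lambda>w. \<Sum>b<B. indicat_real {w. b \<in> bad w \<and> card (bad w) < R} w)"
    by (rule Bochner_Integration.integral_sum[symmetric], rule pmf_integrable_bounded[where B=1])
       (simp add: indicator_le_1)
  also have "\<dots> \<le> measure_pmf.expectation p (\<lambda>w. real R)"
  proof (rule integral_mono)
    have le: "(\<Sum>b<B. indicat_real {w. b \<in> bad w \<and> card (bad w) < R} w) \<le> real R" for w
    proof (cases "card (bad w) < R")
      case True
      have "(\<Sum>b<B. indicat_real {w. b \<in> bad w \<and> card (bad w) < R} w) = (\<Sum>b\<in>bad w. (1::real))"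
        using True by (intro sum.mono_neutral_cong_right) (auto simp: bad_def indicator_def)
      then show ?thesis using True by simp
    qed (simp add: indicator_def)
    then show "(\<Sum>b<B. indicat_real {w. b \<in> bad w \<and> card (bad w) < R} w) \<le> real R" for w .
    show "integrable (measure_pmf p) (\<lambda>w. \<Sum>b<B. indicat_real {w. b \<in> bad w \<and> card (bad w) < R} w)"
      by (rule pmf_integrable_bounded[where B = R]) (use le in \<open>simp add: abs_of_nonneg sum_nonneg\<close>)
  qed simp
  finally have m0: "m 0 \<le> R / B" using B by (simp add: field_simps)
  have "measure_pmf.prob p {w. \<exists>b<n. \<not> Q (w b - w (B + b))} \<le>
     measure_pmf.prob p {w. R \<le> card (bad w)} +
     measure_pmf.prob p ({w. \<exists>b<n. \<not> Q (w b - w (B + b))} - {w. R \<le> card (bad w)})"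
    by (rule prob_le_split)
  also have "measure_pmf.prob p ({w. \<exists>b<n. \<not> Q (w b - w (B + b))} - {w. R \<le> card (bad w)}) \<le>
      measure_pmf.prob p (\<Union>b<n. {w. b \<in> bad w \<and> card (bad w) < R})"
    using n by (intro measure_pmf.finite_measure_mono) (auto simp: bad_def)
  also have "\<dots> \<le> (\<Sum>b<n. m b)"
    unfolding m_def by (rule measure_pmf.finite_measure_subadditive_finite) auto
  also have "\<dots> = n * m 0" by (rule msum[OF n])
  also have "\<dots> \<le> n * (R / B)" by (intro mult_left_mono m0) simp
  finally show ?thesis by (simp add: bad_def)
qed

text \<open>If the coordinates \<open>b\<close> and \<open>B + b\<close> agree for all \<open>b < n\<close>, both for \<open>w\<close> and after
  rotating the first \<open>n\<close> positions cyclically, then consecutive coordinates agree. By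
  exchangeability both conditions fail with the same probability.\<close>

lemma prob_nonconstant_block:
  assumes p: "exchangeable N p" and n: "n \<le> B" "2 * B \<le> N"
  shows "measure_pmf.prob p {w. \<exists>b<n. \<exists>c<n. w b \<noteq> w c} \<le>
    2 * measure_pmf.prob p {w. \<exists>b<n. w b \<noteq> w (B + b)}"
proof -
  define r where "r b = (if b < n then Suc b mod n else b)" for b
  have r: "r permutes {..<N}"
  proof (rule permutes_subset)
    have "inj_on r {..<n}"
    proof (rule inj_onI)
      fix b c assume bc: "b \<in> {..<n}" "c \<in> {..<n}" "r b = r c"
      then show "b = c"
        by (auto simp: r_def mod_Suc split: if_splits)
    qed
    moreover have "r ` {..<n} \<subseteq> {..<n}" by (auto simp: r_def)
    ultimately have "bij_betw r {..<n} {..<n}"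
      by (simp add: bij_betw_def endo_inj_surj)
    then show "r permutes {..<n}" by (rule bij_imp_permutes) (simp add: r_def)
  qed (use n in auto)
  have "measure_pmf.prob p {w. \<exists>b<n. \<exists>c<n. w b \<noteq> w c} \<le>
     measure_pmf.prob p ({w. \<exists>b<n. w b \<noteq> w (B + b)} \<union> {w. \<exists>b<n. (w \<circ> r) b \<noteq> (w \<circ> r) (B + b)})"
  proof (rule measure_pmf.finite_measure_mono, rule subsetI, rule ccontr)
    fix w assume w: "w \<in> {w. \<exists>b<n. \<exists>c<n. w b \<noteq> w c}"
      "w \<notin> {w. \<exists>b<n. w b \<noteq> w (B + b)} \<union> {w. \<exists>b<n. (w \<circ> r) b \<noteq> (w \<circ> r) (B + b)}"
    have "w (Suc b) = w b" if "Suc b < n" for b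
    proof -
      have "w (r b) = w (r (B + b))" "w b = w (B + b)" using w that by auto
      moreover have "r b = Suc b" "r (B + b) = B + b" using that n by (auto simp: r_def)
      ultimately show ?thesis by simp
    qed
    then have const: "w b = w 0" if "b < n" for b using that by (induction b) auto
    obtain b c where "b < n" "c < n" "w b \<noteq> w c" using w(1) by blast
    then show False using const[of b] const[of c] by simp
  qed simp
  also have "\<dots> \<le> measure_pmf.prob p {w. \<exists>b<n. w b \<noteq> w (B + b)} +
      measure_pmf.prob p {w. \<exists>b<n. (w \<circ> r) b \<noteq> (w \<circ> r) (B + b)}"
    by (rule measure_Un_le) auto
  also have "measure_pmf.prob p {w. \<exists>b<n. (w \<circ> r) b \<noteq> (w \<circ> r) (B + b)} =
     measure_pmf.prob p {w. \<exists>b<n. w b \<noteq> w (B + b)}"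
    by (rule exchangeable_prob[OF p r, where Q = "\<lambda>w. \<exists>b<n. w b \<noteq> w (B + b)"])
  finally show ?thesis by simp
qed

text \<open>If one of the numbers \<open>d w b\<close> is nonzero, then toggling the membership of \<open>b\<close> pairs up
  the subsets so that at least one of each pair has nonzero sum. Hence a uniformly random
  subset sum is nonzero with probability at least 1/2.\<close>

lemma prob_some_nonzero_of_subset_sums:
  fixes d :: "'a \<Rightarrow> nat \<Rightarrow> int"
  assumes s: "\<And>T. T \<subseteq> {..<n} \<Longrightarrow> measure_pmf.prob p {w. (\<Sum>b\<in>T. d w b) \<noteq> 0} \<le> s"
  shows "measure_pmf.prob p {w. \<exists>b<n. d w b \<noteq> 0} \<le> 2 * s"
proof -
  let ?P = "Pow {..<n}"
  have c: "card ?P = 2 ^ n" by (simp add: card_Pow)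
  have key: "2 ^ n / 2 \<le> (\<Sum>T\<in>?P. indicat_real {w. (\<Sum>b\<in>T. d w b) \<noteq> 0} w)"
    if "\<exists>b<n. d w b \<noteq> 0" for w
  proof -
    obtain b where b: "b < n" "d w b \<noteq> 0" using \<open>\<exists>b<n. d w b \<noteq> 0\<close> by blast
    let ?f = "\<lambda>T. indicat_real {w. (\<Sum>b\<in>T. d w b) \<noteq> 0} w"
    define h where "h T = (if b \<in> T then T - {b} else insert b T)" for T
    have h: "(\<Sum>T\<in>?P. ?f (h T)) = (\<Sum>T\<in>?P. ?f T)"
      by (rule sum.reindex_bij_witness[where i = h and j = h]) (use b in \<open>auto simp: h_def\<close>)
    have "1 \<le> ?f T + ?f (h T)" if "T \<in> ?P" for T
    proof -
      have "finite T" using that finite_subset by auto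
      then have "(\<Sum>b\<in>T. d w b) \<noteq> (\<Sum>b\<in>h T. d w b)"
        using b by (auto simp: h_def sum.remove)
      then show ?thesis by (auto simp: indicator_def)
    qed
    then have "(\<Sum>T\<in>?P. 1) \<le> (\<Sum>T\<in>?P. ?f T + ?f (h T))" by (rule sum_mono)
    then show ?thesis using c by (simp add: sum.distrib h)
  qed
  have "2 ^ n / 2 * measure_pmf.prob p {w. \<exists>b<n. d w b \<noteq> 0} \<le>
      measure_pmf.expectation p (\<lambda>w. \<Sum>T\<in>?P. indicat_real {w. (\<Sum>b\<in>T. d w b) \<noteq> 0} w)"
  proof (rule pmf_expectation_indicator_le[where B = "2 ^ n"])
    fix w
    have "(\<Sum>T\<in>?P. indicat_real {w. (\<Sum>b\<in>T. d w b) \<noteq> 0} w) \<le> (\<Sum>T\<in>?P. 1)"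
      by (intro sum_mono indicator_le_1)
    then show "(\<Sum>T\<in>?P. indicat_real {w. (\<Sum>b\<in>T. d w b) \<noteq> 0} w) \<le> 2 ^ n"
      using c by simp
    show "0 \<le> (\<Sum>T\<in>?P. indicat_real {w. (\<Sum>b\<in>T. d w b) \<noteq> 0} w)"
      by (intro sum_nonneg indicator_pos_le)
  next
    fix w assume "w \<in> {w. \<exists>b<n. d w b \<noteq> 0}"
    then show "2 ^ n / 2 \<le> (\<Sum>T\<in>?P. indicat_real {w. (\<Sum>b\<in>T. d w b) \<noteq> 0} w)"
      by (intro key) simp
  qed
  also have "\<dots> = (\<Sum>T\<in>?P. measure_pmf.expectation p (indicat_real {w. (\<Sum>b\<in>T. d w b) \<noteq> 0}))"
    by (rule Bochner_Integration.integral_sum, rule pmf_integrable_bounded[where B=1])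
       (simp add: indicator_le_1)
  also have "\<dots> = (\<Sum>T\<in>?P. measure_pmf.prob p {w. (\<Sum>b\<in>T. d w b) \<noteq> 0})" by simp
  also have "\<dots> \<le> (\<Sum>T\<in>?P. s)" by (intro sum_mono s) auto
  also have "\<dots> = 2 ^ n * s" using c by simp
  finally show ?thesis by simp
qed

section \<open>Compatible weight distributions\<close>

lemma permutation_with_image:
  assumes "finite S" "A \<subseteq> S" "B \<subseteq> S" "card A = card B"
  obtains \<sigma> where "\<sigma> permutes S" "\<sigma> ` A = B"
proof -
  have fin: "finite A" "finite B" using assms finite_subset by auto
  obtain f where f: "bij_betw f A B" using finite_same_card_bij[OF fin assms(4)] by blast
  have "card (S - A) = card (S - B)" using assms fin by (simp add: card_Diff_subset)
  then obtain g where g: "bij_betw g (S - A) (S - B)"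
    using finite_same_card_bij[of "S - A" "S - B"] assms(1) by auto
  define \<sigma> where "\<sigma> x = (if x \<in> A then f x else if x \<in> S then g x else x)" for x
  have "bij_betw \<sigma> A B" using f by (rule bij_betw_cong[THEN iffD1, rotated]) (simp add: \<sigma>_def)
  moreover have "bij_betw \<sigma> (S - A) (S - B)"
    using g by (rule bij_betw_cong[THEN iffD1, rotated]) (simp add: \<sigma>_def)
  ultimately have "bij_betw \<sigma> (A \<union> (S - A)) (B \<union> (S - B))" by (rule bij_betw_combine) auto
  moreover have "A \<union> (S - A) = S" "B \<union> (S - B) = S" using assms by auto
  ultimately have "bij_betw \<sigma> S S" by simp
  then have "\<sigma> permutes S" by (rule bij_imp_permutes) (use assms(2) in \<open>auto simp: \<sigma>_def\<close>)
  moreover have "\<sigma> ` A = B" using \<open>bij_betw \<sigma> A B\<close> by (simp add: bij_betw_def)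
  ultimately show ?thesis by (rule that)
qed

lemma prod_cis: "finite A \<Longrightarrow> (\<Prod>i\<in>A. cis (f i)) = cis (\<Sum>i\<in>A. f i)"
  by (induction A rule: finite_induct) (simp_all add: cis_mult)

lemma torus_monomial_block:
  fixes x :: real
  assumes "A \<subseteq> {..<N}"
  shows "torus_monomial N (\<lambda>i. if i \<in> A then cis x else 1) w = cis (x * of_int (\<Sum>i\<in>A. w i))"
proof -
  have "torus_monomial N (\<lambda>i. if i \<in> A then cis x else 1) w = (\<Prod>i\<in>A. cis (real_of_int (w i) * x))"
    unfolding torus_monomial_def
    by (rule prod.mono_neutral_cong_right) (use assms in \<open>auto simp: cis_power_int\<close>)
  also have "\<dots> = cis (\<Sum>i\<in>A. real_of_int (w i) * x)"
    by (rule prod_cis) (use assms finite_subset in auto)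
  finally show ?thesis by (simp add: sum_distrib_left mult.commute)
qed

lemma card_multiples_below:
  fixes n m :: nat
  assumes "0 < n" "n dvd m"
  shows "card {i. i < m \<and> i mod n = 0} = m div n"
proof -
  have "{i. i < m \<and> i mod n = 0} = (*) n ` {..<m div n}"
  proof (rule equalityI; rule subsetI)
    fix i assume i: "i \<in> {i. i < m \<and> i mod n = 0}"
    then have "n * (i div n) = i" using assms by auto
    moreover have "i div n < m div n" using i assms by (simp add: div_less_mono)
    ultimately show "i \<in> (*) n ` {..<m div n}" by (metis image_eqI lessThan_iff)
  next
    fix i assume "i \<in> (*) n ` {..<m div n}"
    then obtain j where j: "i = n * j" "j < m div n" by blast
    have "n * j < n * (m div n)" by (rule mult_strict_left_mono[OF j(2)]) (use assms in simp)
    then show "i \<in> {i. i < m \<and> i mod n = 0}" using assms j by simp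
  qed
  moreover have "inj_on ((*) n) {..<m div n}" using assms by (auto simp: inj_on_def)
  ultimately show ?thesis by (simp add: card_image)
qed

text \<open>Two distinct points of the unit circle have a midpoint inside the open disc; among the
  finitely many roots of unity of order \<open>m\<close> this is uniform.\<close>

lemma roots_of_unity_midpoint_bound:
  fixes m :: nat
  assumes m: "0 < m"
  obtains \<rho> where "0 \<le> \<rho>" "\<rho> < 1"
    "\<And>a b :: int. \<not> int m dvd a - b \<Longrightarrow>
       norm (cis (2 * pi / m) powi a + cis (2 * pi / m) powi b) / 2 \<le> \<rho>"
proof -
  define f where "f r = norm (1 + cis (2 * pi * real r / m)) / 2" for r :: nat
  define \<rho> where "\<rho> = Max (insert 0 (f ` {0<..<m}))"
  have fin: "finite (insert 0 (f ` {0<..<m}))" by simp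
  have lt: "f r < 1" if r: "0 < r" "r < m" for r
  proof (rule ccontr)
    let ?u = "cis (2 * pi * real r / m)"
    assume "\<not> f r < 1"
    then have "2 \<le> norm (1 + ?u)" by (simp add: f_def)
    then have "4 \<le> (norm (1 + ?u))\<^sup>2" using power_mono[of 2 "norm (1 + ?u)" 2] by simp
    also have "\<dots> = 2 + 2 * cos (2 * pi * real r / m)"
      using sin_cos_squared_add[of "2 * pi * real r / m"]
      by (simp add: cmod_power2 power2_sum)
    finally have "cos (2 * pi * real r / m) = 1" using cos_le_one[of "2 * pi * real r / m"] by simp
    then obtain k :: int where "2 * pi * real r / m = of_int k * 2 * pi" by (auto simp: cos_one_2pi_int)
    then have "real r = of_int k * real m" using m by (simp add: field_simps)
    then have "int r = k * int m" by (metis of_int_eq_iff of_int_mult of_int_of_nat_eq)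
    then have "int m dvd int r" by simp
    then have "m dvd r" by simp
    then show False using r by (simp add: nat_dvd_not_less)
  qed
  show ?thesis
  proof (rule that[of \<rho>])
    show "0 \<le> \<rho>" unfolding \<rho>_def by (rule Max_ge[OF fin]) simp
    show "\<rho> < 1" unfolding \<rho>_def using lt by (subst Max_less_iff[OF fin]) auto
    fix a b :: int assume nd: "\<not> int m dvd a - b"
    let ?z = "cis (2 * pi / m)"
    define r where "r = nat ((b - a) mod int m)"
    have r: "int r = (b - a) mod int m" using m by (simp add: r_def)
    have "r \<noteq> 0"
    proof
      assume "r = 0"
      then have "int m dvd b - a" using r by (simp add: dvd_eq_mod_eq_0)
      with nd show False by (metis dvd_minus_iff minus_diff_eq)
    qed
    moreover have "r < m" using m r by (metis of_nat_0_less_iff of_nat_less_iff pos_mod_bound)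
    ultimately have r': "r \<in> {0<..<m}" by simp
    have "?z powi b = ?z powi a * ?z powi (b - a)"
      by (simp add: power_int_add[symmetric])
    then have "norm (?z powi a + ?z powi b) = norm (?z powi a * (1 + ?z powi (b - a)))"
      by (simp add: distrib_left)
    also have "\<dots> = norm (1 + ?z powi (b - a))" by (simp add: norm_mult norm_power_int)
    also have "?z powi (b - a) = cis (2 * pi * real r / m)"
    proof -
      have "int m dvd (b - a) - int r" unfolding r by (simp add: minus_mod_eq_mult_div)
      from cis_mod_period[OF m this] show ?thesis by (simp add: cis_power_int mult.commute)
    qed
    finally have "norm (?z powi a + ?z powi b) / 2 = f r" by (simp add: f_def)
    also have "\<dots> \<le> \<rho>" unfolding \<rho>_def by (rule Max_ge[OF fin]) (use r' in simp)
    finally show "norm (?z powi a + ?z powi b) / 2 \<le> \<rho>" .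
  qed
qed

text \<open>The eigenvalues of a permutation matrix with \<open>b\<close> disjoint cycles of length \<open>d\<close>,
  multiplied by \<open>\<zeta>\<close> on these cycles.\<close>

definition clock :: "nat \<Rightarrow> nat \<Rightarrow> complex \<Rightarrow> nat \<Rightarrow> complex" where
  "clock d b \<zeta> i = (if i < d * b then \<zeta> * cis (2 * pi * real (i mod d) / d) else 1)"

text \<open>What the characters of the inductive limit provide on the diagonal tori: compatible
  functions \<open>F k\<close> with representing distributions \<open>p k\<close> of weights, continuity at the
  identity, and one inequality, \<open>clock_rotation\<close>, which carries all the information about
  matrices outside the torus. The statement is separated from matrices because the rest of
  the argument is purely probabilistic.\<close>

locale weight_tower =
  fixes N :: "nat \<Rightarrow> nat" and F :: "nat \<Rightarrow> (nat \<Rightarrow> complex) \<Rightarrow> complex" and p :: "nat \<Rightarrow> (nat \<Rightarrow> int) pmf"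
  assumes N_0: "2 \<le> N 0" and N_dvd: "\<And>l k. l \<le> k \<Longrightarrow> N l dvd N k" and N_ge: "\<And>k. k \<le> N k"
    and exch: "\<And>k. exchangeable (N k) (p k)"
    and F: "\<And>k z. (\<And>i. norm (z i) = 1) \<Longrightarrow> F k z = measure_pmf.expectation (p k) (torus_monomial (N k) z)"
    and embed: "\<And>l k z. l \<le> k \<Longrightarrow> (\<And>i. norm (z i) = 1) \<Longrightarrow> F k (\<lambda>i. z (i mod N l)) = F l z"
    and near_one: "\<And>k e. 0 < e \<Longrightarrow> \<exists>d>0. \<forall>x. 0 \<le> x \<longrightarrow> x \<le> d \<longrightarrow> 1 - e \<le> Re (F k (one_coordinate 0 (cis x)))"
    and clock_rotation: "\<And>k d b \<zeta>. 2 \<le> d \<Longrightarrow> d * b \<le> N k \<Longrightarrow> norm \<zeta> = 1 \<Longrightarrow>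
      (norm (F k (clock d b \<zeta>) - F k (clock d b 1)))\<^sup>2 \<le>
        4 * measure_pmf.prob (p k) {w. \<exists>j<b. w (d * j) \<noteq> 0 \<and> w (d * j + 1) \<noteq> 0}"
begin

lemma N_pos: "0 < N k"
  using N_dvd[of 0 k] N_0 N_ge[of k] by (cases "N k = 0") auto

lemma N_le: "l \<le> k \<Longrightarrow> N l \<le> N k"
  using N_dvd N_pos by (simp add: dvd_imp_le)

text \<open>Under the embedding of level \<open>l\<close> the first coordinate becomes the block of positions
  congruent to 0 modulo \<open>N l\<close>; exchangeability replaces this block by any other of the same
  size.\<close>

lemma block_character:
  assumes l: "l \<le> k" and A: "A \<subseteq> {..<N k}" "card A = N k div N l"
  shows "measure_pmf.expectation (p k) (\<lambda>w. cis (x * of_int (\<Sum>i\<in>A. w i))) = F l (one_coordinate 0 (cis x))"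
proof -
  let ?B = "{i. i < N k \<and> i mod N l = 0}"
  have B: "?B \<subseteq> {..<N k}" "card ?B = N k div N l"
    using card_multiples_below[OF N_pos N_dvd[OF l]] by auto
  obtain \<sigma> where \<sigma>: "\<sigma> permutes {..<N k}" "\<sigma> ` ?B = A"
    using permutation_with_image[of "{..<N k}" ?B A] A B by auto
  have "F l (one_coordinate 0 (cis x)) = F k (\<lambda>i. one_coordinate 0 (cis x) (i mod N l))"
    by (rule embed[OF l, symmetric]) (simp add: one_coordinate_def)
  also have "\<dots> = measure_pmf.expectation (p k) (torus_monomial (N k) (\<lambda>i. one_coordinate 0 (cis x) (i mod N l)))"
    by (rule F) (simp add: one_coordinate_def)
  also have "torus_monomial (N k) (\<lambda>i. one_coordinate 0 (cis x) (i mod N l)) =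
      torus_monomial (N k) (\<lambda>i. if i \<in> ?B then cis x else 1)"
    unfolding torus_monomial_def by (intro ext prod.cong refl) (simp add: one_coordinate_def)
  also have "\<dots> = (\<lambda>w. cis (x * of_int (\<Sum>i\<in>?B. w i)))"
    by (rule ext) (rule torus_monomial_block[OF B(1)])
  also have "measure_pmf.expectation (p k) \<dots> = measure_pmf.expectation (p k) (\<lambda>w. cis (x * of_int (\<Sum>i\<in>?B. (w \<circ> \<sigma>) i)))"
    by (rule exchangeable_expectation[OF exch \<sigma>(1), symmetric])
  also have "(\<lambda>w :: nat \<Rightarrow> int. cis (x * of_int (\<Sum>i\<in>?B. (w \<circ> \<sigma>) i))) = (\<lambda>w. cis (x * of_int (\<Sum>i\<in>A. w i)))"
  proof
    fix w :: "nat \<Rightarrow> int"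
    have "(\<Sum>i\<in>A. w i) = (\<Sum>i\<in>?B. w (\<sigma> i))"
      unfolding \<sigma>(2)[symmetric] by (rule sum.reindex[unfolded o_def]) (rule inj_on_subset[OF permutes_inj[OF \<sigma>(1)]], simp)
    then show "cis (x * of_int (\<Sum>i\<in>?B. (w \<circ> \<sigma>) i)) = cis (x * of_int (\<Sum>i\<in>A. w i))" by simp
  qed
  finally show ?thesis ..
qed

lemma block_cosine:
  assumes l: "l \<le> k" and A: "A \<subseteq> {..<N k}" "card A = N k div N l"
  shows "measure_pmf.expectation (p k) (\<lambda>w. cos (x * of_int (\<Sum>i\<in>A. w i))) = Re (F l (one_coordinate 0 (cis x)))"
proof -
  have "Re (F l (one_coordinate 0 (cis x))) = measure_pmf.expectation (p k) (\<lambda>w. Re (cis (x * of_int (\<Sum>i\<in>A. w i))))"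
    unfolding block_character[OF l A, symmetric]
    by (rule integral_Re[symmetric]) (rule pmf_integrable_bounded[where B=1], simp)
  then show ?thesis by simp
qed

text \<open>Replacing a subset \<open>T\<close> of the first \<open>B\<close> positions by its translate gives another block
  of the same size; the two block sums differ by the sum of the differences of the pairs
  indexed by \<open>T\<close>.\<close>

lemma sum_over_swapped_block:
  fixes w :: "nat \<Rightarrow> int"
  assumes "T \<subseteq> {..<B}"
  shows "({..<B} - T) \<union> (+) B ` T \<subseteq> {..<2 * B}" "card (({..<B} - T) \<union> (+) B ` T) = B"
    "(\<Sum>i\<in>({..<B} - T) \<union> (+) B ` T. w i) = (\<Sum>i\<in>{..<B} - T. w i) + (\<Sum>i\<in>T. w (B + i))"
proof -
  have fT: "finite T" using assms finite_subset by auto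
  have disj: "({..<B} - T) \<inter> (+) B ` T = {}" by auto
  show "({..<B} - T) \<union> (+) B ` T \<subseteq> {..<2 * B}" using assms by auto
  have "card (({..<B} - T) \<union> (+) B ` T) = (B - card T) + card T"
    using fT disj assms by (subst card_Un_disjoint) (auto simp: card_Diff_subset card_image)
  moreover have "card T \<le> B" using card_mono[OF _ assms] by simp
  ultimately show "card (({..<B} - T) \<union> (+) B ` T) = B" by simp
  show "(\<Sum>i\<in>({..<B} - T) \<union> (+) B ` T. w i) = (\<Sum>i\<in>{..<B} - T. w i) + (\<Sum>i\<in>T. w (B + i))"
    using fT disj by (subst sum.union_disjoint) (auto simp: sum.reindex)
qed

text \<open>The average of the block characters over all blocks that pick one element of each pair
  \<open>(b, B + b)\<close> factorises into midpoints of roots of unity. It is close to 1 in expectation,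
  but of modulus at most \<open>\<rho> ^ R\<close> where \<open>R\<close> pairs differ modulo \<open>m\<close>.\<close>

lemma few_pairs_differ_modulo:
  fixes m R k :: nat
  assumes m: "0 < m"
    and e: "1 - e \<le> Re (F 0 (one_coordinate 0 (cis (2 * pi / m))))"
    and \<rho>: "0 \<le> \<rho>" "\<And>a b :: int. \<not> int m dvd a - b \<Longrightarrow>
       norm (cis (2 * pi / m) powi a + cis (2 * pi / m) powi b) / 2 \<le> \<rho>"
    and R: "\<rho> ^ R \<le> 1 / 2"
    and B: "B = N k div N 0"
  shows "measure_pmf.prob (p k) {w. R \<le> card {b. b < B \<and> \<not> int m dvd w b - w (B + b)}} \<le> 2 * e"
proof -
  let ?z = "cis (2 * pi / m)"
  define g where "g w = (\<Prod>b<B. (?z powi w b + ?z powi w (B + b)) / 2)" for w :: "nat \<Rightarrow> int"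
  have B2: "2 * B \<le> N k"
  proof -
    have "2 * B \<le> N 0 * B" using N_0 by (intro mult_right_mono) auto
    also have "\<dots> \<le> N k" unfolding B by (metis div_times_less_eq_dividend mult.commute)
    finally show ?thesis .
  qed
  have half: "norm ((?z powi a + ?z powi b) / 2) \<le> 1" for a b
    using norm_triangle_ineq[of "?z powi a" "?z powi b"] by (simp add: norm_power_int norm_divide)
  have g1: "norm (g w) \<le> 1" for w
    unfolding g_def prod_norm[symmetric] using half by (intro prod_le_1) auto
  have g2: "norm (g w) \<le> 1 / 2" if ge: "R \<le> card {b. b < B \<and> \<not> int m dvd w b - w (B + b)}" for w
  proof -
    let ?S = "{b. b < B \<and> \<not> int m dvd w b - w (B + b)}"
    obtain S where S: "S \<subseteq> ?S" "card S = R" "finite S"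
      using ge by (rule obtain_subset_with_card_n)
    have "norm (g w) = (\<Prod>b\<in>S. norm ((?z powi w b + ?z powi w (B + b)) / 2)) *
        (\<Prod>b\<in>{..<B} - S. norm ((?z powi w b + ?z powi w (B + b)) / 2))"
      unfolding g_def prod_norm[symmetric] using S by (subst prod.subset_diff[of S]) auto
    also have "\<dots> \<le> (\<Prod>b\<in>S. \<rho>) * 1"
    proof (rule mult_mono)
      show "(\<Prod>b\<in>S. norm ((?z powi w b + ?z powi w (B + b)) / 2)) \<le> (\<Prod>b\<in>S. \<rho>)"
        using S(1) \<rho>(2) by (intro prod_mono) (auto simp: norm_divide)
      show "(\<Prod>b\<in>{..<B} - S. norm ((?z powi w b + ?z powi w (B + b)) / 2)) \<le> 1"
        using half by (intro prod_le_1) auto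
    qed (use \<rho> in \<open>auto intro!: prod_nonneg\<close>)
    also have "\<dots> \<le> 1 / 2" using R S by simp
    finally show ?thesis .
  qed
  have ig: "integrable (measure_pmf (p k)) g" by (rule pmf_integrable_bounded[OF g1])
  have Eg: "measure_pmf.expectation (p k) g = F 0 (one_coordinate 0 ?z)"
  proof -
    \<comment> \<open>Expanding the product, a subset \<open>T\<close> collects the pairs that contribute their
      second element.\<close>
    have gs: "g w = (\<Sum>T\<in>Pow {..<B}. cis (2 * pi / m * of_int (\<Sum>i\<in>({..<B} - T) \<union> (+) B ` T. w i))) / 2 ^ B" for w
    proof -
      have "(\<Prod>b<B. ?z powi w (B + b) + ?z powi w b) =
        (\<Sum>T\<in>Pow {..<B}. (\<Prod>b\<in>T. ?z powi w (B + b)) * (\<Prod>b\<in>{..<B} - T. ?z powi w b))"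
        by (rule prod_add) simp
      also have "\<dots> = (\<Sum>T\<in>Pow {..<B}. cis (2 * pi / m * of_int (\<Sum>i\<in>({..<B} - T) \<union> (+) B ` T. w i)))"
      proof (rule sum.cong[OF refl])
        fix T assume "T \<in> Pow {..<B}"
        then have T: "T \<subseteq> {..<B}" "finite T" using finite_subset by auto
        show "(\<Prod>b\<in>T. ?z powi w (B + b)) * (\<Prod>b\<in>{..<B} - T. ?z powi w b) =
            cis (2 * pi / m * of_int (\<Sum>i\<in>({..<B} - T) \<union> (+) B ` T. w i))"
          unfolding sum_over_swapped_block(3)[OF T(1)] cis_power_int prod_cis[OF T(2)]
            prod_cis[OF finite_Diff[OF finite_lessThan]] cis_mult
          by (rule arg_cong[where f = cis])
             (simp only: of_int_add of_int_sum mult.commute[of "2 * pi / real m"] distrib_right sum_distrib_right add.commute)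
      qed
      finally show ?thesis by (simp add: g_def prod_dividef add.commute)
    qed
    have "measure_pmf.expectation (p k) g =
      (\<Sum>T\<in>Pow {..<B}. measure_pmf.expectation (p k) (\<lambda>w. cis (2 * pi / m * of_int (\<Sum>i\<in>({..<B} - T) \<union> (+) B ` T. w i)))) / 2 ^ B"
      unfolding gs
      by (subst integral_divide_zero, subst Bochner_Integration.integral_sum)
         (auto intro!: pmf_integrable_bounded[where B=1])
    also have "\<dots> = (\<Sum>T\<in>Pow {..<B}. F 0 (one_coordinate 0 ?z)) / 2 ^ B"
    proof (intro arg_cong[where f = "\<lambda>x. x / 2 ^ B"] sum.cong refl block_character)
      fix T assume T: "T \<in> Pow {..<B}"
      show "({..<B} - T) \<union> (+) B ` T \<subseteq> {..<N k}" using sum_over_swapped_block(1)[of T B] T B2 by force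
      show "card (({..<B} - T) \<union> (+) B ` T) = N k div N 0" using sum_over_swapped_block(2)[of T B] T B by simp
    qed simp
    finally show ?thesis by (simp add: card_Pow)
  qed
  have "1 / 2 * measure_pmf.prob (p k) {w. R \<le> card {b. b < B \<and> \<not> int m dvd w b - w (B + b)}} \<le>
      measure_pmf.expectation (p k) (\<lambda>w. 1 - norm (g w))"
  proof (rule pmf_expectation_indicator_le[where B = 1])
    fix w assume "w \<in> {w. R \<le> card {b. b < B \<and> \<not> int m dvd w b - w (B + b)}}"
    then show "1 / 2 \<le> 1 - norm (g w)" using g2[of w] by simp
  qed (use g1 in auto)
  also have "\<dots> = 1 - measure_pmf.expectation (p k) (\<lambda>w. norm (g w))"
    using ig by simp
  also have "\<dots> \<le> 1 - norm (measure_pmf.expectation (p k) g)"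
    using integral_norm_bound[of "measure_pmf (p k)" g] by simp
  also have "\<dots> \<le> e"
    using e complex_Re_le_cmod[of "F 0 (one_coordinate 0 ?z)"] unfolding Eg by linarith
  finally show ?thesis by simp
qed

lemma one_minus_cos_diff_le: "1 - cos (a - b) \<le> 2 * (1 - cos a) + 2 * (1 - cos (b::real))"
proof -
  have e: "cos a * cos a = 1 - sin a * sin a" "cos b * cos b = 1 - sin b * sin b"
    using cos_squared_eq[of a] cos_squared_eq[of b] by (simp_all only: power2_eq_square)
  have "0 \<le> (cos a + cos b - 2) * (cos a + cos b - 2) + (sin a + sin b) * (sin a + sin b)" by simp
  also have "\<dots> = (cos a * cos a + sin a * sin a) + (cos b * cos b + sin b * sin b) + 4 +
      2 * (cos a * cos b + sin a * sin b) - 4 * cos a - 4 * cos b"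
    by (simp only: algebra_simps)
  finally show ?thesis unfolding cos_diff e by simp
qed

text \<open>Differences of block sums are differences of two variables with cosine expectations
  close to 1, so they are rarely nonzero multiples of \<open>m\<close>. When all the pairs are congruent
  modulo \<open>m\<close>, every sum of differences over a set \<open>T\<close> is such a multiple, hence usually 0,
  and this for all \<open>T\<close> forces the individual differences to vanish.\<close>

lemma pair_differences_vanish:
  fixes m k n :: nat
  assumes m: "0 < m"
    and e: "\<And>x. 0 \<le> x \<Longrightarrow> x \<le> 2 * pi / m \<Longrightarrow> 1 - e \<le> Re (F 0 (one_coordinate 0 (cis x)))"
    and B: "B = N k div N 0" and n: "n \<le> B"
    and s: "measure_pmf.prob (p k) {w. \<exists>b<n. \<not> int m dvd w b - w (B + b)} \<le> s"
  shows "measure_pmf.prob (p k) {w. \<exists>b<n. w b \<noteq> w (B + b)} \<le> 2 * (4 * e + s)"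
proof -
  have "measure_pmf.prob (p k) {w. \<exists>b<n. w b - w (B + b) \<noteq> 0} \<le> 2 * (4 * e + s)"
  proof (rule prob_some_nonzero_of_subset_sums)
    fix T assume T: "T \<subseteq> {..<n}"
    then have TB: "T \<subseteq> {..<B}" and fT: "finite T" using n finite_subset by auto
    define D where "D w = (\<Sum>b\<in>T. w b - w (B + b))" for w :: "nat \<Rightarrow> int"
    define X where "X w = (\<Sum>i<B. w i)" for w :: "nat \<Rightarrow> int"
    define X' where "X' w = (\<Sum>i\<in>({..<B} - T) \<union> (+) B ` T. w i)" for w :: "nat \<Rightarrow> int"
    have B2: "2 * B \<le> N k"
    proof -
      have "2 * B \<le> N 0 * B" using N_0 by (intro mult_right_mono) auto
      also have "\<dots> \<le> N k" unfolding B by (metis div_times_less_eq_dividend mult.commute)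
      finally show ?thesis .
    qed
    have D_eq: "D w = X w - X' w" for w
      unfolding D_def X_def X'_def sum_over_swapped_block(3)[OF TB]
      using sum.subset_diff[OF TB, of w] by (simp add: sum_subtractf)
    have "measure_pmf.prob (p k) {w. int m dvd D w \<and> D w \<noteq> 0} \<le> 4 * e"
    proof (rule divisibility_of_cosines[OF m])
      fix x :: real assume x: "0 \<le> x" "x \<le> 2 * pi / m"
      have i: "integrable (measure_pmf (p k)) (\<lambda>w. cos (x * real_of_int (h w)))" for h
        by (rule pmf_integrable_bounded[where B=1]) simp
      have c1: "1 - e \<le> measure_pmf.expectation (p k) (\<lambda>w. cos (x * X w))"
        using block_cosine[of 0 k "{..<B}" x] e[OF x] B B2 by (simp add: X_def)
      have c2: "1 - e \<le> measure_pmf.expectation (p k) (\<lambda>w. cos (x * X' w))"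
      proof -
        have "({..<B} - T) \<union> (+) B ` T \<subseteq> {..<N k}" using sum_over_swapped_block(1)[OF TB] B2 by force
        then show ?thesis
          using block_cosine[of 0 k "({..<B} - T) \<union> (+) B ` T" x] e[OF x]
            sum_over_swapped_block(2)[OF TB] by (simp add: X'_def B)
      qed
      have "1 - measure_pmf.expectation (p k) (\<lambda>w. cos (x * D w)) =
          measure_pmf.expectation (p k) (\<lambda>w. 1 - cos (x * D w))"
        using i by simp
      also have "\<dots> \<le> measure_pmf.expectation (p k) (\<lambda>w. 4 - 2 * cos (x * X w) - 2 * cos (x * X' w))"
      proof (rule integral_mono)
        show "integrable (measure_pmf (p k)) (\<lambda>w. 1 - cos (x * D w))" using i by simp
        show "integrable (measure_pmf (p k)) (\<lambda>w. 4 - 2 * cos (x * X w) - 2 * cos (x * X' w))"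
          by (intro Bochner_Integration.integrable_diff integrable_mult_right i) simp
        fix w
        show "1 - cos (x * D w) \<le> 4 - 2 * cos (x * X w) - 2 * cos (x * X' w)"
          unfolding D_eq using one_minus_cos_diff_le[of "x * X w" "x * X' w"]
          by (simp add: right_diff_distrib)
      qed
      also have "\<dots> = 4 - 2 * measure_pmf.expectation (p k) (\<lambda>w. cos (x * X w)) -
          2 * measure_pmf.expectation (p k) (\<lambda>w. cos (x * X' w))"
        using i[of X] i[of X'] by simp
      finally show "1 - 4 * e \<le> measure_pmf.expectation (p k) (\<lambda>w. cos (x * D w))"
        using c1 c2 by linarith
    qed
    moreover have "measure_pmf.prob (p k) {w. D w \<noteq> 0} \<le>
       measure_pmf.prob (p k) ({w. int m dvd D w \<and> D w \<noteq> 0} \<union> {w. \<exists>b<n. \<not> int m dvd w b - w (B + b)})"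
    proof (rule measure_pmf.finite_measure_mono)
      show "{w. D w \<noteq> 0} \<subseteq> {w. int m dvd D w \<and> D w \<noteq> 0} \<union> {w. \<exists>b<n. \<not> int m dvd w b - w (B + b)}"
        using T by (auto simp: D_def intro!: dvd_sum)
    qed simp
    moreover have "\<dots> \<le> measure_pmf.prob (p k) {w. int m dvd D w \<and> D w \<noteq> 0} +
       measure_pmf.prob (p k) {w. \<exists>b<n. \<not> int m dvd w b - w (B + b)}"
      by (rule measure_Un_le) auto
    ultimately have "measure_pmf.prob (p k) {w. D w \<noteq> 0} \<le> 4 * e + s" using s by linarith
    then show "measure_pmf.prob (p k) {w. (\<Sum>b\<in>T. w b - w (B + b)) \<noteq> 0} \<le> 4 * e + s"
      by (simp add: D_def)
  qed
  then show ?thesis by simp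
qed

text \<open>The block of \<open>N k div N l\<close> positions is a small fraction of the blocks of size
  \<open>N k div N 0\<close>, so no pair in it differs modulo \<open>m\<close>, then no pair differs at all, and then
  \<open>w\<close> is constant on it. Its sum is the multiple by its size of this constant, and a nonzero
  multiple of a large number is excluded by continuity at level \<open>l\<close>.\<close>

theorem small_block_vanishes:
  assumes e: "0 < e"
  shows "\<exists>l k0. l \<le> k0 \<and> (\<forall>k\<ge>k0. measure_pmf.prob (p k) {w. \<exists>i<N k div N l. w i \<noteq> 0} \<le> e)"
proof -
  \<comment> \<open>The errors below add up to \<open>28 * e' + e'\<close>.\<close>
  define e' where "e' = e / 30"
  have e': "0 < e'" using e by (simp add: e'_def)
  \<comment> \<open>\<open>d\<close> and \<open>m\<close> come from continuity at level 0, \<open>l\<close> makes the block small compared with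
    \<open>R\<close>, and only then \<open>d'\<close> comes from continuity at level \<open>l\<close>.\<close>
  obtain d where d: "0 < d" "\<And>x. 0 \<le> x \<Longrightarrow> x \<le> d \<Longrightarrow> 1 - e' \<le> Re (F 0 (one_coordinate 0 (cis x)))"
    using near_one[OF e', of 0] by blast
  obtain m :: nat where m: "2 * pi / d < m" using reals_Archimedean2 by blast
  have m0: "0 < m" using m d by (cases m) (auto simp: divide_less_0_iff)
  have md: "2 * pi / m \<le> d" using m m0 d by (simp add: field_simps)
  obtain \<rho> where \<rho>: "0 \<le> \<rho>" "\<rho> < 1" "\<And>a b :: int. \<not> int m dvd a - b \<Longrightarrow>
       norm (cis (2 * pi / m) powi a + cis (2 * pi / m) powi b) / 2 \<le> \<rho>"
    using roots_of_unity_midpoint_bound[OF m0] by blast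
  obtain R where R: "\<rho> ^ R < 1 / 2" using real_arch_pow_inv[of "1/2" \<rho>] \<rho> by auto
  obtain l :: nat where l: "R * N 0 / e' < l" using reals_Archimedean2 by blast
  obtain d' where d': "0 < d'" "\<And>x. 0 \<le> x \<Longrightarrow> x \<le> d' \<Longrightarrow> 1 - e' \<le> Re (F l (one_coordinate 0 (cis x)))"
    using near_one[OF e', of l] by blast
  obtain k1 :: nat where k1: "N l * (2 * pi / d') < k1" using reals_Archimedean2 by blast
  have "measure_pmf.prob (p k) {w. \<exists>i<N k div N l. w i \<noteq> 0} \<le> e" if k: "k \<ge> max l k1" for k
  proof -
    define n where "n = N k div N l"
    define B where "B = N k div N 0"
    have lk: "l \<le> k" using k by simp
    have nN: "real n = N k / N l" using N_dvd[OF lk] by (simp add: n_def real_of_nat_div)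
    have BN: "real B = N k / N 0" using N_dvd[of 0 k] by (simp add: B_def real_of_nat_div)
    have n0: "0 < n" using N_dvd[OF lk] N_pos N_le[OF lk] by (simp add: n_def div_greater_zero_iff)
    have nB: "n \<le> B" unfolding n_def B_def using N_le[of 0 l] N_pos[of 0] by (intro div_le_mono2) auto
    have B0: "0 < B" using n0 nB by simp
    have B2: "2 * B \<le> N k"
    proof -
      have "2 * B \<le> N 0 * B" using N_0 by (intro mult_right_mono) auto
      also have "\<dots> \<le> N k" unfolding B_def by (metis div_times_less_eq_dividend mult.commute)
      finally show ?thesis .
    qed
    have "measure_pmf.prob (p k) {w. \<exists>b<n. \<not> int m dvd (w b - w (B + b))} \<le>
      measure_pmf.prob (p k) {w. R \<le> card {b. b < B \<and> \<not> int m dvd w b - w (B + b)}} + n * R / B"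
      by (rule prob_some_bad_pair[OF exch B0 B2 nB, where Q = "\<lambda>v. int m dvd v"])
    also have "\<dots> \<le> 2 * e' + e'"
    proof (rule add_mono)
      show "measure_pmf.prob (p k) {w. R \<le> card {b. b < B \<and> \<not> int m dvd w b - w (B + b)}} \<le> 2 * e'"
        using d(2)[of "2 * pi / m"] md \<rho> R by (intro few_pairs_differ_modulo[OF m0 _ \<rho>(1)]) (auto simp: B_def)
      have "n * R / B = R * N 0 / N l" using nN BN N_pos[of k] by (simp add: field_simps)
      also have "\<dots> \<le> e'"
      proof -
        have "R * N 0 / e' \<le> N l" using l N_ge[of l] by linarith
        then show ?thesis using e' N_pos[of l] by (simp add: field_simps)
      qed
      finally show "n * R / B \<le> e'" .
    qed
    finally have s: "measure_pmf.prob (p k) {w. \<exists>b<n. \<not> int m dvd (w b - w (B + b))} \<le> 3 * e'" by simp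
    have P: "measure_pmf.prob (p k) {w. \<exists>b<n. w b \<noteq> w (B + b)} \<le> 2 * (4 * e' + 3 * e')"
      by (rule pair_differences_vanish[OF m0 _ B_def nB s]) (use d(2) md in auto)
    have Q: "measure_pmf.prob (p k) {w. \<exists>b<n. \<exists>c<n. w b \<noteq> w c} \<le> 28 * e'"
      by (rule order_trans[OF prob_nonconstant_block[OF exch nB B2]]) (use P in simp)
    have Z: "measure_pmf.prob (p k) {w. int n dvd (\<Sum>i<n. w i) \<and> (\<Sum>i<n. w i) \<noteq> 0} \<le> e'"
    proof (rule divisibility_of_cosines[OF n0])
      fix x :: real assume x: "0 \<le> x" "x \<le> 2 * pi / n"
      have "2 * pi / n \<le> d'"
      proof -
        have "N l * (2 * pi / d') \<le> N k" using k1 k N_ge[of k] by linarith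
        then show ?thesis unfolding nN using d' N_pos[of l] N_pos[of k] by (simp add: field_simps)
      qed
      then have "1 - e' \<le> Re (F l (one_coordinate 0 (cis x)))" using d'(2)[of x] x by simp
      also have "\<dots> = measure_pmf.expectation (p k) (\<lambda>w. cos (x * of_int (\<Sum>i<n. w i)))"
        by (rule block_cosine[OF lk, symmetric]) (auto simp: n_def intro: less_le_trans[OF _ div_le_dividend])
      finally show "1 - e' \<le> measure_pmf.expectation (p k) (\<lambda>w. cos (x * of_int (\<Sum>i<n. w i)))" .
    qed
    have "measure_pmf.prob (p k) {w. \<exists>i<n. w i \<noteq> 0} \<le>
      measure_pmf.prob (p k) ({w. int n dvd (\<Sum>i<n. w i) \<and> (\<Sum>i<n. w i) \<noteq> 0} \<union> {w. \<exists>b<n. \<exists>c<n. w b \<noteq> w c})"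
    proof (rule measure_pmf.finite_measure_mono, rule subsetI)
      fix w :: "nat \<Rightarrow> int" assume "w \<in> {w. \<exists>i<n. w i \<noteq> 0}"
      then obtain i where i: "i < n" "w i \<noteq> 0" by blast
      show "w \<in> {w. int n dvd (\<Sum>i<n. w i) \<and> (\<Sum>i<n. w i) \<noteq> 0} \<union> {w. \<exists>b<n. \<exists>c<n. w b \<noteq> w c}"
      proof (cases "\<forall>b<n. w b = w i")
        case True
        then have "(\<Sum>b<n. w b) = (\<Sum>b<n. w i)" by (intro sum.cong) auto
        then have "(\<Sum>b<n. w b) = int n * w i" by simp
        then show ?thesis using i n0 by simp
      qed (use i in auto)
    qed simp
    also have "\<dots> \<le> measure_pmf.prob (p k) {w. int n dvd (\<Sum>i<n. w i) \<and> (\<Sum>i<n. w i) \<noteq> 0} +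
        measure_pmf.prob (p k) {w. \<exists>b<n. \<exists>c<n. w b \<noteq> w c}"
      by (rule measure_Un_le) auto
    also have "\<dots> \<le> e" using Q Z e by (simp add: e'_def)
    finally show ?thesis by (simp add: n_def)
  qed
  then show ?thesis by (intro exI[of _ l] exI[of _ "max l k1"]) auto
qed

text \<open>A block of the fixed proportion \<open>1 / N l\<close> usually vanishes, so by exchangeability
  there are few nonzero weights.\<close>

theorem weights_tight:
  assumes e: "0 < e"
  shows "\<exists>R k0. \<forall>k\<ge>k0. measure_pmf.prob (p k) {w. R \<le> card (weight_support (N k) w)} \<le> e"
proof -
  have e3: "0 < e / 3" using e by simp
  obtain l k0 where l: "l \<le> k0" "\<And>k. k \<ge> k0 \<Longrightarrow> measure_pmf.prob (p k) {w. \<exists>i<N k div N l. w i \<noteq> 0} \<le> e / 3"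
    using small_block_vanishes[OF e3] by blast
  have "1 - 1 / real (N l) < 1" using N_pos[of l] by simp
  then obtain R where R: "(1 - 1 / real (N l)) ^ R < e / 3"
    using real_arch_pow_inv[OF e3] by blast
  obtain k1 :: nat where k1: "(real R)\<^sup>2 / (e / 3) < k1" using reals_Archimedean2 by blast
  have "measure_pmf.prob (p k) {w. R \<le> card (weight_support (N k) w)} \<le> e" if k: "k \<ge> max k0 k1" for k
  proof -
    have lk: "l \<le> k" using l k by simp
    have "measure_pmf.prob (p k) {w. R \<le> card (weight_support (N k) w)} \<le>
      measure_pmf.prob (p k) {w. \<exists>i<N k div N l. w i \<noteq> 0} + (1 - real (N k div N l) / N k) ^ R + (real R)\<^sup>2 / N k"
      by (rule prob_support_ge[OF exch N_pos]) simp
    also have "real (N k div N l) / N k = 1 / N l"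
      using N_dvd[OF lk] N_pos[of k] by (simp add: real_of_nat_div)
    also have "measure_pmf.prob (p k) {w. \<exists>i<N k div N l. w i \<noteq> 0} + (1 - 1 / N l) ^ R + (real R)\<^sup>2 / N k \<le>
       e / 3 + e / 3 + e / 3"
    proof (intro add_mono)
      have "(real R)\<^sup>2 / (e / 3) \<le> N k" using k1 k N_ge[of k] by linarith
      then show "(real R)\<^sup>2 / N k \<le> e / 3" using e N_pos[of k] by (simp add: field_simps)
    qed (use l(2) R k in auto)
    finally show ?thesis by simp
  qed
  then show ?thesis by blast
qed

end

section \<open>Power means and the size of the weights\<close>

definition power_mean :: "nat \<Rightarrow> (nat \<Rightarrow> complex) \<Rightarrow> int \<Rightarrow> complex" where
  "power_mean n z v = (\<Sum>x<n. z x powi v) / n"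

lemma norm_power_mean_le:
  assumes "\<And>i. norm (z i) = 1"
  shows "norm (power_mean n z v) \<le> 1"
proof -
  have "norm (\<Sum>x<n. z x powi v) \<le> of_nat (card {..<n}) * 1"
    by (rule sum_norm_bound) (simp add: norm_power_int assms)
  then show ?thesis by (cases "n = 0") (simp_all add: power_mean_def norm_divide divide_le_eq)
qed

lemma power_mean_zero [simp]: "0 < n \<Longrightarrow> power_mean n z 0 = 1"
  by (simp add: power_mean_def)

lemma norm_prod_power_mean_le:
  assumes "\<And>i. norm (z i) = 1"
  shows "norm (\<Prod>i\<in>A. power_mean n z (w i)) \<le> 1"
  unfolding prod_norm[symmetric] using norm_power_mean_le[OF assms] by (intro prod_le_1) auto

text \<open>One factor well inside the disc keeps the product of all of them away from 1.\<close>

lemma one_minus_Re_prod_ge: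
  fixes g :: "'i \<Rightarrow> complex"
  assumes "finite A" "i \<in> A" "\<And>j. j \<in> A \<Longrightarrow> norm (g j) \<le> 1"
  shows "1 - norm (g i) \<le> 1 - Re (\<Prod>j\<in>A. g j)"
proof -
  have "norm (\<Prod>j\<in>A. g j) = norm (g i) * norm (\<Prod>j\<in>A - {i}. g j)"
    using assms by (simp add: prod.remove norm_mult)
  also have "\<dots> \<le> norm (g i) * 1"
    unfolding prod_norm[symmetric] using assms by (intro mult_left_mono prod_le_1) auto
  finally show ?thesis using complex_Re_le_cmod[of "\<Prod>j\<in>A. g j"] by linarith
qed

text \<open>The squared modulus is \<open>1 - 2 * \<alpha> * (1 - \<alpha>) * (1 - cos t)\<close>, and \<open>1 - 2 * c\<close> is at most
  \<open>(1 - c)\<^sup>2\<close>.\<close>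

lemma norm_lazy_rotation_le:
  fixes \<alpha> :: real
  assumes "0 \<le> \<alpha>" "\<alpha> \<le> 1"
  shows "norm (of_real (1 - \<alpha>) + of_real \<alpha> * cis t) \<le> 1 - \<alpha> * (1 - \<alpha>) * (1 - cos t)"
proof (rule power2_le_imp_le)
  let ?c = "\<alpha> * (1 - \<alpha>) * (1 - cos t)"
  have e: "sin t * sin t = 1 - cos t * cos t"
    using sin_squared_eq[of t] by (simp only: power2_eq_square)
  have "(norm (of_real (1 - \<alpha>) + of_real \<alpha> * cis t))\<^sup>2 = 1 - 2 * ?c"
    unfolding cmod_power2 by (simp add: power2_eq_square algebra_simps e)
  also have "\<dots> \<le> (1 - ?c)\<^sup>2" by (simp add: power2_diff)
  finally show "(norm (of_real (1 - \<alpha>) + of_real \<alpha> * cis t))\<^sup>2 \<le> (1 - ?c)\<^sup>2" .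
  have "\<alpha> * (1 - \<alpha>) \<le> 1 / 4"
    using zero_le_power2[of "\<alpha> - 1/2"] by (simp add: power2_eq_square algebra_simps)
  moreover have "0 \<le> 1 - cos t" "1 - cos t \<le> 2" using cos_ge_minus_one[of t] by simp_all
  moreover have "0 \<le> \<alpha> * (1 - \<alpha>)" using assms by simp
  ultimately have "?c \<le> 1 / 4 * 2" by (intro mult_mono) auto
  then show "0 \<le> 1 - ?c" by simp
qed

lemma sum_lessThan_add:
  fixes f :: "nat \<Rightarrow> 'a::comm_monoid_add"
  shows "(\<Sum>i<a + b. f i) = (\<Sum>i<a. f i) + (\<Sum>i<b. f (a + i))"
  by (induction b) (simp_all add: add.assoc)

lemma sum_periodic:
  fixes f :: "nat \<Rightarrow> complex"
  shows "(\<Sum>i<d * b. f (i mod d)) = of_nat b * (\<Sum>r<d. f r)"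
proof (induction b)
  case (Suc b)
  have "(\<Sum>i<d * b + d. f (i mod d)) = (\<Sum>i<d * b. f (i mod d)) + (\<Sum>r<d. f ((d * b + r) mod d))"
    by (rule sum_lessThan_add)
  also have "(\<Sum>r<d. f ((d * b + r) mod d)) = (\<Sum>r<d. f r)" by (rule sum.cong) auto
  finally show ?case using Suc by (simp add: distrib_right add.commute)
qed simp

lemma power_mean_block:
  assumes n: "n \<le> N" "0 < N"
  shows "power_mean N (\<lambda>i. if i < n then cis x else 1) v =
    of_real (1 - n / N) + of_real (n / N) * cis (x * v)"
proof -
  let ?f = "\<lambda>i. (if i < n then cis x else 1) powi v"
  have "(\<Sum>i<n + (N - n). ?f i) = (\<Sum>i<n. ?f i) + (\<Sum>i<N - n. ?f (n + i))"
    by (rule sum_lessThan_add)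
  also have "(\<Sum>i<n. ?f i) = of_nat n * cis (x * v)" by (simp add: cis_power_int mult.commute)
  also have "(\<Sum>i<N - n. ?f (n + i)) = of_nat (N - n)" by simp
  finally have "(\<Sum>i<N. ?f i) = of_nat n * cis (x * v) + (of_nat N - of_nat n)"
    using n by (simp add: of_nat_diff)
  then show ?thesis using n unfolding power_mean_def by (simp add: add_divide_distrib diff_divide_distrib)
qed

text \<open>The \<open>v\<close>-th powers of the \<open>d\<close>-th roots of unity cancel unless \<open>d\<close> divides \<open>v\<close>. So the
  clock shows the phase \<open>x\<close> exactly to the weights divisible by \<open>d\<close>.\<close>

lemma power_mean_clock:
  assumes d: "0 < d" "d * b \<le> N" "0 < N"
  shows "power_mean N (clock d b (cis x)) v =
    (if int d dvd v then of_real (1 - real (d * b) / N) + of_real (real (d * b) / N) * cis (x * v)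
     else of_real (1 - real (d * b) / N))"
proof -
  have pw: "clock d b (cis x) i powi v = cis (x * v) * cis (real (i mod d) * (2 * pi * v / d))" if "i < d * b" for i
    using that by (simp add: clock_def power_int_mult_distrib cis_power_int mult_ac)
  have "(\<Sum>i<d * b. clock d b (cis x) i powi v) = (\<Sum>i<d * b. cis (x * v) * cis (real (i mod d) * (2 * pi * v / d)))"
    by (rule sum.cong) (use pw in auto)
  also have "\<dots> = of_nat b * (cis (x * v) * (if int d dvd v then of_nat d else 0))"
    unfolding sum_periodic[where f = "\<lambda>r. cis (x * v) * cis (real r * (2 * pi * v / d))"]
    using sum_cis_roots_of_unity[OF d(1), of v] by (simp add: sum_distrib_left[symmetric])
  finally have A: "(\<Sum>i<d * b. clock d b (cis x) i powi v) = of_nat b * (cis (x * v) * (if int d dvd v then of_nat d else 0))" .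
  have "(\<Sum>i<d * b + (N - d * b). clock d b (cis x) i powi v) =
      (\<Sum>i<d * b. clock d b (cis x) i powi v) + (\<Sum>i<N - d * b. clock d b (cis x) (d * b + i) powi v)"
    by (rule sum_lessThan_add)
  also have "(\<Sum>i<N - d * b. clock d b (cis x) (d * b + i) powi v) = of_nat (N - d * b)"
    by (simp add: clock_def)
  finally have "(\<Sum>i<N. clock d b (cis x) i powi v) =
      of_nat b * (cis (x * v) * (if int d dvd v then of_nat d else 0)) + (of_nat N - of_nat (d * b))"
    using d(2) unfolding A by (simp add: of_nat_diff)
  then show ?thesis using d unfolding power_mean_def
    by (cases "int d dvd v") (simp_all add: add_divide_distrib diff_divide_distrib mult_ac)
qed

lemma norm_clock: "norm \<zeta> = 1 \<Longrightarrow> norm (clock d b \<zeta> i) = 1"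
  by (simp add: clock_def norm_mult)

lemma permutation_with_two_values:
  assumes "i \<noteq> j" "i < N" "j < (N::nat)" "2 \<le> N"
  obtains \<sigma> where "\<sigma> permutes {..<N}" "\<sigma> 0 = i" "\<sigma> 1 = j"
proof -
  let ?j = "Transposition.transpose i 0 j"
  let ?\<sigma> = "Transposition.transpose i 0 \<circ> Transposition.transpose ?j 1"
  have j: "?j \<noteq> 0" "?j < N" using assms by (auto simp: Transposition.transpose_def)
  have "?\<sigma> permutes {..<N}" using assms j by (intro permutes_compose permutes_swap_id) auto
  moreover have "?\<sigma> 0 = i"
  proof -
    have "Transposition.transpose ?j 1 0 = 0" using j by (simp add: Transposition.transpose_def)
    then show ?thesis by simp
  qed
  moreover have "?\<sigma> 1 = j" by simp
  ultimately show ?thesis by (rule that)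
qed

lemma card_weight_support_permute:
  assumes perm: "\<sigma> permutes {..<N}"
  shows "card (weight_support N (w \<circ> \<sigma>)) = card (weight_support N w)"
proof -
  have "weight_support N w = \<sigma> ` weight_support N (w \<circ> \<sigma>)"
  proof (rule equalityI; rule subsetI)
    fix i assume i: "i \<in> weight_support N w"
    then obtain j where "j < N" "i = \<sigma> j" using permutes_image[OF perm] by (auto simp: weight_support_def image_iff set_eq_iff)
    then show "i \<in> \<sigma> ` weight_support N (w \<circ> \<sigma>)" using i by (auto simp: weight_support_def)
  next
    fix i assume "i \<in> \<sigma> ` weight_support N (w \<circ> \<sigma>)"
    then show "i \<in> weight_support N w" using permutes_in_image[OF perm] by (auto simp: weight_support_def)
  qed
  then show ?thesis using card_image[OF inj_on_subset[OF permutes_inj[OF perm] subset_UNIV]] by metis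
qed

text \<open>Fewer than \<open>R\<close> nonzero coordinates form fewer than \<open>R\<^sup>2\<close> ordered pairs, and all
  \<open>N * (N - 1)\<close> pairs of positions are equally likely.\<close>

lemma prob_two_nonzero:
  fixes N R :: nat
  assumes p: "exchangeable N p" and N: "2 \<le> N"
  shows "N * (N - 1) * measure_pmf.prob p {w. w 0 \<noteq> 0 \<and> w 1 \<noteq> 0 \<and> card (weight_support N w) < R} \<le> (real R)\<^sup>2"
proof -
  let ?I = "{(i, j). i < N \<and> j < N \<and> i \<noteq> j}"
  define q where "q i j = measure_pmf.prob p {w. w i \<noteq> 0 \<and> w j \<noteq> 0 \<and> card (weight_support N w) < R}" for i j
  have fin: "finite ?I" by (rule finite_subset[of _ "{..<N} \<times> {..<N}"]) auto
  have card: "card ?I = N * (N - 1)"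
  proof -
    have "?I = Sigma {..<N} (\<lambda>i. {..<N} - {i})" by auto
    then show ?thesis by (simp add: card_SigmaI)
  qed
  have q: "q i j = q 0 1" if ij: "(i, j) \<in> ?I" for i j
  proof -
    obtain \<sigma> where \<sigma>: "\<sigma> permutes {..<N}" "\<sigma> 0 = i" "\<sigma> 1 = j"
      using permutation_with_two_values[of i j N] ij N by auto
    have "q i j = measure_pmf.prob p {w. (w \<circ> \<sigma>) 0 \<noteq> 0 \<and> (w \<circ> \<sigma>) 1 \<noteq> 0 \<and> card (weight_support N (w \<circ> \<sigma>)) < R}"
      unfolding q_def card_weight_support_permute[OF \<sigma>(1)] o_apply \<sigma>(2,3) ..
    also have "\<dots> = q 0 1"
      unfolding q_def
      by (rule exchangeable_prob[OF p \<sigma>(1), where Q = "\<lambda>w. w 0 \<noteq> 0 \<and> w 1 \<noteq> 0 \<and> card (weight_support N w) < R"])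
    finally show ?thesis .
  qed
  have "real (N * (N - 1)) * q 0 1 = (\<Sum>x\<in>?I. q 0 1)" unfolding card[symmetric] by simp
  also have "\<dots> = (\<Sum>x\<in>?I. q (fst x) (snd x))"
  proof (rule sum.cong[OF refl])
    fix x assume "x \<in> ?I"
    then have "q (fst x) (snd x) = q 0 1" by (intro q) auto
    then show "q 0 1 = q (fst x) (snd x)" ..
  qed
  also have "\<dots> = (\<Sum>x\<in>?I. measure_pmf.expectation p (indicat_real {w. w (fst x) \<noteq> 0 \<and> w (snd x) \<noteq> 0 \<and> card (weight_support N w) < R}))"
    by (simp add: q_def)
  also have "\<dots> = measure_pmf.expectation p (\<lambda>w. \<Sum>x\<in>?I. indicat_real {w. w (fst x) \<noteq> 0 \<and> w (snd x) \<noteq> 0 \<and> card (weight_support N w) < R} w)"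
    by (rule Bochner_Integration.integral_sum[symmetric], rule pmf_integrable_bounded[where B=1])
       (simp add: indicator_le_1)
  also have "\<dots> \<le> measure_pmf.expectation p (\<lambda>w. (real R)\<^sup>2)"
  proof (rule integral_mono)
    have le: "(\<Sum>x\<in>?I. indicat_real {w. w (fst x) \<noteq> 0 \<and> w (snd x) \<noteq> 0 \<and> card (weight_support N w) < R} w) \<le> (real R)\<^sup>2" for w
    proof (cases "card (weight_support N w) < R")
      case True
      let ?S = "weight_support N w"
      have "(\<Sum>x\<in>?I. indicat_real {w. w (fst x) \<noteq> 0 \<and> w (snd x) \<noteq> 0 \<and> card (weight_support N w) < R} w) \<le>
          (\<Sum>x\<in>?S \<times> ?S. 1)"
      proof (rule order_trans)
        show "(\<Sum>x\<in>?I. indicat_real {w. w (fst x) \<noteq> 0 \<and> w (snd x) \<noteq> 0 \<and> card (weight_support N w) < R} w) \<le>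
            (\<Sum>x\<in>?I. if x \<in> ?S \<times> ?S then 1 else 0)"
          by (rule sum_mono) (auto simp: indicator_def weight_support_def)
        have "(\<Sum>x\<in>?I. if x \<in> ?S \<times> ?S then 1 else (0::real)) = card (?I \<inter> ?S \<times> ?S)"
          using fin by (simp add: sum.If_cases)
        also have "\<dots> \<le> card (?S \<times> ?S)" by (intro of_nat_mono card_mono) auto
        finally show "(\<Sum>x\<in>?I. if x \<in> ?S \<times> ?S then 1 else (0::real)) \<le> (\<Sum>x\<in>?S \<times> ?S. 1)" by simp
      qed
      also have "\<dots> = real (card ?S) * real (card ?S)" by (simp add: card_cartesian_product)
      also have "\<dots> \<le> (real R)\<^sup>2" unfolding power2_eq_square using True by (intro mult_mono) auto
      finally show ?thesis .
    qed (simp add: indicator_def)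
    then show "(\<Sum>x\<in>?I. indicat_real {w. w (fst x) \<noteq> 0 \<and> w (snd x) \<noteq> 0 \<and> card (weight_support N w) < R} w) \<le> (real R)\<^sup>2" for w .
    show "integrable (measure_pmf p) (\<lambda>w. \<Sum>x\<in>?I. indicat_real {w. w (fst x) \<noteq> 0 \<and> w (snd x) \<noteq> 0 \<and> card (weight_support N w) < R} w)"
      by (rule pmf_integrable_bounded[where B = "(real R)\<^sup>2"]) (use le in \<open>simp add: abs_of_nonneg sum_nonneg\<close>)
  qed simp
  finally show ?thesis by (simp add: q_def)
qed

context weight_tower
begin

text \<open>Once the number of nonzero weights is bounded, random placement replaces every factor
  \<open>z i powi w i\<close> by a power mean, uniformly in \<open>z\<close>.\<close>

lemma power_mean_approximation:
  assumes e: "0 < e"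
  shows "\<exists>k0. \<forall>k\<ge>k0. \<forall>z. (\<forall>i. norm (z i) = 1) \<longrightarrow>
    norm (F k z - measure_pmf.expectation (p k) (\<lambda>w. \<Prod>j<N k. power_mean (N k) z (w j))) \<le> e"
proof -
  have e4: "0 < e / 4" using e by simp
  obtain R k0 where R: "\<And>k. k \<ge> k0 \<Longrightarrow> measure_pmf.prob (p k) {w. R \<le> card (weight_support (N k) w)} \<le> e / 4"
    using weights_tight[OF e4] by blast
  obtain k1 :: nat where k1: "(real R)\<^sup>2 / (e / 4) < k1" using reals_Archimedean2 by blast
  have "norm (F k z - measure_pmf.expectation (p k) (\<lambda>w. \<Prod>j<N k. power_mean (N k) z (w j))) \<le> e"
    if k: "k \<ge> max k0 k1" and z: "\<And>i. norm (z i) = 1" for k z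
  proof -
    have "norm (measure_pmf.expectation (p k) (\<lambda>w. \<Prod>i<N k. z i powi w i) -
        measure_pmf.expectation (p k) (\<lambda>w. \<Prod>j<N k. (\<Sum>x<N k. z x powi w j) / N k))
      \<le> (real R)\<^sup>2 / N k + 2 * measure_pmf.prob (p k) {w. R \<le> card (weight_support (N k) w)}"
      by (rule exchangeable_product_approximation[where G = "\<lambda>i v. z i powi v", OF exch N_pos])
         (simp_all add: norm_power_int z)
    moreover have "(real R)\<^sup>2 / N k \<le> e / 4"
    proof -
      have "(real R)\<^sup>2 / (e / 4) \<le> N k" using k1 k N_ge[of k] by linarith
      then show ?thesis using e N_pos[of k] by (simp add: field_simps)
    qed
    moreover have "measure_pmf.prob (p k) {w. R \<le> card (weight_support (N k) w)} \<le> e / 4"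
      using R k by simp
    moreover have Fz: "F k z = measure_pmf.expectation (p k) (\<lambda>w. \<Prod>i<N k. z i powi w i)"
      using F[OF z] by (simp add: torus_monomial_def[abs_def])
    ultimately show ?thesis using e unfolding power_mean_def Fz by linarith
  qed
  then show ?thesis by blast
qed

text \<open>Rotating the proportion \<open>1 / N 0\<close> of the coordinates by \<open>x\<close> changes the character
  little. Each factor of the approximating product is a lazy rotation by \<open>x * w j\<close>, so the
  cosine of \<open>x\<close> times any selected weight has expectation close to 1, which bounds its
  tail.\<close>

lemma weights_bounded:
  assumes e: "0 < e"
  shows "\<exists>C k0. \<forall>k\<ge>k0. measure_pmf.prob (p k) {w. \<exists>i<N k. int C \<le> \<bar>w i\<bar>} \<le> e"
proof -
  define \<alpha> where "\<alpha> = 1 / real (N 0)"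
  have \<alpha>: "0 < \<alpha>" "\<alpha> \<le> 1 / 2" using N_0 by (auto simp: \<alpha>_def field_simps)
  define a where "a = \<alpha> * (1 - \<alpha>)"
  have a: "0 < a" using \<alpha> by (simp add: a_def)
  define e' where "e' = e * a / 4"
  have e': "0 < e'" using e a by (simp add: e'_def)
  obtain d where d: "0 < d" "\<And>x. 0 \<le> x \<Longrightarrow> x \<le> d \<Longrightarrow> 1 - e' \<le> Re (F 0 (one_coordinate 0 (cis x)))"
    using near_one[OF e', of 0] by blast
  obtain k0 where k0: "\<And>k z. k \<ge> k0 \<Longrightarrow> (\<forall>i. norm (z i) = 1) \<Longrightarrow>
    norm (F k z - measure_pmf.expectation (p k) (\<lambda>w. \<Prod>j<N k. power_mean (N k) z (w j))) \<le> e'"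
    using power_mean_approximation[OF e'] by blast
  obtain C :: nat where C: "8 / d < C" using reals_Archimedean2 by blast
  have C0: "0 < C" using C d by (cases C) (auto simp: divide_less_0_iff)
  have "measure_pmf.prob (p k) {w. \<exists>i<N k. int C \<le> \<bar>w i\<bar>} \<le> e" if k: "k \<ge> k0" for k
  proof -
    define n where "n = N k div N 0"
    have n: "n \<le> N k" "real n / N k = \<alpha>"
      using N_dvd[of 0 k] N_pos[of k] by (auto simp: n_def \<alpha>_def real_of_nat_div)
    \<comment> \<open>Select one large weight if there is any. Its value may depend on the vector in
      any way, because the bound for the product holds for each factor.\<close>
    define Y where "Y w = (if \<exists>i<N k. int C \<le> \<bar>w i\<bar> then w (SOME i. i < N k \<and> int C \<le> \<bar>w i\<bar>) else 0)" for w :: "nat \<Rightarrow> int"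
    have Y: "(SOME i. i < N k \<and> int C \<le> \<bar>w i\<bar>) < N k \<and> int C \<le> \<bar>w (SOME i. i < N k \<and> int C \<le> \<bar>w i\<bar>)\<bar>"
      if "\<exists>i<N k. int C \<le> \<bar>w i\<bar>" for w :: "nat \<Rightarrow> int"
      using that by (rule someI_ex)
    have "measure_pmf.prob (p k) {w. real C \<le> \<bar>Y w\<bar>} \<le> 2 * (2 * e' / a)"
    proof (rule tail_bound_of_cosines[OF d(1)])
      show "8 \<le> real C * d" using C d by (simp add: field_simps)
      fix x :: real assume x: "0 \<le> x" "x \<le> d"
      define z where "z = (\<lambda>i. if i < n then cis x else 1)"
      have z1: "norm (z i) = 1" for i by (simp add: z_def)
      have Fz: "F k z = F 0 (one_coordinate 0 (cis x))"
      proof -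
        have "z = (\<lambda>i. if i \<in> {..<n} then cis x else 1)" by (simp add: z_def)
        then have "torus_monomial (N k) z = (\<lambda>w. cis (x * of_int (\<Sum>i<n. w i)))"
          using torus_monomial_block[of "{..<n}" "N k" x] n by auto
        then show ?thesis
          using F[of z k, OF z1] block_character[of 0 k "{..<n}" x] n by (simp add: n_def)
      qed
      let ?P = "\<lambda>w. \<Prod>j<N k. power_mean (N k) z (w j)"
      have P1: "norm (?P w) \<le> 1" for w by (rule norm_prod_power_mean_le) (rule z1)
      have iP: "integrable (measure_pmf (p k)) ?P" by (rule pmf_integrable_bounded[OF P1])
      have "Re (F k z) - Re (measure_pmf.expectation (p k) ?P) \<le> e'"
        using k0[OF k, of z] z1 abs_Re_le_cmod[of "F k z - measure_pmf.expectation (p k) ?P"] by simp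
      moreover have "1 - e' \<le> Re (F k z)" using d(2)[OF x] by (simp add: Fz)
      ultimately have E: "1 - Re (measure_pmf.expectation (p k) ?P) \<le> 2 * e'" by linarith
      have pt: "a * (1 - cos (x * Y w)) \<le> 1 - Re (?P w)" for w
      proof (cases "\<exists>i<N k. int C \<le> \<bar>w i\<bar>")
        case True
        define i where "i = (SOME i. i < N k \<and> int C \<le> \<bar>w i\<bar>)"
        have i: "i < N k" "Y w = w i" using Y[OF True] True by (auto simp: i_def Y_def)
        have "power_mean (N k) z (w i) = of_real (1 - \<alpha>) + of_real \<alpha> * cis (x * Y w)"
          unfolding z_def power_mean_block[OF n(1) N_pos] n(2) i(2) ..
        then have "norm (power_mean (N k) z (w i)) \<le> 1 - a * (1 - cos (x * Y w))"
          unfolding a_def using \<alpha> by (simp only:) (rule norm_lazy_rotation_le, auto)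
        moreover have "1 - norm (power_mean (N k) z (w i)) \<le> 1 - Re (?P w)"
          by (rule one_minus_Re_prod_ge) (use i in \<open>auto intro: norm_power_mean_le z1\<close>)
        ultimately show ?thesis by linarith
      next
        case False
        have "Y w = 0" unfolding Y_def using False by (rule if_not_P)
        then show ?thesis using complex_Re_le_cmod[of "?P w"] P1[of w] by simp
      qed
      have ic: "integrable (measure_pmf (p k)) (\<lambda>w. cos (x * Y w))"
        by (rule pmf_integrable_bounded[where B=1]) simp
      have "a * (1 - measure_pmf.expectation (p k) (\<lambda>w. cos (x * Y w))) =
          measure_pmf.expectation (p k) (\<lambda>w. a * (1 - cos (x * Y w)))" using ic by simp
      also have "\<dots> \<le> measure_pmf.expectation (p k) (\<lambda>w. 1 - Re (?P w))"
      proof (rule integral_mono)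
        show "integrable (measure_pmf (p k)) (\<lambda>w. a * (1 - cos (x * Y w)))" using ic by simp
        show "integrable (measure_pmf (p k)) (\<lambda>w. 1 - Re (?P w))" using integrable_Re[OF iP] by simp
      qed (rule pt)
      also have "\<dots> = 1 - Re (measure_pmf.expectation (p k) ?P)"
        using integrable_Re[OF iP] integral_Re[OF iP] by simp
      also note E
      finally show "1 - 2 * e' / a \<le> measure_pmf.expectation (p k) (\<lambda>w. cos (x * real_of_int (Y w)))"
        using a by (simp add: field_simps)
    qed
    also have "2 * (2 * e' / a) = e" using a by (simp add: e'_def)
    also have "{w. real C \<le> \<bar>Y w\<bar>} = {w. \<exists>i<N k. int C \<le> \<bar>w i\<bar>}"
    proof -
      have "real C \<le> real_of_int \<bar>Y w\<bar> \<longleftrightarrow> (\<exists>i<N k. int C \<le> \<bar>w i\<bar>)" for w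
      proof (cases "\<exists>i<N k. int C \<le> \<bar>w i\<bar>")
        case True
        then have "int C \<le> \<bar>Y w\<bar>" using Y[OF True] by (simp add: Y_def)
        then have "real C \<le> real_of_int \<bar>Y w\<bar>" by linarith
        then show ?thesis using True by simp
      next
        case False
        have "Y w = 0" unfolding Y_def using False by (rule if_not_P)
        then show ?thesis using False C0 by simp
      qed
      then show ?thesis by simp
    qed
    finally show ?thesis .
  qed
  then show ?thesis by blast
qed

text \<open>Factors at weights not divisible by \<open>d\<close> do not depend on \<open>x\<close>; they equal
  \<open>1 - \<alpha> \<ge> 1 / 2\<close>, and there are at most \<open>R\<close> of them, which gives the factor \<open>(1 / 2) ^ R\<close>.
  The remaining factors are lazy rotations with rate \<open>\<alpha>\<close> between 1/4 and 1/2, so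
  \<open>\<alpha> * (1 - \<alpha>) \<ge> 1 / 8\<close>.\<close>

lemma clock_mean_difference:
  fixes d b k :: nat
  assumes d: "2 \<le> d" "d * b \<le> N k" and \<alpha>: "\<alpha> = real (d * b) / N k" "1 / 4 \<le> \<alpha>" "\<alpha> \<le> 1 / 2"
    and Y: "card (weight_support (N k) w) \<le> R" "i < N k" "w i \<noteq> 0" "int d dvd w i"
  shows "(1 / 2) ^ R * (1 / 8) * (1 - cos (x * w i)) \<le>
    Re (\<Prod>j<N k. power_mean (N k) (clock d b (cis 0)) (w j)) - Re (\<Prod>j<N k. power_mean (N k) (clock d b (cis x)) (w j))"
proof -
  have d0: "0 < d" using d by simp
  define r where "r j = (if int d dvd w j then 1 else 1 - \<alpha>)" for j
  define g where "g j = (if int d dvd w j then of_real (1 - \<alpha>) + of_real \<alpha> * cis (x * w j) else 1)" for j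
  have m0: "power_mean (N k) (clock d b (cis 0)) (w j) = of_real (r j)" for j
    unfolding power_mean_clock[OF d0 d(2) N_pos] \<alpha>(1)[symmetric] by (simp add: r_def)
  have mx: "power_mean (N k) (clock d b (cis x)) (w j) = of_real (r j) * g j" for j
    unfolding power_mean_clock[OF d0 d(2) N_pos] \<alpha>(1)[symmetric] by (simp add: r_def g_def)
  have g1: "norm (g j) \<le> 1 - 1 / 8 * (1 - cos (x * w j))" if "int d dvd w j" for j
  proof -
    have "norm (g j) \<le> 1 - \<alpha> * (1 - \<alpha>) * (1 - cos (x * w j))"
      unfolding g_def using that \<alpha>(2,3) by (simp only: if_True) (rule norm_lazy_rotation_le, auto)
    moreover have "1 / 4 * (1 / 2) \<le> \<alpha> * (1 - \<alpha>)" using \<alpha> by (intro mult_mono) auto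
    then have "1 / 8 * (1 - cos (x * w j)) \<le> \<alpha> * (1 - \<alpha>) * (1 - cos (x * w j))"
      by (intro mult_right_mono) auto
    ultimately show ?thesis by linarith
  qed
  have gle: "norm (g j) \<le> 1" for j
  proof (cases "int d dvd w j")
    case True
    show ?thesis using g1[OF True] by (rule order_trans) simp
  qed (simp add: g_def)
  define Q where "Q = (\<Prod>j<N k. r j)"
  have Q: "(1 / 2) ^ R \<le> Q"
  proof -
    have "Q = (\<Prod>j\<in>weight_support (N k) w. r j)"
      unfolding Q_def by (rule prod.mono_neutral_right) (auto simp: weight_support_def r_def)
    moreover have "(\<Prod>j\<in>weight_support (N k) w. 1 / 2) \<le> (\<Prod>j\<in>weight_support (N k) w. r j)"
      using \<alpha> by (intro prod_mono) (auto simp: r_def)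
    moreover have "(1 / 2 :: real) ^ R \<le> (1 / 2) ^ card (weight_support (N k) w)"
      using Y(1) by (intro power_decreasing) auto
    ultimately show ?thesis by (simp only: prod_constant)
  qed
  have "(1 / 2) ^ R * (1 / 8 * (1 - cos (x * w i))) \<le> Q * (1 - Re (\<Prod>j<N k. g j))"
  proof (rule mult_mono[OF Q])
    have "1 - norm (g i) \<le> 1 - Re (\<Prod>j<N k. g j)"
      by (rule one_minus_Re_prod_ge) (use Y gle in auto)
    then show "1 / 8 * (1 - cos (x * w i)) \<le> 1 - Re (\<Prod>j<N k. g j)" using g1[OF Y(4)] by linarith
    show "0 \<le> Q" using Q by (meson order_trans zero_le_power zero_le_divide_1_iff zero_le_numeral)
  qed (use cos_le_one in simp)
  also have "\<dots> = Re (\<Prod>j<N k. power_mean (N k) (clock d b (cis 0)) (w j)) - Re (\<Prod>j<N k. power_mean (N k) (clock d b (cis x)) (w j))"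
    unfolding m0 mx prod.distrib of_real_prod[symmetric] Q_def[symmetric] by (simp add: algebra_simps)
  finally show ?thesis by simp
qed

text \<open>At \<open>x = 0\<close> each power mean of the clock is nonnegative and equals its maximal modulus
  over all \<open>x\<close>.\<close>

lemma clock_mean_monotone:
  fixes d b k :: nat
  assumes d: "2 \<le> d" "d * b \<le> N k"
  shows "Re (\<Prod>j<N k. power_mean (N k) (clock d b (cis x)) (w j)) \<le> Re (\<Prod>j<N k. power_mean (N k) (clock d b (cis 0)) (w j))"
proof -
  have d0: "0 < d" using d by simp
  define \<alpha> where "\<alpha> = real (d * b) / N k"
  have \<alpha>: "0 \<le> \<alpha>" "\<alpha> \<le> 1" using d N_pos[of k] by (auto simp: \<alpha>_def divide_le_eq simp flip: of_nat_mult)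
  define r where "r j = (if int d dvd w j then 1 else 1 - \<alpha>)" for j
  have m0: "power_mean (N k) (clock d b (cis 0)) (w j) = of_real (r j)" for j
    unfolding power_mean_clock[OF d0 d(2) N_pos] \<alpha>_def[symmetric] by (simp add: r_def)
  have mx: "norm (power_mean (N k) (clock d b (cis x)) (w j)) \<le> r j" for j
  proof (cases "int d dvd w j")
    case True
    then show ?thesis by (simp add: r_def norm_power_mean_le norm_clock)
  next
    case False
    then have "power_mean (N k) (clock d b (cis x)) (w j) = of_real (1 - \<alpha>)"
      unfolding power_mean_clock[OF d0 d(2) N_pos] \<alpha>_def[symmetric] by (simp only: if_False)
    then show ?thesis using False \<alpha> by (simp only: norm_of_real r_def if_False)
  qed
  have "Re (\<Prod>j<N k. power_mean (N k) (clock d b (cis x)) (w j)) \<le> (\<Prod>j<N k. norm (power_mean (N k) (clock d b (cis x)) (w j)))"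
    using complex_Re_le_cmod by (simp add: prod_norm)
  also have "\<dots> \<le> (\<Prod>j<N k. r j)" using mx by (intro prod_mono) auto
  also have "\<dots> = Re (\<Prod>j<N k. power_mean (N k) (clock d b (cis 0)) (w j))"
    unfolding m0 of_real_prod[symmetric] by (simp only: Re_complex_of_real)
  finally show ?thesis .
qed

text \<open>With many \<open>d\<close>-cycles covering about half of the positions, the assumption
  \<open>clock_rotation\<close> makes the character nearly independent of the phase of the clock, since
  two adjacent nonzero weights are unlikely. By \<open>clock_mean_difference\<close> a nonzero weight
  divisible by \<open>d\<close> would show this phase for every \<open>x\<close>, so that all cosines of this weight
  have expectation close to 1. Taking divisor 1 in \<open>divisibility_of_cosines\<close>, it is usually
  0.\<close>

lemma multiples_vanish:
  assumes d: "2 \<le> d" and e: "0 < e"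
  shows "\<exists>k0. \<forall>k\<ge>k0. measure_pmf.prob (p k) {w. \<exists>i<N k. w i \<noteq> 0 \<and> int d dvd w i} \<le> e"
proof -
  have e2: "0 < e / 2" using e by simp
  obtain R k1 where R: "\<And>k. k \<ge> k1 \<Longrightarrow> measure_pmf.prob (p k) {w. R \<le> card (weight_support (N k) w)} \<le> e / 2"
    using weights_tight[OF e2] by blast
  define c :: real where "c = (1 / 2) ^ R * (1 / 8)"
  have c: "0 < c" by (simp add: c_def)
  define e' where "e' = min 1 (c * e / 2) / 8"
  have e': "0 < e'" "8 * e' \<le> c * e / 2" "e' \<le> 1" using c e by (auto simp: e'_def)
  have e'2: "0 < e'\<^sup>2 / 2" using e' by simp
  obtain R' k2 where R': "\<And>k. k \<ge> k2 \<Longrightarrow> measure_pmf.prob (p k) {w. R' \<le> card (weight_support (N k) w)} \<le> e'\<^sup>2 / 2"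
    using weights_tight[OF e'2] by blast
  obtain k3 where k3: "\<And>k z. k \<ge> k3 \<Longrightarrow> (\<forall>i. norm (z i) = 1) \<Longrightarrow>
    norm (F k z - measure_pmf.expectation (p k) (\<lambda>w. \<Prod>j<N k. power_mean (N k) z (w j))) \<le> e'"
    using power_mean_approximation[OF e'(1)] by blast
  obtain k4 :: nat where k4: "(real R')\<^sup>2 / (e'\<^sup>2 / 2) + 1 < k4" using reals_Archimedean2 by blast
  have "measure_pmf.prob (p k) {w. \<exists>i<N k. w i \<noteq> 0 \<and> int d dvd w i} \<le> e"
    if k: "k \<ge> k1" "k \<ge> k2" "k \<ge> k3" "k \<ge> k4" "k \<ge> 4 * d" for k
  proof -
    \<comment> \<open>The cycles cover between a quarter and half of the positions.\<close>
    define b where "b = N k div (2 * d)"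
    define \<alpha> where "\<alpha> = real (d * b) / N k"
    have Nk: "4 * d \<le> N k" "k4 \<le> N k" using N_ge[of k] k by linarith+
    have N2: "2 \<le> N k" using Nk d by linarith
    have db: "2 * (d * b) \<le> N k"
      unfolding b_def by (metis mult.assoc mult.commute div_times_less_eq_dividend)
    have db': "N k < 2 * (d * b) + 2 * d"
    proof -
      have "N k mod (2 * d) < 2 * d" using d by simp
      moreover have "N k = 2 * d * b + N k mod (2 * d)" unfolding b_def by simp
      ultimately show ?thesis by (simp only: mult.assoc)
    qed
    have dN: "d * b \<le> N k" using db by linarith
    have bN: "b \<le> N k"
    proof -
      have "1 * b \<le> d * b" using d by (intro mult_right_mono) auto
      then show ?thesis using dN by linarith
    qed
    have \<alpha>: "1 / 4 \<le> \<alpha>" "\<alpha> \<le> 1 / 2"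
    proof -
      have "N k \<le> 4 * (d * b)" using db' Nk by linarith
      then have "real (N k) \<le> 4 * real (d * b)" by (metis of_nat_le_iff of_nat_mult of_nat_numeral)
      then show "1 / 4 \<le> \<alpha>" using N_pos[of k] by (simp add: \<alpha>_def field_simps)
      have "2 * real (d * b) \<le> real (N k)" using db by (metis of_nat_le_iff of_nat_mult of_nat_numeral)
      then show "\<alpha> \<le> 1 / 2" using N_pos[of k] by (simp add: \<alpha>_def field_simps)
    qed
    \<comment> \<open>The probability that two given weights are nonzero is of order \<open>1 / (N k)\<^sup>2\<close>,
      which beats the union bound over \<open>b \<le> N k\<close> cycles.\<close>
    have pair: "measure_pmf.prob (p k) {w. \<exists>j<b. w (d * j) \<noteq> 0 \<and> w (d * j + 1) \<noteq> 0} \<le> e'\<^sup>2"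
    proof -
      define q where "q = measure_pmf.prob (p k) {w. w 0 \<noteq> 0 \<and> w 1 \<noteq> 0 \<and> card (weight_support (N k) w) < R'}"
      have "real (N k) * (real (N k) - 1) * q \<le> (real R')\<^sup>2"
        using prob_two_nonzero[OF exch N2, of R'] N2 by (simp add: q_def of_nat_diff)
      moreover have "(real R')\<^sup>2 \<le> (real (N k) - 1) * (e'\<^sup>2 / 2)"
      proof -
        have "(real R')\<^sup>2 / (e'\<^sup>2 / 2) \<le> real (N k) - 1" using k4 Nk by linarith
        then show ?thesis using e'2 by (simp add: field_simps)
      qed
      ultimately have "real (N k) * (real (N k) - 1) * q \<le> (real (N k) - 1) * (e'\<^sup>2 / 2)"
        by (rule order_trans)
      then have "(real (N k) - 1) * (real (N k) * q) \<le> (real (N k) - 1) * (e'\<^sup>2 / 2)"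
        by (simp only: mult.assoc mult.left_commute)
      then have Nq: "real (N k) * q \<le> e'\<^sup>2 / 2" using N2 by (simp add: mult_le_cancel_left_pos)
      have "measure_pmf.prob (p k) {w. \<exists>j<b. w (d * j) \<noteq> 0 \<and> w (d * j + 1) \<noteq> 0} \<le>
        measure_pmf.prob (p k) {w. R' \<le> card (weight_support (N k) w)} +
        measure_pmf.prob (p k) ({w. \<exists>j<b. w (d * j) \<noteq> 0 \<and> w (d * j + 1) \<noteq> 0} - {w. R' \<le> card (weight_support (N k) w)})"
        by (rule prob_le_split)
      also have "measure_pmf.prob (p k) ({w. \<exists>j<b. w (d * j) \<noteq> 0 \<and> w (d * j + 1) \<noteq> 0} - {w. R' \<le> card (weight_support (N k) w)}) \<le>
        measure_pmf.prob (p k) (\<Union>j<b. {w. w (d * j) \<noteq> 0 \<and> w (d * j + 1) \<noteq> 0 \<and> card (weight_support (N k) w) < R'})"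
        by (rule measure_pmf.finite_measure_mono) auto
      also have "\<dots> \<le> (\<Sum>j<b. measure_pmf.prob (p k) {w. w (d * j) \<noteq> 0 \<and> w (d * j + 1) \<noteq> 0 \<and> card (weight_support (N k) w) < R'})"
        by (rule measure_pmf.finite_measure_subadditive_finite) auto
      also have "\<dots> = (\<Sum>j<b. q)"
      proof (rule sum.cong[OF refl])
        fix j assume "j \<in> {..<b}"
        then have "d * (j + 1) \<le> d * b" by (intro mult_left_mono) auto
        then have dj: "d * j + 1 < N k" using dN d by (simp add: distrib_left)
        obtain \<sigma> where \<sigma>: "\<sigma> permutes {..<N k}" "\<sigma> 0 = d * j" "\<sigma> 1 = d * j + 1"
          using permutation_with_two_values[of "d * j" "d * j + 1" "N k"] dj N2 by auto
        have s: "card (weight_support (N k) (w \<circ> \<sigma>)) = card (weight_support (N k) w)" for w :: "nat \<Rightarrow> int"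
          by (rule card_weight_support_permute[OF \<sigma>(1)])
        have "q = measure_pmf.prob (p k) {w. (w \<circ> \<sigma>) 0 \<noteq> 0 \<and> (w \<circ> \<sigma>) 1 \<noteq> 0 \<and> card (weight_support (N k) (w \<circ> \<sigma>)) < R'}"
          unfolding q_def
          by (rule exchangeable_prob[OF exch \<sigma>(1), symmetric,
              where Q = "\<lambda>w. w 0 \<noteq> 0 \<and> w 1 \<noteq> 0 \<and> card (weight_support (N k) w) < R'"])
        then show "measure_pmf.prob (p k) {w. w (d * j) \<noteq> 0 \<and> w (d * j + 1) \<noteq> 0 \<and> card (weight_support (N k) w) < R'} = q"
          unfolding s o_apply \<sigma>(2,3) by simp
      qed
      also have "\<dots> \<le> real (N k) * q"
        using bN by (simp add: q_def mult_right_mono)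
      finally show ?thesis using Nq R'[OF k(2)] by linarith
    qed
    \<comment> \<open>Select a nonzero weight divisible by \<open>d\<close>, provided that there are few nonzero
      weights altogether.\<close>
    define Y where "Y w = (if card (weight_support (N k) w) < R \<and> (\<exists>i<N k. w i \<noteq> 0 \<and> int d dvd w i)
      then w (SOME i. i < N k \<and> w i \<noteq> 0 \<and> int d dvd w i) else 0)" for w :: "nat \<Rightarrow> int"
    have Ysome: "(SOME i. i < N k \<and> w i \<noteq> 0 \<and> int d dvd w i) < N k \<and> w (SOME i. i < N k \<and> w i \<noteq> 0 \<and> int d dvd w i) \<noteq> 0
        \<and> int d dvd w (SOME i. i < N k \<and> w i \<noteq> 0 \<and> int d dvd w i)"
      if "\<exists>i<N k. w i \<noteq> 0 \<and> int d dvd w i" for w :: "nat \<Rightarrow> int"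
      using that by (rule someI_ex)
    have "measure_pmf.prob (p k) {w. int 1 dvd Y w \<and> Y w \<noteq> 0} \<le> 4 * e' / c"
    proof (rule divisibility_of_cosines)
      fix x :: real
      let ?z = "clock d b (cis x)" and ?o = "clock d b (cis 0)"
      let ?P = "\<lambda>z w. \<Prod>j<N k. power_mean (N k) z (w j)"
      have z1: "\<forall>i. norm (?z i) = 1" "\<forall>i. norm (?o i) = 1" by (auto simp: norm_clock)
      have i: "integrable (measure_pmf (p k)) (?P ?z)" "integrable (measure_pmf (p k)) (?P ?o)"
        by (rule pmf_integrable_bounded[where B=1], rule norm_prod_power_mean_le, use z1 in blast)+
      have "(norm (F k ?z - F k ?o))\<^sup>2 \<le> 4 * e'\<^sup>2"
        using clock_rotation[OF d dN, of "cis x"] pair by simp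
      then have "(norm (F k ?z - F k ?o))\<^sup>2 \<le> (2 * e')\<^sup>2" by (simp add: power_mult_distrib)
      then have rot: "norm (F k ?z - F k ?o) \<le> 2 * e'" by (rule power2_le_imp_le) (use e' in simp)
      have "norm (measure_pmf.expectation (p k) (?P ?o) - measure_pmf.expectation (p k) (?P ?z)) \<le> 4 * e'"
        using k3[OF k(3) z1(1)] k3[OF k(3) z1(2)] rot
          norm_triangle_ineq4[of "F k ?z - measure_pmf.expectation (p k) (?P ?z)" "F k ?z - F k ?o"]
          norm_triangle_ineq4[of "F k ?z - measure_pmf.expectation (p k) (?P ?z) - (F k ?z - F k ?o)" "F k ?o - measure_pmf.expectation (p k) (?P ?o)"]
        by (simp add: algebra_simps)
      then have D: "Re (measure_pmf.expectation (p k) (?P ?o)) - Re (measure_pmf.expectation (p k) (?P ?z)) \<le> 4 * e'"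
        using complex_Re_le_cmod[of "measure_pmf.expectation (p k) (?P ?o) - measure_pmf.expectation (p k) (?P ?z)"] by simp
      have ic: "integrable (measure_pmf (p k)) (\<lambda>w. cos (x * Y w))"
        by (rule pmf_integrable_bounded[where B=1]) simp
      have "c * (1 - measure_pmf.expectation (p k) (\<lambda>w. cos (x * Y w))) =
          measure_pmf.expectation (p k) (\<lambda>w. c * (1 - cos (x * Y w)))" using ic by simp
      also have "\<dots> \<le> measure_pmf.expectation (p k) (\<lambda>w. Re (?P ?o w) - Re (?P ?z w))"
      proof (rule integral_mono)
        show "integrable (measure_pmf (p k)) (\<lambda>w. c * (1 - cos (x * Y w)))" using ic by simp
        show "integrable (measure_pmf (p k)) (\<lambda>w. Re (?P ?o w) - Re (?P ?z w))"
          using integrable_Re[OF i(1)] integrable_Re[OF i(2)] by simp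
        fix w :: "nat \<Rightarrow> int"
        show "c * (1 - cos (x * Y w)) \<le> Re (?P ?o w) - Re (?P ?z w)"
        proof (cases "card (weight_support (N k) w) < R \<and> (\<exists>i<N k. w i \<noteq> 0 \<and> int d dvd w i)")
          case True
          define i where "i = (SOME i. i < N k \<and> w i \<noteq> 0 \<and> int d dvd w i)"
          have i: "i < N k" "w i \<noteq> 0" "int d dvd w i" "Y w = w i"
            using Ysome[of w] True by (auto simp: i_def Y_def)
          show ?thesis
            unfolding c_def i(4)
            by (rule clock_mean_difference[where i = i and w = w and R = R, OF d dN \<alpha>_def \<alpha>])
               (use True i(1-3) in auto)
        next
          case False
          then have "Y w = 0" by (auto simp: Y_def)
          then show ?thesis using clock_mean_monotone[OF d dN, of x w] by simp
        qed
      qed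
      also have "\<dots> = Re (measure_pmf.expectation (p k) (?P ?o)) - Re (measure_pmf.expectation (p k) (?P ?z))"
        using integrable_Re[OF i(1)] integrable_Re[OF i(2)] integral_Re[OF i(1)] integral_Re[OF i(2)] by simp
      also note D
      finally show "1 - 4 * e' / c \<le> measure_pmf.expectation (p k) (\<lambda>w. cos (x * real_of_int (Y w)))"
        using c by (simp add: field_simps)
    qed simp
    also have "4 * e' / c \<le> e / 2" using e' c by (simp add: field_simps)
    finally have Y: "measure_pmf.prob (p k) {w. Y w \<noteq> 0} \<le> e / 2" by simp
    have "measure_pmf.prob (p k) {w. \<exists>i<N k. w i \<noteq> 0 \<and> int d dvd w i} \<le>
      measure_pmf.prob (p k) ({w. Y w \<noteq> 0} \<union> {w. R \<le> card (weight_support (N k) w)})"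
      by (rule measure_pmf.finite_measure_mono) (use Ysome in \<open>auto simp: Y_def\<close>)
    also have "\<dots> \<le> measure_pmf.prob (p k) {w. Y w \<noteq> 0} + measure_pmf.prob (p k) {w. R \<le> card (weight_support (N k) w)}"
      by (rule measure_Un_le) auto
    also have "\<dots> \<le> e" using Y R[OF k(1)] by linarith
    finally show ?thesis .
  qed
  then show ?thesis
    by (intro exI[of _ "k1 + k2 + k3 + k4 + 4 * d"]) auto
qed

end

section \<open>The limit distribution of the weight counts\<close>

definition positive_count :: "nat \<Rightarrow> (nat \<Rightarrow> int) \<Rightarrow> nat" where
  "positive_count N w = card {i \<in> {..<N}. 0 < w i}"

definition negative_count :: "nat \<Rightarrow> (nat \<Rightarrow> int) \<Rightarrow> nat" where
  "negative_count N w = card {i \<in> {..<N}. w i < 0}"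

definition trace_monomial :: "complex \<Rightarrow> nat \<times> nat \<Rightarrow> complex" where
  "trace_monomial t x = t ^ fst x * cnj t ^ snd x"

lemma norm_trace_monomial_le: "norm t \<le> 1 \<Longrightarrow> norm (trace_monomial t x) \<le> 1"
  by (simp add: trace_monomial_def norm_mult norm_power mult_le_one power_le_one)

lemma card_weight_support_eq: "card (weight_support N w) = positive_count N w + negative_count N w"
proof -
  have "weight_support N w = {i \<in> {..<N}. 0 < w i} \<union> {i \<in> {..<N}. w i < 0}"
    by (auto simp: weight_support_def)
  moreover have "card ({i \<in> {..<N}. 0 < w i} \<union> {i \<in> {..<N}. w i < 0}) =
      card {i \<in> {..<N}. 0 < w i} + card {i \<in> {..<N}. w i < 0}"
    by (rule card_Un_disjoint) auto
  ultimately show ?thesis by (simp only: positive_count_def negative_count_def)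
qed

lemma power_mean_minus_one:
  assumes "\<And>i. norm (z i) = 1"
  shows "power_mean N z (- 1) = cnj (power_mean N z 1)"
proof -
  have "z i powi (- 1) = cnj (z i)" for i
    using divide_conv_cnj[OF assms[of i], of 1] by (simp add: power_int_minus inverse_eq_divide)
  then show ?thesis by (simp add: power_mean_def)
qed

text \<open>With weights in \<open>{-1, 0, 1}\<close> only the power means of exponents 1 and -1 occur, and
  these are the normalised trace and its conjugate.\<close>

lemma prod_power_mean_small_weights:
  assumes z: "\<And>i. norm (z i) = 1" and N: "0 < N" and w: "\<And>i. i < N \<Longrightarrow> \<bar>w i\<bar> < 2"
  shows "(\<Prod>j<N. power_mean N z (w j)) = trace_monomial (power_mean N z 1) (positive_count N w, negative_count N w)"
proof -
  let ?t = "power_mean N z 1"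
  have "power_mean N z (w j) = (if 0 < w j then ?t else 1) * (if w j < 0 then cnj ?t else 1)" if j: "j < N" for j
  proof -
    consider "w j = 0" | "w j = 1" | "w j = - 1" using w[OF j] by linarith
    then show ?thesis by cases (simp_all add: N power_mean_minus_one[OF z])
  qed
  then have "(\<Prod>j<N. power_mean N z (w j)) =
      (\<Prod>j<N. (if 0 < w j then ?t else 1) * (if w j < 0 then cnj ?t else 1))"
    by (intro prod.cong) auto
  also have "\<dots> = (\<Prod>j\<in>{i \<in> {..<N}. 0 < w i}. ?t) * (\<Prod>j\<in>{i \<in> {..<N}. w i < 0}. cnj ?t)"
    unfolding prod.distrib by (simp only: prod.inter_filter[OF finite_lessThan])
  finally show ?thesis by (simp add: trace_monomial_def positive_count_def negative_count_def)
qed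

lemma power_mean_periodic:
  assumes "0 < n" "n dvd m" "0 < m"
  shows "power_mean m (\<lambda>i. z (i mod n)) v = power_mean n z v"
proof -
  obtain b where b: "m = n * b" using assms(2) by blast
  have "(\<Sum>i<n * b. z (i mod n) powi v) = of_nat b * (\<Sum>r<n. z r powi v)"
    by (rule sum_periodic[where f = "\<lambda>r. z r powi v"])
  then show ?thesis using assms by (simp add: power_mean_def b)
qed

context weight_tower
begin

text \<open>A weight of absolute value at least 2 is either large or a nonzero multiple of one of
  finitely many numbers \<open>d \<ge> 2\<close>, namely of its own absolute value.\<close>

lemma weights_at_most_one:
  assumes e: "0 < e"
  shows "\<exists>k0. \<forall>k\<ge>k0. measure_pmf.prob (p k) {w. \<exists>i<N k. 2 \<le> \<bar>w i\<bar>} \<le> e"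
proof -
  have e2: "0 < e / 2" using e by simp
  obtain C k1 where C: "\<And>k. k \<ge> k1 \<Longrightarrow> measure_pmf.prob (p k) {w. \<exists>i<N k. int C \<le> \<bar>w i\<bar>} \<le> e / 2"
    using weights_bounded[OF e2] by blast
  define e' where "e' = e / 2 / real (Suc C)"
  have e': "0 < e'" using e by (simp add: e'_def)
  have "\<forall>d. \<exists>k0. 2 \<le> d \<longrightarrow> (\<forall>k\<ge>k0. measure_pmf.prob (p k) {w. \<exists>i<N k. w i \<noteq> 0 \<and> int d dvd w i} \<le> e')"
    using multiples_vanish[OF _ e'] by blast
  from choice[OF this] obtain \<kappa> where \<kappa>: "\<forall>d. 2 \<le> d \<longrightarrow>
      (\<forall>k\<ge>\<kappa> d. measure_pmf.prob (p k) {w. \<exists>i<N k. w i \<noteq> 0 \<and> int d dvd w i} \<le> e')" ..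
  have "measure_pmf.prob (p k) {w. \<exists>i<N k. 2 \<le> \<bar>w i\<bar>} \<le> e" if k: "k \<ge> k1 + (\<Sum>d<C. \<kappa> d)" for k
  proof -
    have kd: "\<kappa> d \<le> k" if "d < C" for d
      using member_le_sum[of d "{..<C}" \<kappa>] that k by simp
    have "measure_pmf.prob (p k) {w. \<exists>i<N k. 2 \<le> \<bar>w i\<bar>} \<le>
      measure_pmf.prob (p k) ({w. \<exists>i<N k. int C \<le> \<bar>w i\<bar>} \<union> (\<Union>d\<in>{2..<C}. {w. \<exists>i<N k. w i \<noteq> 0 \<and> int d dvd w i}))"
    proof (rule measure_pmf.finite_measure_mono, rule subsetI)
      fix w :: "nat \<Rightarrow> int" assume "w \<in> {w. \<exists>i<N k. 2 \<le> \<bar>w i\<bar>}"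
      then obtain i where i: "i < N k" "2 \<le> \<bar>w i\<bar>" by blast
      show "w \<in> {w. \<exists>i<N k. int C \<le> \<bar>w i\<bar>} \<union> (\<Union>d\<in>{2..<C}. {w. \<exists>i<N k. w i \<noteq> 0 \<and> int d dvd w i})"
      proof (cases "int C \<le> \<bar>w i\<bar>")
        case False
        have "nat \<bar>w i\<bar> \<in> {2..<C}" using False i by auto
        moreover have "w \<in> {w. \<exists>i<N k. w i \<noteq> 0 \<and> int (nat \<bar>w i\<bar>) dvd w i}" using i by auto
        moreover have "w i \<noteq> 0 \<and> int (nat \<bar>w i\<bar>) dvd w i" using i by auto
        ultimately show ?thesis using i(1) by blast
      qed (use i in blast)
    qed simp
    also have "\<dots> \<le> measure_pmf.prob (p k) {w. \<exists>i<N k. int C \<le> \<bar>w i\<bar>} +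
        measure_pmf.prob (p k) (\<Union>d\<in>{2..<C}. {w. \<exists>i<N k. w i \<noteq> 0 \<and> int d dvd w i})"
      by (rule measure_Un_le) auto
    also have "measure_pmf.prob (p k) (\<Union>d\<in>{2..<C}. {w. \<exists>i<N k. w i \<noteq> 0 \<and> int d dvd w i}) \<le>
        (\<Sum>d\<in>{2..<C}. measure_pmf.prob (p k) {w. \<exists>i<N k. w i \<noteq> 0 \<and> int d dvd w i})"
      by (rule measure_pmf.finite_measure_subadditive_finite) auto
    also have "\<dots> \<le> (\<Sum>d\<in>{2..<C}. e')" by (rule sum_mono) (use \<kappa> kd in auto)
    also have "\<dots> \<le> e / 2"
    proof -
      have "real (C - 2) * e' \<le> Suc C * e'" using e' by (intro mult_right_mono) auto
      also have "\<dots> = e / 2" by (simp add: e'_def del: of_nat_Suc)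
      finally show ?thesis by simp
    qed
    finally show ?thesis using C[of k] k by simp
  qed
  then show ?thesis by blast
qed

lemma trace_monomial_approximation:
  assumes e: "0 < e"
  shows "\<exists>k0. \<forall>k\<ge>k0. \<forall>z. (\<forall>i. norm (z i) = 1) \<longrightarrow>
    norm (F k z - measure_pmf.expectation (p k)
      (\<lambda>w. trace_monomial (power_mean (N k) z 1) (positive_count (N k) w, negative_count (N k) w))) \<le> e"
proof -
  have e4: "0 < e / 4" using e by simp
  obtain k1 where k1: "\<And>k. k \<ge> k1 \<Longrightarrow> measure_pmf.prob (p k) {w. \<exists>i<N k. 2 \<le> \<bar>w i\<bar>} \<le> e / 4"
    using weights_at_most_one[OF e4] by blast
  obtain k2 where k2: "\<And>k z. k \<ge> k2 \<Longrightarrow> (\<forall>i. norm (z i) = 1) \<Longrightarrow>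
    norm (F k z - measure_pmf.expectation (p k) (\<lambda>w. \<Prod>j<N k. power_mean (N k) z (w j))) \<le> e / 4"
    using power_mean_approximation[OF e4] by blast
  have "norm (F k z - measure_pmf.expectation (p k)
      (\<lambda>w. trace_monomial (power_mean (N k) z 1) (positive_count (N k) w, negative_count (N k) w))) \<le> e"
    if k: "k \<ge> k1" "k \<ge> k2" and z: "\<And>i. norm (z i) = 1" for k z
  proof -
    let ?P = "\<lambda>w. \<Prod>j<N k. power_mean (N k) z (w j)"
    let ?T = "\<lambda>w. trace_monomial (power_mean (N k) z 1) (positive_count (N k) w, negative_count (N k) w)"
    have P1: "norm (?P w) \<le> 1" for w by (rule norm_prod_power_mean_le) (rule z)
    have T1: "norm (?T w) \<le> 1" for w by (intro norm_trace_monomial_le norm_power_mean_le z)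
    have "measure_pmf.expectation (p k) ?P - measure_pmf.expectation (p k) ?T =
        measure_pmf.expectation (p k) (\<lambda>w. ?P w - ?T w)"
      by (rule Bochner_Integration.integral_diff[symmetric])
         (rule pmf_integrable_bounded[where B=1], rule P1, rule pmf_integrable_bounded[where B=1], rule T1)
    also have "norm \<dots> \<le> 0 + 2 * measure_pmf.prob (p k) {w. \<exists>i<N k. 2 \<le> \<bar>w i\<bar>}"
    proof (rule norm_expectation_le_split)
      fix w show "norm (?P w - ?T w) \<le> 2"
        using norm_triangle_ineq4[of "?P w" "?T w"] P1[of w] T1[of w] by linarith
      assume "w \<notin> {w. \<exists>i<N k. 2 \<le> \<bar>w i\<bar>}"
      then have "\<bar>w i\<bar> < 2" if "i < N k" for i using that by force
      then have "?P w = ?T w" by (intro prod_power_mean_small_weights z N_pos)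
      then show "norm (?P w - ?T w) \<le> 0" by simp
    qed simp
    finally have PT: "norm (measure_pmf.expectation (p k) ?P - measure_pmf.expectation (p k) ?T) \<le> e / 2"
      using k1[OF k(1)] by linarith
    have "norm (F k z - measure_pmf.expectation (p k) ?P) \<le> e / 4" using k2[OF k(2)] z by blast
    then show ?thesis
      using PT norm_triangle_ineq[of "F k z - measure_pmf.expectation (p k) ?P"
          "measure_pmf.expectation (p k) ?P - measure_pmf.expectation (p k) ?T"] e by simp
  qed
  then show ?thesis by (intro exI[of _ "max k1 k2"]) simp
qed

text \<open>The joint laws of the numbers of positive and negative weights are tight. The
  approximation at level \<open>r n\<close> evaluated at the image of a fixed \<open>z\<close> of level \<open>l\<close>, where
  neither the value of \<open>F\<close> nor the normalised trace changes, becomes an identity in the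
  limit.\<close>

theorem trace_monomial_representation:
  obtains c :: "(nat \<times> nat) pmf" where
    "\<And>l z. (\<And>i. norm (z i) = 1) \<Longrightarrow>
      F l z = measure_pmf.expectation c (trace_monomial (power_mean (N l) z 1))"
proof -
  define c where "c k = map_pmf (\<lambda>w. (positive_count (N k) w, negative_count (N k) w)) (p k)" for k
  have tight: "\<exists>K n0. finite K \<and> (\<forall>n\<ge>n0. 1 - e \<le> measure_pmf.prob (c n) K)" if e: "0 < e" for e
  proof -
    obtain R k0 where R: "\<And>k. k \<ge> k0 \<Longrightarrow> measure_pmf.prob (p k) {w. R \<le> card (weight_support (N k) w)} \<le> e"
      using weights_tight[OF e] by blast
    have "1 - e \<le> measure_pmf.prob (c k) ({..<R} \<times> {..<R})" if k: "k \<ge> k0" for k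
    proof -
      have "1 - e \<le> measure_pmf.prob (p k) (UNIV - {w. R \<le> card (weight_support (N k) w)})"
        using R[OF k] measure_pmf.prob_compl[of "{w. R \<le> card (weight_support (N k) w)}" "p k"] by simp
      also have "\<dots> \<le> measure_pmf.prob (c k) ({..<R} \<times> {..<R})"
        unfolding c_def measure_map_pmf
        by (rule measure_pmf.finite_measure_mono) (auto simp: card_weight_support_eq)
      finally show ?thesis .
    qed
    then show ?thesis by (intro exI[of _ "{..<R} \<times> {..<R}"] exI[of _ k0]) auto
  qed
  obtain r q where r: "strict_mono (r :: nat \<Rightarrow> nat)" and q: "\<And>g :: nat \<times> nat \<Rightarrow> complex. (\<And>x. norm (g x) \<le> 1) \<Longrightarrow>
       (\<lambda>n. measure_pmf.expectation (c (r n)) g) \<longlonglongrightarrow> measure_pmf.expectation q g"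
    by (rule tight_pmf_convergent_subsequence[of UNIV c, OF _ _ tight]) auto
  show ?thesis
  proof (rule that[of q])
    fix l and z :: "nat \<Rightarrow> complex" assume z: "\<And>i. norm (z i) = 1"
    let ?t = "power_mean (N l) z 1"
    let ?g = "trace_monomial ?t"
    have g: "norm (?g x) \<le> 1" for x by (intro norm_trace_monomial_le norm_power_mean_le z)
    have "(\<lambda>n. measure_pmf.expectation (c (r n)) ?g) \<longlonglongrightarrow> F l z"
    proof (rule LIMSEQ_I)
      fix e :: real assume "0 < e"
      then have "0 < e / 2" by simp
      from trace_monomial_approximation[OF this]
      obtain k0 where k0: "\<And>k z. k \<ge> k0 \<Longrightarrow> (\<forall>i. norm (z i) = 1) \<Longrightarrow>
        norm (F k z - measure_pmf.expectation (p k)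
          (\<lambda>w. trace_monomial (power_mean (N k) z 1) (positive_count (N k) w, negative_count (N k) w))) \<le> e / 2"
        by blast
      show "\<exists>no. \<forall>n\<ge>no. norm (measure_pmf.expectation (c (r n)) ?g - F l z) < e"
      proof (intro exI allI impI)
        fix n assume n: "n \<ge> max k0 l"
        have rn: "r n \<ge> k0" "l \<le> r n" using seq_suble[OF r, of n] n by linarith+
        let ?z = "\<lambda>i. z (i mod N l)"
        have "power_mean (N (r n)) ?z 1 = ?t"
          by (rule power_mean_periodic) (use N_pos N_dvd rn in auto)
        moreover have "F (r n) ?z = F l z" by (rule embed[OF rn(2) z])
        moreover have "\<forall>i. norm (?z i) = 1" using z by simp
        ultimately have "norm (F l z - measure_pmf.expectation (c (r n)) ?g) \<le> e / 2"
          using k0[OF rn(1), of ?z] by (simp add: c_def)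
        then show "norm (measure_pmf.expectation (c (r n)) ?g - F l z) < e"
          using \<open>0 < e\<close> by (simp add: norm_minus_commute)
      qed
    qed
    then show "F l z = measure_pmf.expectation q ?g"
      by (rule LIMSEQ_unique) (rule q, rule g)
  qed
qed

end

section \<open>Monomial matrices and the diagonalisation of cyclic shifts\<close>

lemma mat_mult_entry:
  assumes "A \<in> carrier_mat N N" "B \<in> carrier_mat N N" "i < N" "j < N"
  shows "(A * B) $$ (i, j) = (\<Sum>k<N. A $$ (i, k) * B $$ (k, j))"
  using assms by (auto simp: scalar_prod_def lessThan_atLeast0 intro!: sum.cong)

lemma adjoint_carrier [simp]: "A \<in> carrier_mat N N \<Longrightarrow> mat_adjoint A \<in> carrier_mat N N"
  for A :: "complex mat"
  by (intro carrier_matI) auto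

lemma adjoint_entry:
  fixes A :: "complex mat"
  assumes "A \<in> carrier_mat N N" "i < N" "j < N"
  shows "mat_adjoint A $$ (i, j) = cnj (A $$ (j, i))"
  using assms by (intro mat_adjoint_index) auto

lemma mat_adjoint_mult:
  fixes A B :: "complex mat"
  assumes A: "A \<in> carrier_mat N N" and B: "B \<in> carrier_mat N N"
  shows "mat_adjoint (A * B) = mat_adjoint B * mat_adjoint A"
proof (rule eq_matI)
  fix i j assume "i < dim_row (mat_adjoint B * mat_adjoint A)" "j < dim_col (mat_adjoint B * mat_adjoint A)"
  then have ij: "i < N" "j < N" using A B by auto
  have "mat_adjoint (A * B) $$ (i, j) = cnj (\<Sum>k<N. A $$ (j, k) * B $$ (k, i))"
    using ij mat_mult_entry[OF A B] by (subst adjoint_entry[of _ N]) (use A B in auto)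
  also have "\<dots> = (\<Sum>k<N. mat_adjoint B $$ (i, k) * mat_adjoint A $$ (k, j))"
    unfolding cnj_sum by (rule sum.cong) (use ij adjoint_entry[OF A] adjoint_entry[OF B] in \<open>auto simp: mult.commute\<close>)
  also have "\<dots> = (mat_adjoint B * mat_adjoint A) $$ (i, j)"
    by (rule mat_mult_entry[symmetric]) (use A B ij in auto)
  finally show "mat_adjoint (A * B) $$ (i, j) = (mat_adjoint B * mat_adjoint A) $$ (i, j)" .
qed (use A B in auto)

lemma unitary_matsI:
  fixes A :: "complex mat"
  assumes "A \<in> carrier_mat N N" "mat_adjoint A * A = 1\<^sub>m N"
  shows "A \<in> unitary_mats N"
  using assms mat_mult_left_right_inverse[of "mat_adjoint A" N A] by (simp add: unitary_mats_def)

lemma unitary_matsD: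
  assumes "A \<in> unitary_mats N"
  shows "A \<in> carrier_mat N N" "mat_adjoint A \<in> carrier_mat N N"
    "A * mat_adjoint A = 1\<^sub>m N" "mat_adjoint A * A = 1\<^sub>m N"
  using assms by (auto simp: unitary_mats_def)

text \<open>A permutation matrix whose row \<open>i\<close> is scaled by \<open>z i\<close>. Diagonal matrices are the case
  of the identity permutation.\<close>

definition monomial_mat :: "nat \<Rightarrow> (nat \<Rightarrow> complex) \<Rightarrow> (nat \<Rightarrow> nat) \<Rightarrow> complex mat" where
  "monomial_mat N z \<pi> = Matrix.mat N N (\<lambda>(i, j). if i = \<pi> j then z i else 0)"

abbreviation diagonal :: "nat \<Rightarrow> (nat \<Rightarrow> complex) \<Rightarrow> complex mat" where
  "diagonal N z \<equiv> monomial_mat N z id"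

lemma monomial_mat_carrier [simp]: "monomial_mat N z \<pi> \<in> carrier_mat N N"
  by (simp add: monomial_mat_def)

lemma monomial_mat_entry: "i < N \<Longrightarrow> j < N \<Longrightarrow> monomial_mat N z \<pi> $$ (i, j) = (if i = \<pi> j then z i else 0)"
  by (simp add: monomial_mat_def)

lemma monomial_mat_mult:
  assumes \<sigma>: "\<sigma> permutes {..<N}" and \<pi>: "\<pi> permutes {..<N}"
  shows "monomial_mat N a \<pi> * monomial_mat N b \<sigma> = monomial_mat N (\<lambda>i. a i * b (inv_into UNIV \<pi> i)) (\<pi> \<circ> \<sigma>)"
proof (rule eq_matI)
  fix i j assume "i < dim_row (monomial_mat N (\<lambda>i. a i * b (inv_into UNIV \<pi> i)) (\<pi> \<circ> \<sigma>))"
    "j < dim_col (monomial_mat N (\<lambda>i. a i * b (inv_into UNIV \<pi> i)) (\<pi> \<circ> \<sigma>))"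
  then have ij: "i < N" "j < N" by (auto simp: monomial_mat_def)
  have sj: "\<sigma> j < N" using permutes_in_image[OF \<sigma>, of j] ij by simp
  have "(monomial_mat N a \<pi> * monomial_mat N b \<sigma>) $$ (i, j) =
     (\<Sum>k<N. monomial_mat N a \<pi> $$ (i, k) * monomial_mat N b \<sigma> $$ (k, j))"
    by (rule mat_mult_entry) (use ij in auto)
  also have "\<dots> = (\<Sum>k<N. if k = \<sigma> j then (if i = \<pi> (\<sigma> j) then a i else 0) * b (\<sigma> j) else 0)"
    by (rule sum.cong) (use ij in \<open>auto simp: monomial_mat_entry\<close>)
  also have "\<dots> = (if i = \<pi> (\<sigma> j) then a i else 0) * b (\<sigma> j)" using sj by simp
  also have "\<dots> = monomial_mat N (\<lambda>i. a i * b (inv_into UNIV \<pi> i)) (\<pi> \<circ> \<sigma>) $$ (i, j)"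
    using ij permutes_inverses(2)[OF \<pi>] by (simp add: monomial_mat_entry)
  finally show "(monomial_mat N a \<pi> * monomial_mat N b \<sigma>) $$ (i, j) =
     monomial_mat N (\<lambda>i. a i * b (inv_into UNIV \<pi> i)) (\<pi> \<circ> \<sigma>) $$ (i, j)" .
qed (auto simp: monomial_mat_def)

lemma monomial_mat_adjoint:
  assumes \<pi>: "\<pi> permutes {..<N}"
  shows "mat_adjoint (monomial_mat N a \<pi>) = monomial_mat N (\<lambda>i. cnj (a (\<pi> i))) (inv_into UNIV \<pi>)"
proof (rule eq_matI)
  fix i j assume "i < dim_row (monomial_mat N (\<lambda>i. cnj (a (\<pi> i))) (inv_into UNIV \<pi>))"
    "j < dim_col (monomial_mat N (\<lambda>i. cnj (a (\<pi> i))) (inv_into UNIV \<pi>))"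
  then have ij: "i < N" "j < N" by (auto simp: monomial_mat_def)
  have "(j = \<pi> i) = (i = inv_into UNIV \<pi> j)"
    using permutes_inverses[OF \<pi>] by metis
  then show "mat_adjoint (monomial_mat N a \<pi>) $$ (i, j) =
      monomial_mat N (\<lambda>i. cnj (a (\<pi> i))) (inv_into UNIV \<pi>) $$ (i, j)"
    using ij by (auto simp: adjoint_entry[OF monomial_mat_carrier] monomial_mat_entry)
qed (auto simp: monomial_mat_def)

lemma monomial_mat_cong:
  "(\<And>i. i < N \<Longrightarrow> a i = b i) \<Longrightarrow> monomial_mat N a \<pi> = monomial_mat N b \<pi>"
  by (intro eq_matI) (auto simp: monomial_mat_def)

lemma diagonal_one: "diagonal N (\<lambda>_. 1) = 1\<^sub>m N"
  by (intro eq_matI) (auto simp: monomial_mat_def)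

lemma adjoint_monomial_mult_monomial:
  assumes \<pi>: "\<pi> permutes {..<N}"
  shows "mat_adjoint (monomial_mat N a \<pi>) * monomial_mat N b \<pi> = diagonal N (\<lambda>j. cnj (a (\<pi> j)) * b (\<pi> j))"
proof -
  have \<pi>': "inv_into UNIV \<pi> permutes {..<N}" by (rule permutes_inv[OF \<pi>])
  show ?thesis
    unfolding monomial_mat_adjoint[OF \<pi>] monomial_mat_mult[OF \<pi> \<pi>']
    by (simp add: permutes_inv_o[OF \<pi>] permutes_inv_inv[OF \<pi>])
qed

lemma monomial_mat_unitary:
  assumes \<pi>: "\<pi> permutes {..<N}" and z: "\<And>i. norm (z i) = 1"
  shows "monomial_mat N z \<pi> \<in> unitary_mats N"
proof (rule unitary_matsI)
  have "cnj (z i) * z i = 1" for i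
    using z[of i] complex_norm_square[of "z i"] by (simp add: mult.commute)
  then show "mat_adjoint (monomial_mat N z \<pi>) * monomial_mat N z \<pi> = 1\<^sub>m N"
    by (simp add: adjoint_monomial_mult_monomial[OF \<pi>] diagonal_one)
qed simp

lemma permutes_id_lessThan [simp]: "id permutes {..<N::nat}"
  by (rule permutes_id)

lemma diagonal_conjugate_monomial:
  assumes \<pi>: "\<pi> permutes {..<N}"
  shows "diagonal N e * monomial_mat N z \<pi> * mat_adjoint (diagonal N e) =
    monomial_mat N (\<lambda>i. e i * z i * cnj (e (inv_into UNIV \<pi> i))) \<pi>"
  unfolding monomial_mat_adjoint[OF permutes_id_lessThan] inv_id monomial_mat_mult[OF \<pi> permutes_id_lessThan]
    id_o monomial_mat_mult[OF permutes_id_lessThan \<pi>] o_id by simp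

lemma permutation_conjugate_diagonal:
  assumes \<pi>: "\<pi> permutes {..<N}"
  shows "monomial_mat N (\<lambda>_. 1) \<pi> * diagonal N z * mat_adjoint (monomial_mat N (\<lambda>_. 1) \<pi>) =
    diagonal N (z \<circ> inv_into UNIV \<pi>)"
proof -
  have \<pi>': "inv_into UNIV \<pi> permutes {..<N}" by (rule permutes_inv[OF \<pi>])
  show ?thesis
    unfolding monomial_mat_adjoint[OF \<pi>] monomial_mat_mult[OF permutes_id_lessThan \<pi>] o_id
      monomial_mat_mult[OF \<pi>' \<pi>] permutes_inv_o(1)[OF \<pi>]
    by (simp add: o_def)
qed

text \<open>The product of the \<open>b\<close> disjoint cycles of length \<open>d\<close> on consecutive positions.\<close>

definition block_cycle :: "nat \<Rightarrow> nat \<Rightarrow> nat \<Rightarrow> nat" where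
  "block_cycle d b i = (if i < d * b then (if Suc (i mod d) = d then i - i mod d else Suc i) else i)"

text \<open>Block diagonal, with \<open>b\<close> copies of the unitary discrete Fourier transform of size \<open>d\<close>
  followed by an identity matrix.\<close>

definition fourier_mat :: "nat \<Rightarrow> nat \<Rightarrow> nat \<Rightarrow> complex mat" where
  "fourier_mat N d b = Matrix.mat N N (\<lambda>(i, j).
     if i < d * b \<and> j < d * b then
       (if i div d = j div d then cis (- 2 * pi * (real (i mod d) * real (j mod d)) / d) / sqrt d else 0)
     else if i = j then 1 else 0)"

lemma block_cycle_block:
  assumes "0 < d" "i < d * b"
  shows "block_cycle d b i div d = i div d" "block_cycle d b i < d * b"
    "block_cycle d b i mod d = Suc (i mod d) mod d"
proof -
  have i: "i = d * (i div d) + i mod d" "i mod d < d" using assms by auto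
  have D: "(d * q + r) div d = q" "(d * q + r) mod d = r" if "r < d" for q r using that by auto
  have q: "i div d < b" using assms by (simp add: less_mult_imp_div_less mult.commute)
  have lt: "d * (i div d) + r < d * b" if "r < d" for r
  proof -
    have "d * (i div d) + r < d * (i div d + 1)" using that by simp
    also have "\<dots> \<le> d * b" using q by (intro mult_left_mono) auto
    finally show ?thesis .
  qed
  have "\<exists>r<d. block_cycle d b i = d * (i div d) + r \<and> r = Suc (i mod d) mod d"
  proof (cases "Suc (i mod d) = d")
    case True
    then have "block_cycle d b i = d * (i div d) + 0"
      using assms i(1) by (simp add: block_cycle_def minus_mod_eq_mult_div)
    then show ?thesis using True assms by (intro exI[of _ 0]) simp
  next
    case False
    then have s: "Suc (i mod d) < d" using i(2) by simp
    have "block_cycle d b i = d * (i div d) + Suc (i mod d)"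
      using assms False i(1) by (simp add: block_cycle_def)
    then show ?thesis using s by (intro exI[of _ "Suc (i mod d)"]) simp
  qed
  then obtain r where r: "r < d" "block_cycle d b i = d * (i div d) + r" "r = Suc (i mod d) mod d" by blast
  show "block_cycle d b i div d = i div d" using D(1)[OF r(1)] by (simp only: r(2))
  show "block_cycle d b i < d * b" using lt[OF r(1)] by (simp only: r(2))
  show "block_cycle d b i mod d = Suc (i mod d) mod d" using D(2)[OF r(1)] r(3) by (simp only: r(2))
qed

lemma block_cycle_permutes:
  assumes d: "0 < d" and N: "d * b \<le> N"
  shows "block_cycle d b permutes {..<N}"
proof (rule permutes_subset)
  have "inj_on (block_cycle d b) {..<d * b}"
  proof (rule inj_onI)
    fix i j assume ij: "i \<in> {..<d * b}" "j \<in> {..<d * b}" "block_cycle d b i = block_cycle d b j"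
    have "i div d = j div d" using block_cycle_block(1)[OF d, of i b] block_cycle_block(1)[OF d, of j b] ij by simp
    moreover have "Suc (i mod d) mod d = Suc (j mod d) mod d"
      using block_cycle_block(3)[OF d, of i b] block_cycle_block(3)[OF d, of j b] ij by simp
    then have "i mod d = j mod d"
      using d mod_less_divisor[OF d, of i] mod_less_divisor[OF d, of j] by (auto simp: mod_Suc split: if_splits)
    ultimately show "i = j" by (metis div_mult_mod_eq)
  qed
  moreover have "block_cycle d b ` {..<d * b} \<subseteq> {..<d * b}" using block_cycle_block(2)[OF d] by auto
  ultimately have "bij_betw (block_cycle d b) {..<d * b} {..<d * b}"
    by (simp add: bij_betw_def endo_inj_surj)
  then show "block_cycle d b permutes {..<d * b}" by (rule bij_imp_permutes) (simp add: block_cycle_def)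
qed (use N in auto)

lemma sum_over_block:
  fixes g :: "nat \<Rightarrow> complex"
  assumes d: "0 < d" and q: "q < b"
  shows "(\<Sum>i<d * b. if i div d = q then g (i mod d) else 0) = (\<Sum>r<d. g r)"
proof -
  have "(\<Sum>i<d * b. if i div d = q then g (i mod d) else 0) = (\<Sum>i\<in>(\<lambda>r. d * q + r) ` {..<d}. g (i mod d))"
  proof (rule sum.mono_neutral_cong_right)
    show "(\<lambda>r. d * q + r) ` {..<d} \<subseteq> {..<d * b}"
    proof (rule image_subsetI)
      fix r assume "r \<in> {..<d}"
      then have "d * q + r < d * (q + 1)" by simp
      also have "\<dots> \<le> d * b" using q by (intro mult_left_mono) auto
      finally show "d * q + r \<in> {..<d * b}" by simp
    qed
    show "\<forall>i\<in>{..<d * b} - (\<lambda>r. d * q + r) ` {..<d}. (if i div d = q then g (i mod d) else 0) = 0"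
    proof (rule ballI)
      fix i assume "i \<in> {..<d * b} - (\<lambda>r. d * q + r) ` {..<d}"
      then have "i \<notin> (\<lambda>r. d * q + r) ` {..<d}" by blast
      then have "i div d \<noteq> q" using d by (metis image_eqI lessThan_iff mod_less_divisor mult_div_mod_eq)
      then show "(if i div d = q then g (i mod d) else 0) = 0" by simp
    qed
  qed (use d in auto)
  also have "\<dots> = (\<Sum>r<d. g ((d * q + r) mod d))" by (subst sum.reindex) (auto simp: inj_on_def)
  also have "\<dots> = (\<Sum>r<d. g r)" by (rule sum.cong) auto
  finally show ?thesis .
qed

lemma fourier_mat_outside:
  "i < N \<Longrightarrow> j < N \<Longrightarrow> \<not> (i < d * b \<and> j < d * b) \<Longrightarrow> fourier_mat N d b $$ (i, j) = (if i = j then 1 else 0)"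
  unfolding fourier_mat_def by (simp only: index_mat split_conv if_False)

lemma fourier_mat_inside:
  "i < N \<Longrightarrow> j < N \<Longrightarrow> i < d * b \<Longrightarrow> j < d * b \<Longrightarrow> fourier_mat N d b $$ (i, j) =
    (if i div d = j div d then cis (- 2 * pi * (real (i mod d) * real (j mod d)) / d) / sqrt d else 0)"
  unfolding fourier_mat_def by (simp only: index_mat split_conv simp_thms if_True)

lemma fourier_mat_unitary:
  assumes d: "0 < d" and N: "d * b \<le> N"
  shows "fourier_mat N d b \<in> unitary_mats N"
proof (rule unitary_matsI)
  let ?V = "fourier_mat N d b"
  show V: "?V \<in> carrier_mat N N" by (simp add: fourier_mat_def)
  show "mat_adjoint ?V * ?V = 1\<^sub>m N"
  proof (rule eq_matI)
    fix j l assume "j < dim_row (1\<^sub>m N :: complex mat)" "l < dim_col (1\<^sub>m N :: complex mat)"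
    then have jl: "j < N" "l < N" by auto
    have "(mat_adjoint ?V * ?V) $$ (j, l) = (\<Sum>i<N. cnj (?V $$ (i, j)) * ?V $$ (i, l))"
      unfolding mat_mult_entry[OF adjoint_carrier[OF V] V jl]
      by (rule sum.cong) (use jl adjoint_entry[OF V] in auto)
    also have "\<dots> = (if j = l then 1 else 0)"
    proof (cases "j < d * b \<and> l < d * b")
      case False
      have "(\<Sum>i<N. cnj (?V $$ (i, j)) * ?V $$ (i, l)) = (\<Sum>i<N. if i = j then (if j = l then 1 else 0) else 0)"
      proof (rule sum.cong[OF refl])
        fix i assume "i \<in> {..<N}"
        then have i: "i < N" by simp
        show "cnj (?V $$ (i, j)) * ?V $$ (i, l) = (if i = j then (if j = l then 1 else 0) else 0)"
        proof (cases "j < d * b")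
          case True
          then have l: "\<not> l < d * b" using False by simp
          then have "?V $$ (i, l) = (if i = l then 1 else 0)" "?V $$ (l, j) = (if l = j then 1 else 0)"
            using fourier_mat_outside[OF i jl(2)] fourier_mat_outside[OF jl(2,1)] by blast+
          moreover have "j \<noteq> l" using True l by auto
          ultimately show ?thesis by auto
        next
          case False
          then have "?V $$ (i, j) = (if i = j then 1 else 0)" "?V $$ (j, l) = (if j = l then 1 else 0)"
            using fourier_mat_outside[OF i jl(1)] fourier_mat_outside[OF jl] by blast+
          then show ?thesis by auto
        qed
      qed
      then show ?thesis using jl by simp
    next
      case True
      let ?q = "j div d"
      have q: "?q < b" using True by (simp add: less_mult_imp_div_less mult.commute)
      let ?a = "int (j mod d) - int (l mod d)"
      have "(\<Sum>i<N. cnj (?V $$ (i, j)) * ?V $$ (i, l)) = (\<Sum>i<d * b. cnj (?V $$ (i, j)) * ?V $$ (i, l))"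
      proof (rule sum.mono_neutral_right)
        show "\<forall>i\<in>{..<N} - {..<d * b}. cnj (?V $$ (i, j)) * ?V $$ (i, l) = 0"
        proof (rule ballI)
          fix i assume "i \<in> {..<N} - {..<d * b}"
          then have i: "i < N" "\<not> (i < d * b \<and> l < d * b)" "i \<noteq> l" using True by auto
          then show "cnj (?V $$ (i, j)) * ?V $$ (i, l) = 0"
            using fourier_mat_outside[OF i(1) jl(2) i(2)] by simp
        qed
      qed (use N in auto)
      also have "\<dots> = (\<Sum>i<d * b. if i div d = ?q then (if j div d = l div d then cis (real (i mod d) * (2 * pi * ?a / d)) / d else 0) else 0)"
      proof (rule sum.cong[OF refl])
        fix i assume "i \<in> {..<d * b}"
        then have i: "i < d * b" "i < N" using N by auto
        have s: "complex_of_real (sqrt d) * complex_of_real (sqrt d) = of_nat d"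
          by (metis of_nat_0_le_iff of_real_mult of_real_of_nat_eq real_sqrt_mult_self abs_of_nonneg)
        have "- 2 * pi * (real (i mod d) * real (l mod d)) / d - (- 2 * pi * (real (i mod d) * real (j mod d)) / d) =
            real (i mod d) * (2 * pi * ?a / d)"
          using d by (simp add: field_simps)
        then have "cnj (cis (- 2 * pi * (real (i mod d) * real (j mod d)) / d)) * cis (- 2 * pi * (real (i mod d) * real (l mod d)) / d) =
            cis (real (i mod d) * (2 * pi * ?a / d))"
          unfolding cis_cnj cis_mult by (rule arg_cong[where f = cis, THEN trans[rotated]]) (simp add: algebra_simps)
        then have "cnj (cis (- 2 * pi * (real (i mod d) * real (j mod d)) / d) / sqrt d) * (cis (- 2 * pi * (real (i mod d) * real (l mod d)) / d) / sqrt d) =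
            cis (real (i mod d) * (2 * pi * ?a / d)) / d"
          by (simp add: s)
        then show "cnj (?V $$ (i, j)) * ?V $$ (i, l) =
            (if i div d = ?q then (if j div d = l div d then cis (real (i mod d) * (2 * pi * ?a / d)) / d else 0) else 0)"
          using fourier_mat_inside[OF i(2) jl(1) i(1)] fourier_mat_inside[OF i(2) jl(2) i(1)] True by simp
      qed
      also have "\<dots> = (\<Sum>r<d. if j div d = l div d then cis (real r * (2 * pi * ?a / d)) / d else 0)"
        by (rule sum_over_block[OF d q])
      also have "\<dots> = (if j div d = l div d then (if int d dvd ?a then 1 else 0) else 0)"
        using sum_cis_roots_of_unity[OF d, of ?a] d by (simp add: sum_divide_distrib[symmetric])
      also have "\<dots> = (if j = l then 1 else 0)"
      proof -
        have "int d dvd ?a \<longleftrightarrow> j mod d = l mod d"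
          using d by (metis mod_eq_dvd_iff mod_mod_trivial of_nat_eq_iff zmod_int)
        then show ?thesis by (metis div_mult_mod_eq)
      qed
      finally show ?thesis .
    qed
    finally show "(mat_adjoint ?V * ?V) $$ (j, l) = 1\<^sub>m N $$ (j, l)" using jl by simp
  qed (use V in auto)
qed

text \<open>The columns of the discrete Fourier transform are eigenvectors of the cyclic shift,
  with the \<open>d\<close>-th roots of unity as eigenvalues.\<close>

lemma cycle_fourier_eq_fourier_clock:
  assumes d: "0 < d" and N: "d * b \<le> N"
  shows "monomial_mat N (\<lambda>i. if i < d * b then \<zeta> else 1) (block_cycle d b) * fourier_mat N d b =
    fourier_mat N d b * diagonal N (clock d b \<zeta>)"
proof (rule eq_matI)
  let ?V = "fourier_mat N d b" and ?\<pi> = "block_cycle d b" and ?z = "\<lambda>i. if i < d * b then \<zeta> else 1"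
  have V: "?V \<in> carrier_mat N N" by (simp add: fourier_mat_def)
  have \<pi>: "?\<pi> permutes {..<N}" by (rule block_cycle_permutes[OF d N])
  fix i j assume "i < dim_row (?V * diagonal N (clock d b \<zeta>))" "j < dim_col (?V * diagonal N (clock d b \<zeta>))"
  then have ij: "i < N" "j < N" using V by (auto simp: monomial_mat_def)
  obtain k where k: "k < N" "i = ?\<pi> k" using permutes_image[OF \<pi>] ij(1) by (metis image_iff lessThan_iff)
  have "(monomial_mat N ?z ?\<pi> * ?V) $$ (i, j) = (\<Sum>l<N. monomial_mat N ?z ?\<pi> $$ (i, l) * ?V $$ (l, j))"
    by (rule mat_mult_entry) (use V ij in auto)
  also have "\<dots> = (\<Sum>l<N. if l = k then ?z i * ?V $$ (k, j) else 0)"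
  proof (rule sum.cong[OF refl])
    fix l assume "l \<in> {..<N}"
    moreover have "(i = ?\<pi> l) = (l = k)" using k(2) injD[OF permutes_inj[OF \<pi>], of k l] by auto
    ultimately show "monomial_mat N ?z ?\<pi> $$ (i, l) * ?V $$ (l, j) = (if l = k then ?z i * ?V $$ (k, j) else 0)"
      using ij by (simp add: monomial_mat_entry)
  qed
  also have "\<dots> = ?z i * ?V $$ (k, j)" using k by simp
  also have "\<dots> = ?V $$ (i, j) * clock d b \<zeta> j"
  proof (cases "k < d * b")
    case False
    then have "i = k" using k by (simp add: block_cycle_def)
    then show ?thesis using False fourier_mat_outside[OF ij, of d b] by (simp add: clock_def)
  next
    case True
    have i: "i < d * b" "i div d = k div d" "i mod d = Suc (k mod d) mod d"
      using block_cycle_block[OF d True] by (simp_all add: k(2))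
    show ?thesis
    proof (cases "j < d * b \<and> i div d = j div d")
      case False
      have "?V $$ (k, j) = 0 \<and> ?V $$ (i, j) = 0"
      proof (cases "j < d * b")
        case jb: True
        then show ?thesis
          using False i fourier_mat_inside[OF k(1) ij(2) True jb] fourier_mat_inside[OF ij i(1) jb] by simp
      next
        case jb: False
        then have "k \<noteq> j" "i \<noteq> j" using True i by auto
        then show ?thesis
          using jb fourier_mat_outside[OF k(1) ij(2), of d b] fourier_mat_outside[OF ij, of d b] by simp
      qed
      then show ?thesis by simp
    next
      case j: True
      \<comment> \<open>Shifting the row index by one multiplies the entry by the \<open>j\<close>-th power of a
        primitive root of unity, also across the end of the cycle.\<close>
      have "cis (2 * pi * real_of_int (- (int (k mod d) * int (j mod d))) / d) =
          cis (2 * pi * real_of_int (- (int (i mod d) * int (j mod d)) + int (j mod d)) / d)"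
      proof (rule cis_mod_period[OF d])
        have "- (int (k mod d) * int (j mod d)) - (- (int (i mod d) * int (j mod d)) + int (j mod d)) =
            (int (i mod d) - int (Suc (k mod d))) * int (j mod d)"
          by (simp add: algebra_simps)
        moreover have "int d dvd int (i mod d) - int (Suc (k mod d))"
          unfolding i(3) by (metis mod_eq_dvd_iff mod_mod_trivial zmod_int)
        ultimately show "int d dvd - (int (k mod d) * int (j mod d)) - (- (int (i mod d) * int (j mod d)) + int (j mod d))"
          by (simp only: dvd_mult2)
      qed
      then have "cis (- 2 * pi * (real (k mod d) * real (j mod d)) / d) =
          cis (- 2 * pi * (real (i mod d) * real (j mod d)) / d) * cis (2 * pi * real (j mod d) / d)"
        by (simp add: cis_mult algebra_simps add_divide_distrib diff_divide_distrib)
      then show ?thesis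
        using i j fourier_mat_inside[OF k(1) ij(2) True] fourier_mat_inside[OF ij i(1)] by (simp add: clock_def)
    qed
  qed
  also have "\<dots> = (\<Sum>l<N. if l = j then ?V $$ (i, j) * clock d b \<zeta> j else 0)" using ij by simp
  also have "\<dots> = (\<Sum>l<N. ?V $$ (i, l) * diagonal N (clock d b \<zeta>) $$ (l, j))"
    by (rule sum.cong) (use ij in \<open>auto simp: monomial_mat_entry\<close>)
  also have "\<dots> = (?V * diagonal N (clock d b \<zeta>)) $$ (i, j)"
    by (rule mat_mult_entry[symmetric]) (use V ij in auto)
  finally show "(monomial_mat N ?z ?\<pi> * ?V) $$ (i, j) = (?V * diagonal N (clock d b \<zeta>)) $$ (i, j)" .
qed (auto simp: fourier_mat_def monomial_mat_def)

section \<open>Diagonalisation of unitary matrices\<close>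

text \<open>A Householder reflection maps the first unit vector to a multiple \<open>\<beta> * x\<close> of a given
  unit vector. The phase is chosen so that the reflecting vector \<open>u\<close> does not vanish.\<close>

lemma unitary_column_with_direction:
  fixes x :: "nat \<Rightarrow> complex"
  assumes n: "0 < n" and x: "(\<Sum>i<n. x i * cnj (x i)) = 1"
  obtains W \<beta> where "W \<in> unitary_mats n" "norm \<beta> = 1" "\<And>i. i < n \<Longrightarrow> W $$ (i, 0) = \<beta> * x i"
proof -
  define r where "r = norm (x 0)"
  define \<alpha> where "\<alpha> = (if x 0 = 0 then 1 else - x 0 / of_real r)"
  have r: "0 \<le> r" by (simp add: r_def)
  have \<alpha>1: "norm \<alpha> = 1" by (auto simp: \<alpha>_def r_def norm_divide)
  have x0: "x 0 = - \<alpha> * of_real r" by (auto simp: \<alpha>_def r_def)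
  have \<alpha>\<alpha>: "\<alpha> * cnj \<alpha> = 1" "cnj \<alpha> * \<alpha> = 1" using \<alpha>1 complex_norm_square[of \<alpha>] by (auto simp: mult.commute)
  \<comment> \<open>\<open>W\<close> is the reflection in the hyperplane orthogonal to \<open>u\<close>, whose squared length is
    \<open>2 * (1 + r)\<close>.\<close>
  define u where "u i = (if i = 0 then - \<alpha> * of_real (1 + r) else x i)" for i
  define c :: complex where "c = of_real (1 / (1 + r))"
  have c: "c * of_real (1 + r) = 1" using r by (simp add: c_def del: of_real_add)
  define W where "W = Matrix.mat n n (\<lambda>(i, j). (if i = j then 1 else 0) - c * u i * cnj (u j))"
  have We: "W $$ (i, j) = (if i = j then 1 else 0) - c * u i * cnj (u j)" if "i < n" "j < n" for i j
    using that by (simp add: W_def)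
  have W: "W \<in> carrier_mat n n" by (simp add: W_def)
  have uu: "(\<Sum>i<n. cnj (u i) * u i) = 2 * of_real (1 + r)"
  proof -
    have "(\<Sum>i<n. cnj (u i) * u i) = cnj (u 0) * u 0 + (\<Sum>i\<in>{..<n} - {0}. x i * cnj (x i))"
      using n by (subst sum.remove[of _ 0]) (auto simp: u_def mult.commute intro!: sum.cong)
    also have "(\<Sum>i\<in>{..<n} - {0}. x i * cnj (x i)) = 1 - x 0 * cnj (x 0)"
      using x n by (subst (asm) sum.remove[of _ 0]) (auto simp: algebra_simps)
    also have "x 0 * cnj (x 0) = (\<alpha> * cnj \<alpha>) * (of_real r * of_real r)" by (simp add: x0)
    also have "cnj (u 0) * u 0 = (\<alpha> * cnj \<alpha>) * (of_real (1 + r) * of_real (1 + r))" by (simp add: u_def)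
    finally show ?thesis unfolding \<alpha>\<alpha> by (simp add: algebra_simps)
  qed
  have "mat_adjoint W * W = 1\<^sub>m n"
  proof (rule eq_matI)
    fix i j assume "i < dim_row (1\<^sub>m n :: complex mat)" "j < dim_col (1\<^sub>m n :: complex mat)"
    then have ij: "i < n" "j < n" by auto
    have cc: "cnj c = c" by (simp add: c_def)
    have "(mat_adjoint W * W) $$ (i, j) = (\<Sum>k<n. cnj (W $$ (k, i)) * W $$ (k, j))"
      unfolding mat_mult_entry[OF adjoint_carrier[OF W] W ij]
      by (rule sum.cong) (use ij adjoint_entry[OF W] in auto)
    also have "\<dots> = (\<Sum>k<n. (if k = j then (if i = j then 1 else 0) - c * u i * cnj (u j) else 0) +
        (if k = i then - (c * u i * cnj (u j)) else 0) + c * c * u i * cnj (u j) * (cnj (u k) * u k))"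
    proof (rule sum.cong[OF refl])
      fix k assume "k \<in> {..<n}"
      then have k: "k < n" by simp
      have a: "cnj (W $$ (k, i)) = (if k = i then 1 else 0) - c * cnj (u k) * u i"
        unfolding We[OF k ij(1)] by (simp add: cc)
      show "cnj (W $$ (k, i)) * W $$ (k, j) = (if k = j then (if i = j then 1 else 0) - c * u i * cnj (u j) else 0) +
        (if k = i then - (c * u i * cnj (u j)) else 0) + c * c * u i * cnj (u j) * (cnj (u k) * u k)"
        unfolding a We[OF k ij(2)] by (cases "k = i"; cases "k = j") (simp_all add: algebra_simps)
    qed
    also have "\<dots> = ((if i = j then 1 else 0) - c * u i * cnj (u j)) - c * u i * cnj (u j) +
        c * c * u i * cnj (u j) * (2 * of_real (1 + r))"
      unfolding sum.distrib sum_distrib_left[symmetric] uu using ij by simp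
    also have "c * c * u i * cnj (u j) * (2 * of_real (1 + r)) = 2 * (c * of_real (1 + r)) * (c * u i * cnj (u j))"
      by (simp only: mult_ac)
    finally show "(mat_adjoint W * W) $$ (i, j) = 1\<^sub>m n $$ (i, j)" unfolding c using ij by simp
  qed (use W in auto)
  then have "W \<in> unitary_mats n" by (rule unitary_matsI[OF W])
  moreover have "W $$ (i, 0) = cnj \<alpha> * x i" if "i < n" for i
  proof (cases "i = 0")
    case True
    have "W $$ (0, 0) = 1 - (c * of_real (1 + r)) * (\<alpha> * cnj \<alpha>) * of_real (1 + r)"
      using We[OF n n] by (simp add: u_def mult_ac)
    also have "\<dots> = - of_real r" unfolding c \<alpha>\<alpha> by simp
    also have "\<dots> = cnj \<alpha> * x 0" unfolding x0 using \<alpha>\<alpha> by (simp add: mult.assoc[symmetric])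
    finally show ?thesis using True by simp
  next
    case False
    then have "W $$ (i, 0) = (c * of_real (1 + r)) * (cnj \<alpha> * x i)"
      using We[OF that n] by (simp add: u_def mult_ac)
    then show ?thesis unfolding c by simp
  qed
  ultimately show ?thesis using \<alpha>1 by (intro that[of W "cnj \<alpha>"]) auto
qed

text \<open>The direct sum of the 1 by 1 matrix \<open>a\<close> and \<open>C\<close>.\<close>

definition corner_mat :: "nat \<Rightarrow> complex \<Rightarrow> complex mat \<Rightarrow> complex mat" where
  "corner_mat N a C = Matrix.mat (Suc N) (Suc N) (\<lambda>(i, j).
     case i of 0 \<Rightarrow> (case j of 0 \<Rightarrow> a | Suc _ \<Rightarrow> 0) | Suc i' \<Rightarrow> (case j of 0 \<Rightarrow> 0 | Suc j' \<Rightarrow> C $$ (i', j')))"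

lemma corner_mat_carrier [simp]: "corner_mat N a C \<in> carrier_mat (Suc N) (Suc N)"
  by (simp add: corner_mat_def)

lemma corner_mat_entries:
  "corner_mat N a C $$ (0, 0) = a"
  "j < N \<Longrightarrow> corner_mat N a C $$ (0, Suc j) = 0"
  "i < N \<Longrightarrow> corner_mat N a C $$ (Suc i, 0) = 0"
  "i < N \<Longrightarrow> j < N \<Longrightarrow> corner_mat N a C $$ (Suc i, Suc j) = C $$ (i, j)"
  by (simp_all add: corner_mat_def)

lemma mat_eq_cornerI:
  assumes A: "A \<in> carrier_mat (Suc N) (Suc N)" "A $$ (0, 0) = a" "\<And>j. j < N \<Longrightarrow> A $$ (0, Suc j) = 0"
    "\<And>i. i < N \<Longrightarrow> A $$ (Suc i, 0) = 0" "\<And>i j. i < N \<Longrightarrow> j < N \<Longrightarrow> A $$ (Suc i, Suc j) = C $$ (i, j)"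
  shows "A = corner_mat N a C"
proof (rule eq_matI)
  fix i j assume "i < dim_row (corner_mat N a C)" "j < dim_col (corner_mat N a C)"
  then have ij: "i < Suc N" "j < Suc N" by (auto simp: corner_mat_def)
  show "A $$ (i, j) = corner_mat N a C $$ (i, j)"
    using ij A corner_mat_entries[where N = N and a = a and C = C] by (cases i; cases j) auto
qed (use A in \<open>auto simp: corner_mat_def\<close>)

lemma corner_mat_mult:
  assumes "C \<in> carrier_mat N N" "D \<in> carrier_mat N N"
  shows "corner_mat N a C * corner_mat N b D = corner_mat N (a * b) (C * D)"
proof (rule mat_eq_cornerI)
  note e = mat_mult_entry[OF corner_mat_carrier corner_mat_carrier]
  note s = sum.lessThan_Suc_shift corner_mat_entries
  show "(corner_mat N a C * corner_mat N b D) $$ (0, 0) = a * b"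
    by (subst e) (simp_all add: s del: sum.lessThan_Suc)
  show "(corner_mat N a C * corner_mat N b D) $$ (0, Suc j) = 0" if "j < N" for j
    using that by (subst e) (simp_all add: s del: sum.lessThan_Suc)
  show "(corner_mat N a C * corner_mat N b D) $$ (Suc i, 0) = 0" if "i < N" for i
    using that by (subst e) (simp_all add: s del: sum.lessThan_Suc)
  show "(corner_mat N a C * corner_mat N b D) $$ (Suc i, Suc j) = (C * D) $$ (i, j)" if "i < N" "j < N" for i j
    using that by (subst e) (simp_all add: s mat_mult_entry[OF assms] del: sum.lessThan_Suc)
qed (rule mult_carrier_mat[OF corner_mat_carrier corner_mat_carrier])

lemma corner_mat_adjoint:
  assumes "C \<in> carrier_mat N N"
  shows "mat_adjoint (corner_mat N a C) = corner_mat N (cnj a) (mat_adjoint C)"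
proof (rule mat_eq_cornerI)
  show "mat_adjoint (corner_mat N a C) \<in> carrier_mat (Suc N) (Suc N)" by simp
qed (simp_all add: adjoint_entry[OF corner_mat_carrier] corner_mat_entries adjoint_entry[OF assms])

lemma corner_mat_one: "corner_mat N 1 (1\<^sub>m N) = 1\<^sub>m (Suc N)"
  by (rule mat_eq_cornerI[symmetric]) auto

lemma corner_mat_diagonal: "corner_mat N a (diagonal N z) = diagonal (Suc N) (case_nat a z)"
  by (rule mat_eq_cornerI[symmetric]) (simp_all add: monomial_mat_entry)

lemma corner_mat_unitary:
  assumes "V \<in> unitary_mats N"
  shows "corner_mat N 1 V \<in> unitary_mats (Suc N)"
  using unitary_matsD[OF assms]
  by (intro unitary_matsI) (simp_all add: corner_mat_adjoint corner_mat_mult corner_mat_one)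

text \<open>Induction on the size. Conjugating by a unitary matrix whose first column is an
  eigenvector clears the first column below the diagonal; the eigenvalue has modulus 1, and
  since the rows of a unitary matrix are unit vectors, the first row is cleared as well.\<close>

theorem unitary_diagonalization:
  assumes "A \<in> unitary_mats N"
  shows "\<exists>V\<in>unitary_mats N. \<exists>z. (\<forall>i. norm (z i) = 1) \<and> A = V * diagonal N z * mat_adjoint V"
  using assms
proof (induction N arbitrary: A)
  case 0
  then have "A = 1\<^sub>m 0" by (intro eq_matI) (auto simp: unitary_mats_def)
  moreover have "1\<^sub>m 0 * diagonal 0 (\<lambda>_. 1) * mat_adjoint (1\<^sub>m 0) = (1\<^sub>m 0 :: complex mat)"
    by (intro eq_matI) auto
  ultimately have "A = 1\<^sub>m 0 * diagonal 0 (\<lambda>_. 1) * mat_adjoint (1\<^sub>m 0)" by (simp only:)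
  moreover have "\<forall>i :: nat. norm (1 :: complex) = 1" by simp
  ultimately show ?case
    by (intro bexI[OF _ unitary_mats_one] exI[of _ "\<lambda>_. 1"] conjI)
next
  case (Suc N)
  let ?n = "Suc N"
  note A = unitary_matsD[OF Suc.prems]
  have "spectrum A \<noteq> {}" by (rule spectrum_non_empty[OF A(1)]) simp
  then obtain l where "eigenvalue A l" by (auto simp: spectrum_def)
  then obtain v where v: "v \<in> carrier_vec ?n" "v \<noteq> 0\<^sub>v ?n" "A *\<^sub>v v = l \<cdot>\<^sub>v v"
    using A(1) by (auto simp: eigenvalue_def eigenvector_def)
  define s where "s = (\<Sum>i<?n. (norm (vec_index v i))\<^sup>2)"
  have "\<exists>i<?n. vec_index v i \<noteq> 0"
  proof (rule ccontr)
    assume "\<not> (\<exists>i<?n. vec_index v i \<noteq> 0)"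
    then have "v = 0\<^sub>v ?n" using v(1) by (intro eq_vecI) auto
    with v(2) show False by simp
  qed
  then obtain i0 where i0: "i0 < ?n" "vec_index v i0 \<noteq> 0" by blast
  have "(norm (vec_index v i0))\<^sup>2 \<le> s" unfolding s_def by (rule member_le_sum) (use i0 in auto)
  then have s: "0 < s" using i0 by (smt (verit) zero_less_norm_iff zero_less_power)
  define x where "x i = vec_index v i / of_real (sqrt s)" for i
  have x1: "(\<Sum>i<?n. x i * cnj (x i)) = 1"
  proof -
    have "x i * cnj (x i) = of_real ((norm (vec_index v i))\<^sup>2 / s)" for i
    proof -
      have "complex_of_real (sqrt s) * complex_of_real (sqrt s) = of_real s"
        using s by (metis of_real_mult real_sqrt_mult_self abs_of_pos)
      then show ?thesis by (simp only: x_def complex_cnj_divide complex_cnj_complex_of_real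
          times_divide_times_eq of_real_divide complex_norm_square)
    qed
    then have "(\<Sum>i<?n. x i * cnj (x i)) = of_real (\<Sum>i<?n. (norm (vec_index v i))\<^sup>2 / s)" by simp
    also have "(\<Sum>i<?n. (norm (vec_index v i))\<^sup>2 / s) = 1" using s by (simp add: sum_divide_distrib[symmetric] s_def[symmetric] del: sum.lessThan_Suc)
    finally show ?thesis by simp
  qed
  have Ax: "(\<Sum>j<?n. A $$ (i, j) * x j) = l * x i" if i: "i < ?n" for i
  proof -
    have "vec_index (A *\<^sub>v v) i = (\<Sum>j<?n. A $$ (i, j) * vec_index v j)"
      using i v(1) A(1) by (auto simp: scalar_prod_def lessThan_atLeast0 intro!: sum.cong)
    moreover have "vec_index (l \<cdot>\<^sub>v v) i = l * vec_index v i" using i v(1) by simp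
    ultimately have "(\<Sum>j<?n. A $$ (i, j) * vec_index v j) = l * vec_index v i" using v(3) by simp
    then have "(\<Sum>j<?n. A $$ (i, j) * vec_index v j) / of_real (sqrt s) = l * vec_index v i / of_real (sqrt s)" by simp
    then show ?thesis unfolding x_def sum_divide_distrib by (simp del: sum.lessThan_Suc)
  qed
  obtain W \<beta> where W: "W \<in> unitary_mats ?n" "norm \<beta> = 1" "\<And>i. i < ?n \<Longrightarrow> W $$ (i, 0) = \<beta> * x i"
    using unitary_column_with_direction[OF _ x1] by blast
  note W' = unitary_matsD[OF W(1)]
  define B where "B = mat_adjoint W * (A * W)"
  have BU: "B \<in> unitary_mats ?n"
    unfolding B_def by (intro unitary_mats_mult unitary_mats_adjoint W Suc.prems)
  note B = unitary_matsD[OF BU]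
  have AW: "A * W \<in> carrier_mat ?n ?n" using A W' by simp
  have Bcol: "B $$ (i, 0) = (if i = 0 then l else 0)" if i: "i < ?n" for i
  proof -
    have AW0: "(A * W) $$ (k, 0) = l * W $$ (k, 0)" if k: "k < ?n" for k
    proof -
      have "(A * W) $$ (k, 0) = (\<Sum>j<?n. A $$ (k, j) * W $$ (j, 0))"
        by (rule mat_mult_entry[OF A(1) W'(1)]) (use k in auto)
      also have "\<dots> = (\<Sum>j<?n. \<beta> * (A $$ (k, j) * x j))" by (rule sum.cong) (use W(3) in auto)
      also have "\<dots> = \<beta> * (l * x k)" unfolding sum_distrib_left[symmetric] Ax[OF k] ..
      finally show ?thesis using W(3)[OF k] by simp
    qed
    have "B $$ (i, 0) = (\<Sum>k<?n. mat_adjoint W $$ (i, k) * (A * W) $$ (k, 0))"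
      unfolding B_def by (rule mat_mult_entry[OF W'(2) AW]) (use i in auto)
    also have "\<dots> = (\<Sum>k<?n. l * (mat_adjoint W $$ (i, k) * W $$ (k, 0)))"
      by (rule sum.cong) (use AW0 in auto)
    also have "\<dots> = l * (mat_adjoint W * W) $$ (i, 0)"
      unfolding sum_distrib_left[symmetric] by (subst mat_mult_entry[OF W'(2,1)]) (use i in auto)
    finally show ?thesis using i by (simp add: W'(4))
  qed
  have l1: "cnj l * l = 1"
  proof -
    have "(mat_adjoint B * B) $$ (0, 0) = (\<Sum>k<?n. cnj (B $$ (k, 0)) * B $$ (k, 0))"
      by (subst mat_mult_entry[OF B(2,1)]) (auto simp: adjoint_entry[OF B(1)] intro!: sum.cong simp del: sum.lessThan_Suc)
    also have "\<dots> = (\<Sum>k<?n. if k = 0 then cnj l * l else 0)"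
      by (rule sum.cong) (use Bcol in auto)
    also have "\<dots> = cnj l * l" by (simp del: sum.lessThan_Suc)
    finally show ?thesis by (simp add: B(4))
  qed
  then have nl: "norm l = 1"
    using complex_norm_square[of l] by (simp add: mult.commute) (metis norm_ge_zero of_real_eq_1_iff of_real_power power2_eq_1_iff abs_of_nonneg abs_1 abs_minus_cancel norm_one)
  have Brow: "B $$ (0, Suc j) = 0" if j: "j < N" for j
  proof -
    have "(B * mat_adjoint B) $$ (0, 0) = (\<Sum>k<?n. of_real ((norm (B $$ (0, k)))\<^sup>2))"
      by (subst mat_mult_entry[OF B(1,2)])
         (auto simp: adjoint_entry[OF B(1)] complex_norm_square[symmetric] intro!: sum.cong simp del: sum.lessThan_Suc)
    then have "of_real (\<Sum>k<?n. (norm (B $$ (0, k)))\<^sup>2) = (1 :: complex)"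
      by (simp add: B(3) del: sum.lessThan_Suc)
    then have "(\<Sum>k<?n. (norm (B $$ (0, k)))\<^sup>2) = 1" by (simp only: of_real_eq_1_iff)
    then have "(\<Sum>k<N. (norm (B $$ (0, Suc k)))\<^sup>2) = 0"
      unfolding sum.lessThan_Suc_shift using Bcol[of 0] nl by simp
    then have "\<forall>k\<in>{..<N}. (norm (B $$ (0, Suc k)))\<^sup>2 = 0" by (subst (asm) sum_nonneg_eq_0_iff) auto
    then show ?thesis using j by simp
  qed
  define C where "C = Matrix.mat N N (\<lambda>(i, j). B $$ (Suc i, Suc j))"
  have C: "C \<in> carrier_mat N N" by (simp add: C_def)
  have BC: "B = corner_mat N l C"
    by (rule mat_eq_cornerI) (use B(1) Bcol Brow in \<open>auto simp: C_def\<close>)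
  have "mat_adjoint C * C = 1\<^sub>m N"
  proof (rule eq_matI)
    fix i j assume "i < dim_row (1\<^sub>m N :: complex mat)" "j < dim_col (1\<^sub>m N :: complex mat)"
    then have ij: "i < N" "j < N" by auto
    have "corner_mat N (cnj l * l) (mat_adjoint C * C) = 1\<^sub>m ?n"
      using B(4) unfolding BC corner_mat_adjoint[OF C] corner_mat_mult[OF adjoint_carrier[OF C] C] .
    from arg_cong[OF this, of "\<lambda>M. M $$ (Suc i, Suc j)"]
    show "(mat_adjoint C * C) $$ (i, j) = 1\<^sub>m N $$ (i, j)"
      using ij by (simp add: corner_mat_entries)
  qed (use C in auto)
  then have "C \<in> unitary_mats N" by (rule unitary_matsI[OF C])
  from Suc.IH[OF this] obtain V z where V: "V \<in> unitary_mats N" "\<forall>i. norm (z i) = 1"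
    "C = V * diagonal N z * mat_adjoint V" by blast
  note V' = unitary_matsD[OF V(1)]
  let ?V = "corner_mat N 1 V"
  have B2: "B = ?V * diagonal ?n (case_nat l z) * mat_adjoint ?V"
    unfolding BC V(3) corner_mat_adjoint[OF V'(1)] corner_mat_diagonal[symmetric]
      corner_mat_mult[OF V'(1) monomial_mat_carrier]
    by (subst corner_mat_mult[OF mult_carrier_mat[OF V'(1) monomial_mat_carrier] V'(2)]) simp
  have VV: "?V \<in> unitary_mats ?n" by (rule corner_mat_unitary[OF V(1)])
  note VV' = unitary_matsD[OF VV]
  have "A = W * B * mat_adjoint W"
  proof -
    have "W * B = A * W"
      unfolding B_def by (rule trans[OF assoc_mult_mat[OF W'(1,2) AW, symmetric]]) (simp only: W'(3) left_mult_one_mat[OF AW])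
    then show ?thesis using assoc_mult_mat[OF A(1) W'(1,2)] A(1) by (simp add: W'(3))
  qed
  also have "\<dots> = (W * ?V) * diagonal ?n (case_nat l z) * (mat_adjoint ?V * mat_adjoint W)"
  proof -
    note D = monomial_mat_carrier[of ?n "case_nat l z" id]
    note m = mult_carrier_mat[of _ ?n ?n _ ?n]
    show ?thesis
      unfolding B2 assoc_mult_mat[OF W'(1) VV'(1) D] 
        assoc_mult_mat[OF W'(1) m[OF VV'(1) D] m[OF VV'(2) W'(2)]]
        assoc_mult_mat[OF W'(1) m[OF m[OF VV'(1) D] VV'(2)] W'(2)]
        assoc_mult_mat[OF m[OF VV'(1) D] VV'(2) W'(2)] ..
  qed
  also have "mat_adjoint ?V * mat_adjoint W = mat_adjoint (W * ?V)"
    by (rule mat_adjoint_mult[OF W'(1) VV'(1), symmetric])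
  finally show ?case
  proof (intro bexI[OF _ unitary_mats_mult[OF W(1) VV]] exI[of _ "case_nat l z"] conjI)
    show "\<forall>i. norm (case i of 0 \<Rightarrow> l | Suc x \<Rightarrow> z x) = 1" using V(2) nl by (simp split: nat.split)
  qed
qed

section \<open>Positive-definite class functions on a unitary group\<close>

locale unitary_class_function =
  fixes N :: nat and f :: "complex mat \<Rightarrow> complex"
  assumes one: "f (1\<^sub>m N) = 1"
    and central: "\<And>A B. A \<in> unitary_mats N \<Longrightarrow> B \<in> unitary_mats N \<Longrightarrow> f (A * B) = f (B * A)"
    and pd: "\<And>(m::nat) X c. (\<And>i. i < m \<Longrightarrow> X i \<in> unitary_mats N) \<Longrightarrow>
      (\<Sum>i<m. \<Sum>j<m. c i * cnj (c j) * f (mat_adjoint (X j) * X i)) \<in> \<real>\<^sub>\<ge>\<^sub>0"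
    and cont: "\<And>Z z. (\<And>n i. norm (Z n i) = 1) \<Longrightarrow> (\<And>i. norm (z i) = 1) \<Longrightarrow>
      (\<And>i. i < N \<Longrightarrow> (\<lambda>n. Z n i) \<longlonglongrightarrow> z i) \<Longrightarrow> (\<lambda>n. f (diagonal N (Z n))) \<longlonglongrightarrow> f (diagonal N z)"
begin

lemma pd_finite:
  assumes "finite I" and X: "\<And>s. s \<in> I \<Longrightarrow> X s \<in> unitary_mats N"
  shows "(\<Sum>s\<in>I. \<Sum>t\<in>I. c s * cnj (c t) * f (mat_adjoint (X t) * X s)) \<in> \<real>\<^sub>\<ge>\<^sub>0"
proof -
  obtain h where h: "bij_betw h {..<card I} I"
    using ex_bij_betw_nat_finite[OF assms(1)] by (auto simp: atLeast0LessThan)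
  have "(\<Sum>s\<in>I. \<Sum>t\<in>I. c s * cnj (c t) * f (mat_adjoint (X t) * X s)) =
      (\<Sum>i<card I. \<Sum>t\<in>I. c (h i) * cnj (c t) * f (mat_adjoint (X t) * X (h i)))"
    by (rule sum.reindex_bij_betw[OF h, symmetric])
  also have "\<dots> = (\<Sum>i<card I. \<Sum>j<card I. c (h i) * cnj (c (h j)) * f (mat_adjoint (X (h j)) * X (h i)))"
    by (intro sum.cong refl sum.reindex_bij_betw[OF h, symmetric])
  finally show ?thesis
    using pd[of "card I" "X \<circ> h" "c \<circ> h"] X bij_betwE[OF h] by simp
qed

lemma conjugate:
  assumes V: "V \<in> unitary_mats N" and A: "A \<in> unitary_mats N"
  shows "f (V * A * mat_adjoint V) = f A"
proof -
  note V' = unitary_matsD[OF V] and A' = unitary_matsD[OF A]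
  have "f (V * A * mat_adjoint V) = f (mat_adjoint V * (V * A))"
    by (rule central[OF unitary_mats_mult[OF V A] unitary_mats_adjoint[OF V]])
  also have "mat_adjoint V * (V * A) = A"
    unfolding assoc_mult_mat[OF V'(2,1) A'(1), symmetric] V'(4) using A'(1) by simp
  finally show ?thesis .
qed

lemma hermitian:
  assumes A: "A \<in> unitary_mats N"
  shows "f (mat_adjoint A) = cnj (f A)"
proof -
  note A' = unitary_matsD[OF A]
  let ?X = "\<lambda>i::nat. if i = 0 then 1\<^sub>m N else A"
  have one': "mat_adjoint (1\<^sub>m N) = (1\<^sub>m N :: complex mat)" by (intro eq_matI) (auto simp: mat_adjoint_index)
  have "(\<Sum>i<2. \<Sum>j<2. (if i = 0 then 1 else c) * cnj (if j = 0 then 1 else c) * f (mat_adjoint (?X j) * ?X i)) \<in> \<real>\<^sub>\<ge>\<^sub>0"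
    for c
    by (rule pd[where c = "\<lambda>i. if i = 0 then 1 else c"]) (use A unitary_mats_one in auto)
  then have "Im (1 + cnj c * f (mat_adjoint A) + (c * f A + c * cnj c)) = 0" for c
    using A' by (simp add: one' one numeral_2_eq_2 complex_nonneg_Reals_iff)
  from this[of 1] this[of \<i>] show ?thesis by (simp add: complex_eq_iff)
qed

text \<open>The Cauchy-Schwarz inequality of the positive-definite form, obtained by adding the
  identity matrix to the family with the coefficient \<open>- S\<close>.\<close>

lemma norm_sum_power2_le:
  assumes I: "finite I" and X: "\<And>s. s \<in> I \<Longrightarrow> X s \<in> unitary_mats N"
  shows "(norm (\<Sum>s\<in>I. c s * f (X s)))\<^sup>2 \<le> Re (\<Sum>s\<in>I. \<Sum>t\<in>I. c s * cnj (c t) * f (mat_adjoint (X t) * X s))"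
proof -
  define S where "S = (\<Sum>s\<in>I. c s * f (X s))"
  define Q where "Q = (\<Sum>s\<in>I. \<Sum>t\<in>I. c s * cnj (c t) * f (mat_adjoint (X t) * X s))"
  define X' where "X' = case_option (1\<^sub>m N) X"
  define c' where "c' = case_option (- S) c"
  have one': "mat_adjoint (1\<^sub>m N) = (1\<^sub>m N :: complex mat)" by (intro eq_matI) (auto simp: mat_adjoint_index)
  have S': "(\<Sum>s\<in>I. cnj (c s) * f (mat_adjoint (X s))) = cnj S"
    unfolding S_def cnj_sum by (rule sum.cong) (auto simp: hermitian[OF X])
  have row: "(\<Sum>t\<in>insert None (Some ` I). g t) = g None + (\<Sum>t\<in>I. g (Some t))" for g :: "'a option \<Rightarrow> complex"
    using I by (subst sum.insert) (auto simp: sum.reindex)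
  have "(\<Sum>s\<in>insert None (Some ` I). \<Sum>t\<in>insert None (Some ` I). c' s * cnj (c' t) * f (mat_adjoint (X' t) * X' s)) \<in> \<real>\<^sub>\<ge>\<^sub>0"
    by (rule pd_finite) (use I X unitary_mats_one in \<open>auto simp: X'_def\<close>)
  also have "(\<Sum>s\<in>insert None (Some ` I). \<Sum>t\<in>insert None (Some ` I). c' s * cnj (c' t) * f (mat_adjoint (X' t) * X' s)) =
     (S * cnj S + (\<Sum>t\<in>I. - S * (cnj (c t) * f (mat_adjoint (X t))))) +
     (\<Sum>s\<in>I. - cnj S * (c s * f (X s)) + (\<Sum>t\<in>I. c s * cnj (c t) * f (mat_adjoint (X t) * X s)))"
    unfolding row
    by (intro arg_cong2[where f = "(+)"] sum.cong refl)
       (auto simp: X'_def c'_def one' one unitary_matsD[OF X] left_mult_one_mat[OF unitary_matsD(1)[OF X]] right_mult_one_mat[OF unitary_matsD(2)[OF X]])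
  also have "\<dots> = Q - S * cnj S"
    unfolding sum.distrib sum_distrib_left[symmetric] S' S_def[symmetric] Q_def[symmetric] by simp
  finally have "0 \<le> Re (Q - S * cnj S)" by (simp add: complex_nonneg_Reals_iff)
  then have "Re (S * cnj S) \<le> Re Q" by simp
  also have "S * cnj S = of_real ((norm S)\<^sup>2)" by (rule complex_norm_square[symmetric])
  finally show ?thesis by (simp add: S_def Q_def)
qed

text \<open>Permutation matrices permute the diagonal entries by conjugation, so the restriction
  to the diagonal torus is symmetric.\<close>

lemma weights:
  obtains p where "exchangeable N p"
    "\<And>z. (\<And>i. norm (z i) = 1) \<Longrightarrow> f (diagonal N z) = measure_pmf.expectation p (torus_monomial N z)"
proof (rule symmetric_torus_bochner[where N = N and F = "\<lambda>z. f (diagonal N z)"])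
  show "f (diagonal N z) = f (diagonal N z')" if "\<And>i. i < N \<Longrightarrow> z i = z' i" for z z'
    by (rule arg_cong[where f = f]) (rule monomial_mat_cong[OF that])
  show "f (diagonal N (\<lambda>_. 1)) = 1" by (simp add: diagonal_one one)
  show "(\<Sum>s\<in>I. \<Sum>t\<in>I. c s * cnj (c t) * f (diagonal N (\<lambda>i. Z s i * cnj (Z t i)))) \<in> \<real>\<^sub>\<ge>\<^sub>0"
    if "finite I" "\<And>s i. s \<in> I \<Longrightarrow> norm (Z s i) = 1" for I :: "(nat \<Rightarrow> nat) set" and Z c
  proof -
    have "(\<Sum>s\<in>I. \<Sum>t\<in>I. c s * cnj (c t) * f (mat_adjoint (diagonal N (Z t)) * diagonal N (Z s))) \<in> \<real>\<^sub>\<ge>\<^sub>0"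
      by (rule pd_finite) (use that monomial_mat_unitary[OF permutes_id_lessThan] in auto)
    then show ?thesis by (simp add: adjoint_monomial_mult_monomial mult.commute)
  qed
  show "(\<lambda>n. f (diagonal N (Z n))) \<longlonglongrightarrow> f (diagonal N z)" if "\<And>n i. norm (Z n i) = 1" "\<And>i. norm (z i) = 1"
      "\<And>i. i < N \<Longrightarrow> (\<lambda>n. Z n i) \<longlonglongrightarrow> z i" for Z z by (rule cont[OF that])
  show "f (diagonal N (z \<circ> \<sigma>)) = f (diagonal N z)" if z: "\<And>i. norm (z i) = 1" and \<sigma>: "\<sigma> permutes {..<N}" for z \<sigma>
  proof -
    have \<sigma>': "inv_into UNIV \<sigma> permutes {..<N}" by (rule permutes_inv[OF \<sigma>])
    have "f (diagonal N (z \<circ> inv_into UNIV (inv_into UNIV \<sigma>))) = f (diagonal N z)"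
      unfolding permutation_conjugate_diagonal[OF \<sigma>', symmetric]
      by (rule conjugate[OF monomial_mat_unitary[OF \<sigma>'] monomial_mat_unitary[OF permutes_id_lessThan]]) (use z in auto)
    then show ?thesis by (simp add: permutes_inv_inv[OF \<sigma>])
  qed
qed blast

lemma near_one:
  assumes "0 < e"
  shows "\<exists>d>0. \<forall>x. 0 \<le> x \<longrightarrow> x \<le> d \<longrightarrow> 1 - e \<le> Re (f (diagonal N (one_coordinate 0 (cis x))))"
proof -
  obtain d where "0 < d" "\<And>x. 0 \<le> x \<Longrightarrow> x \<le> d \<Longrightarrow> 1 - e \<le> Re (f (diagonal N (one_coordinate 0 (cis x))))"
  proof (rule torus_continuity_near_one[where N = N and F = "\<lambda>z. f (diagonal N z)" and i = 0])
    show "(\<lambda>n. f (diagonal N (Z n))) \<longlonglongrightarrow> f (diagonal N z)" if "\<And>n i. norm (Z n i) = 1" "\<And>i. norm (z i) = 1"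
      "\<And>i. i < N \<Longrightarrow> (\<lambda>n. Z n i) \<longlonglongrightarrow> z i" for Z z by (rule cont[OF that])
  qed (use assms diagonal_one one in auto)
  then show ?thesis by blast
qed

lemma cycle_eq_clock:
  assumes d: "0 < d" and N: "d * b \<le> N" and \<zeta>: "norm \<zeta> = 1"
  shows "f (monomial_mat N (\<lambda>i. if i < d * b then \<zeta> else 1) (block_cycle d b)) = f (diagonal N (clock d b \<zeta>))"
proof -
  let ?V = "fourier_mat N d b" and ?M = "monomial_mat N (\<lambda>i. if i < d * b then \<zeta> else 1) (block_cycle d b)"
  have V: "?V \<in> unitary_mats N" by (rule fourier_mat_unitary[OF d N])
  note V' = unitary_matsD[OF V]
  have D: "diagonal N (clock d b \<zeta>) \<in> unitary_mats N"
    by (rule monomial_mat_unitary[OF permutes_id_lessThan]) (use \<zeta> in \<open>auto simp: clock_def norm_mult\<close>)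
  have M: "?M \<in> carrier_mat N N" by simp
  have "?M = ?M * (?V * mat_adjoint ?V)" unfolding V'(3) by (rule right_mult_one_mat[OF M, symmetric])
  also have "\<dots> = ?M * ?V * mat_adjoint ?V" by (rule assoc_mult_mat[OF M V'(1,2), symmetric])
  also have "\<dots> = ?V * diagonal N (clock d b \<zeta>) * mat_adjoint ?V" unfolding cycle_fourier_eq_fourier_clock[OF d N] ..
  finally show ?thesis using conjugate[OF V D] by simp
qed

end

lemma torus_monomial_mult: "torus_monomial N (\<lambda>i. y i * z i) w = torus_monomial N y w * torus_monomial N z w"
  by (simp add: torus_monomial_def power_int_mult_distrib prod.distrib)

lemma torus_monomial_cnj: "torus_monomial N (\<lambda>i. cnj (z i)) w = cnj (torus_monomial N z w)"
  by (simp add: torus_monomial_def)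

lemma torus_monomial_compose:
  assumes "\<sigma> permutes {..<N}"
  shows "torus_monomial N (z \<circ> \<sigma>) w = torus_monomial N z (w \<circ> inv_into UNIV \<sigma>)"
  using torus_monomial_permute[OF permutes_inv[OF assms], of z w] permutes_inv_inv[OF assms] by simp

lemma torus_monomial_unit_cnj:
  assumes "\<And>i. norm (z i) = 1"
  shows "torus_monomial N (\<lambda>i. cnj (z i)) w = torus_monomial N z (\<lambda>i. - w i)"
  unfolding torus_monomial_def
proof (rule prod.cong[OF refl])
  fix i
  have "cnj (z i) * z i = 1" using assms[of i] complex_norm_square[of "z i"] by (simp add: mult.commute)
  then have "cnj (z i) = inverse (z i)" by (metis inverse_unique mult.commute)
  then show "cnj (z i) powi w i = z i powi (- w i)" by (simp add: power_int_minus power_int_inverse)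
qed

text \<open>In each coordinate the powers of the roots of unity cancel unless the exponent is
  divisible by \<open>m\<close>.\<close>

lemma sum_torus_monomial:
  fixes v :: "nat \<Rightarrow> int" and m :: nat
  assumes m: "0 < m"
  shows "(\<Sum>s\<in>torus_points N m. torus_monomial N (torus_point N m s) v) =
    (if \<forall>i<N. int m dvd v i then of_nat m ^ N else 0)"
proof -
  have "(\<Sum>s\<in>torus_points N m. torus_monomial N (torus_point N m s) v) =
      (\<Sum>s\<in>PiE {..<N} (\<lambda>_. {..<m}). \<Prod>i<N. cis (real (s i) * (2 * pi * v i / m)))"
    unfolding torus_points_def torus_monomial_def
    by (intro sum.cong prod.cong refl) (simp add: torus_point_def cis_power_int mult_ac)
  also have "\<dots> = (\<Prod>i<N. \<Sum>r<m. cis (real r * (2 * pi * v i / m)))"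
    by (subst prod_sum_PiE) auto
  also have "\<dots> = (\<Prod>i<N. if int m dvd v i then of_nat m else 0)"
    by (simp only: sum_cis_roots_of_unity[OF m])
  also have "\<dots> = (if \<forall>i<N. int m dvd v i then of_nat m ^ N else 0)"
  proof (cases "\<forall>i<N. int m dvd v i")
    case True
    then have "(\<Prod>i<N. if int m dvd v i then of_nat m else (0::complex)) = (\<Prod>i<N. of_nat m)" by (intro prod.cong) auto
    then show ?thesis using True by simp
  qed (auto intro!: prod_zero)
  finally show ?thesis .
qed

text \<open>A vector invariant under the cycles is constant on each cycle, so it is nonzero at the
  first two positions of some cycle as soon as it is nonzero at any position of the cycles.\<close>

lemma block_cycle_invariant_nonzero:
  fixes w :: "nat \<Rightarrow> int"
  assumes d: "2 \<le> d" and N: "d * b \<le> N" and inv: "\<And>j. j < N \<Longrightarrow> w (block_cycle d b j) = w j"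
    and i: "i < d * b" "w i \<noteq> 0"
  shows "\<exists>j<b. w (d * j) \<noteq> 0 \<and> w (d * j + 1) \<noteq> 0"
proof -
  let ?q = "i div d"
  have q: "?q < b" using i d by (simp add: less_mult_imp_div_less mult.commute)
  have lt: "d * ?q + r < d * b" if "r < d" for r
  proof -
    have "d * ?q + r < d * (?q + 1)" using that by simp
    also have "\<dots> \<le> d * b" using q by (intro mult_left_mono) auto
    finally show ?thesis .
  qed
  have const: "w (d * ?q + r) = w (d * ?q)" if "r < d" for r
    using that
  proof (induction r)
    case (Suc r)
    have "(d * ?q + r) mod d = r" using Suc.prems by (simp)
    then have "block_cycle d b (d * ?q + r) = d * ?q + Suc r"
      using lt[of r] Suc.prems by (simp add: block_cycle_def)
    then show ?case using inv[of "d * ?q + r"] lt[of r] Suc N by simp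
  qed simp
  have "w i = w (d * ?q)" using const[of "i mod d"] d by simp
  then have "w (d * ?q) \<noteq> 0" "w (d * ?q + 1) \<noteq> 0" using i(2) const[of 1] d by auto
  then show ?thesis using q by blast
qed

lemma prob_large_coordinate_tendsto_0:
  fixes p :: "(nat \<Rightarrow> int) pmf"
  shows "(\<lambda>K. measure_pmf.prob p {w. \<exists>i<N. int K \<le> \<bar>w i\<bar>}) \<longlonglongrightarrow> 0"
proof -
  let ?A = "\<lambda>K. {w :: nat \<Rightarrow> int. \<exists>i<N. int K \<le> \<bar>w i\<bar>}"
  have "(\<lambda>K. measure_pmf.prob p (?A K)) \<longlonglongrightarrow> measure_pmf.prob p (\<Inter>K. ?A K)"
    by (rule measure_pmf.finite_Lim_measure_decseq) (auto simp: decseq_def intro: order_trans)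
  moreover have "(\<Inter>K. ?A K) = {}"
  proof (rule ccontr)
    assume "(\<Inter>K. ?A K) \<noteq> {}"
    then obtain w where w: "w \<in> (\<Inter>K. ?A K)" by blast
    let ?K = "nat (\<Sum>i<N. \<bar>w i\<bar>) + 1"
    have "w \<in> ?A ?K" using w by blast
    then obtain i where i: "i < N" "int ?K \<le> \<bar>w i\<bar>" by blast
    have "\<bar>w i\<bar> \<le> (\<Sum>i<N. \<bar>w i\<bar>)" by (rule member_le_sum) (use i in auto)
    then show False using i by simp
  qed
  ultimately show ?thesis by simp
qed

text \<open>Let \<open>M a\<close> be the cyclic permutation matrix, multiplied by \<open>\<zeta>\<close> on the cycles if \<open>a\<close>
  holds. The difference of the values at the two clocks is an average, over the diagonal
  matrices \<open>E\<close> of order \<open>m\<close>, of \<open>f\<close> at \<open>E * M True * E\<^sup>*\<close> minus \<open>f\<close> at \<open>E * M False * E\<^sup>*\<close>.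
  In the quadratic form bounding its square by Cauchy-Schwarz only diagonal matrices occur,
  so it is the expectation of \<open>(norm (h w))\<^sup>2\<close>; and averaging over \<open>E\<close> makes \<open>h w\<close> vanish
  unless \<open>w\<close> is invariant under the cycles modulo \<open>m\<close>. As \<open>m\<close> grows, the congruence becomes
  equality.\<close>

lemma (in unitary_class_function) clock_rotation:
  fixes p :: "(nat \<Rightarrow> int) pmf" and \<zeta> :: complex
  assumes rep: "\<And>z. (\<And>i. norm (z i) = 1) \<Longrightarrow> f (diagonal N z) = measure_pmf.expectation p (torus_monomial N z)"
    and d: "2 \<le> d" and N: "d * b \<le> N" and \<zeta>: "norm \<zeta> = 1"
  shows "(norm (f (diagonal N (clock d b \<zeta>)) - f (diagonal N (clock d b 1))))\<^sup>2 \<le>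
    4 * measure_pmf.prob p {w. \<exists>j<b. w (d * j) \<noteq> 0 \<and> w (d * j + 1) \<noteq> 0}"
    (is "?L \<le> 4 * measure_pmf.prob p ?B")
proof -
  define \<pi> where "\<pi> = block_cycle d b"
  have d0: "0 < d" using d by simp
  have \<pi>: "\<pi> permutes {..<N}" unfolding \<pi>_def by (rule block_cycle_permutes[OF d0 N])
  note \<pi>' = permutes_inv[OF \<pi>]
  define A :: "bool \<Rightarrow> nat \<Rightarrow> complex" where "A a i = (if i < d * b then (if a then \<zeta> else 1) else 1)" for a i
  have A1: "norm (A a i) = 1" for a i using \<zeta> by (simp add: A_def)
  have fA: "f (monomial_mat N (A a) \<pi>) = f (diagonal N (clock d b (if a then \<zeta> else 1)))" for a
    using cycle_eq_clock[OF d0 N, of "if a then \<zeta> else 1"] \<zeta> unfolding A_def \<pi>_def by simp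
  have bound: "?L \<le> 4 * (measure_pmf.prob p ?B + measure_pmf.prob p {w. \<exists>i<N. int K \<le> \<bar>w i\<bar>})" if K: "0 < K" for K
  proof -
    \<comment> \<open>Coordinates of absolute value below \<open>K\<close> that are congruent modulo \<open>m\<close> are equal.\<close>
    define m where "m = 2 * K"
    have m: "0 < m" using K by (simp add: m_def)
    define E where "E = torus_point N m"
    have E1: "norm (E s i) = 1" for s i by (simp add: E_def torus_point_def)
    define I where "I = torus_points N m \<times> (UNIV :: bool set)"
    have I: "finite I" by (simp add: I_def finite_torus_points)
    define y where "y sa j = E (fst sa) (\<pi> j) * A (snd sa) (\<pi> j) * cnj (E (fst sa) j)" for sa j
    have y1: "norm (y sa j) = 1" for sa j by (simp add: y_def norm_mult A1 E1)
    define X where "X sa = diagonal N (E (fst sa)) * monomial_mat N (A (snd sa)) \<pi> * mat_adjoint (diagonal N (E (fst sa)))" for sa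
    have DU: "diagonal N (E s) \<in> unitary_mats N" for s by (rule monomial_mat_unitary[OF permutes_id_lessThan E1])
    have MU: "monomial_mat N (A a) \<pi> \<in> unitary_mats N" for a by (rule monomial_mat_unitary[OF \<pi> A1])
    have XU: "X sa \<in> unitary_mats N" for sa
      unfolding X_def by (intro unitary_mats_mult unitary_mats_adjoint DU MU)
    have fX: "f (X sa) = f (diagonal N (clock d b (if snd sa then \<zeta> else 1)))" for sa
      unfolding X_def conjugate[OF DU MU] fA ..
    have XX: "f (mat_adjoint (X ta) * X sa) =
        measure_pmf.expectation p (\<lambda>w. torus_monomial N (y sa) w * cnj (torus_monomial N (y ta) w))" for sa ta
    proof -
      have "mat_adjoint (X ta) * X sa = diagonal N (\<lambda>j. y sa j * cnj (y ta j))"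
        unfolding X_def diagonal_conjugate_monomial[OF \<pi>] adjoint_monomial_mult_monomial[OF \<pi>]
        by (simp add: y_def permutes_inverses(2)[OF \<pi>] mult_ac)
      then have "f (mat_adjoint (X ta) * X sa) = measure_pmf.expectation p (torus_monomial N (\<lambda>j. y sa j * cnj (y ta j)))"
        using rep[of "\<lambda>j. y sa j * cnj (y ta j)"] by (simp add: norm_mult y1)
      then show ?thesis by (simp only: torus_monomial_mult[abs_def] torus_monomial_cnj)
    qed
    define c :: "(nat \<Rightarrow> nat) \<times> bool \<Rightarrow> complex" where "c sa = (if snd sa then 1 else - 1) / of_nat m ^ N" for sa
    have sI: "(\<Sum>sa\<in>I. g sa) = (\<Sum>s\<in>torus_points N m. g (s, True) + g (s, False))" for g :: "(nat \<Rightarrow> nat) \<times> bool \<Rightarrow> complex"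
      unfolding I_def by (simp add: sum.cartesian_product' UNIV_bool)
    have S: "(\<Sum>sa\<in>I. c sa * f (X sa)) = f (diagonal N (clock d b \<zeta>)) - f (diagonal N (clock d b 1))"
      using m unfolding sI by (simp add: c_def fX card_torus_points divide_simps)
    define h where "h w = (\<Sum>sa\<in>I. c sa * torus_monomial N (y sa) w)" for w
    have hh: "(\<Sum>sa\<in>I. \<Sum>ta\<in>I. c sa * cnj (c ta) * f (mat_adjoint (X ta) * X sa)) =
        measure_pmf.expectation p (\<lambda>w. of_real ((norm (h w))\<^sup>2))"
    proof -
      have int: "integrable (measure_pmf p) (\<lambda>w. c sa * cnj (c ta) * (torus_monomial N (y sa) w * cnj (torus_monomial N (y ta) w)))" for sa ta
        by (rule pmf_integrable_bounded[where B = "norm (c sa * cnj (c ta))"])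
           (simp add: norm_mult norm_torus_monomial[OF y1])
      have "(\<Sum>sa\<in>I. \<Sum>ta\<in>I. c sa * cnj (c ta) * f (mat_adjoint (X ta) * X sa)) =
          (\<Sum>sa\<in>I. \<Sum>ta\<in>I. measure_pmf.expectation p (\<lambda>w. c sa * cnj (c ta) * (torus_monomial N (y sa) w * cnj (torus_monomial N (y ta) w))))"
        unfolding XX by simp
      also have "\<dots> = measure_pmf.expectation p (\<lambda>w. \<Sum>sa\<in>I. \<Sum>ta\<in>I. c sa * cnj (c ta) * (torus_monomial N (y sa) w * cnj (torus_monomial N (y ta) w)))"
        using int by simp
      also have "(\<lambda>w. \<Sum>sa\<in>I. \<Sum>ta\<in>I. c sa * cnj (c ta) * (torus_monomial N (y sa) w * cnj (torus_monomial N (y ta) w))) = (\<lambda>w. of_real ((norm (h w))\<^sup>2))"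
        unfolding complex_norm_square h_def cnj_sum sum_product by (intro ext sum.cong refl) (simp add: mult_ac)
      finally show ?thesis .
    qed
    \<comment> \<open>The average over the points of order \<open>m\<close> factors out.\<close>
    have hE: "h w = (torus_monomial N (A True \<circ> \<pi>) w - 1) * (if \<forall>i<N. int m dvd w (inv_into UNIV \<pi> i) - w i then 1 else 0)" for w
    proof -
      define v where "v i = w (inv_into UNIV \<pi> i) - w i" for i
      have ty: "torus_monomial N (y (s, a)) w = torus_monomial N (A a \<circ> \<pi>) w * torus_monomial N (E s) v" for s a
      proof -
        have "y (s, a) = (\<lambda>j. ((A a \<circ> \<pi>) j * ((E s \<circ> \<pi>) j * cnj (E s j))))"
          by (simp add: y_def fun_eq_iff mult_ac)
        then have "torus_monomial N (y (s, a)) w = torus_monomial N (A a \<circ> \<pi>) w *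
            (torus_monomial N (E s) (w \<circ> inv_into UNIV \<pi>) * torus_monomial N (E s) (\<lambda>i. - w i))"
          by (simp only: torus_monomial_mult torus_monomial_unit_cnj[OF E1] torus_monomial_compose[OF \<pi>])
        also have "torus_monomial N (E s) (w \<circ> inv_into UNIV \<pi>) * torus_monomial N (E s) (\<lambda>i. - w i) = torus_monomial N (E s) v"
          unfolding torus_monomial_def prod.distrib[symmetric]
        proof (rule prod.cong[OF refl])
          fix i
          have "E s i \<noteq> 0" using E1[of s i] by auto
          then show "E s i powi (w \<circ> inv_into UNIV \<pi>) i * E s i powi (- w i) = E s i powi v i"
            by (simp add: v_def power_int_add[symmetric])
        qed
        finally show ?thesis .
      qed
      have "torus_monomial N (A False \<circ> \<pi>) w = 1" by (simp add: A_def torus_monomial_def)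
      then have "h w = (\<Sum>s\<in>torus_points N m. (torus_monomial N (A True \<circ> \<pi>) w - 1) / of_nat m ^ N * torus_monomial N (E s) v)"
        unfolding h_def sI by (intro sum.cong refl) (simp add: ty c_def algebra_simps diff_divide_distrib)
      also have "\<dots> = (torus_monomial N (A True \<circ> \<pi>) w - 1) / of_nat m ^ N * (if \<forall>i<N. int m dvd v i then of_nat m ^ N else 0)"
        unfolding sum_distrib_left[symmetric] E_def sum_torus_monomial[OF m] ..
      finally show ?thesis using m by (auto simp: v_def)
    qed
    have h_le: "(norm (h w))\<^sup>2 \<le> 4 * indicator (?B \<union> {w. \<exists>i<N. int K \<le> \<bar>w i\<bar>}) w" for w
    proof -
      have t1: "norm (torus_monomial N (A True \<circ> \<pi>) w) = 1" by (rule norm_torus_monomial) (simp add: A1)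
      have "norm (torus_monomial N (A True \<circ> \<pi>) w - 1) \<le> norm (torus_monomial N (A True \<circ> \<pi>) w) + norm (1::complex)"
        by (rule norm_triangle_ineq4)
      then have h2: "norm (h w) \<le> 2" using t1 by (auto simp: hE)
      show ?thesis
      proof (cases "w \<in> ?B \<union> {w. \<exists>i<N. int K \<le> \<bar>w i\<bar>}")
        case True
        have "(norm (h w))\<^sup>2 \<le> 2\<^sup>2" by (rule power_mono[OF h2]) simp
        then show ?thesis using True by simp
      next
        case False
        then have small: "\<And>i. i < N \<Longrightarrow> \<bar>w i\<bar> < int K" by force
        have "h w = 0"
        proof (cases "\<forall>i<N. int m dvd w (inv_into UNIV \<pi> i) - w i")
          case True
          have eq: "w (inv_into UNIV \<pi> i) = w i" if i: "i < N" for i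
          proof (rule ccontr)
            assume ne: "w (inv_into UNIV \<pi> i) \<noteq> w i"
            have "inv_into UNIV \<pi> i < N" using permutes_in_image[OF \<pi>', of i] i by simp
            then have "\<bar>w (inv_into UNIV \<pi> i) - w i\<bar> < int m"
              using small[OF i] small[of "inv_into UNIV \<pi> i"] by (simp add: m_def)
            moreover have "int m \<le> \<bar>w (inv_into UNIV \<pi> i) - w i\<bar>"
              using dvd_imp_le_int[of "w (inv_into UNIV \<pi> i) - w i" "int m"] True i ne by simp
            ultimately show False by simp
          qed
          have inv: "w (block_cycle d b j) = w j" if j: "j < N" for j
          proof -
            have "\<pi> j < N" using permutes_in_image[OF \<pi>, of j] j by simp
            from eq[OF this] show ?thesis unfolding permutes_inverses(2)[OF \<pi>] by (simp add: \<pi>_def)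
          qed
          have z: "w i = 0" if "i < d * b" for i
          proof (rule ccontr)
            assume "w i \<noteq> 0"
            from block_cycle_invariant_nonzero[OF d N inv that this] show False using False by blast
          qed
          have "torus_monomial N (A True \<circ> \<pi>) w = (\<Prod>i<N. 1)"
            unfolding torus_monomial_def
          proof (rule prod.cong[OF refl])
            fix i assume "i \<in> {..<N}"
            show "(A True \<circ> \<pi>) i powi w i = 1"
            proof (cases "i < d * b")
              case True then show ?thesis by (simp add: z)
            next
              case False
              then have "\<pi> i = i" by (simp add: \<pi>_def block_cycle_def)
              then show ?thesis using False by (simp add: A_def)
            qed
          qed
          then show ?thesis by (simp add: hE)
        qed (auto simp: hE)
        then show ?thesis by simp
      qed
    qed
    have "?L \<le> Re (measure_pmf.expectation p (\<lambda>w. of_real ((norm (h w))\<^sup>2)))"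
      using norm_sum_power2_le[where I = I and X = X and c = c, OF I XU] unfolding S hh .
    also have "\<dots> = measure_pmf.expectation p (\<lambda>w. (norm (h w))\<^sup>2)" by (simp only: integral_complex_of_real Re_complex_of_real)
    also have "\<dots> \<le> measure_pmf.expectation p (\<lambda>w. 4 * indicator (?B \<union> {w. \<exists>i<N. int K \<le> \<bar>w i\<bar>}) w)"
    proof (rule integral_mono)
      have "(norm (h w))\<^sup>2 \<le> 4" for w by (rule order_trans[OF h_le]) (simp add: indicator_def)
      then show "integrable (measure_pmf p) (\<lambda>w. (norm (h w))\<^sup>2)"
        by (intro pmf_integrable_bounded[where B = 4]) simp
      show "integrable (measure_pmf p) (\<lambda>w. 4 * indicator (?B \<union> {w. \<exists>i<N. int K \<le> \<bar>w i\<bar>}) w :: real)"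
        by (rule pmf_integrable_bounded[where B = 4]) (simp add: indicator_def)
    qed (rule h_le)
    also have "\<dots> = 4 * measure_pmf.prob p (?B \<union> {w. \<exists>i<N. int K \<le> \<bar>w i\<bar>})" by simp
    also have "\<dots> \<le> 4 * (measure_pmf.prob p ?B + measure_pmf.prob p {w. \<exists>i<N. int K \<le> \<bar>w i\<bar>})"
      by (intro mult_left_mono measure_Un_le) auto
    finally show ?thesis .
  qed
  have "(\<lambda>K. 4 * (measure_pmf.prob p ?B + measure_pmf.prob p {w. \<exists>i<N. int K \<le> \<bar>w i\<bar>})) \<longlonglongrightarrow> 4 * (measure_pmf.prob p ?B + 0)"
    by (intro tendsto_intros prob_large_coordinate_tendsto_0)
  moreover have "\<exists>K0. \<forall>K\<ge>K0. ?L \<le> 4 * (measure_pmf.prob p ?B + measure_pmf.prob p {w. \<exists>i<N. int K \<le> \<bar>w i\<bar>})"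
    by (intro exI[of _ 1] allI impI bound) linarith
  ultimately show ?thesis using LIMSEQ_le_const by (simp only: add_0_right) blast
qed

section \<open>Characters of the inductive limit as mixtures\<close>

lemma mat_trace_comm:
  assumes A: "A \<in> carrier_mat N N" and B: "B \<in> carrier_mat N N"
  shows "mat_trace (A * B) = mat_trace (B * A)"
proof -
  have t: "mat_trace (X * Y) = (\<Sum>i<N. \<Sum>k<N. X $$ (i, k) * Y $$ (k, i))"
    if "X \<in> carrier_mat N N" "Y \<in> carrier_mat N N" for X Y
    unfolding mat_trace_def using that by (intro sum.cong) (auto simp: mat_mult_entry[OF that] simp del: index_mult_mat(1))
  show ?thesis unfolding t[OF A B] t[OF B A] by (subst sum.swap) (simp add: mult.commute)
qed

lemma mat_trace_diagonal: "mat_trace (diagonal N z) = (\<Sum>i<N. z i)"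
  by (simp add: mat_trace_def monomial_mat_def)

lemma mat_trace_one: "mat_trace (1\<^sub>m N) = of_nat N"
  by (simp add: mat_trace_def)

lemma mat_trace_unitary_conjugate:
  assumes V: "V \<in> unitary_mats N" and A: "A \<in> carrier_mat N N"
  shows "mat_trace (V * A * mat_adjoint V) = mat_trace A"
proof -
  note V' = unitary_matsD[OF V]
  have "mat_trace (V * A * mat_adjoint V) = mat_trace (mat_adjoint V * (V * A))"
    by (rule mat_trace_comm[OF mult_carrier_mat[OF V'(1) A] V'(2)])
  also have "mat_adjoint V * (V * A) = A"
    unfolding assoc_mult_mat[OF V'(2,1) A, symmetric] V'(4) by (rule left_mult_one_mat[OF A])
  finally show ?thesis .
qed

lemma mat_trace_adjoint_mult:
  fixes A B :: "complex mat"
  assumes A: "A \<in> carrier_mat N N" and B: "B \<in> carrier_mat N N"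
  shows "mat_trace (mat_adjoint B * A) = (\<Sum>e\<in>{..<N} \<times> {..<N}. A $$ e * cnj (B $$ e))"
proof -
  have "mat_trace (mat_adjoint B * A) = (\<Sum>i<N. \<Sum>k<N. A $$ (k, i) * cnj (B $$ (k, i)))"
    unfolding mat_trace_def using A B
    by (intro sum.cong)
       (auto simp: mat_mult_entry[OF adjoint_carrier[OF B] A] adjoint_entry[OF B] mult.commute simp del: index_mult_mat(1) intro!: sum.cong)
  also have "\<dots> = (\<Sum>k<N. \<Sum>i<N. A $$ (k, i) * cnj (B $$ (k, i)))" by (rule sum.swap)
  finally show ?thesis by (simp add: sum.cartesian_product case_prod_unfold)
qed

lemma diag_block_mat_replicate_diagonal:
  assumes "0 < M"
  shows "diag_block_mat (replicate m (diagonal M z)) = diagonal (m * M) (\<lambda>i. z (i mod M))"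
proof (induction m)
  case 0
  show ?case by (intro eq_matI) (auto simp: monomial_mat_def)
next
  case (Suc m)
  show ?case
    unfolding diag_block_mat_replicate_Suc[OF monomial_mat_carrier] Suc
  proof (rule eq_matI)
    fix i j assume "i < dim_row (diagonal (Suc m * M) (\<lambda>i. z (i mod M)))" "j < dim_col (diagonal (Suc m * M) (\<lambda>i. z (i mod M)))"
    then have ij: "i < M + m * M" "j < M + m * M" by (auto simp: monomial_mat_def)
    have "(i - M) mod M = i mod M" if "\<not> i < M" using that by (simp add: le_mod_geq)
    then show "four_block_mat (diagonal M z) (0\<^sub>m M (m * M)) (0\<^sub>m (m * M) M) (diagonal (m * M) (\<lambda>i. z (i mod M))) $$ (i, j) =
        diagonal (Suc m * M) (\<lambda>i. z (i mod M)) $$ (i, j)"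
      using ij by (auto simp: monomial_mat_def)
  qed (auto simp: monomial_mat_def)
qed

lemma limitin_unitary_topology:
  assumes A: "\<And>n. A n \<in> unitary_mats N" "B \<in> unitary_mats N"
    and lim: "\<And>i j. i < N \<Longrightarrow> j < N \<Longrightarrow> (\<lambda>n. A n $$ (i, j)) \<longlonglongrightarrow> B $$ (i, j)"
  shows "limitin (unitary_topology N) A B sequentially"
proof -
  let ?e = "\<lambda>A :: complex mat. \<lambda>(i, j)\<in>{..<N} \<times> {..<N}. A $$ (i, j)"
  let ?T = "product_topology (\<lambda>_. euclidean :: complex topology) ({..<N} \<times> {..<N})"
  have "limitin ?T (\<lambda>n. ?e (A n)) (?e B) sequentially"
    unfolding limitin_componentwise using lim by (auto simp: PiE_def)
  then have *: "\<forall>U. openin ?T U \<and> ?e B \<in> U \<longrightarrow> eventually (\<lambda>n. ?e (A n) \<in> U) sequentially"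
    by (simp add: limitin_def)
  show ?thesis
    unfolding limitin_def
  proof (intro conjI allI impI)
    show "B \<in> topspace (unitary_topology N)" using A by simp
    fix S assume S: "openin (unitary_topology N) S \<and> B \<in> S"
    then obtain U where U: "openin ?T U" "S = ?e -` U \<inter> unitary_mats N"
      unfolding unitary_topology_def openin_pullback_topology by blast
    then have "eventually (\<lambda>n. ?e (A n) \<in> U) sequentially" using * S by blast
    then show "eventually (\<lambda>n. A n \<in> S) sequentially"
      by (rule eventually_mono) (use U A in auto)
  qed
qed

lemma limitin_unitary_diagonal:
  assumes Z: "\<And>n i. norm (Z n i) = 1" "\<And>i. norm (z i) = 1" "\<And>i. i < N \<Longrightarrow> (\<lambda>n. Z n i) \<longlonglongrightarrow> z i"
  shows "limitin (unitary_topology N) (\<lambda>n. diagonal N (Z n)) (diagonal N z) sequentially"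
proof (rule limitin_unitary_topology)
  show "diagonal N (Z n) \<in> unitary_mats N" for n by (rule monomial_mat_unitary[OF permutes_id_lessThan Z(1)])
  show "diagonal N z \<in> unitary_mats N" by (rule monomial_mat_unitary[OF permutes_id_lessThan Z(2)])
  show "(\<lambda>n. diagonal N (Z n) $$ (i, j)) \<longlonglongrightarrow> diagonal N z $$ (i, j)" if "i < N" "j < N" for i j
    using that Z(3) by (simp add: monomial_mat_entry)
qed

lemma continuous_map_mat_trace:
  "continuous_map (unitary_topology N) euclidean (\<lambda>A. mat_trace A / of_nat N)"
proof -
  let ?e = "\<lambda>A :: complex mat. \<lambda>(i, j)\<in>{..<N} \<times> {..<N}. A $$ (i, j)"
  let ?T = "product_topology (\<lambda>_. euclidean :: complex topology) ({..<N} \<times> {..<N})"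
  have "continuous_map ?T euclidean (\<lambda>h. (\<Sum>i<N. h (i, i)))"
    by (intro continuous_map_sum continuous_map_product_projection) auto
  then have "continuous_map ?T euclidean ((\<lambda>x. x / of_nat N) \<circ> (\<lambda>h. (\<Sum>i<N. h (i, i))))"
    by (rule continuous_map_compose) (simp add: divide_inverse continuous_intros)
  then have "continuous_map (unitary_topology N) euclidean (((\<lambda>x. x / of_nat N) \<circ> (\<lambda>h. (\<Sum>i<N. h (i, i)))) \<circ> ?e)"
    unfolding unitary_topology_def by (rule continuous_map_pullback)
  then show ?thesis
    by (rule continuous_map_eq) (auto simp: mat_trace_def unitary_mats_def intro!: arg_cong2[where f = "(/)"] sum.cong)
qed

text \<open>The letter \<open>\<chi>\<close> denotes characters from here on, not the vector binder.\<close>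

unbundle no vec_syntax

text \<open>Levels are numbered from 0 here, so that level \<open>k\<close> has the matrix size
  \<open>level_size n (Suc k)\<close>.\<close>

locale block_sequence =
  fixes n :: "nat \<Rightarrow> nat"
  assumes n_gt_1: "\<And>k. 1 \<le> k \<Longrightarrow> 1 < n k"
begin

definition N :: "nat \<Rightarrow> nat" where "N k = level_size n (Suc k)"

definition lift :: "nat \<Rightarrow> complex mat \<Rightarrow> lim_elem" where "lift k = to_lim n (Suc k)"

lemma N_Suc: "N (Suc k) = N k * n (Suc (Suc k))"
  by (simp add: N_def level_size_Suc)

lemma N_0: "2 \<le> N 0"
  using n_gt_1[of 1] by (simp add: N_def level_size_def)

lemma N_gt: "k + 2 \<le> N k"
proof (induction k)
  case 0 show ?case using N_0 by simp
next
  case (Suc k)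
  have "N k * 2 \<le> N (Suc k)" unfolding N_Suc using n_gt_1[of "Suc (Suc k)"] by (intro mult_left_mono) auto
  then show ?case using Suc by simp
qed

lemma N_pos: "0 < N k"
  using N_gt[of k] by simp

lemma N_dvd: "l \<le> k \<Longrightarrow> N l dvd N k"
  by (induction k rule: dec_induct) (auto simp: N_Suc)

lemma carrierE:
  assumes "u \<in> carrier (unitary_lim n)"
  obtains k A where "A \<in> unitary_mats (N k)" "u = lift k A"
proof -
  obtain k A where "1 \<le> k" "A \<in> unitary_mats (level_size n k)" "u = to_lim n k A"
    using assms by (auto simp: unitary_lim_def)
  then show ?thesis using that[of A "k - 1"] by (simp add: N_def lift_def)
qed

lemma lift_carrier: "A \<in> unitary_mats (N k) \<Longrightarrow> lift k A \<in> carrier (unitary_lim n)"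
  by (simp add: N_def lift_def to_lim_in_unitary_lim)

lemma lift_mult:
  "A \<in> unitary_mats (N k) \<Longrightarrow> B \<in> unitary_mats (N k) \<Longrightarrow>
    lift k A \<otimes>\<^bsub>unitary_lim n\<^esub> lift k B = lift k (A * B)"
  by (simp add: N_def lift_def mult_unitary_lim)

lemma lift_one: "\<one>\<^bsub>unitary_lim n\<^esub> = lift k (1\<^sub>m (N k))"
  by (simp add: N_def lift_def one_unitary_lim[of "Suc k"])

lemma lift_inv:
  assumes A: "A \<in> unitary_mats (N k)"
  shows "inv\<^bsub>unitary_lim n\<^esub> (lift k A) = lift k (mat_adjoint A)"
proof (rule group.inv_equality[OF group_unitary_lim])
  show "lift k (mat_adjoint A) \<otimes>\<^bsub>unitary_lim n\<^esub> lift k A = \<one>\<^bsub>unitary_lim n\<^esub>"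
    unfolding lift_mult[OF unitary_mats_adjoint[OF A] A] unitary_matsD(4)[OF A] by (rule lift_one[symmetric])
qed (use A lift_carrier unitary_mats_adjoint in auto)

lemma lift_embed:
  assumes "A \<in> unitary_mats (N k)"
  obtains B where "B \<in> unitary_mats (N (k + i))" "lift (k + i) B = lift k A"
proof
  show "level_embed n (Suc k) i A \<in> unitary_mats (N (k + i))"
    using unitary_mats_embed[of A n "Suc k" i] assms by (simp add: N_def)
  show "lift (k + i) (level_embed n (Suc k) i A) = lift k A"
    using to_lim_embed[of "Suc k" A n i] assms unitary_mats_pairs[of "Suc k" A n] by (simp add: N_def lift_def)
qed

lemma common_level:
  fixes m :: nat
  assumes "\<And>i. i < m \<Longrightarrow> g i \<in> carrier (unitary_lim n)"
  obtains k A where "\<And>i. i < m \<Longrightarrow> A i \<in> unitary_mats (N k)" "\<And>i. i < m \<Longrightarrow> g i = lift k (A i)"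
proof -
  have "\<exists>k A. \<forall>i<m. A i \<in> unitary_mats (N k) \<and> g i = lift k (A i)"
    using assms
  proof (induction m)
    case (Suc m)
    have "\<exists>k A. \<forall>i<m. A i \<in> unitary_mats (N k) \<and> g i = lift k (A i)" by (rule Suc.IH) (use Suc.prems in auto)
    then obtain k A where A: "\<And>i. i < m \<Longrightarrow> A i \<in> unitary_mats (N k)" "\<And>i. i < m \<Longrightarrow> g i = lift k (A i)" by blast
    obtain l B where B: "B \<in> unitary_mats (N l)" "g m = lift l B" using Suc.prems[of m] by (auto elim: carrierE)
    have "\<exists>C. C \<in> unitary_mats (N (k + l)) \<and> lift (k + l) C = lift k (A i)" if "i < m" for i
      using lift_embed[OF A(1)[OF that], of l] by blast
    then obtain C where C: "\<And>i. i < m \<Longrightarrow> C i \<in> unitary_mats (N (k + l)) \<and> lift (k + l) (C i) = lift k (A i)" by metis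
    obtain D where D: "D \<in> unitary_mats (N (k + l))" "lift (k + l) D = lift l B"
      using lift_embed[OF B(1), of k] by (metis add.commute)
    have "\<forall>i<Suc m. (C(m := D)) i \<in> unitary_mats (N (k + l)) \<and> g i = lift (k + l) ((C(m := D)) i)"
      using A B C D by (auto simp: less_Suc_eq)
    then show ?case by blast
  qed simp
  then show ?thesis using that by blast
qed

text \<open>The block-diagonal embedding repeats the diagonal entries periodically.\<close>

lemma lift_diagonal:
  assumes "l \<le> k" and z: "\<And>i. norm (z i) = 1"
  shows "lift k (diagonal (N k) (\<lambda>i. z (i mod N l))) = lift l (diagonal (N l) z)"
proof -
  have e: "level_embed n (Suc l) i (diagonal (N l) z) = diagonal (N (l + i)) (\<lambda>j. z (j mod N l))" for i
  proof (induction i)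
    case 0
    show ?case by simp (rule monomial_mat_cong, simp)
  next
    case (Suc i)
    have "level_embed n (Suc l) (Suc i) (diagonal (N l) z) =
        diag_block_mat (replicate (n (Suc (Suc (l + i)))) (diagonal (N (l + i)) (\<lambda>j. z (j mod N l))))"
      by (simp only: level_embed.simps Suc add_Suc)
    also have "\<dots> = diagonal (n (Suc (Suc (l + i))) * N (l + i)) (\<lambda>j. z (j mod N (l + i) mod N l))"
      by (rule diag_block_mat_replicate_diagonal[OF N_pos])
    also have "\<dots> = diagonal (N (l + Suc i)) (\<lambda>j. z (j mod N l))"
      using N_dvd[of l "l + i"] by (simp add: N_Suc mult.commute mod_mod_cancel)
    finally show ?case .
  qed
  have "(Suc l, diagonal (N l) z) \<in> level_pairs n"
    by (rule unitary_mats_pairs) (use monomial_mat_unitary[OF permutes_id_lessThan z] in \<open>auto simp: N_def\<close>)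
  from to_lim_embed[OF this, of "k - l"] show ?thesis
    using assms(1) by (simp add: lift_def e)
qed

lemma lim_tr_lift:
  assumes "A \<in> unitary_mats (N k)"
  shows "lim_tr n (lift k A) = mat_trace A / of_nat (N k)"
  using lim_tr_to_lim[of n "Suc k" A, OF n_gt_1] unitary_mats_pairs[of "Suc k" A n] assms by (simp add: N_def lift_def)

lemma lim_tr_lift_diagonal:
  assumes "\<And>i. norm (z i) = 1"
  shows "lim_tr n (lift k (diagonal (N k) z)) = power_mean (N k) z 1"
  by (simp add: lim_tr_lift monomial_mat_unitary[OF permutes_id_lessThan assms] mat_trace_diagonal power_mean_def)

lemma norm_lim_tr_le:
  assumes "u \<in> carrier (unitary_lim n)"
  shows "norm (lim_tr n u) \<le> 1"
proof -
  obtain k A where A: "A \<in> unitary_mats (N k)" "u = lift k A" using assms by (rule carrierE)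
  obtain V z where V: "V \<in> unitary_mats (N k)" "\<forall>i. norm (z i) = 1" "A = V * diagonal (N k) z * mat_adjoint V"
    using unitary_diagonalization[OF A(1)] by blast
  have "lim_tr n u = power_mean (N k) z 1"
    unfolding A(2) lim_tr_lift[OF A(1)]
    unfolding V(3) mat_trace_unitary_conjugate[OF V(1) monomial_mat_carrier] mat_trace_diagonal
    by (simp add: power_mean_def)
  then show ?thesis using norm_power_mean_le[of z "N k" 1] V(2) by simp
qed

lemma continuous_map_lift:
  assumes "continuous_map (unitary_lim_topology n) euclidean g"
  shows "continuous_map (unitary_topology (N k)) euclidean (\<lambda>A. g (lift k A))"
  using assms continuous_map_unitary_lim[of n g euclidean] by (simp add: N_def lift_def)

lemma continuous_map_lim_tr: "continuous_map (unitary_lim_topology n) euclidean (lim_tr n)"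
proof -
  have "continuous_map (unitary_topology (level_size n k)) euclidean (\<lambda>A. lim_tr n (to_lim n k A))" if k: "1 \<le> k" for k
    by (rule continuous_map_eq[OF continuous_map_mat_trace])
       (use k lim_tr_to_lim[OF n_gt_1] unitary_mats_pairs in auto)
  then show ?thesis by (subst continuous_map_unitary_lim) auto
qed

lemma character_unitary_class_function:
  assumes \<chi>: "group_character (unitary_lim n) (unitary_lim_topology n) \<chi>"
  shows "unitary_class_function (N k) (\<lambda>A. \<chi> (lift k A))"
proof
  show "\<chi> (lift k (1\<^sub>m (N k))) = 1" using \<chi> by (simp add: group_character_def lift_one[of k])
  show "\<chi> (lift k (A * B)) = \<chi> (lift k (B * A))" if "A \<in> unitary_mats (N k)" "B \<in> unitary_mats (N k)" for A B
    using \<chi> that lift_carrier by (simp add: group_character_def lift_mult[symmetric])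
  show "(\<Sum>i<m. \<Sum>j<m. c i * cnj (c j) * \<chi> (lift k (mat_adjoint (X j) * X i))) \<in> \<real>\<^sub>\<ge>\<^sub>0"
    if X: "\<And>i. i < m \<Longrightarrow> X i \<in> unitary_mats (N k)" for m :: nat and X c
  proof -
    have "(\<Sum>i<m. \<Sum>j<m. c i * cnj (c j) * \<chi> (inv\<^bsub>unitary_lim n\<^esub> (lift k (X j)) \<otimes>\<^bsub>unitary_lim n\<^esub> lift k (X i))) \<in> \<real>\<^sub>\<ge>\<^sub>0"
      using \<chi> X lift_carrier unfolding group_character_def positive_definite_def by simp
    also have "(\<Sum>i<m. \<Sum>j<m. c i * cnj (c j) * \<chi> (inv\<^bsub>unitary_lim n\<^esub> (lift k (X j)) \<otimes>\<^bsub>unitary_lim n\<^esub> lift k (X i))) =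
        (\<Sum>i<m. \<Sum>j<m. c i * cnj (c j) * \<chi> (lift k (mat_adjoint (X j) * X i)))"
      by (intro sum.cong refl) (use X in \<open>simp add: lift_inv lift_mult unitary_mats_adjoint\<close>)
    finally show ?thesis .
  qed
  show "(\<lambda>m. \<chi> (lift k (diagonal (N k) (Z m)))) \<longlonglongrightarrow> \<chi> (lift k (diagonal (N k) z))"
    if "\<And>n i. norm (Z n i) = 1" "\<And>i. norm (z i) = 1" "\<And>i. i < N k \<Longrightarrow> (\<lambda>n. Z n i) \<longlonglongrightarrow> z i" for Z z
  proof -
    have "continuous_map (unitary_topology (N k)) euclidean (\<lambda>A. \<chi> (lift k A))"
      using \<chi> by (intro continuous_map_lift) (simp add: group_character_def)
    from continuous_map_limit[OF this limitin_unitary_diagonal[OF that]] show ?thesis by (simp add: o_def)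
  qed
qed

text \<open>The restrictions of a character to the diagonal tori form a weight tower; its mixing
  distribution represents the character on every unitary matrix, because unitary matrices
  are diagonalisable and both sides are invariant under conjugation.\<close>

theorem character_representation:
  assumes \<chi>: "group_character (unitary_lim n) (unitary_lim_topology n) \<chi>"
  obtains c :: "(nat \<times> nat) pmf" where
    "\<And>u. u \<in> carrier (unitary_lim n) \<Longrightarrow> \<chi> u = measure_pmf.expectation c (trace_monomial (lim_tr n u))"
proof -
  define F where "F k z = \<chi> (lift k (diagonal (N k) z))" for k z
  have "\<exists>p. exchangeable (N k) p \<and> (\<forall>z. (\<forall>i. norm (z i) = 1) \<longrightarrow> F k z = measure_pmf.expectation p (torus_monomial (N k) z))" for k
  proof -
    interpret unitary_class_function "N k" "\<lambda>A. \<chi> (lift k A)" by (rule character_unitary_class_function[OF \<chi>])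
    show ?thesis using weights unfolding F_def by blast
  qed
  then obtain p where p: "\<And>k. exchangeable (N k) (p k)"
    "\<And>k z. (\<And>i. norm (z i) = 1) \<Longrightarrow> F k z = measure_pmf.expectation (p k) (torus_monomial (N k) z)" by metis
  interpret weight_tower N F p
  proof
    show "2 \<le> N 0" by (rule N_0)
    show "N l dvd N k" if "l \<le> k" for l k using that by (rule N_dvd)
    show "k \<le> N k" for k using N_gt[of k] by simp
    show "exchangeable (N k) (p k)" for k by (rule p)
    show "F k z = measure_pmf.expectation (p k) (torus_monomial (N k) z)" if "\<And>i. norm (z i) = 1" for k z
      by (rule p(2)[OF that])
    show "F k (\<lambda>i. z (i mod N l)) = F l z" if "l \<le> k" "\<And>i. norm (z i) = 1" for l k z
      unfolding F_def by (rule arg_cong[where f = \<chi>, OF lift_diagonal[OF that]])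
    fix k :: nat
    interpret unitary_class_function "N k" "\<lambda>A. \<chi> (lift k A)" by (rule character_unitary_class_function[OF \<chi>])
    show "\<exists>d>0. \<forall>x. 0 \<le> x \<longrightarrow> x \<le> d \<longrightarrow> 1 - e \<le> Re (F k (one_coordinate 0 (cis x)))" if "0 < e" for e
      unfolding F_def by (rule near_one[OF that])
    show "(norm (F k (clock d b \<zeta>) - F k (clock d b 1)))\<^sup>2 \<le>
        4 * measure_pmf.prob (p k) {w. \<exists>j<b. w (d * j) \<noteq> 0 \<and> w (d * j + 1) \<noteq> 0}"
      if "2 \<le> d" "d * b \<le> N k" "norm \<zeta> = 1" for d b \<zeta>
      unfolding F_def by (rule clock_rotation[OF _ that]) (use p(2) in \<open>simp add: F_def\<close>)
  qed
  obtain c :: "(nat \<times> nat) pmf" where c: "\<And>l z. (\<And>i. norm (z i) = 1) \<Longrightarrow>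
      F l z = measure_pmf.expectation c (trace_monomial (power_mean (N l) z 1))"
    by (rule trace_monomial_representation) blast
  have "\<chi> u = measure_pmf.expectation c (trace_monomial (lim_tr n u))" if u: "u \<in> carrier (unitary_lim n)" for u
  proof -
    obtain k A where A: "A \<in> unitary_mats (N k)" "u = lift k A" using u by (rule carrierE)
    interpret unitary_class_function "N k" "\<lambda>A. \<chi> (lift k A)" by (rule character_unitary_class_function[OF \<chi>])
    obtain V z where V: "V \<in> unitary_mats (N k)" "\<forall>i. norm (z i) = 1" "A = V * diagonal (N k) z * mat_adjoint V"
      using unitary_diagonalization[OF A(1)] by blast
    have D: "diagonal (N k) z \<in> unitary_mats (N k)" by (rule monomial_mat_unitary[OF permutes_id_lessThan]) (use V in auto)
    have "lim_tr n u = power_mean (N k) z 1"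
      unfolding A(2) lim_tr_lift[OF A(1)]
      unfolding V(3) mat_trace_unitary_conjugate[OF V(1) monomial_mat_carrier] mat_trace_diagonal
      by (simp add: power_mean_def)
    moreover have "\<chi> u = F k z"
      unfolding A(2) V(3) F_def by (rule conjugate[OF V(1) D])
    ultimately show ?thesis using c[of z k] V(2) by simp
  qed
  then show ?thesis by (rule that)
qed

end

section \<open>Mixtures of trace monomials are characters\<close>

lemma pmf_expectation_nonneg_Reals:
  fixes g :: "'a \<Rightarrow> complex"
  assumes "\<And>x. g x \<in> \<real>\<^sub>\<ge>\<^sub>0"
  shows "measure_pmf.expectation p g \<in> \<real>\<^sub>\<ge>\<^sub>0"
proof -
  have "g = (\<lambda>x. of_real (Re (g x)))"
    using assms by (auto simp: fun_eq_iff complex_eq_iff complex_nonneg_Reals_iff)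
  then have "measure_pmf.expectation p g = of_real (measure_pmf.expectation p (\<lambda>x. Re (g x)))"
    by (metis integral_complex_of_real)
  moreover have "0 \<le> measure_pmf.expectation p (\<lambda>x. Re (g x))"
    by (rule Bochner_Integration.integral_nonneg) (use assms in \<open>auto simp: complex_nonneg_Reals_iff\<close>)
  ultimately show ?thesis by simp
qed

lemma pmf_expectation_convex:
  fixes g :: "'a \<Rightarrow> complex"
  assumes c: "\<And>x. pmf c x = \<alpha> * pmf a x + \<beta> * pmf b x" and g: "\<And>x. norm (g x) \<le> B"
  shows "measure_pmf.expectation c g = of_real \<alpha> * measure_pmf.expectation a g + of_real \<beta> * measure_pmf.expectation b g"
proof -
  have e: "measure_pmf.expectation p g = (\<integral>x. pmf p x *\<^sub>R g x \<partial>count_space UNIV)" for p :: "'a pmf"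
    unfolding measure_pmf_eq_density by (rule integral_density) auto
  have i: "integrable (count_space UNIV) (\<lambda>x. pmf p x *\<^sub>R g x)" for p :: "'a pmf"
  proof -
    have "integrable (density (count_space UNIV) (\<lambda>x. ennreal (pmf p x))) g"
      using pmf_integrable_bounded[OF g, of p] unfolding measure_pmf_eq_density .
    then show ?thesis by (subst (asm) integrable_density) auto
  qed
  have "measure_pmf.expectation c g = (\<integral>x. \<alpha> *\<^sub>R (pmf a x *\<^sub>R g x) + \<beta> *\<^sub>R (pmf b x *\<^sub>R g x) \<partial>count_space UNIV)"
    unfolding e c by (simp add: scaleR_add_left)
  also have "\<dots> = \<alpha> *\<^sub>R (\<integral>x. pmf a x *\<^sub>R g x \<partial>count_space UNIV) + \<beta> *\<^sub>R (\<integral>x. pmf b x *\<^sub>R g x \<partial>count_space UNIV)"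
    using i[of a] i[of b]
    by (subst Bochner_Integration.integral_add) (auto simp only: integral_scaleR_right integrable_scaleR_right)
  finally show ?thesis by (simp add: e scaleR_conv_of_real)
qed

text \<open>Kernels of finite rank in the form of a Gram matrix. Lists of vectors keep the number
  of summands implicit, so that products are formed by list operations.\<close>

definition gram_kernel :: "nat \<Rightarrow> (nat \<Rightarrow> nat \<Rightarrow> complex) \<Rightarrow> bool" where
  "gram_kernel m K \<longleftrightarrow> (\<exists>xs :: (nat \<Rightarrow> complex) list. \<forall>i<m. \<forall>j<m. K i j = (\<Sum>x\<leftarrow>xs. x i * cnj (x j)))"

text \<open>The Schur product of Gram matrices is the Gram matrix of the pointwise products of the
  vectors.\<close>

lemma gram_kernel_mult:
  assumes "gram_kernel m K" "gram_kernel m L"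
  shows "gram_kernel m (\<lambda>i j. K i j * L i j)"
proof -
  obtain xs ys where x: "\<forall>i<m. \<forall>j<m. K i j = (\<Sum>x\<leftarrow>xs. x i * cnj (x j))"
    and y: "\<forall>i<m. \<forall>j<m. L i j = (\<Sum>x\<leftarrow>ys. x i * cnj (x j))"
    using assms unfolding gram_kernel_def by blast
  have e: "(\<Sum>z\<leftarrow>concat (map (\<lambda>x. map (\<lambda>y i. x i * y i) ys) xs). z i * cnj (z j)) =
      (\<Sum>x\<leftarrow>xs. x i * cnj (x j)) * (\<Sum>x\<leftarrow>ys. x i * cnj (x j))" for i j
  proof (induction xs)
    case (Cons a xs)
    have "(\<Sum>y\<leftarrow>ys. a i * y i * cnj (a j * y j)) = a i * cnj (a j) * (\<Sum>y\<leftarrow>ys. y i * cnj (y j))"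
      by (induction ys) (simp_all add: algebra_simps)
    then show ?case using Cons by (simp add: o_def distrib_right)
  qed simp
  show ?thesis
    unfolding gram_kernel_def
  proof (intro exI allI impI)
    fix i j assume ij: "i < m" "j < m"
    show "K i j * L i j = (\<Sum>z\<leftarrow>concat (map (\<lambda>x. map (\<lambda>y i. x i * y i) ys) xs). z i * cnj (z j))"
      unfolding e using x y ij by simp
  qed
qed

lemma gram_kernel_cnj:
  assumes "gram_kernel m K"
  shows "gram_kernel m (\<lambda>i j. cnj (K i j))"
proof -
  obtain xs where x: "\<forall>i<m. \<forall>j<m. K i j = (\<Sum>x\<leftarrow>xs. x i * cnj (x j))"
    using assms unfolding gram_kernel_def by blast
  have e: "(\<Sum>z\<leftarrow>map (\<lambda>x i. cnj (x i)) xs. z i * cnj (z j)) = cnj (\<Sum>x\<leftarrow>xs. x i * cnj (x j))" for i j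
    by (induction xs) auto
  show ?thesis
    unfolding gram_kernel_def
  proof (intro exI allI impI)
    fix i j assume ij: "i < m" "j < m"
    show "cnj (K i j) = (\<Sum>z\<leftarrow>map (\<lambda>x i. cnj (x i)) xs. z i * cnj (z j))"
      unfolding e using x ij by simp
  qed
qed

lemma gram_kernel_power:
  assumes "gram_kernel m K"
  shows "gram_kernel m (\<lambda>i j. K i j ^ p)"
proof (induction p)
  case 0
  have "\<forall>i<m. \<forall>j<m. K i j ^ 0 = (\<Sum>x\<leftarrow>[\<lambda>_. 1]. x i * cnj (x j))" by simp
  then show ?case unfolding gram_kernel_def by blast
next
  case (Suc p)
  then show ?case using gram_kernel_mult[OF assms Suc] by simp
qed

lemma gram_kernel_positive:
  assumes "gram_kernel m K"
  shows "(\<Sum>i<m. \<Sum>j<m. c i * cnj (c j) * K i j) \<in> \<real>\<^sub>\<ge>\<^sub>0"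
proof -
  obtain xs where x: "\<And>i j. i < m \<Longrightarrow> j < m \<Longrightarrow> K i j = (\<Sum>x\<leftarrow>xs. x i * cnj (x j))"
    using assms unfolding gram_kernel_def by blast
  have "(\<Sum>i<m. \<Sum>j<m. c i * cnj (c j) * K i j) = (\<Sum>i<m. \<Sum>j<m. c i * cnj (c j) * (\<Sum>x\<leftarrow>xs. x i * cnj (x j)))"
    by (intro sum.cong refl) (simp add: x)
  also have "\<dots> = (\<Sum>x\<leftarrow>xs. (\<Sum>i<m. c i * x i) * cnj (\<Sum>i<m. c i * x i))"
  proof (induction xs)
    case (Cons a xs)
    have "(\<Sum>i<m. \<Sum>j<m. c i * cnj (c j) * (a i * cnj (a j))) = (\<Sum>i<m. c i * a i) * cnj (\<Sum>i<m. c i * a i)"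
      unfolding cnj_sum sum_product by (intro sum.cong refl) (simp add: mult_ac)
    then show ?case using Cons by (simp add: distrib_left sum.distrib)
  qed simp
  also have "\<dots> \<in> \<real>\<^sub>\<ge>\<^sub>0"
  proof (induction xs)
    case (Cons a xs)
    have "z * cnj z \<in> \<real>\<^sub>\<ge>\<^sub>0" for z :: complex
      by (simp add: complex_norm_square[symmetric] del: of_real_power)
    then show ?case unfolding list.map sum_list.Cons by (intro nonneg_Reals_add_I Cons)
  qed simp
  finally show ?thesis .
qed

lemma continuous_expectation_trace_monomial:
  "continuous_on (cball 0 1) (\<lambda>t. measure_pmf.expectation c (trace_monomial t))"
proof (rule continuous_on_sequentiallyI)
  fix u :: "nat \<Rightarrow> complex" and a
  assume u: "\<forall>n. u n \<in> cball 0 1" "a \<in> cball 0 1" "u \<longlonglongrightarrow> a"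
  show "(\<lambda>n. measure_pmf.expectation c (trace_monomial (u n))) \<longlonglongrightarrow> measure_pmf.expectation c (trace_monomial a)"
  proof (rule integral_dominated_convergence[where w = "\<lambda>_. 1"])
    show "AE x in measure_pmf c. (\<lambda>n. trace_monomial (u n) x) \<longlonglongrightarrow> trace_monomial a x"
      unfolding trace_monomial_def by (intro AE_I2 tendsto_intros u)
    show "AE x in measure_pmf c. norm (trace_monomial (u n) x) \<le> 1" for n
      using norm_trace_monomial_le[of "u n"] u by simp
  qed auto
qed

context block_sequence
begin

definition mixed_trace_character :: "(nat \<times> nat) pmf \<Rightarrow> lim_elem \<Rightarrow> complex" where
  "mixed_trace_character c = (\<lambda>u\<in>carrier (unitary_lim n). measure_pmf.expectation c (trace_monomial (lim_tr n u)))"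

lemma lim_tr_commute:
  assumes "g \<in> carrier (unitary_lim n)" "h \<in> carrier (unitary_lim n)"
  shows "lim_tr n (g \<otimes>\<^bsub>unitary_lim n\<^esub> h) = lim_tr n (h \<otimes>\<^bsub>unitary_lim n\<^esub> g)"
proof -
  obtain k A B where k: "1 \<le> k" and U: "A \<in> unitary_mats (level_size n k)" "B \<in> unitary_mats (level_size n k)"
    and gh: "g = to_lim n k A" "h = to_lim n k B"
    using unitary_lim_common_level[OF assms] .
  have tr: "lim_tr n (to_lim n k C) = mat_trace C / of_nat (level_size n k)" if "C \<in> unitary_mats (level_size n k)" for C
    by (rule lim_tr_to_lim[OF n_gt_1 unitary_mats_pairs[OF k that]])
  show ?thesis
    unfolding gh mult_unitary_lim[OF k U] mult_unitary_lim[OF k U(2,1)] 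
      tr[OF unitary_mats_mult[OF U]] tr[OF unitary_mats_mult[OF U(2,1)]]
    by (simp only: mat_trace_comm[OF unitary_matsD(1)[OF U(1)] unitary_matsD(1)[OF U(2)]])
qed

text \<open>At a common level \<open>tr (B\<^sup>* * A)\<close> is the normalised inner product of the matrices \<open>A\<close>
  and \<open>B\<close>, regarded as vectors of their entries.\<close>

lemma gram_kernel_lim_tr:
  fixes m :: nat
  assumes g: "\<And>i. i < m \<Longrightarrow> g i \<in> carrier (unitary_lim n)"
  shows "gram_kernel m (\<lambda>i j. lim_tr n (inv\<^bsub>unitary_lim n\<^esub> (g j) \<otimes>\<^bsub>unitary_lim n\<^esub> g i))"
proof -
  obtain k A where A: "\<And>i. i < m \<Longrightarrow> A i \<in> unitary_mats (N k)" "\<And>i. i < m \<Longrightarrow> g i = lift k (A i)"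
  proof (rule common_level[of m g])
    show "g i \<in> carrier (unitary_lim n)" if "i < m" for i by (rule g[OF that])
  qed (rule that)
  obtain es where es: "set es = {..<N k} \<times> {..<N k}" "distinct es"
    using finite_distinct_list[of "{..<N k} \<times> {..<N k}"] by auto
  have "lim_tr n (inv\<^bsub>unitary_lim n\<^esub> (g j) \<otimes>\<^bsub>unitary_lim n\<^esub> g i) =
      (\<Sum>x\<leftarrow>map (\<lambda>e i. A i $$ e / of_real (sqrt (N k))) es. x i * cnj (x j))" if ij: "i < m" "j < m" for i j
  proof -
    have sq: "complex_of_real (sqrt (N k)) * complex_of_real (sqrt (N k)) = of_nat (N k)"
      by (metis of_nat_0_le_iff of_real_mult of_real_of_nat_eq real_sqrt_mult_self abs_of_nonneg)
    have "lim_tr n (inv\<^bsub>unitary_lim n\<^esub> (g j) \<otimes>\<^bsub>unitary_lim n\<^esub> g i) = mat_trace (mat_adjoint (A j) * A i) / of_nat (N k)"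
      using A[OF ij(1)] A[OF ij(2)] by (simp add: lift_inv lift_mult lim_tr_lift unitary_mats_adjoint unitary_mats_mult)
    also have "\<dots> = (\<Sum>e\<in>set es. A i $$ e / of_real (sqrt (N k)) * cnj (A j $$ e / of_real (sqrt (N k))))"
      unfolding mat_trace_adjoint_mult[OF unitary_matsD(1)[OF A(1)[OF ij(1)]] unitary_matsD(1)[OF A(1)[OF ij(2)]]] es(1) sum_divide_distrib
      by (intro sum.cong refl) (simp add: sq)
    also have "\<dots> = (\<Sum>x\<leftarrow>map (\<lambda>e i. A i $$ e / of_real (sqrt (N k))) es. x i * cnj (x j))"
      by (simp add: sum_list_distinct_conv_sum_set[OF es(2)] o_def)
    finally show ?thesis .
  qed
  then show ?thesis unfolding gram_kernel_def by blast
qed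

text \<open>Positive definiteness holds for each trace monomial by \<open>gram_kernel_lim_tr\<close> and passes
  to expectations; continuity is that of the trace together with dominated convergence, as
  the trace has modulus at most 1.\<close>

lemma group_character_mixed:
  "group_character (unitary_lim n) (unitary_lim_topology n) (mixed_trace_character c)"
  unfolding group_character_def
proof (intro conjI ballI)
  let ?G = "unitary_lim n"
  interpret group ?G by (rule group_unitary_lim)
  show "mixed_trace_character c \<in> extensional (carrier ?G)" by (simp add: mixed_trace_character_def)
  have "continuous_map (unitary_lim_topology n) (top_of_set (cball 0 1)) (lim_tr n)"
    using continuous_map_lim_tr norm_lim_tr_le by (auto simp: continuous_map_in_subtopology)
  from continuous_map_compose[OF this, of euclidean "\<lambda>t. measure_pmf.expectation c (trace_monomial t)"]
  have "continuous_map (unitary_lim_topology n) euclidean ((\<lambda>t. measure_pmf.expectation c (trace_monomial t)) \<circ> lim_tr n)"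
    using continuous_expectation_trace_monomial by simp
  then show "continuous_map (unitary_lim_topology n) euclidean (mixed_trace_character c)"
    by (rule continuous_map_eq) (simp add: mixed_trace_character_def)
  show "positive_definite ?G (mixed_trace_character c)"
    unfolding positive_definite_def
  proof (intro allI impI)
    fix m :: nat and g :: "nat \<Rightarrow> lim_elem" and a :: "nat \<Rightarrow> complex"
    assume g: "\<forall>i<m. g i \<in> carrier ?G"
    define T where "T i j = lim_tr n (inv\<^bsub>?G\<^esub> (g j) \<otimes>\<^bsub>?G\<^esub> g i)" for i j
    have T: "gram_kernel m T" unfolding T_def by (rule gram_kernel_lim_tr) (use g in auto)
    have T1: "norm (T i j) \<le> 1" if "i < m" "j < m" for i j
      unfolding T_def by (rule norm_lim_tr_le) (use g that in auto)
    have "(\<Sum>i<m. \<Sum>j<m. a i * cnj (a j) * mixed_trace_character c (inv\<^bsub>?G\<^esub> (g j) \<otimes>\<^bsub>?G\<^esub> g i)) =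
        (\<Sum>i<m. \<Sum>j<m. measure_pmf.expectation c (\<lambda>x. a i * cnj (a j) * trace_monomial (T i j) x))"
      by (intro sum.cong refl) (use g in \<open>simp add: mixed_trace_character_def T_def\<close>)
    also have "\<dots> = measure_pmf.expectation c (\<lambda>x. \<Sum>i<m. \<Sum>j<m. a i * cnj (a j) * trace_monomial (T i j) x)"
    proof -
      have int: "integrable (measure_pmf c) (\<lambda>x. a i * cnj (a j) * trace_monomial (T i j) x)" if "i < m" "j < m" for i j
        by (rule pmf_integrable_bounded[where B = "norm (a i * cnj (a j)) * 1"])
           (unfold norm_mult[of "a i * cnj (a j)"], intro mult_left_mono norm_trace_monomial_le T1 that norm_ge_zero)
      then have "measure_pmf.expectation c (\<lambda>x. \<Sum>i<m. \<Sum>j<m. a i * cnj (a j) * trace_monomial (T i j) x) =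
          (\<Sum>i<m. measure_pmf.expectation c (\<lambda>x. \<Sum>j<m. a i * cnj (a j) * trace_monomial (T i j) x))"
        by (intro Bochner_Integration.integral_sum Bochner_Integration.integrable_sum) auto
      also have "\<dots> = (\<Sum>i<m. \<Sum>j<m. measure_pmf.expectation c (\<lambda>x. a i * cnj (a j) * trace_monomial (T i j) x))"
        by (intro sum.cong refl Bochner_Integration.integral_sum) (use int in auto)
      finally show ?thesis by (rule sym)
    qed
    also have "\<dots> \<in> \<real>\<^sub>\<ge>\<^sub>0"
    proof (rule pmf_expectation_nonneg_Reals)
      fix x :: "nat \<times> nat"
      show "(\<Sum>i<m. \<Sum>j<m. a i * cnj (a j) * trace_monomial (T i j) x) \<in> \<real>\<^sub>\<ge>\<^sub>0"
        unfolding trace_monomial_def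
        by (intro gram_kernel_positive gram_kernel_mult gram_kernel_power gram_kernel_cnj T)
    qed
    finally show "(\<Sum>i<m. \<Sum>j<m. a i * cnj (a j) * mixed_trace_character c (inv\<^bsub>?G\<^esub> (g j) \<otimes>\<^bsub>?G\<^esub> g i)) \<in> \<real>\<^sub>\<ge>\<^sub>0" .
  qed
  show "mixed_trace_character c (g \<otimes>\<^bsub>?G\<^esub> h) = mixed_trace_character c (h \<otimes>\<^bsub>?G\<^esub> g)"
    if "g \<in> carrier ?G" "h \<in> carrier ?G" for g h
    using that by (simp add: mixed_trace_character_def lim_tr_commute[OF that])
  have "lim_tr n \<one>\<^bsub>?G\<^esub> = 1"
    unfolding lift_one[of 0] lim_tr_lift[OF unitary_mats_one] mat_trace_one using N_pos[of 0] by simp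
  then have "trace_monomial (lim_tr n \<one>\<^bsub>?G\<^esub>) = (\<lambda>_. 1)" by (simp add: trace_monomial_def fun_eq_iff)
  then show "mixed_trace_character c \<one>\<^bsub>?G\<^esub> = 1" by (simp add: mixed_trace_character_def)
qed

definition trace_character :: "nat \<times> nat \<Rightarrow> lim_elem \<Rightarrow> complex" where
  "trace_character x = (\<lambda>u\<in>carrier (unitary_lim n). trace_monomial (lim_tr n u) x)"

lemma mixed_trace_character_return: "mixed_trace_character (return_pmf x) = trace_character x"
  by (simp add: mixed_trace_character_def trace_character_def)

lemma mixed_trace_character_cases:
  assumes \<chi>: "group_character (unitary_lim n) (unitary_lim_topology n) \<chi>"
  obtains c where "\<chi> = mixed_trace_character c"
proof -
  obtain c where c: "\<And>u. u \<in> carrier (unitary_lim n) \<Longrightarrow> \<chi> u = measure_pmf.expectation c (trace_monomial (lim_tr n u))"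
    by (rule character_representation[OF \<chi>]) blast
  have "\<chi> = mixed_trace_character c"
    using \<chi> c by (auto simp: mixed_trace_character_def fun_eq_iff group_character_def extensional_def)
  then show ?thesis by (rule that)
qed

section \<open>The indecomposable characters\<close>

text \<open>If the mixing distribution charges a pair \<open>x\<close> and is not concentrated on it, then the
  character is a proper convex combination of the trace monomial of \<open>x\<close> and of the mixture
  conditioned on the complement of \<open>x\<close>. Indecomposability makes both equal to the
  character.\<close>

lemma indecomposable_is_trace_character:
  assumes \<chi>: "indecomposable_character (unitary_lim n) (unitary_lim_topology n) \<chi>"
  obtains x where "\<chi> = trace_character x"
proof -
  obtain c where c: "\<chi> = mixed_trace_character c"
    using \<chi> mixed_trace_character_cases unfolding indecomposable_character_def by blast
  obtain x where x: "x \<in> set_pmf c" using set_pmf_not_empty[of c] by blast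
  define \<alpha> where "\<alpha> = pmf c x"
  have \<alpha>0: "0 < \<alpha>" using x by (simp add: \<alpha>_def pmf_positive_iff)
  show ?thesis
  proof (cases "set_pmf c \<subseteq> {x}")
    case True
    then have "c = return_pmf x" by (simp add: set_pmf_subset_singleton)
    then show ?thesis using c mixed_trace_character_return that by simp
  next
    case False
    then have ne: "set_pmf c \<inter> (- {x}) \<noteq> {}" by blast
    define b where "b = cond_pmf c (- {x})"
    have P: "measure_pmf.prob c (- {x}) = 1 - \<alpha>"
      using measure_pmf.prob_compl[of "{x}" c] by (simp add: \<alpha>_def measure_pmf_single Compl_eq_Diff_UNIV)
    have "0 < measure_pmf.prob c (- {x})" using measure_measure_pmf_not_zero[OF ne] by (simp add: zero_less_measure_iff)
    then have \<alpha>1: "\<alpha> < 1" using P by simp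
    have pm: "pmf c y = \<alpha> * pmf (return_pmf x) y + (1 - \<alpha>) * pmf b y" for y
      using \<alpha>1 by (cases "y = x") (auto simp: b_def pmf_cond[OF ne] P \<alpha>_def pmf_return)
    have eq: "\<chi> u = of_real \<alpha> * trace_character x u + of_real (1 - \<alpha>) * mixed_trace_character b u"
      if u: "u \<in> carrier (unitary_lim n)" for u
      using pmf_expectation_convex[OF pm norm_trace_monomial_le[OF norm_lim_tr_le[OF u]]] u
      by (simp add: c mixed_trace_character_def trace_character_def)
    have "trace_character x = mixed_trace_character b"
      using \<chi> \<alpha>0 \<alpha>1 eq group_character_mixed[of b] group_character_mixed[of "return_pmf x"]
      unfolding indecomposable_character_def mixed_trace_character_return by blast
    then have "\<chi> u = trace_character x u" if "u \<in> carrier (unitary_lim n)" for u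
      using eq[OF that] by (simp add: distrib_right[symmetric] of_real_add[symmetric] del: of_real_add)
    moreover have "\<chi> \<in> extensional (carrier (unitary_lim n))" by (simp add: c mixed_trace_character_def)
    moreover have "trace_character x \<in> extensional (carrier (unitary_lim n))" by (simp add: trace_character_def)
    ultimately have "\<chi> = trace_character x" by (intro extensionalityI) auto
    then show ?thesis by (rule that)
  qed
qed

text \<open>The element is \<open>\<zeta>\<close> times a diagonal matrix with two conjugate entries of real part \<open>y\<close>
  and all other entries 1.\<close>

lemma trace_value_exists:
  assumes y: "\<bar>y\<bar> \<le> 1" and \<zeta>: "norm \<zeta> = 1"
  obtains u where "u \<in> carrier (unitary_lim n)" "lim_tr n u = \<zeta> * of_real ((real (N 0) - 2 + 2 * y) / N 0)"
proof -
  define \<phi> where "\<phi> = arccos y"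
  have cos: "cos \<phi> = y" unfolding \<phi>_def by (rule cos_arccos) (use y in auto)
  define z where "z i = \<zeta> * (if i = 0 then cis \<phi> else if i = 1 then cis (- \<phi>) else 1)" for i :: nat
  have z1: "norm (z i) = 1" for i by (simp add: z_def norm_mult \<zeta>)
  obtain M where M: "N 0 = Suc (Suc M)" using le_Suc_ex[OF N_0] by auto
  have "(\<Sum>i<N 0. z i) = \<zeta> * (cis \<phi> + cis (- \<phi>) + of_nat M)"
    unfolding M sum.lessThan_Suc_shift by (simp add: z_def distrib_left)
  also have "cis \<phi> + cis (- \<phi>) = of_real (2 * y)" by (simp add: complex_eq_iff cos)
  finally have "(\<Sum>i<N 0. z i) = \<zeta> * of_real (real (N 0) - 2 + 2 * y)" using M by simp
  then have "lim_tr n (lift 0 (diagonal (N 0) z)) = \<zeta> * of_real ((real (N 0) - 2 + 2 * y) / N 0)"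
    by (simp add: lim_tr_lift_diagonal[OF z1] power_mean_def)
  then show ?thesis
    by (rule that[OF lift_carrier[OF monomial_mat_unitary[OF permutes_id_lessThan z1]]])
qed

text \<open>The first kind of values has cosine 1/2, so that \<open>s = 1 - 1 / N 0\<close>; the cosine
  \<open>1 / (2 * N 0)\<close> gives \<open>s\<^sup>2\<close>.\<close>

lemma trace_values:
  obtains s :: real where "0 < s" "s < 1"
    "\<And>\<zeta>. norm \<zeta> = 1 \<Longrightarrow> \<exists>u\<in>carrier (unitary_lim n). lim_tr n u = \<zeta> * of_real s"
    "\<exists>u\<in>carrier (unitary_lim n). lim_tr n u = of_real (s\<^sup>2)"
proof -
  define s where "s = (real (N 0) - 1) / N 0"
  have N: "2 \<le> real (N 0)" using N_0 by simp
  show ?thesis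
  proof (rule that[of s])
    show "0 < s" "s < 1" using N by (auto simp: s_def)
    show "\<exists>u\<in>carrier (unitary_lim n). lim_tr n u = \<zeta> * of_real s" if "norm \<zeta> = 1" for \<zeta>
      using trace_value_exists[of "1/2" \<zeta>] that by (auto simp: s_def)
    have "(real (N 0) - 2 + 2 * (1 / (2 * N 0))) / N 0 = s\<^sup>2"
      using N by (simp add: s_def field_simps power2_eq_square)
    moreover have "\<bar>1 / (2 * real (N 0))\<bar> \<le> 1" using N by (simp add: field_simps)
    ultimately show "\<exists>u\<in>carrier (unitary_lim n). lim_tr n u = of_real (s\<^sup>2)"
      using trace_value_exists[of "1 / (2 * real (N 0))" 1] by auto
  qed
qed

lemma norm_trace_monomial_power2:
  "complex_of_real ((norm (trace_monomial t x))\<^sup>2) = trace_monomial (of_real ((norm t)\<^sup>2)) x"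
  by (simp add: trace_monomial_def norm_mult norm_power power_mult_distrib power_mult[symmetric] mult.commute)

text \<open>The squared modulus of a trace monomial at \<open>t\<close> is the same monomial at \<open>(norm t)\<^sup>2\<close>.
  So the mean squared distance to a fixed monomial is determined by the values of the
  mixture at the two points \<open>t\<close> and \<open>(norm t)\<^sup>2\<close>.\<close>

lemma trace_monomial_variance:
  assumes t: "norm t \<le> 1"
  shows "measure_pmf.expectation c (\<lambda>x. (norm (trace_monomial t x - trace_monomial t y))\<^sup>2) =
    Re (measure_pmf.expectation c (trace_monomial (of_real ((norm t)\<^sup>2)))) -
    2 * Re (cnj (trace_monomial t y) * measure_pmf.expectation c (trace_monomial t)) +
    Re (trace_monomial (of_real ((norm t)\<^sup>2)) y)"
proof -
  have p: "(norm (a - b))\<^sup>2 = (norm a)\<^sup>2 - 2 * Re (cnj b * a) + (norm b)\<^sup>2" for a b :: complex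
    unfolding cmod_power2 by (simp add: power2_eq_square algebra_simps)
  have t2: "norm (complex_of_real ((norm t)\<^sup>2)) \<le> 1" using t by (simp add: norm_power power_le_one)
  have i1: "integrable (measure_pmf c) (trace_monomial t)"
    by (rule pmf_integrable_bounded[OF norm_trace_monomial_le[OF t]])
  have i2: "integrable (measure_pmf c) (trace_monomial (of_real ((norm t)\<^sup>2)))"
    by (rule pmf_integrable_bounded[OF norm_trace_monomial_le[OF t2]])
  have "(\<lambda>x. (norm (trace_monomial t x - trace_monomial t y))\<^sup>2) =
      (\<lambda>x. Re (trace_monomial (of_real ((norm t)\<^sup>2)) x) - 2 * Re (cnj (trace_monomial t y) * trace_monomial t x)
        + Re (trace_monomial (of_real ((norm t)\<^sup>2)) y))"
    unfolding p norm_trace_monomial_power2[symmetric] by simp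
  then show ?thesis using i1 i2 by (simp add: integral_Re)
qed

text \<open>The modulus determines \<open>a + b\<close> and the phase determines \<open>a - b\<close>.\<close>

lemma trace_monomial_eqD:
  assumes s: "0 < s" "s < (1::real)" and eq: "\<And>\<zeta>. norm \<zeta> = 1 \<Longrightarrow> trace_monomial (\<zeta> * of_real s) x = trace_monomial (\<zeta> * of_real s) y"
  shows "x = y"
proof -
  obtain a b p q where xy: "x = (a, b)" "y = (p, q)" by (metis prod.exhaust)
  have n: "norm (trace_monomial (of_real s) (a, b)) = s ^ (a + b)" for a b
    using s by (simp add: trace_monomial_def norm_mult norm_power power_add)
  have "s ^ (a + b) = s ^ (p + q)" using arg_cong[OF eq[of 1], of norm] n by (simp add: xy)
  then have ab: "a + b = p + q" using s by (metis power_inject_exp' less_irrefl)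
  have m: "trace_monomial (cis r * of_real s) (a, b) = cis (r * (real a - real b)) * of_real (s ^ (a + b))" for r a b
    by (simp add: trace_monomial_def power_mult_distrib Complex.DeMoivre cis_cnj cis_mult power_add algebra_simps)
  have "a = p"
  proof (rule ccontr)
    assume "a \<noteq> p"
    let ?d = "2 * (real a - real p)"
    have d: "?d \<noteq> 0" using \<open>a \<noteq> p\<close> by simp
    \<comment> \<open>At this angle the two phases would be opposite.\<close>
    let ?r = "pi / ?d"
    have "cis (?r * (real a - real b)) = cis (?r * (real p - real q))"
      using eq[of "cis ?r"] s by (simp add: xy m ab)
    then have "cis (?r * (real a - real b)) * cis (- (?r * (real p - real q))) = 1"
      by (simp add: cis_mult)
    then have "cis (?r * ((real a - real b) - (real p - real q))) = 1"
      unfolding cis_mult by (simp only: right_diff_distrib add_uminus_conv_diff)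
    moreover have "(real a - real b) - (real p - real q) = ?d" using ab by (simp add: algebra_simps flip: of_nat_add)
    ultimately show False using d by (simp add: cis_pi)
  qed
  then show ?thesis using ab xy by simp
qed

text \<open>In a convex decomposition of the trace monomial of \<open>y\<close> both parts are mixtures. The
  weighted sum of their mean squared distances to the monomial of \<open>y\<close> depends only on the
  decomposed function, so it is 0 as for the monomial itself. Both mixing distributions are
  therefore concentrated on \<open>y\<close>.\<close>

lemma trace_character_indecomposable:
  "indecomposable_character (unitary_lim n) (unitary_lim_topology n) (trace_character y)"
  unfolding indecomposable_character_def
proof (intro conjI notI)
  let ?G = "unitary_lim n"
  show "group_character ?G (unitary_lim_topology n) (trace_character y)"
    using group_character_mixed[of "return_pmf y"] by (simp add: mixed_trace_character_return)
  assume "\<exists>\<alpha> \<chi>1 \<chi>2. 0 < \<alpha> \<and> \<alpha> < 1 \<and> group_character ?G (unitary_lim_topology n) \<chi>1 \<and>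
      group_character ?G (unitary_lim_topology n) \<chi>2 \<and> \<chi>1 \<noteq> \<chi>2 \<and>
      (\<forall>g\<in>carrier ?G. trace_character y g = of_real \<alpha> * \<chi>1 g + of_real (1 - \<alpha>) * \<chi>2 g)"
  then obtain \<alpha> \<chi>1 \<chi>2 where \<alpha>: "0 < \<alpha>" "\<alpha> < 1" and \<chi>: "group_character ?G (unitary_lim_topology n) \<chi>1"
      "group_character ?G (unitary_lim_topology n) \<chi>2" "\<chi>1 \<noteq> \<chi>2"
    and eq: "\<And>g. g \<in> carrier ?G \<Longrightarrow> trace_character y g = of_real \<alpha> * \<chi>1 g + of_real (1 - \<alpha>) * \<chi>2 g" by blast
  obtain c1 where c1: "\<chi>1 = mixed_trace_character c1" using \<chi>(1) by (rule mixed_trace_character_cases)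
  obtain c2 where c2: "\<chi>2 = mixed_trace_character c2" using \<chi>(2) by (rule mixed_trace_character_cases)
  let ?E = "\<lambda>c t. measure_pmf.expectation c (trace_monomial t)"
  have mix: "of_real \<alpha> * ?E c1 (lim_tr n u) + of_real (1 - \<alpha>) * ?E c2 (lim_tr n u) = trace_monomial (lim_tr n u) y"
    if "u \<in> carrier ?G" for u
    using eq[OF that] that by (simp add: c1 c2 mixed_trace_character_def trace_character_def)
  obtain s where s: "0 < s" "s < 1" "\<And>\<zeta>. norm \<zeta> = 1 \<Longrightarrow> \<exists>u\<in>carrier ?G. lim_tr n u = \<zeta> * of_real s"
    "\<exists>u\<in>carrier ?G. lim_tr n u = of_real (s\<^sup>2)" by (rule trace_values) blast
  have zero: "trace_monomial (\<zeta> * of_real s) x = trace_monomial (\<zeta> * of_real s) y"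
    if \<zeta>: "norm \<zeta> = 1" and x: "x \<in> set_pmf c1 \<or> x \<in> set_pmf c2" for \<zeta> x
  proof -
    define t where "t = \<zeta> * of_real s"
    have nt: "norm t = s" using \<zeta> s by (simp add: t_def norm_mult)
    have t1: "norm t \<le> 1" using nt s by simp
    let ?m = "trace_monomial t y"
    let ?V = "\<lambda>c. measure_pmf.expectation c (\<lambda>x. (norm (trace_monomial t x - ?m))\<^sup>2)"
    have e1: "of_real \<alpha> * ?E c1 t + of_real (1 - \<alpha>) * ?E c2 t = ?m"
      using s(3)[OF \<zeta>] mix unfolding t_def by metis
    have e2: "of_real \<alpha> * ?E c1 (of_real (s\<^sup>2)) + of_real (1 - \<alpha>) * ?E c2 (of_real (s\<^sup>2)) = trace_monomial (of_real (s\<^sup>2)) y"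
      using s(4) mix by metis
    have m2: "Re (cnj ?m * ?m) = Re (trace_monomial (of_real (s\<^sup>2)) y)"
      unfolding mult.commute[of "cnj ?m"] complex_norm_square[symmetric] norm_trace_monomial_power2 nt ..
    have "\<alpha> * ?V c1 + (1 - \<alpha>) * ?V c2 =
        Re (of_real \<alpha> * ?E c1 (of_real (s\<^sup>2)) + of_real (1 - \<alpha>) * ?E c2 (of_real (s\<^sup>2)))
        - 2 * Re (cnj ?m * (of_real \<alpha> * ?E c1 t + of_real (1 - \<alpha>) * ?E c2 t)) + Re (trace_monomial (of_real (s\<^sup>2)) y)"
      unfolding trace_monomial_variance[OF t1] nt by (simp add: algebra_simps)
    also have "\<dots> = 0" unfolding e1 e2 m2 by simp
    finally have sum0: "\<alpha> * ?V c1 + (1 - \<alpha>) * ?V c2 = 0" .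
    have nn: "0 \<le> ?V c1" "0 \<le> ?V c2" by (auto intro: Bochner_Integration.integral_nonneg)
    then have "0 \<le> \<alpha> * ?V c1" "0 \<le> (1 - \<alpha>) * ?V c2" using \<alpha> by simp_all
    then have "\<alpha> * ?V c1 = 0" "(1 - \<alpha>) * ?V c2 = 0" using sum0 by linarith+
    then have V0: "?V c1 = 0" "?V c2 = 0" using \<alpha> by simp_all
    have *: "(norm (trace_monomial t x - ?m))\<^sup>2 = 0" if "?V c = 0" "x \<in> set_pmf c" for c
    proof -
      have "norm (trace_monomial t x - ?m) \<le> 2" for x
        using norm_triangle_ineq4[of "trace_monomial t x" ?m] norm_trace_monomial_le[OF t1, of x] norm_trace_monomial_le[OF t1, of y] by linarith
      then have "(norm (trace_monomial t x - ?m))\<^sup>2 \<le> 2\<^sup>2" for x by (rule power_mono) simp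
      then have "integrable (measure_pmf c) (\<lambda>x. (norm (trace_monomial t x - ?m))\<^sup>2)"
        by (intro pmf_integrable_bounded[where B = "2\<^sup>2"]) simp
      then have "AE x in measure_pmf c. (norm (trace_monomial t x - ?m))\<^sup>2 = 0"
        using that(1) by (subst (asm) integral_nonneg_eq_0_iff_AE) auto
      then show ?thesis using that(2) by (simp add: AE_measure_pmf_iff)
    qed
    then show ?thesis using x V0 by (auto simp: t_def)
  qed
  have "x = y" if "x \<in> set_pmf c1 \<or> x \<in> set_pmf c2" for x
    by (rule trace_monomial_eqD[OF s(1,2)]) (rule zero[OF _ that])
  then have "set_pmf c1 \<subseteq> {y}" "set_pmf c2 \<subseteq> {y}" by auto
  then have "c1 = return_pmf y" "c2 = return_pmf y" by (simp_all add: set_pmf_subset_singleton)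
  then show False using \<chi>(3) by (simp add: c1 c2)
qed

end

theorem theorem1p6:
  fixes n :: "nat \<Rightarrow> nat"
  assumes "\<And>k. 1 \<le> k \<Longrightarrow> 1 < n k"
  shows "{\<chi>. indecomposable_character (unitary_lim n) (unitary_lim_topology n) \<chi>} =
    {(\<lambda>u\<in>carrier (unitary_lim n). lim_tr n u ^ p * cnj (lim_tr n u) ^ q) | p q :: nat. True}"
proof -
  interpret block_sequence n by unfold_locales (rule assms)
  have t: "trace_character (p, q) = (\<lambda>u\<in>carrier (unitary_lim n). lim_tr n u ^ p * cnj (lim_tr n u) ^ q)" for p q
    by (simp add: trace_character_def trace_monomial_def)
  show ?thesis
  proof (intro equalityI subsetI)
    fix \<chi> assume "\<chi> \<in> {\<chi>. indecomposable_character (unitary_lim n) (unitary_lim_topology n) \<chi>}"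
    then obtain x where "\<chi> = trace_character x" using indecomposable_is_trace_character by blast
    then show "\<chi> \<in> {(\<lambda>u\<in>carrier (unitary_lim n). lim_tr n u ^ p * cnj (lim_tr n u) ^ q) | p q :: nat. True}"
      using t by (cases x) auto
  qed (use trace_character_indecomposable t in force)
qed

end
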